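(* Let $E$ be a holomorphic vector bundle of rank $r$ over a compact complex manifold $M$ endowed with a fixed Riemannian metric $g$. Every singular Hermitian metric on $E$ that is Griffiths seminegative or Griffiths semipositive is $L^2$ integrable, i.e. belongs to $L^2(Herm^+(E))$.
   Context: $\mu_g$ is the measure on $M$ induced by the volume form of $g$; "almost everywhere" refers to $\mu_g$. $\alpha:M\to\mathbb{R}$ is a fixed smooth function with $\alpha>-1/r$. A singular Hermitian inner product on a finite-dimensional complex vector space $V$ is a function $\|\cdot\|:V\to[0,\infty]$ with $\|\lambda v\|=|\lambda|\|v\|$, $\|v+w\|\le\|v\|+\|w\|$ and $\|v+w\|^2+\|v-w\|^2=2(\|v\|^2+\|w\|^2)$. It is finite if it never takes the value $\infty$, and positive definite if $\|v\|=0$ only for $v=0$. A singular Hermitian metric $h$ on $E$ is an assignment, measurable in $x$, of a singular Hermitian inner product $h_x$ on each fiber $E_x$, which is finite and positive definite for almost every $x$. Thus, up to a.e. equality, $h$ is a measurable section of $Herm^+(E)$, the bundle whose fiber at $x$ is the open cone $Herm^+(E_x)$ of positive definite Hermitian forms in the real vector space $Herm(E_x)$ of Hermitian sesquilinear forms on $E_x$. $h$ is Griffiths seminegative if $\log\|u\|_h^2$ (equivalently $\|u\|_h^2$) is plurisubharmonic for every local holomorphic section $u$ of $E$ (the function identically $-\infty$ is allowed as plurisubharmonic). $h$ is Griffiths semipositive if the dual metric $h^*$ on $E^*$ (given by $\|f\|_{h^*}=\sup\{|f(v)|:v\in E_x,\|v\|_h\le1\}$ for $f\in E_x^*$) is a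 Griffiths seminegative singular Hermitian metric on $E^*$. For $h\in Herm^+(E_x)$ and $v\in Herm(E_x)$, $h^{-1}v\in End(E_x)$ is defined by $v(a,b)=h(a,(h^{-1}v)b)$. $d_x$ is the Riemannian distance on $Herm^+(E_x)$ for the metric $\langle v,w\rangle_h=tr(h^{-1}vh^{-1}w)+\alpha(x)\,tr(h^{-1}v)\,tr(h^{-1}w)$. Fixing a smooth Hermitian metric $h_0$ on $E$, a singular Hermitian metric $h$ is $L^2$ integrable, $h\in L^2(Herm^+(E))$, if $\int_M d_x(h(x),h_0(x))^2\mu_g(x)<\infty$ (independent of $h_0$). *)

theory Defs
  imports "HOL-Analysis.Analysis" "HOL-Algebra.Algebraic_Closure_Type"
begin

section \<open>Analysis on open subsets of $\mathbb{C}^n$\<close>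

primrec Ck_on ::
  "nat \<Rightarrow> 'a::real_normed_vector set \<Rightarrow> ('a \<Rightarrow> 'b::real_normed_vector) \<Rightarrow> bool" where
  "Ck_on 0 S f \<longleftrightarrow> continuous_on S f"
| "Ck_on (Suc k) S f \<longleftrightarrow>
     (\<exists>f'. (\<forall>x\<in>S. (f has_derivative f' x) (at x)) \<and> (\<forall>v. Ck_on k S (\<lambda>x. f' x v)))"

definition smooth_on :: "'a::real_normed_vector set \<Rightarrow> ('a \<Rightarrow> 'b::real_normed_vector) \<Rightarrow> bool" where
  "smooth_on S f \<longleftrightarrow> (\<forall>k. Ck_on k S f)"

text \<open>Holomorphic in several variables (on an open set): the real derivative exists and is
  complex linear.\<close>

definition holo_on :: "(complex^'n::finite) set \<Rightarrow> (complex^'n \<Rightarrow> complex^'k::finite) \<Rightarrow> bool" where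
  "holo_on S f \<longleftrightarrow>
     (\<forall>z\<in>S. \<exists>D. (f has_derivative D) (at z) \<and> (\<forall>c v. D (c *s v) = c *s D v))"

text \<open>The integral of an extended-real function as the integral of its positive part minus that of
  its negative part (\<^const>\<open>e2ennreal\<close> sends negative numbers to 0). It is meaningful as soon as the
  positive part has finite integral, and may then be $-\infty$.\<close>

definition ereal_integral :: "'a measure \<Rightarrow> ('a \<Rightarrow> ereal) \<Rightarrow> ereal" where
  "ereal_integral N f =
     enn2ereal (\<integral>\<^sup>+ x. e2ennreal (f x) \<partial>N) - enn2ereal (\<integral>\<^sup>+ x. e2ennreal (- f x) \<partial>N)"

text \<open>Plurisubharmonic on the open set \<open>S\<close>: values in $[-\infty,\infty)$, upper semicontinuous, and
  the sub-mean value inequality on every closed disc of a complex line contained in \<open>S\<close>. The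
  function identically $-\infty$ is allowed. On the circle the function is bounded above, so the
  integral below is meaningful.\<close>

definition psh_on :: "(complex^'n::finite) set \<Rightarrow> (complex^'n \<Rightarrow> ereal) \<Rightarrow> bool" where
  "psh_on S f \<longleftrightarrow>
     (\<forall>z\<in>S. f z < \<infinity>) \<and>
     (\<forall>c. openin (top_of_set S) {z\<in>S. f z < c}) \<and>
     (\<forall>a b. (\<forall>\<zeta>. cmod \<zeta> \<le> 1 \<longrightarrow> a + \<zeta> *s b \<in> S) \<longrightarrow>
        f a \<le> ereal_integral (restrict_space lborel {0..2*pi}) (\<lambda>\<theta>. f (a + cis \<theta> *s b))
               / ereal (2*pi))"

definition ennreal_log :: "ennreal \<Rightarrow> ereal" where
  "ennreal_log x =
     (if x = 0 then -\<infinity> else if x = \<infinity> then \<infinity> else ereal (ln (enn2real x)))"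


section \<open>Complex manifolds\<close>

text \<open>A chart is a pair of its domain and its coordinate map; values of the coordinate map outside
  the domain are irrelevant. The manifold is the whole type \<open>'m\<close>, of complex dimension
  \<open>CARD('n)\<close>.\<close>

type_synonym ('m, 'n) chart = "'m set \<times> ('m \<Rightarrow> complex^'n)"

definition complex_atlas :: "('m::topological_space, 'n::finite) chart set \<Rightarrow> bool" where
  "complex_atlas A \<longleftrightarrow>
     (\<Union>(U, \<phi>)\<in>A. U) = UNIV \<and>
     (\<forall>(U, \<phi>)\<in>A. open U \<and> open (\<phi> ` U) \<and> homeomorphism U (\<phi> ` U) \<phi> (inv_into U \<phi>)) \<and>
     (\<forall>(U, \<phi>)\<in>A. \<forall>(U', \<phi>')\<in>A. holo_on (\<phi> ` (U \<inter> U')) (\<phi>' \<circ> inv_into U \<phi>))"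

definition manifold_smooth ::
  "('m, 'n::finite) chart set \<Rightarrow> 'm set \<Rightarrow> ('m \<Rightarrow> 'b::real_normed_vector) \<Rightarrow> bool" where
  "manifold_smooth A W f \<longleftrightarrow> (\<forall>(U, \<phi>)\<in>A. smooth_on (\<phi> ` (U \<inter> W)) (f \<circ> inv_into U \<phi>))"

definition manifold_holo ::
  "('m, 'n::finite) chart set \<Rightarrow> 'm set \<Rightarrow> ('m \<Rightarrow> complex^'k::finite) \<Rightarrow> bool" where
  "manifold_holo A W f \<longleftrightarrow> (\<forall>(U, \<phi>)\<in>A. holo_on (\<phi> ` (U \<inter> W)) (f \<circ> inv_into U \<phi>))"

definition manifold_psh ::
  "('m, 'n::finite) chart set \<Rightarrow> 'm set \<Rightarrow> ('m \<Rightarrow> ereal) \<Rightarrow> bool" where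
  "manifold_psh A W f \<longleftrightarrow> (\<forall>(U, \<phi>)\<in>A. psh_on (\<phi> ` (U \<inter> W)) (f \<circ> inv_into U \<phi>))"

text \<open>A Riemannian metric in classical tensor notation: a chart identifies the real tangent space at
  a point of its domain with $\mathbb{C}^n=\mathbb{R}^{2n}$, \<open>g c x\<close> is the inner product at \<open>x\<close>
  read in the chart \<open>c\<close>, and the readings in two charts are related by the derivative of the
  transition map.\<close>

definition riemannian_metric ::
  "('m, 'n::finite) chart set \<Rightarrow>
   (('m, 'n) chart \<Rightarrow> 'm \<Rightarrow> complex^'n \<Rightarrow> complex^'n \<Rightarrow> real) \<Rightarrow> bool" where
  "riemannian_metric A g \<longleftrightarrow>
     (\<forall>(U, \<phi>)\<in>A. \<forall>x\<in>U. bilinear (g (U, \<phi>) x) \<and>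
        (\<forall>v w. g (U, \<phi>) x v w = g (U, \<phi>) x w v) \<and> (\<forall>v. v \<noteq> 0 \<longrightarrow> g (U, \<phi>) x v v > 0)) \<and>
     (\<forall>(U, \<phi>)\<in>A. \<forall>v w. smooth_on (\<phi> ` U) (\<lambda>z. g (U, \<phi>) (inv_into U \<phi> z) v w)) \<and>
     (\<forall>(U, \<phi>)\<in>A. \<forall>(U', \<phi>')\<in>A. \<forall>x\<in>U \<inter> U'. \<forall>v w.
        let D = frechet_derivative (\<phi>' \<circ> inv_into U \<phi>) (at (\<phi> x))
        in g (U, \<phi>) x v w = g (U', \<phi>') x (D v) (D w))"

text \<open>The Gram matrix of a real bilinear form in the standard real basis
  $e_1,\dots,e_n,ie_1,\dots,ie_n$ of $\mathbb{C}^n$, indexed by \<open>'n + 'n\<close>.\<close>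

definition real_frame :: "'n::finite + 'n \<Rightarrow> complex^'n" where
  "real_frame k = (case k of Inl i \<Rightarrow> axis i 1 | Inr i \<Rightarrow> axis i \<i>)"

definition gram :: "(complex^'n::finite \<Rightarrow> complex^'n \<Rightarrow> real) \<Rightarrow> real^('n + 'n)^('n + 'n)" where
  "gram b = (\<chi> k l. b (real_frame k) (real_frame l))"

text \<open>\<open>\<mu>\<close> is the measure of the Riemannian volume form: the Borel measure that has density
  $\sqrt{\det g_{kl}}$ in every chart. On a compact manifold there is exactly one such measure.\<close>

definition riemannian_volume ::
  "('m::topological_space, 'n::finite) chart set \<Rightarrow>
   (('m, 'n) chart \<Rightarrow> 'm \<Rightarrow> complex^'n \<Rightarrow> complex^'n \<Rightarrow> real) \<Rightarrow> 'm measure \<Rightarrow> bool" where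
  "riemannian_volume A g \<mu> \<longleftrightarrow>
     sets \<mu> = sets borel \<and>
     (\<forall>(U, \<phi>)\<in>A. \<forall>B\<in>sets borel. B \<subseteq> U \<longrightarrow>
        emeasure \<mu> B =
          (\<integral>\<^sup>+ z\<in>\<phi> ` B. ennreal (sqrt (det (gram (g (U, \<phi>) (inv_into U \<phi> z))))) \<partial>lborel))"


section \<open>Complex vector spaces, norms and Hermitian forms\<close>

text \<open>Fibers are modules over the ring \<open>ring_of_type_algebra\<close> of complex
  numbers. The multiplication and unit fields that the record type inherits from rings play no
  role.\<close>

type_synonym 'v cspace = "(complex, 'v) module"

definition lin_iso :: "'v cspace \<Rightarrow> ('v \<Rightarrow> complex^'r::finite) \<Rightarrow> bool" where
  "lin_iso V T \<longleftrightarrow>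
     bij_betw T (carrier V) UNIV \<and>
     (\<forall>a\<in>carrier V. \<forall>b\<in>carrier V. T (a \<oplus>\<^bsub>V\<^esub> b) = T a + T b) \<and>
     (\<forall>c. \<forall>a\<in>carrier V. T (c \<odot>\<^bsub>V\<^esub> a) = c *s T a)"

text \<open>In \<^typ>\<open>ennreal\<close> we have \<open>0 * \<infinity> = 0\<close>, the convention that is meant in
  $\|\lambda v\|=|\lambda|\,\|v\|$.\<close>

definition singular_inner_product :: "'v cspace \<Rightarrow> ('v \<Rightarrow> ennreal) \<Rightarrow> bool" where
  "singular_inner_product V N \<longleftrightarrow>
     (\<forall>c. \<forall>a\<in>carrier V. N (c \<odot>\<^bsub>V\<^esub> a) = ennreal (cmod c) * N a) \<and>
     (\<forall>a\<in>carrier V. \<forall>b\<in>carrier V. N (a \<oplus>\<^bsub>V\<^esub> b) \<le> N a + N b) \<and>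
     (\<forall>a\<in>carrier V. \<forall>b\<in>carrier V.
        (N (a \<oplus>\<^bsub>V\<^esub> b))\<^sup>2 + (N (a \<ominus>\<^bsub>V\<^esub> b))\<^sup>2 = 2 * ((N a)\<^sup>2 + (N b)\<^sup>2))"

definition finite_norm :: "'v cspace \<Rightarrow> ('v \<Rightarrow> ennreal) \<Rightarrow> bool" where
  "finite_norm V N \<longleftrightarrow> (\<forall>a\<in>carrier V. N a \<noteq> \<infinity>)"

definition definite_norm :: "'v cspace \<Rightarrow> ('v \<Rightarrow> ennreal) \<Rightarrow> bool" where
  "definite_norm V N \<longleftrightarrow> (\<forall>a\<in>carrier V. N a = 0 \<longrightarrow> a = \<zero>\<^bsub>V\<^esub>)"

text \<open>Sesquilinear forms are linear in the first and conjugate linear in the second argument.\<close>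

definition Herm :: "'v cspace \<Rightarrow> ('v \<Rightarrow> 'v \<Rightarrow> complex) set" where
  "Herm V = {h.
     (\<forall>a\<in>carrier V. \<forall>b\<in>carrier V. \<forall>c\<in>carrier V. h (a \<oplus>\<^bsub>V\<^esub> b) c = h a c + h b c) \<and>
     (\<forall>z. \<forall>a\<in>carrier V. \<forall>b\<in>carrier V. h (z \<odot>\<^bsub>V\<^esub> a) b = z * h a b) \<and>
     (\<forall>a\<in>carrier V. \<forall>b\<in>carrier V. h b a = cnj (h a b))}"

definition HermPos :: "'v cspace \<Rightarrow> ('v \<Rightarrow> 'v \<Rightarrow> complex) set" where
  "HermPos V = {h\<in>Herm V. \<forall>a\<in>carrier V. a \<noteq> \<zero>\<^bsub>V\<^esub> \<longrightarrow> Re (h a a) > 0}"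

text \<open>The Hermitian form \<open>h\<close> with \<open>h a a = (N a)\<^sup>2\<close>, by polarization. It is only used where \<open>N\<close> is
  finite.\<close>

definition norm_form :: "'v cspace \<Rightarrow> ('v \<Rightarrow> ennreal) \<Rightarrow> 'v \<Rightarrow> 'v \<Rightarrow> complex" where
  "norm_form V N a b =
     (let q = (\<lambda>v. complex_of_real (enn2real ((N v)\<^sup>2)))
      in (q (a \<oplus>\<^bsub>V\<^esub> b) - q (a \<ominus>\<^bsub>V\<^esub> b)
          + \<i> * q (a \<oplus>\<^bsub>V\<^esub> (\<i> \<odot>\<^bsub>V\<^esub> b)) - \<i> * q (a \<ominus>\<^bsub>V\<^esub> (\<i> \<odot>\<^bsub>V\<^esub> b))) / 4)"

definition form_quotient ::
  "'v cspace \<Rightarrow> ('v \<Rightarrow> 'v \<Rightarrow> complex) \<Rightarrow> ('v \<Rightarrow> 'v \<Rightarrow> complex) \<Rightarrow> 'v \<Rightarrow> 'v" where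
  \<comment> \<open>the endomorphism $h^{-1}v$\<close>
  "form_quotient V h v b = (THE c. c \<in> carrier V \<and> (\<forall>a\<in>carrier V. v a b = h a c))"

text \<open>The trace of an endomorphism of an \<open>r\<close>-dimensional space, read in any linear isomorphism to
  $\mathbb{C}^r$. It does not depend on the isomorphism, since the trace is invariant under
  conjugation.\<close>

definition endo_trace :: "'r::finite itself \<Rightarrow> 'v cspace \<Rightarrow> ('v \<Rightarrow> 'v) \<Rightarrow> complex" where
  "endo_trace r V F =
     (let T = (SOME T :: 'v \<Rightarrow> complex^'r. lin_iso V T)
      in trace (matrix (T \<circ> F \<circ> inv_into (carrier V) T)))"

text \<open>The Riemannian metric on the cone of positive definite forms. The value is a real
  number, of which the real part is taken to obtain the type \<^typ>\<open>real\<close>.\<close>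

definition herm_metric ::
  "'r::finite itself \<Rightarrow> 'v cspace \<Rightarrow> real \<Rightarrow> ('v \<Rightarrow> 'v \<Rightarrow> complex) \<Rightarrow>
   ('v \<Rightarrow> 'v \<Rightarrow> complex) \<Rightarrow> ('v \<Rightarrow> 'v \<Rightarrow> complex) \<Rightarrow> real" where
  "herm_metric r V s h v w =
     Re (endo_trace r V (form_quotient V h v \<circ> form_quotient V h w)
         + complex_of_real s * endo_trace r V (form_quotient V h v)
                             * endo_trace r V (form_quotient V h w))"

text \<open>Piecewise \<open>C\<^sup>1\<close> curves in the finite-dimensional space of Hermitian forms; differentiability is
  tested on the values \<open>\<gamma> t a b\<close>, which are linear coordinates. The velocity has arbitrary values at
  the finitely many exceptional parameters.\<close>

definition herm_curve ::
  "'v cspace \<Rightarrow> ('v \<Rightarrow> 'v \<Rightarrow> complex) \<Rightarrow> ('v \<Rightarrow> 'v \<Rightarrow> complex) \<Rightarrow>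
   (real \<Rightarrow> 'v \<Rightarrow> 'v \<Rightarrow> complex) \<Rightarrow> bool" where
  "herm_curve V h k \<gamma> \<longleftrightarrow>
     (\<forall>t\<in>{0..1}. \<gamma> t \<in> HermPos V) \<and>
     (\<forall>a\<in>carrier V. \<forall>b\<in>carrier V.
        (\<lambda>t. \<gamma> t a b) piecewise_C1_differentiable_on {0..1} \<and>
        \<gamma> 0 a b = h a b \<and> \<gamma> 1 a b = k a b)"

definition herm_curve_length ::
  "'r::finite itself \<Rightarrow> 'v cspace \<Rightarrow> real \<Rightarrow> (real \<Rightarrow> 'v \<Rightarrow> 'v \<Rightarrow> complex) \<Rightarrow> ennreal" where
  "herm_curve_length r V s \<gamma> =
     (\<integral>\<^sup>+ t\<in>{0..1}.
        (let \<gamma>' = (\<lambda>a b. vector_derivative (\<lambda>u. \<gamma> u a b) (at t))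
         in ennreal (sqrt (herm_metric r V s (\<gamma> t) \<gamma>' \<gamma>'))) \<partial>lborel)"

definition herm_dist ::
  "'r::finite itself \<Rightarrow> 'v cspace \<Rightarrow> real \<Rightarrow>
   ('v \<Rightarrow> 'v \<Rightarrow> complex) \<Rightarrow> ('v \<Rightarrow> 'v \<Rightarrow> complex) \<Rightarrow> ennreal" where
  "herm_dist r V s h k = (INF \<gamma>\<in>{\<gamma>. herm_curve V h k \<gamma>}. herm_curve_length r V s \<gamma>)"


section \<open>Holomorphic vector bundles\<close>

text \<open>A bundle is given by its fibers \<open>E x\<close> together with a holomorphic bundle atlas: a set of local
  trivializations, each consisting of an open set \<open>U\<close> and linear isomorphisms
  \<open>\<tau> x : E x \<rightarrow> \<complex>\<^sup>r\<close> for \<open>x \<in> U\<close>, whose transition functions are holomorphic. The topology and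
  complex structure of the total space are those determined by the trivializations.\<close>

type_synonym ('m, 'v, 'r) triv = "'m set \<times> ('m \<Rightarrow> 'v \<Rightarrow> complex^'r)"

abbreviation (input) triv_inv ::
  "('m \<Rightarrow> 'v cspace) \<Rightarrow> ('m \<Rightarrow> 'v \<Rightarrow> complex^'r) \<Rightarrow> 'm \<Rightarrow> complex^'r \<Rightarrow> 'v" where
  "triv_inv E \<tau> x \<equiv> inv_into (carrier (E x)) (\<tau> x)"

definition holomorphic_vector_bundle ::
  "('m::topological_space, 'n::finite) chart set \<Rightarrow> ('m \<Rightarrow> 'v cspace) \<Rightarrow>
   ('m, 'v, 'r::finite) triv set \<Rightarrow> bool" where
  "holomorphic_vector_bundle A E \<T> \<longleftrightarrow>
     (\<forall>x. Module.module ring_of_type_algebra (E x)) \<and>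
     (\<Union>(U, \<tau>)\<in>\<T>. U) = UNIV \<and>
     (\<forall>(U, \<tau>)\<in>\<T>. open U \<and> (\<forall>x\<in>U. lin_iso (E x) (\<tau> x))) \<and>
     (\<forall>(U, \<tau>)\<in>\<T>. \<forall>(U', \<tau>')\<in>\<T>. \<forall>v.
        manifold_holo A (U \<inter> U') (\<lambda>x. \<tau>' x (triv_inv E \<tau> x v)))"

definition holomorphic_section ::
  "('m, 'n::finite) chart set \<Rightarrow> ('m \<Rightarrow> 'v cspace) \<Rightarrow> ('m, 'v, 'r::finite) triv set \<Rightarrow>
   'm set \<Rightarrow> ('m \<Rightarrow> 'v) \<Rightarrow> bool" where
  "holomorphic_section A E \<T> W u \<longleftrightarrow>
     (\<forall>x\<in>W. u x \<in> carrier (E x)) \<and>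
     (\<forall>(U, \<tau>)\<in>\<T>. manifold_holo A (U \<inter> W) (\<lambda>x. \<tau> x (u x)))"

definition smooth_hermitian_metric ::
  "('m, 'n::finite) chart set \<Rightarrow> ('m \<Rightarrow> 'v cspace) \<Rightarrow> ('m, 'v, 'r::finite) triv set \<Rightarrow>
   ('m \<Rightarrow> 'v \<Rightarrow> 'v \<Rightarrow> complex) \<Rightarrow> bool" where
  "smooth_hermitian_metric A E \<T> h \<longleftrightarrow>
     (\<forall>x. h x \<in> HermPos (E x)) \<and>
     (\<forall>(U, \<tau>)\<in>\<T>. \<forall>v w. manifold_smooth A U (\<lambda>x. h x (triv_inv E \<tau> x v) (triv_inv E \<tau> x w)))"

text \<open>Linear functionals are made extensional, so that equality in the dual space is equality of
  functionals on \<open>V\<close>.\<close>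

definition dual_space :: "'v cspace \<Rightarrow> ('v \<Rightarrow> complex) cspace" where
  "dual_space V =
     \<lparr>carrier = {f \<in> extensional (carrier V).
        (\<forall>a\<in>carrier V. \<forall>b\<in>carrier V. f (a \<oplus>\<^bsub>V\<^esub> b) = f a + f b) \<and>
        (\<forall>c. \<forall>a\<in>carrier V. f (c \<odot>\<^bsub>V\<^esub> a) = c * f a)},
      monoid.mult = undefined, one = undefined,
      ring.zero = (\<lambda>a\<in>carrier V. 0),
      add = (\<lambda>f f'. \<lambda>a\<in>carrier V. f a + f' a),
      smult = (\<lambda>c f. \<lambda>a\<in>carrier V. c * f a)\<rparr>"

text \<open>The dual frame of a local frame gives the trivializations of the dual bundle.\<close>

definition dual_trivs ::
  "('m \<Rightarrow> 'v cspace) \<Rightarrow> ('m, 'v, 'r::finite) triv set \<Rightarrow> ('m, 'v \<Rightarrow> complex, 'r) triv set" where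
  "dual_trivs E \<T> = (\<lambda>(U, \<tau>). (U, \<lambda>x f. \<chi> i. f (triv_inv E \<tau> x (axis i 1)))) ` \<T>"

definition dual_norm :: "'v cspace \<Rightarrow> ('v \<Rightarrow> ennreal) \<Rightarrow> ('v \<Rightarrow> complex) \<Rightarrow> ennreal" where
  "dual_norm V N f = (SUP a\<in>{a\<in>carrier V. N a \<le> 1}. ennreal (cmod (f a)))"


section \<open>Singular Hermitian metrics\<close>

text \<open>Measurability is Lebesgue measurability (with respect to the completion of \<open>\<mu>\<close>), tested on
  the constant sections of local trivializations.\<close>

definition singular_hermitian_metric ::
  "'m measure \<Rightarrow> ('m \<Rightarrow> 'v cspace) \<Rightarrow> ('m, 'v, 'r::finite) triv set \<Rightarrow>
   ('m \<Rightarrow> 'v \<Rightarrow> ennreal) \<Rightarrow> bool" where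
  "singular_hermitian_metric \<mu> E \<T> h \<longleftrightarrow>
     (\<forall>x. singular_inner_product (E x) (h x)) \<and>
     (\<forall>(U, \<tau>)\<in>\<T>. \<forall>v.
        (\<lambda>x. h x (triv_inv E \<tau> x v)) \<in> borel_measurable (restrict_space (completion \<mu>) U)) \<and>
     (AE x in \<mu>. finite_norm (E x) (h x) \<and> definite_norm (E x) (h x))"

definition griffiths_seminegative ::
  "('m::topological_space, 'n::finite) chart set \<Rightarrow> 'm measure \<Rightarrow> ('m \<Rightarrow> 'v cspace) \<Rightarrow>
   ('m, 'v, 'r::finite) triv set \<Rightarrow> ('m \<Rightarrow> 'v \<Rightarrow> ennreal) \<Rightarrow> bool" where
  "griffiths_seminegative A \<mu> E \<T> h \<longleftrightarrow>
     singular_hermitian_metric \<mu> E \<T> h \<and>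
     (\<forall>W u. open W \<and> holomorphic_section A E \<T> W u \<longrightarrow>
        manifold_psh A W (\<lambda>x. ennreal_log ((h x (u x))\<^sup>2)))"

definition griffiths_semipositive ::
  "('m::topological_space, 'n::finite) chart set \<Rightarrow> 'm measure \<Rightarrow> ('m \<Rightarrow> 'v cspace) \<Rightarrow>
   ('m, 'v, 'r::finite) triv set \<Rightarrow> ('m \<Rightarrow> 'v \<Rightarrow> ennreal) \<Rightarrow> bool" where
  "griffiths_semipositive A \<mu> E \<T> h \<longleftrightarrow>
     singular_hermitian_metric \<mu> E \<T> h \<and>
     griffiths_seminegative A \<mu> (\<lambda>x. dual_space (E x)) (dual_trivs E \<T>)
       (\<lambda>x. dual_norm (E x) (h x))"

definition L2_integrable ::
  "'m measure \<Rightarrow> ('m \<Rightarrow> 'v cspace) \<Rightarrow> ('m, 'v, 'r::finite) triv set \<Rightarrow> ('m \<Rightarrow> real) \<Rightarrow>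
   ('m \<Rightarrow> 'v \<Rightarrow> 'v \<Rightarrow> complex) \<Rightarrow> ('m \<Rightarrow> 'v \<Rightarrow> ennreal) \<Rightarrow> bool" where
  "L2_integrable \<mu> E \<T> \<alpha> h0 h \<longleftrightarrow>
     singular_hermitian_metric \<mu> E \<T> h \<and>
     (\<integral>\<^sup>+ x. (herm_dist TYPE('r) (E x) (\<alpha> x) (norm_form (E x) (h x)) (h0 x))\<^sup>2 \<partial>completion \<mu>) < \<infinity>"

end

theory Submission
  imports Defs "Jordan_Normal_Form.Determinant"
begin

text \<open>Let \<open>M\<close> be the matrix of a seminegative metric in a local holomorphic frame. It is bounded
  above because the squared norms of the frame are plurisubharmonic, so the distance to a smooth
  metric is bounded in terms of $|\log\det M|$, by the length of a straight segment. It remains to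
  see that $\log\det M$ is locally square integrable.

  First, $\log\det M$ satisfies the submean inequality on discs. The squared norms of sections
  that are polynomial of degree less than \<open>N\<close> in the coordinate of the disc, averaged over the
  \<open>N\<close>-th roots of unity, form a Gram matrix that is unitarily congruent to the block diagonal
  matrix of the values of \<open>M\<close> at these roots. If \<open>M\<close> is a trigonometric polynomial on the
  circle, then the submean inequality for squared norms bounds all but boundedly many pivots of this
  Gram matrix below by the pivots of \<open>M\<close> at the center, and $N\to\infty$ gives the claim. The
  general case follows by convolution with $(1+\cos t)^d$ and semicontinuity.

  Second, a nonnegative function of one variable with the supermean property is square integrable
  near every point where it is finite, by comparing its iterated averages over discs of radius
  $2^{-k}$; averaging over the complex lines through a point yields the same in several variables.
  This applies to $\log\det M$, subtracted from a constant, because \<open>M\<close> is definite at some point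
  arbitrarily close to any given one.

  The dual of a semipositive metric is seminegative, and two-sided bounds of the form
  $c|v|\le\|v\|\le|v|/c$ pass from the dual metric to the metric with the same \<open>c\<close>.\<close>

no_notation Matrix.vec_index (infixl \<open>$\<close> 100)
no_notation Matrix.scalar_prod (infix \<open>\<bullet>\<close> 70)
no_notation fps_nth (infixl \<open>$\<close> 75)
hide_const (open) Determinant.det Matrix.mat Matrix.vec Matrix.row Matrix.col Matrix.rows Matrix.cols Matrix.unit_vec Coset.order

text \<open>A seminegative metric is only upper semicontinuous and may degenerate on a null set, so
  the determinant has to be estimated from squared norms of sections alone. For \<open>M\<close> of
  degree \<open>d\<close> on a circle, the mean over the \<open>N\<close>-th roots of unity is the
  exact circle mean on sections of degree below \<open>N - d\<close>. Hence \<open>N - d\<close>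
  blocks of pivots inherit the submean inequality; the other \<open>d\<close> blocks enter through a
  fixed lower bound, which disappears after division by \<open>N\<close>. Both regularizations,
  adding a multiple of the identity and averaging over rotations, preserve the submean inequality,
  and their errors have the sign that Fatou's lemma needs. Square integrability rests on a gain over
  a trivial estimate. Halving the radius of a disc multiplies the mean of a nonnegative function by
  at most 4, but by at most 3 under the supermean property, while the mean defect against a fixed
  weight at radius \<open>s\<close> is of order \<open>s^2\<close>. A dyadic step from radius
  \<open>1/2^k\<close> thus costs a multiple of \<open>(3/4)^k\<close>, and these costs are
  summable.\<close>

section \<open>Pivots and determinants of Hermitian forms\<close>

definition hform :: "nat \<Rightarrow> (nat \<Rightarrow> nat \<Rightarrow> complex) \<Rightarrow> (nat \<Rightarrow> complex) \<Rightarrow> (nat \<Rightarrow> complex) \<Rightarrow> complex" where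
  "hform n G x y = (\<Sum>i<n. \<Sum>j<n. G i j * x i * cnj (y j))"

lemma hform_add_left: "hform n G (\<lambda>i. x i + x' i) y = hform n G x y + hform n G x' y"
  by (simp add: hform_def algebra_simps sum.distrib)

lemma hform_add_right: "hform n G x (\<lambda>i. y i + y' i) = hform n G x y + hform n G x y'"
  by (simp add: hform_def algebra_simps sum.distrib)

lemma hform_cnj:
  assumes "\<And>i j. i < n \<Longrightarrow> j < n \<Longrightarrow> G j i = cnj (G i j)"
  shows "hform n G y x = cnj (hform n G x y)"
proof -
  have "hform n G y x = (\<Sum>j<n. \<Sum>i<n. G j i * y j * cnj (x i))"
    by (simp add: hform_def)
  also have "\<dots> = (\<Sum>i<n. \<Sum>j<n. G j i * y j * cnj (x i))"
    by (rule sum.swap)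
  also have "\<dots> = cnj (hform n G x y)"
    unfolding hform_def cnj_sum
  proof (intro sum.cong refl)
    fix i j assume "i \<in> {..<n}" "j \<in> {..<n}"
    then have "G j i = cnj (G i j)" using assms by blast
    then show "G j i * y j * cnj (x i) = cnj (G i j * x i * cnj (y j))" by simp
  qed
  finally show ?thesis .
qed

lemma hform_cong:
  assumes "\<And>i. i < n \<Longrightarrow> x i = x' i" "\<And>i. i < n \<Longrightarrow> y i = y' i"
  shows "hform n G x y = hform n G x' y'"
  unfolding hform_def using assms by (intro sum.cong) auto

lemma hform_left: "hform n G x y = (\<Sum>j<n. (\<Sum>i<n. x i * G i j) * cnj (y j))"
  unfolding hform_def by (subst sum.swap) (simp add: sum_distrib_right sum_distrib_left mult_ac)

lemma hform_Suc_zero: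
  assumes "x n = 0" "y n = 0"
  shows "hform (Suc n) G x y = hform n G x y"
  by (simp add: hform_def assms)

lemma solve_left:
  fixes G :: "nat \<Rightarrow> nat \<Rightarrow> complex"
  assumes "Determinant.det (Matrix.mat n n (\<lambda>(i,j). G i j)) \<noteq> 0"
  obtains y where "\<And>j. j < n \<Longrightarrow> (\<Sum>i<n. y i * G i j) = b j"
proof -
  let ?A = "Matrix.mat n n (\<lambda>(i,j). G i j)"
  have A: "?A \<in> carrier_mat n n" by simp
  from det_non_zero_imp_unit[OF A assms, of "()"]
  obtain B where B: "B \<in> carrier_mat n n" "B * ?A = 1\<^sub>m n"
    by (auto simp: Units_def ring_mat_def)
  define y where "y i = (\<Sum>k<n. b k * (B $$ (k,i)))" for i
  have "(\<Sum>i<n. y i * G i j) = b j" if j: "j < n" for j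
  proof -
    have *: "(\<Sum>i<n. B $$ (k,i) * G i j) = (if k = j then 1 else 0)" if "k < n" for k
    proof -
      have "(B * ?A) $$ (k,j) = (\<Sum>i<n. B $$ (k,i) * G i j)"
        using B(1) that j by (simp add: times_mat_def scalar_prod_def lessThan_atLeast0)
      then show ?thesis using B(2) that j by simp
    qed
    have "(\<Sum>i<n. y i * G i j) = (\<Sum>i<n. \<Sum>k<n. b k * (B $$ (k,i) * G i j))"
      by (simp add: y_def sum_distrib_right mult.assoc)
    also have "\<dots> = (\<Sum>k<n. b k * (\<Sum>i<n. B $$ (k,i) * G i j))"
      by (subst sum.swap) (simp add: sum_distrib_left)
    also have "\<dots> = (\<Sum>k<n. b k * (if k = j then 1 else 0))"
      by (intro sum.cong refl) (simp add: *)
    also have "\<dots> = b j" using j by (simp add: if_distrib cong: if_cong)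
    finally show ?thesis .
  qed
  then show ?thesis using that by blast
qed

text \<open>Adding the combination \<open>y\<close> of the first \<open>n\<close> rows to the last
  row clears that row except in its corner, which becomes the Schur complement. The matrix
  \<open>?L\<close> that does this is unipotent, so the determinant does not change.\<close>

lemma det_schur_step:
  fixes G :: "nat \<Rightarrow> nat \<Rightarrow> complex"
  assumes y: "\<And>j. j < n \<Longrightarrow> (\<Sum>i<n. y i * G i j) = - G n j"
  shows "Determinant.det (Matrix.mat (Suc n) (Suc n) (\<lambda>(i,j). G i j)) =
     Determinant.det (Matrix.mat n n (\<lambda>(i,j). G i j)) * ((\<Sum>i<n. y i * G i n) + G n n)"
proof -
  let ?A = "Matrix.mat n n (\<lambda>(i,j). G i j)"
  let ?A' = "Matrix.mat (Suc n) (Suc n) (\<lambda>(i,j). G i j)"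
  let ?s = "(\<Sum>i<n. y i * G i n) + G n n"
  let ?L = "Matrix.mat (Suc n) (Suc n) (\<lambda>(i,j). if i = j then 1 else if i = n then y j else 0)"
  let ?T = "four_block_mat ?A (Matrix.mat n 1 (\<lambda>(i,j). G i n)) (0\<^sub>m 1 n) (Matrix.mat 1 1 (\<lambda>_. ?s))"
  have L: "Determinant.det ?L = 1"
  proof -
    have "Determinant.det ?L = prod_list (diag_mat ?L)"
      by (rule det_lower_triangular[of "Suc n"]) auto
    moreover have "map (\<lambda>i. ?L $$ (i, i)) [0..<Suc n] = map (\<lambda>i. 1) [0..<Suc n]"
      by (intro map_cong) auto
    ultimately show ?thesis
      unfolding diag_mat_def by (simp add: map_replicate_const del: upt_Suc)
  qed
  have "?L * ?A' = ?T"
  proof (rule eq_matI)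
    fix i j assume ij: "i < dim_row ?T" "j < dim_col ?T"
    have e: "(?L * ?A') $$ (i,j) = (\<Sum>k<Suc n. (if i = k then 1 else if i = n then y k else 0) * G k j)"
      using ij by (simp add: times_mat_def scalar_prod_def lessThan_atLeast0 del: sum.op_ivl_Suc)
    show "(?L * ?A') $$ (i,j) = ?T $$ (i,j)"
    proof (cases "i < n")
      case True
      then have "(?L * ?A') $$ (i,j) = G i j"
        unfolding e by (simp add: if_distribR if_distrib[of "\<lambda>a. a * _"] cong: if_cong)
      then show ?thesis using True ij by (auto simp: index_mat_four_block less_Suc_eq)
    next
      case False
      then have i: "i = n" using ij by simp
      have "(\<Sum>k<n. (if n = k then 1 else if n = n then y k else 0) * G k j) = (\<Sum>k<n. y k * G k j)"
        by (intro sum.cong) auto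
      then have "(?L * ?A') $$ (i,j) = (\<Sum>k<n. y k * G k j) + G n j"
        unfolding e unfolding i by (simp only: sum.lessThan_Suc) simp
      then show ?thesis using i ij y[of j] by (auto simp: index_mat_four_block less_Suc_eq)
    qed
  qed auto
  moreover have "Determinant.det (?L * ?A') = Determinant.det ?L * Determinant.det ?A'"
    by (rule det_mult[of _ "Suc n"]) auto
  moreover have "Determinant.det ?T = Determinant.det ?A * Determinant.det (Matrix.mat 1 1 (\<lambda>_. ?s))"
    by (rule det_four_block_mat_lower_left_zero) auto
  moreover have "Determinant.det (Matrix.mat 1 1 (\<lambda>_. ?s)) = ?s"
    by (subst det_single[of _ ]) auto
  ultimately show ?thesis using L by simp
qed

text \<open>\<open>\<delta> i\<close> is the Gram-Schmidt pivot, the squared distance of the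
  \<open>i\<close>-th basis vector from the span of the earlier ones. Knowing it as an attained
  minimum, and not just as a factor of the determinant, makes it possible to compare determinants
  pivot by pivot: a single test vector bounds it above, and an estimate valid for all admissible
  vectors bounds it below.\<close>

lemma hermitian_det_flag:
  assumes herm: "\<And>i j. i < n \<Longrightarrow> j < n \<Longrightarrow> G j i = cnj (G i j)"
    and pos: "\<And>x. (\<exists>i<n. x i \<noteq> 0) \<Longrightarrow> Re (hform n G x x) > 0"
  obtains \<delta> :: "nat \<Rightarrow> real" where
    "\<And>i. i < n \<Longrightarrow> \<delta> i > 0"
    "\<And>i x. i < n \<Longrightarrow> x i = 1 \<Longrightarrow> (\<And>j. i < j \<Longrightarrow> j < n \<Longrightarrow> x j = 0) \<Longrightarrow> \<delta> i \<le> Re (hform n G x x)"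
    "\<And>i. i < n \<Longrightarrow> \<exists>x. x i = 1 \<and> (\<forall>j. i < j \<and> j < n \<longrightarrow> x j = 0) \<and> \<delta> i = Re (hform n G x x)"
    "Determinant.det (Matrix.mat n n (\<lambda>(i,j). G i j)) = of_real (\<Prod>i<n. \<delta> i)"
proof -
  define Q where "Q n \<delta> \<longleftrightarrow> (\<forall>i<n. \<delta> i > 0) \<and>
    (\<forall>i<n. \<forall>x. x i = 1 \<longrightarrow> (\<forall>j. i < j \<and> j < n \<longrightarrow> x j = 0) \<longrightarrow> \<delta> i \<le> Re (hform n G x x)) \<and>
    (\<forall>i<n. \<exists>x. x i = 1 \<and> (\<forall>j. i < j \<and> j < n \<longrightarrow> x j = 0) \<and> \<delta> i = Re (hform n G x x)) \<and>
    Determinant.det (Matrix.mat n n (\<lambda>(i,j). G i j)) = of_real (\<Prod>i<n. \<delta> i)"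
    for n and \<delta> :: "nat \<Rightarrow> real"
  have "\<exists>\<delta>. Q n \<delta>"
    using assms
  proof (induction n)
    case 0
    show ?case by (simp add: Determinant.det_def Q_def)
  next
    case (Suc n)
    have pos': "Re (hform n G x x) > 0" if nz: "\<exists>i<n. x i \<noteq> 0" for x
    proof -
      have "hform n G x x = hform n G (x(n := 0)) (x(n := 0))" by (rule hform_cong) auto
      also have "\<dots> = hform (Suc n) G (x(n := 0)) (x(n := 0))"
        by (rule hform_Suc_zero[symmetric]) auto
      finally have "hform n G x x = hform (Suc n) G (x(n := 0)) (x(n := 0))" .
      moreover obtain i where "i < n" "x i \<noteq> 0" using nz by blast
      then have "\<exists>i<Suc n. (x(n := 0)) i \<noteq> 0" by (intro exI[of _ i]) auto
      ultimately show ?thesis using Suc.prems(2)[of "x(n := 0)"] by metis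
    qed
    have herm': "G j i = cnj (G i j)" if "i < n" "j < n" for i j by (rule Suc.prems(1)) (simp_all add: that less_SucI)
    have "\<exists>\<delta>. Q n \<delta>"
    proof (rule Suc.IH)
      show "G j i = cnj (G i j)" if "i < n" "j < n" for i j using that by (rule herm')
      show "0 < Re (hform n G x x)" if "\<exists>i<n. x i \<noteq> 0" for x using that by (rule pos')
    qed
    then obtain d where Qd: "Q n d" ..
    note d = Qd[unfolded Q_def, THEN conjunct1, rule_format]
      Qd[unfolded Q_def, THEN conjunct2, THEN conjunct1, rule_format]
      Qd[unfolded Q_def, THEN conjunct2, THEN conjunct2, THEN conjunct1, rule_format]
      Qd[unfolded Q_def, THEN conjunct2, THEN conjunct2, THEN conjunct2]
    have "(\<Prod>i<n. d i) > 0" using d(1) by (intro prod_pos) auto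
    then have "Determinant.det (Matrix.mat n n (\<lambda>(i,j). G i j)) \<noteq> 0"
      unfolding d(4) by (metis less_irrefl of_real_eq_0_iff)
    from solve_left[OF this, of "\<lambda>j. - G n j"] obtain y where
      y: "\<And>j. j < n \<Longrightarrow> (\<Sum>i<n. y i * G i j) = - G n j" by blast
    \<comment> \<open>By the choice of \<open>y\<close>, the vector \<open>Y\<close> is orthogonal
      to the first \<open>n\<close> basis vectors. It is the last basis vector minus its projection
      to their span, and the new minimum is attained there.\<close>
    define Y where "Y = y(n := 1)"
    define s where "s = (\<Sum>i<n. y i * G i n) + G n n"
    have YG: "(\<Sum>i<Suc n. Y i * G i j) = (if j = n then s else 0)" if "j \<le> n" for j
    proof -
      have "(\<Sum>i<Suc n. Y i * G i j) = (\<Sum>i<n. y i * G i j) + G n j"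
        by (simp add: Y_def)
      then show ?thesis using y[of j] that by (auto simp: s_def)
    qed
    have hY: "hform (Suc n) G Y w = s * cnj (w n)" for w
      unfolding hform_left using YG by simp
    have hY': "hform (Suc n) G w Y = cnj s * w n" for w
    proof -
      have "hform (Suc n) G w Y = cnj (hform (Suc n) G Y w)"
        by (rule hform_cnj) (rule Suc.prems(1))
      then show ?thesis by (simp add: hY)
    qed
    have Yn: "Y n = 1" by (simp add: Y_def)
    have hYY: "hform (Suc n) G Y Y = s" using hY[of Y] Yn by simp
    have "hform (Suc n) G Y Y = cnj s" using hY'[of Y] Yn by simp
    then have "cnj s = s" using hYY by (rule trans[OF sym])
    then have sreal: "s = of_real (Re s)" by (metis Reals_cnj_iff of_real_Re)
    have "\<exists>i<Suc n. Y i \<noteq> 0" using Yn by (intro exI[of _ n]) simp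
    from Suc.prems(2)[OF this] have spos: "Re s > 0" unfolding hYY .
    have last: "Re s \<le> Re (hform (Suc n) G x x)" if "x n = 1" for x
    proof -
      \<comment> \<open>\<open>z\<close> lies in the span to which \<open>Y\<close> is orthogonal,
        so the cross terms vanish and Pythagoras applies.\<close>
      define z where "z i = x i - Y i" for i
      have x: "x = (\<lambda>i. Y i + z i)" by (simp add: z_def)
      have zn: "z n = 0" using that by (simp add: z_def Y_def)
      have "hform (Suc n) G x x = hform (Suc n) G Y Y + hform (Suc n) G Y z + hform (Suc n) G z Y + hform (Suc n) G z z"
        unfolding x hform_add_left hform_add_right by simp
      also have "\<dots> = s + hform (Suc n) G z z"
        unfolding hYY by (simp only: hY[of z] hY'[of z] zn) simp
      finally have e: "hform (Suc n) G x x = s + hform (Suc n) G z z" .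
      have "Re (hform (Suc n) G z z) \<ge> 0"
      proof (cases "\<exists>i<Suc n. z i \<noteq> 0")
        case True
        then show ?thesis using Suc.prems(2) by (simp add: less_imp_le)
      next
        case False
        then show ?thesis by (simp add: hform_def)
      qed
      then show ?thesis using e by simp
    qed
    define \<delta> where "\<delta> = d(n := Re s)"
    have ext: "hform (Suc n) G x x = hform n G x x" if "x n = 0" for x :: "nat \<Rightarrow> complex"
      using that by (simp add: hform_Suc_zero)
    show ?case unfolding Q_def
    proof (intro exI[of _ \<delta>] conjI allI impI)
      fix i assume "i < Suc n" then show "\<delta> i > 0" using d(1) spos by (auto simp: \<delta>_def less_Suc_eq)
    next
      fix i and x :: "nat \<Rightarrow> complex" assume i: "i < Suc n" and x: "x i = 1" "\<forall>j. i < j \<and> j < Suc n \<longrightarrow> x j = 0"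
      show "\<delta> i \<le> Re (hform (Suc n) G x x)"
      proof (cases "i = n")
        case True then show ?thesis using last[of x] x by (simp add: \<delta>_def)
      next
        case False
        then have "x n = 0" using x i by auto
        then show ?thesis using d(2)[of i x] False i x by (simp add: \<delta>_def ext)
      qed
    next
      fix i assume i: "i < Suc n"
      show "\<exists>x. x i = 1 \<and> (\<forall>j. i < j \<and> j < Suc n \<longrightarrow> x j = 0) \<and> \<delta> i = Re (hform (Suc n) G x x)"
      proof (cases "i = n")
        case True
        have "Y i = 1" "\<forall>j. i < j \<and> j < Suc n \<longrightarrow> Y j = 0" "\<delta> i = Re (hform (Suc n) G Y Y)"
          unfolding hYY using True Yn by (auto simp: \<delta>_def)
        then show ?thesis by blast
      next
        case False
        then obtain x where x: "x i = 1" "\<forall>j. i < j \<and> j < n \<longrightarrow> x j = 0" "d i = Re (hform n G x x)"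
          using d(3)[of i] i by (metis less_antisym)
        have "hform n G x x = hform n G (x(n := 0)) (x(n := 0))" by (rule hform_cong) auto
        moreover have "hform n G (x(n := 0)) (x(n := 0)) = hform (Suc n) G (x(n := 0)) (x(n := 0))"
          by (rule ext[symmetric]) simp
        ultimately have "\<delta> i = Re (hform (Suc n) G (x(n := 0)) (x(n := 0)))"
          using x(3) False by (simp add: \<delta>_def)
        moreover have "(x(n := 0)) i = 1" "\<forall>j. i < j \<and> j < Suc n \<longrightarrow> (x(n := 0)) j = 0"
          using x False i by auto
        ultimately show ?thesis by blast
      qed
    next
      show "Determinant.det (Matrix.mat (Suc n) (Suc n) (\<lambda>(i,j). G i j)) = of_real (\<Prod>i<Suc n. \<delta> i)"
      proof -
        have "Determinant.det (Matrix.mat (Suc n) (Suc n) (\<lambda>(i,j). G i j)) =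
            Determinant.det (Matrix.mat n n (\<lambda>(i,j). G i j)) * s"
          unfolding s_def by (rule det_schur_step) (rule y)
        also have "\<dots> = of_real (\<Prod>i<n. d i) * of_real (Re s)"
          unfolding d(4) by (subst sreal) (rule refl)
        also have "(\<Prod>i<n. d i) = (\<Prod>i<n. \<delta> i)" by (intro prod.cong) (auto simp: \<delta>_def)
        also have "Re s = \<delta> n" by (simp add: \<delta>_def)
        finally show ?thesis by simp
      qed
    qed
  qed
  then obtain \<delta> where Q: "Q n \<delta>" ..
  show ?thesis
  proof (rule that[of \<delta>])
    show "\<delta> i > 0" if "i < n" for i using Q that unfolding Q_def by blast
    show "\<delta> i \<le> Re (hform n G x x)"
      if "i < n" "x i = 1" "\<And>j. i < j \<Longrightarrow> j < n \<Longrightarrow> x j = 0" for i x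
      using Q[unfolded Q_def, THEN conjunct2, THEN conjunct1, rule_format, of i x] that by blast
    show "\<exists>x. x i = 1 \<and> (\<forall>j. i < j \<and> j < n \<longrightarrow> x j = 0) \<and> \<delta> i = Re (hform n G x x)"
      if "i < n" for i using Q that unfolding Q_def by blast
    show "Determinant.det (Matrix.mat n n (\<lambda>(i,j). G i j)) = of_real (\<Prod>i<n. \<delta> i)"
      using Q unfolding Q_def by blast
  qed
qed

definition sesq :: "complex^'r^'r \<Rightarrow> complex^'r \<Rightarrow> complex^'r \<Rightarrow> complex" where
  "sesq M v w = (\<Sum>i\<in>UNIV. \<Sum>j\<in>UNIV. M$i$j * v$i * cnj (w$j))"

definition qf :: "complex^'r^'r \<Rightarrow> complex^'r \<Rightarrow> real" where
  "qf M v = Re (sesq M v v)"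

definition hermitian :: "complex^'r^'r \<Rightarrow> bool" where
  "hermitian M \<longleftrightarrow> (\<forall>i j. M$j$i = cnj (M$i$j))"

lemma det_eq_Determinant_det:
  fixes M :: "complex^'r^'r"
  assumes f: "bij_betw f {..<CARD('r)} (UNIV :: 'r::finite set)"
  shows "det M = Determinant.det (Matrix.mat CARD('r) CARD('r) (\<lambda>(i,j). M $ f i $ f j))"
proof -
  let ?n = "CARD('r)"
  have f': "bij_betw f {0..<?n} UNIV" using f by (simp add: lessThan_atLeast0)
  have inj: "inj_on f {0..<?n}" using f' by (simp add: bij_betw_def)
  have "Determinant.det (Matrix.mat ?n ?n (\<lambda>(i,j). M $ f i $ f j)) =
      (\<Sum>p | p permutes {0..<?n}. of_int (sign p) * (\<Prod>i=0..<?n. M $ f i $ f (p i)))"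
  proof (subst det_def'[OF mat_carrier], rule sum.cong[OF refl])
    fix p assume "p \<in> {p. p permutes {0..<?n}}"
    then have "i < ?n \<Longrightarrow> p i < ?n" for i using permutes_in_image[of p "{0..<?n}" i] by simp
    then show "of_int (sign p) * (\<Prod>i=0..<?n. Matrix.mat ?n ?n (\<lambda>(i,j). M $ f i $ f j) $$ (i, p i)) =
        of_int (sign p) * (\<Prod>i=0..<?n. M $ f i $ f (p i))" by simp
  qed
  also have "\<dots> = (\<Sum>p | p permutes {0..<?n}.
      (\<lambda>p'. of_int (sign p') * (\<Prod>i\<in>UNIV. M $ i $ p' i)) (map_permutation {0..<?n} f p))"
  proof (intro sum.cong refl)
    fix p assume "p \<in> {p. p permutes {0..<?n}}"
    then have p: "p permutes {0..<?n}" by simp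
    have s: "sign (map_permutation {0..<?n} f p) = sign p"
      using sign_map_permutation[OF inj p] by simp
    have "(\<Prod>i\<in>UNIV. M $ i $ map_permutation {0..<?n} f p i) =
        (\<Prod>i=0..<?n. M $ f i $ map_permutation {0..<?n} f p (f i))"
      by (rule prod.reindex_bij_betw[OF f', symmetric])
    also have "\<dots> = (\<Prod>i=0..<?n. M $ f i $ f (p i))"
    proof (intro prod.cong refl)
      fix i assume "i \<in> {0..<?n}"
      then show "M $ f i $ map_permutation {0..<?n} f p (f i) = M $ f i $ f (p i)"
        using inj by (simp add: map_permutation_def restrict_id_def)
    qed
    finally show "of_int (sign p) * (\<Prod>i=0..<?n. M $ f i $ f (p i)) =
        (\<lambda>p'. of_int (sign p') * (\<Prod>i\<in>UNIV. M $ i $ p' i)) (map_permutation {0..<?n} f p)"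
      by (simp add: s)
  qed
  also have "\<dots> = (\<Sum>p | p permutes (UNIV::'r set). of_int (sign p) * (\<Prod>i\<in>UNIV. M $ i $ p i))"
  proof (rule sum.reindex_bij_betw)
    show "bij_betw (map_permutation {0..<?n} f) {p. p permutes {0..<?n}} {p. p permutes (UNIV::'r set)}"
    proof -
      have "map_permutation {0..<?n} f =
          (\<lambda>\<pi> x. if x \<in> UNIV then f (\<pi> (inv_into {0..<?n} f x)) else x)"
        using f' by (auto simp: map_permutation_def restrict_id_def bij_betw_def fun_eq_iff)
      then show ?thesis using bij_betw_permutations[OF f'] by simp
    qed
  qed
  finally show ?thesis by (simp add: Determinants.det_def)
qed

text \<open>The bridge between two encodings. The Gram matrices of sections have size
  \<open>N * r\<close> with \<open>N\<close> tending to infinity, so they are indexed by natural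
  numbers, while the matrices of the metric are indexed by the type \<open>'r\<close>.\<close>

lemma hform_eq_sesq:
  fixes M :: "complex^'r^'r"
  assumes f: "bij_betw f {..<CARD('r)} (UNIV :: 'r::finite set)"
  shows "hform CARD('r) (\<lambda>i j. M $ f i $ f j) x y =
    sesq M (\<chi> s. x (inv_into {..<CARD('r)} f s)) (\<chi> s. y (inv_into {..<CARD('r)} f s))"
proof -
  let ?g = "inv_into {..<CARD('r)} f"
  have gf: "i < CARD('r) \<Longrightarrow> ?g (f i) = i" for i
    using f by (simp add: bij_betw_def)
  show ?thesis
    unfolding sesq_def hform_def sum.reindex_bij_betw[OF f, symmetric]
    by (intro sum.cong refl) (simp add: gf)
qed

lemma hform_eq_sesq':
  fixes M :: "complex^'r^'r"
  assumes f: "bij_betw f {..<CARD('r)} (UNIV :: 'r::finite set)"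
  shows "sesq M v w = hform CARD('r) (\<lambda>i j. M $ f i $ f j) (\<lambda>i. v $ f i) (\<lambda>i. w $ f i)"
  unfolding sesq_def hform_def sum.reindex_bij_betw[OF f, symmetric] by simp

lemma det_pos_flag:
  fixes M :: "complex^'r::finite^'r"
  assumes f: "bij_betw f {..<CARD('r)} (UNIV :: 'r::finite set)"
    and herm: "hermitian M" and pos: "\<And>v. v \<noteq> 0 \<Longrightarrow> qf M v > 0"
  obtains \<delta> :: "nat \<Rightarrow> real" where
    "\<And>i. i < CARD('r) \<Longrightarrow> \<delta> i > 0"
    "\<And>i v. i < CARD('r) \<Longrightarrow> v $ f i = 1 \<Longrightarrow> (\<And>j. i < j \<Longrightarrow> j < CARD('r) \<Longrightarrow> v $ f j = 0) \<Longrightarrow> \<delta> i \<le> qf M v"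
    "det M = of_real (\<Prod>i<CARD('r). \<delta> i)"
proof -
  let ?n = "CARD('r)" and ?G = "\<lambda>i j. M $ f i $ f j"
  have herm': "?G j i = cnj (?G i j)" if "i < ?n" "j < ?n" for i j
    using herm unfolding hermitian_def by blast
  have pos': "Re (hform ?n ?G x x) > 0" if nz: "\<exists>i<?n. x i \<noteq> 0" for x
  proof -
    obtain i where i: "i < ?n" "x i \<noteq> 0" using nz by blast
    have "(\<chi> s. x (inv_into {..<?n} f s)) $ f i \<noteq> 0"
      using i f by (simp add: bij_betw_def)
    then have "(\<chi> s. x (inv_into {..<?n} f s)) \<noteq> 0" by (metis zero_index)
    then show ?thesis using pos unfolding hform_eq_sesq[OF f] qf_def by blast
  qed
  obtain \<delta> :: "nat \<Rightarrow> real" where d: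
    "\<And>i. i < ?n \<Longrightarrow> \<delta> i > 0"
    "\<And>i x. i < ?n \<Longrightarrow> x i = 1 \<Longrightarrow> (\<And>j. i < j \<Longrightarrow> j < ?n \<Longrightarrow> x j = 0) \<Longrightarrow> \<delta> i \<le> Re (hform ?n ?G x x)"
    "Determinant.det (Matrix.mat ?n ?n (\<lambda>(i,j). ?G i j)) = of_real (\<Prod>i<?n. \<delta> i)"
    by (rule hermitian_det_flag[of ?n ?G]) (use herm' pos' in blast)+
  show ?thesis
  proof (rule that[of \<delta>])
    show "\<delta> i > 0" if "i < ?n" for i using d(1) that .
    show "\<delta> i \<le> qf M v" if "i < ?n" "v $ f i = 1" "\<And>j. i < j \<Longrightarrow> j < ?n \<Longrightarrow> v $ f j = 0" for i v
      using d(2)[of i "\<lambda>i. v $ f i"] that unfolding qf_def hform_eq_sesq'[OF f] by blast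
    show "det M = of_real (\<Prod>i<?n. \<delta> i)"
      unfolding det_eq_Determinant_det[OF f] d(3) ..
  qed
qed

lemma ex_enum: "\<exists>f. bij_betw f {..<CARD('r)} (UNIV :: 'r::finite set)"
  using ex_bij_betw_nat_finite[of "UNIV :: 'r set"] by (auto simp: lessThan_atLeast0)

lemma sesq_axis [simp]: "sesq M (axis i 1) (axis j 1) = M $ i $ j"
  by (simp add: sesq_def axis_def if_distrib[of "\<lambda>a. _ * a"] if_distrib[of cnj] cong: if_cong)

text \<open>Hadamard's inequality: the basis vector \<open>axis (f i) 1\<close> is itself admissible
  in the minimum that defines the \<open>i\<close>-th pivot, so each pivot is at most a diagonal
  entry.\<close>

lemma hadamard_det_le:
  fixes M :: "complex^'r::finite^'r"
  assumes herm: "hermitian M" and pos: "\<And>v. v \<noteq> 0 \<Longrightarrow> qf M v > 0"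
  shows "det M = of_real (Re (det M))" "Re (det M) > 0" "Re (det M) \<le> (\<Prod>i\<in>UNIV. Re (M$i$i))"
proof -
  obtain f where f: "bij_betw f {..<CARD('r)} (UNIV :: 'r set)" using ex_enum by blast
  obtain \<delta> :: "nat \<Rightarrow> real" where d:
    "\<And>i. i < CARD('r) \<Longrightarrow> \<delta> i > 0"
    "\<And>i v. i < CARD('r) \<Longrightarrow> v $ f i = 1 \<Longrightarrow> (\<And>j. i < j \<Longrightarrow> j < CARD('r) \<Longrightarrow> v $ f j = 0) \<Longrightarrow> \<delta> i \<le> qf M v"
    "det M = of_real (\<Prod>i<CARD('r). \<delta> i)"
    by (rule det_pos_flag[OF f herm pos]) blast+
  show "det M = of_real (Re (det M))" by (simp only: d(3) Re_complex_of_real)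
  show "Re (det M) > 0" unfolding d(3) Re_complex_of_real using d(1) by (intro prod_pos) auto
  have "\<delta> i \<le> Re (M $ f i $ f i)" if i: "i < CARD('r)" for i
  proof -
    have "\<delta> i \<le> qf M (axis (f i) 1)"
    proof (rule d(2)[OF i])
      show "axis (f i) 1 $ f j = 0" if "i < j" "j < CARD('r)" for j
      proof -
        have "f j \<noteq> f i" using f i that by (metis bij_betw_def inj_on_eq_iff lessThan_iff less_irrefl)
        then show ?thesis by (simp add: axis_def)
      qed
    qed (simp add: axis_def)
    then show ?thesis by (simp add: qf_def)
  qed
  then have "(\<Prod>i<CARD('r). \<delta> i) \<le> (\<Prod>i<CARD('r). Re (M $ f i $ f i))"
    using d(1) by (intro prod_mono) (auto simp: less_imp_le)
  also have "\<dots> = (\<Prod>i\<in>UNIV. Re (M$i$i))" by (rule prod.reindex_bij_betw[OF f])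
  finally show "Re (det M) \<le> (\<Prod>i\<in>UNIV. Re (M$i$i))" by (simp only: d(3) Re_complex_of_real)
qed

section \<open>Unitary congruence and block diagonal matrices\<close>

text \<open>\<open>unit\<close> says that \<open>V\<close> is unitary. Forms are linear in the first
  argument, so the congruence multiplies \<open>D\<close> by the transpose of \<open>V\<close> on
  the left and by the conjugate of \<open>V\<close> on the right; the two outer determinants have
  product 1.\<close>

lemma unitary_congruence:
  fixes V D :: "nat \<Rightarrow> nat \<Rightarrow> complex"
  assumes unit: "\<And>a b. a < n \<Longrightarrow> b < n \<Longrightarrow> (\<Sum>k<n. V a k * cnj (V b k)) = (if a = b then 1 else 0)"
  defines "G \<equiv> \<lambda>b b'. \<Sum>a'<n. (\<Sum>a<n. V a b * D a a') * cnj (V a' b')"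
  shows "Determinant.det (Matrix.mat n n (\<lambda>(i,j). G i j)) = Determinant.det (Matrix.mat n n (\<lambda>(i,j). D i j))"
    and "hform n G x y = hform n D (\<lambda>a. \<Sum>b<n. V a b * x b) (\<lambda>a. \<Sum>b<n. V a b * y b)"
proof -
  let ?V = "Matrix.mat n n (\<lambda>(i,j). V i j)" and ?C = "Matrix.mat n n (\<lambda>(i,j). cnj (V i j))"
  let ?D = "Matrix.mat n n (\<lambda>(i,j). D i j)"
  have G: "Matrix.mat n n (\<lambda>(i,j). G i j) = (transpose_mat ?V * ?D) * ?C"
    by (rule eq_matI) (auto simp: G_def times_mat_def scalar_prod_def lessThan_atLeast0)
  have "?V * transpose_mat ?C = 1\<^sub>m n"
    using unit by (intro eq_matI) (auto simp: times_mat_def scalar_prod_def lessThan_atLeast0)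
  then have "Determinant.det (?V * transpose_mat ?C) = 1" by simp
  moreover have "Determinant.det (?V * transpose_mat ?C) = Determinant.det ?V * Determinant.det ?C"
    by (subst det_mult[of _ n]) (auto simp: Determinant.det_transpose[of _ n])
  ultimately have VC: "Determinant.det ?V * Determinant.det ?C = 1" by simp
  have "Determinant.det (Matrix.mat n n (\<lambda>(i,j). G i j)) =
      Determinant.det ?V * Determinant.det ?D * Determinant.det ?C"
  proof -
    have "Determinant.det ((transpose_mat ?V * ?D) * ?C) = Determinant.det (transpose_mat ?V * ?D) * Determinant.det ?C"
      by (rule det_mult[of _ n]) auto
    also have "Determinant.det (transpose_mat ?V * ?D) = Determinant.det (transpose_mat ?V) * Determinant.det ?D"
      by (rule det_mult[of _ n]) auto
    also have "Determinant.det (transpose_mat ?V) = Determinant.det ?V"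
      by (rule Determinant.det_transpose[of _ n]) auto
    finally show ?thesis unfolding G .
  qed
  then show "Determinant.det (Matrix.mat n n (\<lambda>(i,j). G i j)) = Determinant.det ?D"
    using VC by (simp add: mult_ac)
  have "hform n G x y = (\<Sum>b<n. \<Sum>b'<n. \<Sum>a'<n. \<Sum>a<n. D a a' * (V a b * x b) * cnj (V a' b' * y b'))"
    unfolding hform_def G_def by (simp add: sum_distrib_left sum_distrib_right mult_ac)
  also have "\<dots> = (\<Sum>b<n. \<Sum>a'<n. \<Sum>b'<n. \<Sum>a<n. D a a' * (V a b * x b) * cnj (V a' b' * y b'))"
    by (intro sum.cong refl sum.swap)
  also have "\<dots> = (\<Sum>b<n. \<Sum>a'<n. \<Sum>a<n. \<Sum>b'<n. D a a' * (V a b * x b) * cnj (V a' b' * y b'))"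
    by (intro sum.cong refl sum.swap)
  also have "\<dots> = (\<Sum>b<n. \<Sum>a<n. \<Sum>a'<n. \<Sum>b'<n. D a a' * (V a b * x b) * cnj (V a' b' * y b'))"
    by (intro sum.cong refl sum.swap)
  also have "\<dots> = (\<Sum>a<n. \<Sum>b<n. \<Sum>a'<n. \<Sum>b'<n. D a a' * (V a b * x b) * cnj (V a' b' * y b'))"
    by (rule sum.swap)
  also have "\<dots> = (\<Sum>a<n. \<Sum>a'<n. \<Sum>b<n. \<Sum>b'<n. D a a' * (V a b * x b) * cnj (V a' b' * y b'))"
    by (intro sum.cong refl sum.swap)
  also have "\<dots> = (\<Sum>a<n. \<Sum>a'<n. \<Sum>b'<n. \<Sum>b<n. D a a' * (V a b * x b) * cnj (V a' b' * y b'))"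
    by (intro sum.cong refl sum.swap)
  also have "\<dots> = hform n D (\<lambda>a. \<Sum>b<n. V a b * x b) (\<lambda>a. \<Sum>b<n. V a b * y b)"
    unfolding hform_def by (simp add: sum_distrib_left sum_distrib_right)
  finally show "hform n G x y = hform n D (\<lambda>a. \<Sum>b<n. V a b * x b) (\<lambda>a. \<Sum>b<n. V a b * y b)" .
qed

definition block_diag :: "nat \<Rightarrow> (nat \<Rightarrow> nat \<Rightarrow> nat \<Rightarrow> complex) \<Rightarrow> nat \<Rightarrow> nat \<Rightarrow> complex" where
  "block_diag r B a b = (if a div r = b div r then B (a div r) (a mod r) (b mod r) else 0)"

lemma sum_div_mod:
  fixes F :: "nat \<Rightarrow> nat \<Rightarrow> 'a::comm_monoid_add"
  assumes "r > 0"
  shows "(\<Sum>a<N * r. F (a div r) (a mod r)) = (\<Sum>q<N. \<Sum>i<r. F q i)"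
proof -
  have "(\<Sum>a<N * r. F (a div r) (a mod r)) = (\<Sum>q<N. \<Sum>a=q*r..<q*r+r. F (a div r) (a mod r))"
    by (rule sum.nat_group[symmetric])
  also have "\<dots> = (\<Sum>q<N. \<Sum>i<r. F q i)"
  proof (rule sum.cong[OF refl])
    fix q
    have "(\<Sum>a=q*r..<q*r+r. F (a div r) (a mod r)) = (\<Sum>i=0..<r. F ((i + q*r) div r) ((i + q*r) mod r))"
      using sum.shift_bounds_nat_ivl[of "\<lambda>a. F (a div r) (a mod r)" 0 "q*r" r] by (simp add: add.commute)
    also have "\<dots> = (\<Sum>i<r. F q i)"
      using assms by (auto intro!: sum.cong simp: lessThan_atLeast0)
    finally show "(\<Sum>a=q*r..<q*r+r. F (a div r) (a mod r)) = (\<Sum>i<r. F q i)" .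
  qed
  finally show ?thesis .
qed

lemma det_block_diag:
  assumes r: "r > 0"
  shows "Determinant.det (Matrix.mat (N * r) (N * r) (\<lambda>(i,j). block_diag r B i j)) =
    (\<Prod>q<N. Determinant.det (Matrix.mat r r (\<lambda>(i,j). B q i j)))"
proof (induction N)
  case 0
  show ?case by (simp add: Determinant.det_def)
next
  case (Suc N)
  have lt: "a div r < N" if "a < N * r" for a
    using that r by (simp add: less_mult_imp_div_less)
  have ge: "a div r = N \<and> a mod r = a - N * r" if "\<not> a < N * r" "a < N * r + r" for a
  proof -
    have "a = N * r + (a - N * r)" "a - N * r < r" using that by auto
    then show ?thesis by (metis add.commute div_mult_self3 div_less mod_mult_self3 mod_less add_cancel_right_right r less_numeral_extra(3))
  qed
  have "Matrix.mat (Suc N * r) (Suc N * r) (\<lambda>(i,j). block_diag r B i j) =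
    four_block_mat (Matrix.mat (N * r) (N * r) (\<lambda>(i,j). block_diag r B i j)) (0\<^sub>m (N*r) r) (0\<^sub>m r (N*r))
       (Matrix.mat r r (\<lambda>(i,j). B N i j))" (is "?L = ?R")
  proof (rule eq_matI)
    fix i j assume "i < dim_row ?R" "j < dim_col ?R"
    then have ij: "i < N * r + r" "j < N * r + r" by auto
    show "?L $$ (i,j) = ?R $$ (i,j)"
    proof (cases "i < N * r"; cases "j < N * r")
      assume *: "i < N * r" "j < N * r"
      then show ?thesis using ij by (simp add: index_mat_four_block)
    next
      assume *: "i < N * r" "\<not> j < N * r"
      then show ?thesis using ij lt[of i] ge[of j] by (simp add: index_mat_four_block block_diag_def)
    next
      assume *: "\<not> i < N * r" "j < N * r"
      then show ?thesis using ij lt[of j] ge[of i] by (simp add: index_mat_four_block block_diag_def)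
    next
      assume *: "\<not> i < N * r" "\<not> j < N * r"
      then show ?thesis using ij ge[of i] ge[of j] by (simp add: index_mat_four_block block_diag_def)
    qed
  qed auto
  then show ?case
    by (simp only:) (subst det_four_block_mat_lower_left_zero[of _ "N*r" _ r], auto simp: Suc)
qed

lemma hform_block_diag:
  assumes r: "r > 0"
  shows "hform (N * r) (block_diag r B) (\<lambda>a. x (a div r) (a mod r)) (\<lambda>a. y (a div r) (a mod r)) =
    (\<Sum>q<N. hform r (B q) (x q) (y q))"
proof -
  define F where "F q i q' i' = (if q = q' then B q i i' else 0) * x q i * cnj (y q' i')" for q i q' i'
  have "hform (N * r) (block_diag r B) (\<lambda>a. x (a div r) (a mod r)) (\<lambda>a. y (a div r) (a mod r)) =
    (\<Sum>a<N*r. \<Sum>b<N*r. F (a div r) (a mod r) (b div r) (b mod r))"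
    unfolding hform_def block_diag_def F_def by simp
  also have "\<dots> = (\<Sum>a<N*r. \<Sum>q'<N. \<Sum>i'<r. F (a div r) (a mod r) q' i')"
    by (rule sum.cong[OF refl]) (rule sum_div_mod[OF r])
  also have "\<dots> = (\<Sum>q<N. \<Sum>i<r. \<Sum>q'<N. \<Sum>i'<r. F q i q' i')"
    by (rule sum_div_mod[OF r])
  also have "\<dots> = (\<Sum>q<N. hform r (B q) (x q) (y q))"
    unfolding hform_def
  proof (rule sum.cong[OF refl], rule sum.cong[OF refl])
    fix q i assume q: "q \<in> {..<N}"
    have "(\<Sum>q'<N. \<Sum>i'<r. F q i q' i') =
      (\<Sum>q'<N. if q = q' then (\<Sum>i'<r. B q i i' * x q i * cnj (y q i')) else 0)"
      by (rule sum.cong[OF refl]) (auto simp: F_def)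
    also have "\<dots> = (\<Sum>i'<r. B q i i' * x q i * cnj (y q i'))" using q by simp
    finally show "(\<Sum>q'<N. \<Sum>i'<r. F q i q' i') = (\<Sum>i'<r. B q i i' * x q i * cnj (y q i'))" .
  qed
  finally show ?thesis .
qed

section \<open>Integration over the circle and its rotation invariance\<close>

definition circ :: "real measure" where "circ = restrict_space lborel {0..2*pi}"

lemma space_circ [simp]: "space circ = {0..2*pi}" by (simp add: circ_def space_restrict_space)

lemma finite_measure_circ: "finite_measure circ"
  by (rule finite_measureI) (simp add: circ_def emeasure_restrict_space space_restrict_space)

lemma emeasure_circ: "emeasure circ (space circ) = ennreal (2*pi)"
  by (simp add: circ_def emeasure_restrict_space space_restrict_space)

lemma measure_circ: "measure circ {0..2*pi} = 2*pi"
  using emeasure_circ by (simp add: measure_def)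

lemma borel_measurable_circ: "f \<in> borel_measurable borel \<Longrightarrow> f \<in> borel_measurable circ"
  unfolding circ_def by (rule measurable_restrict_space1) simp

lemma integrable_circ:
  fixes f :: "real \<Rightarrow> 'b::{banach, second_countable_topology}"
  assumes "f \<in> borel_measurable borel" "\<And>\<theta>. \<theta> \<in> {0..2*pi} \<Longrightarrow> norm (f \<theta>) \<le> B"
  shows "integrable circ f"
  by (rule finite_measure.integrable_const_bound[OF finite_measure_circ, of _ B])
     (use assms in \<open>auto intro!: AE_I2 borel_measurable_circ\<close>)

lemma continuous_integrable_circ:
  fixes f :: "real \<Rightarrow> 'b::{banach, second_countable_topology}"
  assumes "continuous_on UNIV f"
  shows "integrable circ f"
proof -
  have "compact (f ` {0..2*pi})"
    using assms by (intro compact_continuous_image) (auto intro: continuous_on_subset)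
  then obtain B where "\<And>y. y \<in> f ` {0..2*pi} \<Longrightarrow> norm y \<le> B"
    using compact_imp_bounded bounded_iff by metis
  then show ?thesis
    using assms by (intro integrable_circ[of f B]) (auto intro: borel_measurable_continuous_onI)
qed

lemma nn_integral_circ: "(\<integral>\<^sup>+\<theta>. f \<theta> \<partial>circ) = (\<integral>\<^sup>+\<theta>. f \<theta> * indicator {0..2*pi} \<theta> \<partial>lborel)"
  unfolding circ_def by (subst nn_integral_restrict_space) auto

text \<open>The part of the shifted interval beyond \<open>2*pi\<close> is moved back by one period.
  With nonnegative integrals the splitting is free of integrability conditions.\<close>

lemma nn_integral_circ_shift:
  fixes F :: "real \<Rightarrow> ennreal"
  assumes F: "F \<in> borel_measurable borel" and per: "\<And>\<theta>. F (\<theta> + 2*pi) = F \<theta>"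
    and \<phi>: "\<phi> \<in> {0..2*pi}"
  shows "(\<integral>\<^sup>+\<theta>. F (\<theta> + \<phi>) \<partial>circ) = (\<integral>\<^sup>+\<theta>. F \<theta> \<partial>circ)"
proof -
  note [measurable] = F
  have tr: "(\<integral>\<^sup>+x. f x \<partial>lborel) = (\<integral>\<^sup>+x. f (x + c) \<partial>lborel)"
    if "f \<in> borel_measurable borel" for f :: "real \<Rightarrow> ennreal" and c
    using nn_integral_real_affine[OF that, of 1 c] by (simp add: add.commute)
  have ae: "AE x in lborel. x \<noteq> (a::real)" for a by (rule AE_lborel_singleton)
  have "(\<integral>\<^sup>+\<theta>. F (\<theta> + \<phi>) \<partial>circ) = (\<integral>\<^sup>+x. F (x + \<phi>) * indicator {\<phi>..2*pi+\<phi>} (x + \<phi>) \<partial>lborel)"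
    unfolding nn_integral_circ by (intro nn_integral_cong) (auto simp: indicator_def)
  also have "\<dots> = (\<integral>\<^sup>+x. F x * indicator {\<phi>..2*pi+\<phi>} x \<partial>lborel)"
    by (rule tr[symmetric]) measurable
  \<comment> \<open>The two intervals share the point \<open>2*pi\<close>, so the integrands agree
    only almost everywhere.\<close>
  also have "\<dots> = (\<integral>\<^sup>+x. F x * indicator {\<phi>..2*pi} x + F x * indicator {2*pi..2*pi+\<phi>} x \<partial>lborel)"
    by (rule nn_integral_cong_AE, use ae[of "2*pi"] in eventually_elim)
       (use \<phi> in \<open>auto simp: indicator_def\<close>)
  also have "\<dots> = (\<integral>\<^sup>+x. F x * indicator {\<phi>..2*pi} x \<partial>lborel) + (\<integral>\<^sup>+x. F x * indicator {2*pi..2*pi+\<phi>} x \<partial>lborel)"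
    by (rule nn_integral_add) auto
  also have "(\<integral>\<^sup>+x. F x * indicator {2*pi..2*pi+\<phi>} x \<partial>lborel) =
      (\<integral>\<^sup>+x. F (x + 2*pi) * indicator {2*pi..2*pi+\<phi>} (x + 2*pi) \<partial>lborel)"
    by (rule tr) measurable
  also have "\<dots> = (\<integral>\<^sup>+x. F x * indicator {0..\<phi>} x \<partial>lborel)"
    by (intro nn_integral_cong) (auto simp: indicator_def per)
  also have "(\<integral>\<^sup>+x. F x * indicator {\<phi>..2*pi} x \<partial>lborel) + (\<integral>\<^sup>+x. F x * indicator {0..\<phi>} x \<partial>lborel) =
      (\<integral>\<^sup>+x. F x * indicator {\<phi>..2*pi} x + F x * indicator {0..\<phi>} x \<partial>lborel)"
    by (rule nn_integral_add[symmetric]) auto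
  also have "\<dots> = (\<integral>\<^sup>+x. F x * indicator {0..2*pi} x \<partial>lborel)"
    by (rule nn_integral_cong_AE, use ae[of \<phi>] in eventually_elim)
       (use \<phi> in \<open>auto simp: indicator_def\<close>)
  finally show ?thesis unfolding nn_integral_circ .
qed

section \<open>Trigonometric polynomials\<close>

definition trig_poly :: "nat \<Rightarrow> (real \<Rightarrow> complex) \<Rightarrow> bool" where
  "trig_poly n F \<longleftrightarrow> (\<exists>c. \<forall>\<theta>. F \<theta> = (\<Sum>l\<in>{-int n..int n}. c l * cis (of_int l * \<theta>)))"

lemma trig_poly_cis:
  assumes "\<bar>l\<bar> \<le> int n"
  shows "trig_poly n (\<lambda>\<theta>. c * cis (of_int l * \<theta>))"
  unfolding trig_poly_def
proof (intro exI allI)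
  fix \<theta>
  have "(\<Sum>k\<in>{-int n..int n}. (if k = l then c else 0) * cis (of_int k * \<theta>)) =
     (\<Sum>k\<in>{-int n..int n}. if k = l then c * cis (of_int l * \<theta>) else 0)"
    by (intro sum.cong refl) auto
  also have "\<dots> = c * cis (of_int l * \<theta>)" using assms by (auto simp: sum.delta abs_le_iff)
  finally show "c * cis (of_int l * \<theta>) = (\<Sum>k\<in>{-int n..int n}. (if k = l then c else 0) * cis (of_int k * \<theta>))" ..
qed

lemma trig_poly_zero: "trig_poly n (\<lambda>_. 0)"
  unfolding trig_poly_def by (rule exI[of _ "\<lambda>_. 0"]) simp

lemma trig_poly_add:
  assumes "trig_poly n F" "trig_poly n G"
  shows "trig_poly n (\<lambda>\<theta>. F \<theta> + G \<theta>)"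
proof -
  obtain c c' where "\<And>\<theta>. F \<theta> = (\<Sum>l\<in>{-int n..int n}. c l * cis (of_int l * \<theta>))"
    "\<And>\<theta>. G \<theta> = (\<Sum>l\<in>{-int n..int n}. c' l * cis (of_int l * \<theta>))"
    using assms unfolding trig_poly_def by blast
  then show ?thesis unfolding trig_poly_def
    by (intro exI[of _ "\<lambda>l. c l + c' l"]) (simp add: sum.distrib distrib_right)
qed

lemma trig_poly_sum:
  assumes "\<And>i. i \<in> I \<Longrightarrow> trig_poly n (F i)"
  shows "trig_poly n (\<lambda>\<theta>. \<Sum>i\<in>I. F i \<theta>)"
  using assms
  by (induction I rule: infinite_finite_induct) (auto intro: trig_poly_zero trig_poly_add)

lemma trig_poly_mult:
  assumes "trig_poly n F" "trig_poly m G"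
  shows "trig_poly (n + m) (\<lambda>\<theta>. F \<theta> * G \<theta>)"
proof -
  obtain c c' where F: "\<And>\<theta>. F \<theta> = (\<Sum>l\<in>{-int n..int n}. c l * cis (of_int l * \<theta>))"
    and G: "\<And>\<theta>. G \<theta> = (\<Sum>l\<in>{-int m..int m}. c' l * cis (of_int l * \<theta>))"
    using assms unfolding trig_poly_def by blast
  have "trig_poly (n + m) (\<lambda>\<theta>. \<Sum>l\<in>{-int n..int n}. \<Sum>k\<in>{-int m..int m}. (c l * c' k) * cis (of_int (l + k) * \<theta>))"
    by (intro trig_poly_sum trig_poly_cis) auto
  also have "(\<lambda>\<theta>. \<Sum>l\<in>{-int n..int n}. \<Sum>k\<in>{-int m..int m}. (c l * c' k) * cis (of_int (l + k) * \<theta>)) = (\<lambda>\<theta>. F \<theta> * G \<theta>)"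
    unfolding F G sum_product by (intro ext sum.cong refl) (simp add: distrib_right flip: cis_mult)
  finally show ?thesis .
qed

lemma trig_poly_cmult: "trig_poly n F \<Longrightarrow> trig_poly n (\<lambda>\<theta>. c * F \<theta>)"
  using trig_poly_mult[OF trig_poly_cis[of 0 0 c], of n F] by simp

lemma trig_poly_const: "trig_poly n (\<lambda>\<theta>. c)"
  using trig_poly_cis[of 0 n c] by simp

lemma trig_poly_shift:
  assumes "trig_poly n F"
  shows "trig_poly n (\<lambda>\<theta>. F (\<theta> + \<phi>))"
proof -
  obtain c where "\<And>\<theta>. F \<theta> = (\<Sum>l\<in>{-int n..int n}. c l * cis (of_int l * \<theta>))"
    using assms unfolding trig_poly_def by blast
  then show ?thesis unfolding trig_poly_def
    by (intro exI[of _ "\<lambda>l. c l * cis (of_int l * \<phi>)"] allI)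
       (simp add: distrib_left mult.assoc cis_mult add.commute)
qed

lemma trig_poly_continuous:
  assumes "trig_poly n F"
  shows "continuous_on UNIV F"
proof -
  obtain c where F: "\<And>\<theta>. F \<theta> = (\<Sum>l\<in>{-int n..int n}. c l * cis (of_int l * \<theta>))"
    using assms unfolding trig_poly_def by blast
  have "F = (\<lambda>\<theta>. \<Sum>l\<in>{-int n..int n}. c l * cis (of_int l * \<theta>))" using F by (rule ext)
  then show ?thesis by (auto intro!: continuous_intros continuous_on_cis)
qed

lemma cis_int_2pi: "cis (of_int l * (2 * pi)) = 1"
proof -
  have "cis (2 * pi * of_int l) = 1" by (rule cis_multiple_2pi) simp
  then show ?thesis by (simp add: mult_ac)
qed

lemma trig_poly_periodic:
  assumes "trig_poly n F"
  shows "F (\<theta> + 2*pi) = F \<theta>"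
proof -
  obtain c where F: "\<And>\<theta>. F \<theta> = (\<Sum>l\<in>{-int n..int n}. c l * cis (of_int l * \<theta>))"
    using assms unfolding trig_poly_def by blast
  show ?thesis unfolding F
    by (intro sum.cong refl) (simp add: distrib_left cis_int_2pi flip: cis_mult)
qed

lemma integral_cis_circ: "(LINT \<theta>|circ. cis (of_int l * \<theta>)) = (if l = 0 then 2 * pi else 0)"
proof (cases "l = 0")
  case True
  then show ?thesis using measure_circ by (simp add: scaleR_conv_of_real)
next
  case False
  have "(LINT \<theta>|circ. cis (of_int l * \<theta>)) = (\<integral>\<theta>. indicator {0..2*pi} \<theta> *\<^sub>R cis (of_int l * \<theta>) \<partial>lborel)"
    unfolding circ_def by (subst integral_restrict_space) auto
  also have "\<dots> = cis (of_int l * (2*pi)) / (\<i> * of_int l) - cis (of_int l * 0) / (\<i> * of_int l)"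
  proof (rule integral_FTC_Icc)
    show "((\<lambda>\<theta>. cis (of_int l * \<theta>) / (\<i> * of_int l)) has_vector_derivative cis (of_int l * x)) (at x within {0..2*pi})" for x
    proof -
      have "((\<lambda>z. exp (\<i> * (of_int l * z)) / (\<i> * of_int l)) has_field_derivative exp (\<i> * (of_int l * of_real x))) (at (of_real x))"
      proof -
        have "((\<lambda>z. exp (\<i> * (of_int l * z))) has_field_derivative (exp (\<i> * (of_int l * of_real x)) * (\<i> * of_int l))) (at (of_real x))"
          by (auto intro!: derivative_eq_intros)
        from DERIV_cdivide[OF this, of "\<i> * of_int l"] show ?thesis using False by simp
      qed
      from has_vector_derivative_real_field[OF this, of "{0..2*pi}"]
      show ?thesis by (simp add: cis_conv_exp o_def)
    qed
    show "continuous_on {0..2*pi} (\<lambda>\<theta>. cis (of_int l * \<theta>))"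
      by (auto intro!: continuous_intros continuous_on_cis)
  qed simp
  also have "\<dots> = 0" using cis_int_2pi[of l] by simp
  finally show ?thesis using False by simp
qed

text \<open>If \<open>l\<close> is nonzero and less than \<open>N\<close> in absolute value, the
  ratio \<open>x\<close> of the geometric sum is an \<open>N\<close>-th root of unity other than 1,
  so the sum vanishes. The frequency \<open>N\<close> itself would be constant on the roots.\<close>

lemma sum_roots_cis:
  assumes "\<bar>l\<bar> < int N"
  shows "(\<Sum>j<N. cis (of_int l * (2*pi*real j / real N))) = (if l = 0 then of_nat N else 0)"
proof (cases "l = 0")
  case True then show ?thesis by simp
next
  case False
  have N: "N > 0" using assms by linarith
  define x where "x = cis (of_int l * (2*pi / real N))"
  have e: "cis (of_int l * (2*pi*real j / real N)) = x ^ j" for j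
    unfolding x_def Complex.DeMoivre by (simp add: mult_ac)
  have "x \<noteq> 1"
  proof
    assume "x = 1"
    then have "cos (of_int l * (2*pi / real N)) = 1" by (simp add: x_def complex_eq_iff)
    then obtain k :: int where "of_int l * (2*pi / real N) = of_int k * 2 * pi"
      by (auto simp: cos_one_2pi_int)
    then have "of_int l = (of_int k * real N :: real)" using N by (simp add: field_simps)
    then have "l = k * int N" by (metis of_int_eq_iff of_int_mult of_int_of_nat_eq)
    then have "k \<noteq> 0" "\<bar>l\<bar> = \<bar>k\<bar> * int N" using False by (auto simp: abs_mult)
    then have "1 * int N \<le> \<bar>k\<bar> * int N" by (intro mult_right_mono) auto
    then have "int N \<le> \<bar>l\<bar>" using \<open>\<bar>l\<bar> = \<bar>k\<bar> * int N\<close> by simp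
    then show False using assms by simp
  qed
  moreover have "x ^ N = 1"
    unfolding x_def Complex.DeMoivre using N cis_int_2pi[of l] by (simp add: mult_ac)
  ultimately show ?thesis unfolding e using False by (simp add: sum_gp_strict)
qed

text \<open>Both means single out the coefficient of frequency 0, since \<open>n < N\<close>
  prevents any other frequency from being constant on the \<open>N\<close>-th roots of unity. This
  exactness takes the place of a limit of Riemann sums.\<close>

lemma trig_poly_discrete_mean:
  assumes F: "trig_poly n F" and N: "n < N"
  shows "(\<Sum>j<N. F (2*pi*real j / real N)) / of_nat N = (LINT \<theta>|circ. F \<theta>) / (2*pi)"
proof -
  obtain c where F: "\<And>\<theta>. F \<theta> = (\<Sum>l\<in>{-int n..int n}. c l * cis (of_int l * \<theta>))"
    using F unfolding trig_poly_def by blast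
  have [simp]: "integrable circ (\<lambda>\<theta>. cis (of_int l * \<theta>))" for l
    by (rule continuous_integrable_circ) (auto intro!: continuous_intros continuous_on_cis)
  have "(\<Sum>j<N. F (2*pi*real j / real N)) = (\<Sum>l\<in>{-int n..int n}. c l * (\<Sum>j<N. cis (of_int l * (2*pi*real j / real N))))"
    unfolding F by (subst sum.swap) (simp add: sum_distrib_left)
  also have "\<dots> = (\<Sum>l\<in>{-int n..int n}. if l = 0 then c 0 * of_nat N else 0)"
  proof (rule sum.cong[OF refl])
    fix l assume "l \<in> {-int n..int n}"
    then have "\<bar>l\<bar> < int N" using N by auto
    from sum_roots_cis[OF this]
    show "c l * (\<Sum>j<N. cis (of_int l * (2*pi*real j / real N))) = (if l = 0 then c 0 * of_nat N else 0)"
      by simp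
  qed
  also have "\<dots> = c 0 * of_nat N" by (simp add: sum.delta)
  finally have 1: "(\<Sum>j<N. F (2*pi*real j / real N)) = c 0 * of_nat N" .
  have "(LINT \<theta>|circ. F \<theta>) = (\<Sum>l\<in>{-int n..int n}. c l * (LINT \<theta>|circ. cis (of_int l * \<theta>)))"
    unfolding F by (subst Bochner_Integration.integral_sum) auto
  also have "\<dots> = (\<Sum>l\<in>{-int n..int n}. if l = 0 then c 0 * (2 * pi) else 0)"
    by (rule sum.cong[OF refl]) (auto simp: integral_cis_circ)
  also have "\<dots> = c 0 * (2*pi)" by (simp add: sum.delta)
  finally show ?thesis using 1 N by simp
qed

section \<open>The discrete bound for determinants on a circle\<close>

lemma hform_unit:
  assumes "i < n" "j < n"
  shows "hform n G (\<lambda>k. if k = i then 1 else 0) (\<lambda>k. if k = j then 1 else 0) = G i j"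
  unfolding hform_def using assms
  by (simp add: if_distrib[of "\<lambda>a. _ * a"] if_distrib[of cnj] if_distribR cong: if_cong)

lemma prod_div_mod:
  fixes F :: "nat \<Rightarrow> nat \<Rightarrow> 'a::comm_monoid_mult"
  assumes "r > 0"
  shows "(\<Prod>a<N * r. F (a div r) (a mod r)) = (\<Prod>q<N. \<Prod>i<r. F q i)"
proof -
  have "(\<Prod>a<N * r. F (a div r) (a mod r)) = (\<Prod>q<N. \<Prod>a=q*r..<q*r+r. F (a div r) (a mod r))"
    by (rule prod.nat_group[symmetric])
  also have "\<dots> = (\<Prod>q<N. \<Prod>i<r. F q i)"
  proof (rule prod.cong[OF refl])
    fix q
    have "(\<Prod>a=q*r..<q*r+r. F (a div r) (a mod r)) = (\<Prod>i=0..<r. F ((i + q*r) div r) ((i + q*r) mod r))"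
      using prod.shift_bounds_nat_ivl[of "\<lambda>a. F (a div r) (a mod r)" 0 "q*r" r] by (simp add: add.commute)
    also have "\<dots> = (\<Prod>i<r. F q i)"
      using assms by (auto intro!: prod.cong simp: lessThan_atLeast0)
    finally show "(\<Prod>a=q*r..<q*r+r. F (a div r) (a mod r)) = (\<Prod>i<r. F q i)" .
  qed
  finally show ?thesis .
qed

lemma sesq_scale: "sesq M (c *s v) (d *s w) = c * cnj d * sesq M v w"
  by (simp add: sesq_def sum_distrib_left mult_ac)

lemma qf_cis [simp]: "qf M (cis t *s v) = qf M v"
  by (simp add: qf_def sesq_scale cis_cnj cis_mult)

lemma hermitian_sesq_real:
  assumes "hermitian M" shows "sesq M v v = of_real (qf M v)"
proof -
  have "sesq M v v = (\<Sum>j\<in>UNIV. \<Sum>i\<in>UNIV. M$i$j * v$i * cnj (v$j))"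
    unfolding sesq_def by (rule sum.swap)
  also have "\<dots> = cnj (sesq M v v)"
    unfolding sesq_def cnj_sum
  proof (rule sum.cong[OF refl], rule sum.cong[OF refl])
    fix i j
    have "M$i$j = cnj (M$j$i)" using assms unfolding hermitian_def by blast
    then show "M$i$j * v$i * cnj (v$j) = cnj (M$j$i * v$j * cnj (v$i))" by simp
  qed
  finally have "cnj (sesq M v v) = sesq M v v" by simp
  then show ?thesis unfolding qf_def by (metis Reals_cnj_iff of_real_Re)
qed

text \<open>The frequencies \<open>k - k'\<close> coming from the section lie between
  \<open>-q\<close> and \<open>q\<close>, and \<open>H\<close> adds at most \<open>d\<close>. This
  degree decides for which sections the mean over the roots of unity is exact.\<close>

lemma trig_poly_sesq:
  fixes H :: "real \<Rightarrow> complex^'r::finite^'r"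
  assumes "\<And>i j. trig_poly d (\<lambda>\<theta>. H \<theta> $ i $ j)"
  shows "trig_poly (d + q) (\<lambda>\<theta>. sesq (H \<theta>) (\<Sum>k\<le>q. cis (real k * \<theta>) *s a k) (\<Sum>k\<le>q. cis (real k * \<theta>) *s a k))"
proof -
  have "trig_poly (d + q) (\<lambda>\<theta>. \<Sum>i\<in>UNIV. \<Sum>j\<in>UNIV. H \<theta> $ i $ j *
     (\<Sum>k\<le>q. \<Sum>k'\<le>q. (a k $ i * cnj (a k' $ j)) * cis (of_int (int k - int k') * \<theta>)))"
    by (intro trig_poly_sum trig_poly_mult assms trig_poly_cis) auto
  also have "(\<lambda>\<theta>. \<Sum>i\<in>UNIV. \<Sum>j\<in>UNIV. H \<theta> $ i $ j *
     (\<Sum>k\<le>q. \<Sum>k'\<le>q. (a k $ i * cnj (a k' $ j)) * cis (of_int (int k - int k') * \<theta>))) =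
     (\<lambda>\<theta>. sesq (H \<theta>) (\<Sum>k\<le>q. cis (real k * \<theta>) *s a k) (\<Sum>k\<le>q. cis (real k * \<theta>) *s a k))"
  proof
    fix \<theta>
    have c: "cis (of_int (int k - int k') * \<theta>) = cis (real k * \<theta>) * cnj (cis (real k' * \<theta>))" for k k'
      by (simp add: cis_cnj cis_mult left_diff_distrib)
    show "(\<Sum>i\<in>UNIV. \<Sum>j\<in>UNIV. H \<theta> $ i $ j *
     (\<Sum>k\<le>q. \<Sum>k'\<le>q. (a k $ i * cnj (a k' $ j)) * cis (of_int (int k - int k') * \<theta>))) =
      sesq (H \<theta>) (\<Sum>k\<le>q. cis (real k * \<theta>) *s a k) (\<Sum>k\<le>q. cis (real k * \<theta>) *s a k)"
      unfolding sesq_def c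
    proof (rule sum.cong[OF refl], rule sum.cong[OF refl])
      fix i j
      have "(\<Sum>k\<le>q. \<Sum>k'\<le>q. a k $ i * cnj (a k' $ j) * (cis (real k * \<theta>) * cnj (cis (real k' * \<theta>)))) =
        (\<Sum>k\<le>q. cis (real k * \<theta>) * a k $ i) * (\<Sum>k'\<le>q. cnj (cis (real k' * \<theta>) * a k' $ j))"
        unfolding sum_product by (intro sum.cong refl) (simp add: mult_ac)
      then show "H \<theta> $ i $ j * (\<Sum>k\<le>q. \<Sum>k'\<le>q. a k $ i * cnj (a k' $ j) * (cis (real k * \<theta>) * cnj (cis (real k' * \<theta>)))) =
        H \<theta> $ i $ j * (\<Sum>k\<le>q. cis (real k * \<theta>) *s a k) $ i * cnj ((\<Sum>k\<le>q. cis (real k * \<theta>) *s a k) $ j)"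
        by (simp add: sum_component mult.assoc)
    qed
  qed
  finally show ?thesis .
qed

text \<open>The sum over \<open>k\<close> is the boundary value of the polynomial section with
  coefficients \<open>a k\<close>, and \<open>a 0\<close> is its value at the center of the disc,
  where the metric is \<open>H0\<close>. The factor \<open>2 * pi\<close> is the total mass of
  \<open>circ\<close>.\<close>

definition submean_polys :: "(real \<Rightarrow> complex^'r^'r) \<Rightarrow> complex^'r^'r \<Rightarrow> bool" where
  "submean_polys H H0 \<longleftrightarrow> (\<forall>m a. ennreal (2 * pi * qf H0 (a 0)) \<le>
     (\<integral>\<^sup>+\<theta>. ennreal (qf (H \<theta>) (\<Sum>k\<le>m. cis (real k * \<theta>) *s a k)) \<partial>circ))"

text \<open>Parseval's identity for the discrete Fourier transform, with the frequencies in the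
  decreasing order that \<open>discrete_det_bound\<close> uses.\<close>

lemma sum_roots_norm:
  fixes y :: "nat \<Rightarrow> complex"
  shows "(\<Sum>j<N. (cmod (\<Sum>q<N. cis (real (N - Suc q) * (2*pi*real j / real N)) * y q))\<^sup>2) = real N * (\<Sum>q<N. (cmod (y q))\<^sup>2)"
proof -
  let ?e = "\<lambda>q j. cis (real (N - Suc q) * (2*pi*real j / real N))"
  have "complex_of_real (\<Sum>j<N. (cmod (\<Sum>q<N. ?e q j * y q))\<^sup>2) =
     (\<Sum>j<N. (\<Sum>q<N. ?e q j * y q) * (\<Sum>q<N. cnj (?e q j * y q)))"
    by (simp only: of_real_sum complex_norm_square cnj_sum)
  also have "\<dots> = (\<Sum>j<N. \<Sum>q<N. \<Sum>q'<N. y q * cnj (y q') * (?e q j * cnj (?e q' j)))"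
    unfolding sum_product by (intro sum.cong refl) (simp add: mult_ac)
  also have "\<dots> = (\<Sum>q<N. \<Sum>j<N. \<Sum>q'<N. y q * cnj (y q') * (?e q j * cnj (?e q' j)))"
    by (rule sum.swap)
  also have "\<dots> = (\<Sum>q<N. \<Sum>q'<N. \<Sum>j<N. y q * cnj (y q') * (?e q j * cnj (?e q' j)))"
    by (rule sum.cong[OF refl]) (rule sum.swap)
  also have "\<dots> = (\<Sum>q<N. \<Sum>q'<N. if q = q' then of_nat N * (y q * cnj (y q)) else 0)"
  proof (rule sum.cong[OF refl], rule sum.cong[OF refl])
    fix q q' assume q: "q \<in> {..<N}" "q' \<in> {..<N}"
    have "?e q j * cnj (?e q' j) = cis (of_int (int q' - int q) * (2*pi*real j / real N))" for j
    proof -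
      have "real (N - Suc q) * (2*pi*real j / real N) + - (real (N - Suc q') * (2*pi*real j / real N)) =
        of_int (int q' - int q) * (2*pi*real j / real N)"
        using q by (simp add: of_nat_diff algebra_simps add_divide_distrib diff_divide_distrib)
      then show ?thesis by (simp only: cis_cnj cis_mult)
    qed
    then have "(\<Sum>j<N. y q * cnj (y q') * (?e q j * cnj (?e q' j))) =
      y q * cnj (y q') * (\<Sum>j<N. cis (of_int (int q' - int q) * (2*pi*real j / real N)))"
      by (simp only: sum_distrib_left)
    also have "(\<Sum>j<N. cis (of_int (int q' - int q) * (2*pi*real j / real N))) = (if int q' - int q = 0 then of_nat N else 0)"
      by (rule sum_roots_cis) (use q in auto)
    finally show "(\<Sum>j<N. y q * cnj (y q') * (?e q j * cnj (?e q' j))) = (if q = q' then of_nat N * (y q * cnj (y q)) else 0)"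
      by auto
  qed
  also have "\<dots> = complex_of_real (real N * (\<Sum>q<N. (cmod (y q))\<^sup>2))"
  proof -
    have "(\<Sum>q<N. \<Sum>q'<N. if q = q' then of_nat N * (y q * cnj (y q)) else 0) = (\<Sum>q<N. of_nat N * (y q * cnj (y q)))"
      by simp
    also have "\<dots> = complex_of_real (real N * (\<Sum>q<N. (cmod (y q))\<^sup>2))"
      by (simp only: of_real_mult of_real_sum complex_norm_square sum_distrib_left of_real_of_nat_eq)
    finally show ?thesis .
  qed
  finally show ?thesis by (simp only: of_real_eq_iff)
qed

text \<open>The right-hand side is the determinant of the block diagonal matrix of the values of
  \<open>H\<close>, hence by unitary congruence that of the Gram matrix \<open>G\<close> of the
  monomial sections of degree less than \<open>N\<close>. The pivots of \<open>G\<close> are bounded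
  below one by one: \<open>(N - d) * r\<close> of them by pivots of \<open>H0\<close>, through the
  submean inequality, and the remaining \<open>d * r\<close> by \<open>c\<close>.\<close>

theorem discrete_det_bound:
  fixes H :: "real \<Rightarrow> complex^'r::finite^'r"
  assumes trig: "\<And>i j. trig_poly d (\<lambda>\<theta>. H \<theta> $ i $ j)"
    and herm: "\<And>\<theta>. hermitian (H \<theta>)"
    and c: "c > 0" and low: "\<And>\<theta> v. c * (norm v)\<^sup>2 \<le> qf (H \<theta>) v"
    and H0: "hermitian H0" "\<And>v. v \<noteq> 0 \<Longrightarrow> qf H0 v > 0"
    and sub: "submean_polys H H0"
    and N: "d < N"
  shows "Re (det H0) ^ (N - d) * c ^ (CARD('r) * d) \<le> (\<Prod>j<N. Re (det (H (2*pi*real j / real N))))"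
proof -
  define r where "r = CARD('r)"
  have r: "r > 0" by (simp add: r_def)
  obtain f where f: "bij_betw f {..<CARD('r)} (UNIV :: 'r set)" using ex_enum by blast
  define g where "g = inv_into {..<CARD('r)} f"
  have gf: "g (f i) = i" if "i < r" for i using f that by (simp add: g_def r_def bij_betw_def)
  have gr: "g s < r" for s
    unfolding g_def r_def using inv_into_into[of s f "{..<CARD('r)}"] f by (auto simp: bij_betw_def)
  obtain \<delta>0 :: "nat \<Rightarrow> real" where d0:
    "\<And>i. i < r \<Longrightarrow> \<delta>0 i > 0"
    "\<And>i v. i < r \<Longrightarrow> v $ f i = 1 \<Longrightarrow> (\<And>j. i < j \<Longrightarrow> j < r \<Longrightarrow> v $ f j = 0) \<Longrightarrow> \<delta>0 i \<le> qf H0 v"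
    "det H0 = of_real (\<Prod>i<r. \<delta>0 i)"
    by (rule det_pos_flag[OF f H0]) (auto simp: r_def)
  define n where "n = N * r"
  have N0: "N > 0" using N by simp
  define \<theta> where "\<theta> j = 2*pi*real j / real N" for j :: nat
  define B where "B q i i' = H (\<theta> q) $ f i $ f i'" for q i i'
  define D where "D = block_diag r B"
  \<comment> \<open>A Fourier matrix in each of the \<open>r\<close> coordinates. The frequencies
    decrease with the block number so that all sections whose coefficients vanish after a given
    index have a monomial in common, and this monomial has modulus 1 on the circle.\<close>
  define V where "V a b = (if a mod r = b mod r then cis (real (N - Suc (b div r)) * \<theta> (a div r)) / of_real (sqrt (real N)) else 0)" for a b
  have sq: "complex_of_real (sqrt (real N)) * complex_of_real (sqrt (real N)) = of_nat N"
    by (simp flip: of_real_mult)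
  have unit: "(\<Sum>k<n. V a k * cnj (V b k)) = (if a = b then 1 else 0)" if ab: "a < n" "b < n" for a b
  proof -
    have dv: "a div r < N" "b div r < N" "a mod r < r" "b mod r < r"
      using ab r by (simp_all add: n_def less_mult_imp_div_less)
    let ?e = "\<lambda>q. cis (real (N - Suc q) * \<theta> (a div r)) * cnj (cis (real (N - Suc q) * \<theta> (b div r)))"
    have "(\<Sum>k<n. V a k * cnj (V b k)) = (\<Sum>k<N*r. (\<lambda>q i. (if a mod r = i \<and> b mod r = i then ?e q / of_nat N else 0)) (k div r) (k mod r))"
      unfolding V_def n_def using sq N0 by (intro sum.cong refl) auto
    also have "\<dots> = (\<Sum>q<N. \<Sum>i<r. (if a mod r = i \<and> b mod r = i then ?e q / of_nat N else 0))"
      by (rule sum_div_mod[OF r])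
    also have "\<dots> = (\<Sum>q<N. if a mod r = b mod r then ?e q / of_nat N else 0)"
    proof (rule sum.cong[OF refl])
      fix q
      have "(\<Sum>i<r. (if a mod r = i \<and> b mod r = i then ?e q / of_nat N else 0)) =
        (\<Sum>i<r. if i = a mod r then (if a mod r = b mod r then ?e q / of_nat N else 0) else 0)"
        by (rule sum.cong[OF refl]) auto
      then show "(\<Sum>i<r. (if a mod r = i \<and> b mod r = i then ?e q / of_nat N else 0)) = (if a mod r = b mod r then ?e q / of_nat N else 0)"
        using dv by (simp add: sum.delta)
    qed
    also have "\<dots> = (if a mod r = b mod r then (\<Sum>q<N. ?e q) / of_nat N else 0)"
      by (simp add: sum_divide_distrib)
    also have "(\<Sum>q<N. ?e q) = (\<Sum>k<N. cis (real k * \<theta> (a div r)) * cnj (cis (real k * \<theta> (b div r))))"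
      by (rule sum.nat_diff_reindex)
    also have "\<dots> = (\<Sum>k<N. cis (of_int (int (a div r) - int (b div r)) * (2*pi*real k / real N)))"
    proof (rule sum.cong[OF refl])
      fix k
      have "real k * \<theta> (a div r) + - (real k * \<theta> (b div r)) = of_int (int (a div r) - int (b div r)) * (2*pi*real k / real N)"
        using N0 by (simp add: \<theta>_def field_simps)
      then show "cis (real k * \<theta> (a div r)) * cnj (cis (real k * \<theta> (b div r))) =
          cis (of_int (int (a div r) - int (b div r)) * (2*pi*real k / real N))"
        by (simp only: cis_cnj cis_mult)
    qed
    also have "\<dots> = (if int (a div r) - int (b div r) = 0 then of_nat N else 0)"
      by (rule sum_roots_cis) (use dv in auto)
    also have "(if a mod r = b mod r then (if int (a div r) - int (b div r) = 0 then of_nat N else 0) / of_nat N else 0) = (if a = b then 1 else (0::complex))"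
    proof -
      have "a = b" if "a mod r = b mod r" "a div r = b div r"
        using that by (metis div_mult_mod_eq)
      then show ?thesis using N0 by auto
    qed
    finally show ?thesis .
  qed
  define G where "G b b' = (\<Sum>a'<n. (\<Sum>a<n. V a b * D a a') * cnj (V a' b'))" for b b'
  have G_abs: "G = (\<lambda>b b'. \<Sum>a'<n. (\<Sum>a<n. V a b * D a a') * cnj (V a' b'))"
    by (intro ext) (rule G_def)
  have cong_det: "Determinant.det (Matrix.mat n n (\<lambda>(i,j). G i j)) = Determinant.det (Matrix.mat n n (\<lambda>(i,j). D i j))"
    unfolding G_abs by (rule unitary_congruence(1)) (rule unit)
  have cong_form: "hform n G x y = hform n D (\<lambda>a. \<Sum>b<n. V a b * x b) (\<lambda>a. \<Sum>b<n. V a b * y b)" for x y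
    unfolding G_abs by (rule unitary_congruence(2)) (rule unit)
  \<comment> \<open>The section with coefficient vector \<open>x\<close> at the angle
    \<open>t\<close>; block \<open>q\<close> holds the coefficient of degree
    \<open>N - Suc q\<close>.\<close>
  define u where "u x t = (\<chi> s. \<Sum>q<N. cis (real (N - Suc q) * t) * x (q * r + g s))" for x :: "nat \<Rightarrow> complex" and t
  have Dherm: "D j i = cnj (D i j)" for i j
  proof -
    have *: "H t $ a $ b = cnj (H t $ b $ a)" for t a b using herm[of t] unfolding hermitian_def by blast
    show ?thesis
    proof (cases "i div r = j div r")
      case True
      then show ?thesis unfolding D_def block_diag_def B_def by (simp only: if_True simp_thms) (rule *)
    next
      case False
      then show ?thesis by (simp add: D_def block_diag_def)
    qed
  qed
  have Gherm: "G j i = cnj (G i j)" if "i < n" "j < n" for i j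
  proof -
    let ?ei = "\<lambda>k. if k = i then 1 else 0 :: complex" and ?ej = "\<lambda>k. if k = j then 1 else 0 :: complex"
    have "G j i = hform n G ?ej ?ei" by (rule hform_unit[symmetric]) (use that in auto)
    also have "\<dots> = cnj (hform n G ?ei ?ej)" unfolding cong_form by (rule hform_cnj) (rule Dherm)
    also have "hform n G ?ei ?ej = G i j" by (rule hform_unit) (use that in auto)
    finally show ?thesis .
  qed
  have form: "Re (hform n G x x) = (\<Sum>j<N. qf (H (\<theta> j)) (u x (\<theta> j))) / real N" for x
  proof -
    define y where "y q i = u x (\<theta> q) $ f i / of_real (sqrt (real N))" for q i
    have Vx: "(\<Sum>b<n. V a b * x b) = y (a div r) (a mod r)" if "a < n" for a
    proof -
      have am: "a mod r < r" using r by simp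
      have "(\<Sum>b<n. V a b * x b) = (\<Sum>b<N*r. (\<lambda>q i. (if a mod r = i then cis (real (N - Suc q) * \<theta> (a div r)) / of_real (sqrt (real N)) * x (q * r + i) else 0)) (b div r) (b mod r))"
        unfolding V_def n_def by (rule sum.cong[OF refl]) auto
      also have "\<dots> = (\<Sum>q<N. \<Sum>i<r. (if a mod r = i then cis (real (N - Suc q) * \<theta> (a div r)) / of_real (sqrt (real N)) * x (q * r + i) else 0))"
        by (rule sum_div_mod[OF r])
      also have "\<dots> = (\<Sum>q<N. cis (real (N - Suc q) * \<theta> (a div r)) / of_real (sqrt (real N)) * x (q * r + a mod r))"
        using am by (intro sum.cong refl) simp
      also have "\<dots> = y (a div r) (a mod r)"
        using am by (simp add: y_def u_def gf sum_divide_distrib)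
      finally show ?thesis .
    qed
    have "hform n G x x = hform n D (\<lambda>a. y (a div r) (a mod r)) (\<lambda>a. y (a div r) (a mod r))"
      unfolding cong_form by (rule hform_cong) (auto simp: Vx)
    also have "\<dots> = (\<Sum>q<N. hform r (B q) (y q) (y q))"
      unfolding n_def D_def by (rule hform_block_diag[OF r])
    also have "\<dots> = (\<Sum>q<N. sesq (H (\<theta> q)) (u x (\<theta> q)) (u x (\<theta> q)) / of_nat N)"
    proof (rule sum.cong[OF refl])
      fix q
      have "hform r (B q) (y q) (y q) = (\<Sum>i<r. \<Sum>j<r. (B q i j * u x (\<theta> q) $ f i * cnj (u x (\<theta> q) $ f j)) / of_nat N)"
        unfolding hform_def y_def using N0
        by (intro sum.cong refl) (simp add: sq[symmetric])
      also have "\<dots> = hform r (B q) (\<lambda>i. u x (\<theta> q) $ f i) (\<lambda>i. u x (\<theta> q) $ f i) / of_nat N"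
        unfolding hform_def sum_divide_distrib ..
      also have "hform r (B q) (\<lambda>i. u x (\<theta> q) $ f i) (\<lambda>i. u x (\<theta> q) $ f i) = sesq (H (\<theta> q)) (u x (\<theta> q)) (u x (\<theta> q))"
        unfolding r_def B_def by (rule hform_eq_sesq'[OF f, symmetric])
      finally show "hform r (B q) (y q) (y q) = sesq (H (\<theta> q)) (u x (\<theta> q)) (u x (\<theta> q)) / of_nat N" .
    qed
    finally have "hform n G x x = (\<Sum>q<N. sesq (H (\<theta> q)) (u x (\<theta> q)) (u x (\<theta> q)) / of_nat N)" .
    then show ?thesis by (simp add: qf_def sum_divide_distrib)
  qed
  \<comment> \<open>By Parseval, the mean of the squared norms of the section over the roots is the
    sum of the squares of its coefficients. A coefficient equal to 1 therefore makes the form at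
    least \<open>c\<close>.\<close>
  have low1: "c * (cmod (x b))\<^sup>2 \<le> Re (hform n G x x)" if b: "b < n" for x b
  proof -
    define i q where "i = b mod r" and "q = b div r"
    have iq: "i < r" "q < N" "b = q * r + i" using b r by (simp_all add: n_def i_def q_def less_mult_imp_div_less)
    have "real N * (cmod (x b))\<^sup>2 \<le> real N * (\<Sum>q<N. (cmod (x (q * r + i)))\<^sup>2)"
      using iq by (intro mult_left_mono) (auto intro!: member_le_sum)
    also have "\<dots> = (\<Sum>j<N. (cmod (u x (\<theta> j) $ f i))\<^sup>2)"
      using sum_roots_norm[of N "\<lambda>q. x (q * r + i)"] iq by (simp add: u_def \<theta>_def gf)
    also have "\<dots> \<le> (\<Sum>j<N. (norm (u x (\<theta> j)))\<^sup>2)"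
      by (intro sum_mono power_mono component_le_norm_cart norm_ge_zero)
         (auto simp: Finite_Cartesian_Product.norm_nth_le)
    finally have "c * (real N * (cmod (x b))\<^sup>2) \<le> c * (\<Sum>j<N. (norm (u x (\<theta> j)))\<^sup>2)"
      using c by simp
    also have "\<dots> \<le> (\<Sum>j<N. qf (H (\<theta> j)) (u x (\<theta> j)))"
      unfolding sum_distrib_left by (intro sum_mono low)
    finally show ?thesis unfolding form using N0 by (simp add: field_simps)
  qed
  have Gpos: "Re (hform n G x x) > 0" if nz: "\<exists>b<n. x b \<noteq> 0" for x
  proof -
    obtain b where b: "b < n" "x b \<noteq> 0" using nz by blast
    then have "0 < c * (cmod (x b))\<^sup>2" using c by simp
    then show ?thesis using low1[OF b(1), of x] by linarith
  qed
  \<comment> \<open>Only degrees from \<open>N - Suc q0\<close> on occur, so the section is a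
    monomial times a polynomial \<open>w\<close> of degree at most \<open>q0\<close>, and the
    monomial does not affect the norm on the circle. The value \<open>a 0\<close> of
    \<open>w\<close> at the center has coordinate 1 at \<open>f i\<close> and vanishes at the later
    coordinates, so \<open>\<delta>0 i\<close> is a lower bound for the form of \<open>H0\<close> at
    it.\<close>
  have low2: "\<delta>0 (b mod r) \<le> Re (hform n G x x)"
    if b: "b < n" "b div r < N - d" and xb: "x b = 1" and x0: "\<And>k. b < k \<Longrightarrow> k < n \<Longrightarrow> x k = 0" for x b
  proof -
    define i q0 where "i = b mod r" and "q0 = b div r"
    have iq: "i < r" "q0 < N - d" "b = q0 * r + i" using b r by (simp_all add: n_def i_def q0_def)
    define a where "a m = (\<chi> s. x ((q0 - m) * r + g s))" for m
    define w where "w t = (\<Sum>k\<le>q0. cis (real k * t) *s a k)" for t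
    have uw: "u x t = cis (real (N - Suc q0) * t) *s w t" for t
    proof (subst Finite_Cartesian_Product.vec_eq_iff, rule allI)
      fix s
      have "u x t $ s = (\<Sum>q<N. cis (real (N - Suc q) * t) * x (q * r + g s))" by (simp add: u_def)
      also have "\<dots> = (\<Sum>q\<le>q0. cis (real (N - Suc q) * t) * x (q * r + g s))"
      proof (rule sum.mono_neutral_right)
        show "{..q0} \<subseteq> {..<N}" using iq by auto
        show "\<forall>q\<in>{..<N} - {..q0}. cis (real (N - Suc q) * t) * x (q * r + g s) = 0"
        proof
          fix q assume q: "q \<in> {..<N} - {..q0}"
          have "b < (q0 + 1) * r" using iq by simp
          also have "(q0 + 1) * r \<le> q * r" using q by (intro mult_right_mono) auto
          also have "q * r \<le> q * r + g s" by simp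
          finally have 1: "b < q * r + g s" .
          have "q * r + g s < (q + 1) * r" using gr[of s] by simp
          also have "(q + 1) * r \<le> n" unfolding n_def using q by (intro mult_right_mono) auto
          finally show "cis (real (N - Suc q) * t) * x (q * r + g s) = 0" using x0[OF 1] by simp
        qed
      qed simp
      also have "\<dots> = (\<Sum>m\<le>q0. cis (real (N - Suc (q0 - m)) * t) * x ((q0 - m) * r + g s))"
        by (rule sum.nat_diff_reindex[of "\<lambda>q. cis (real (N - Suc q) * t) * x (q * r + g s)" "Suc q0", unfolded lessThan_Suc_atMost diff_Suc_Suc, symmetric])
      also have "\<dots> = (\<Sum>m\<le>q0. cis (real (N - Suc q0) * t) * (cis (real m * t) * x ((q0 - m) * r + g s)))"
      proof (rule sum.cong[OF refl])
        fix m assume m: "m \<in> {..q0}"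
        have "real (N - Suc (q0 - m)) = real (N - Suc q0) + real m"
          using m iq by (simp add: of_nat_diff)
        then have "cis (real (N - Suc (q0 - m)) * t) = cis (real (N - Suc q0) * t) * cis (real m * t)"
          by (simp only: distrib_right cis_mult)
        then show "cis (real (N - Suc (q0 - m)) * t) * x ((q0 - m) * r + g s) =
          cis (real (N - Suc q0) * t) * (cis (real m * t) * x ((q0 - m) * r + g s))"
          by (simp only: mult.assoc)
      qed
      also have "\<dots> = (cis (real (N - Suc q0) * t) *s w t) $ s"
        by (simp add: w_def a_def sum_component sum_distrib_left)
      finally show "u x t $ s = (cis (real (N - Suc q0) * t) *s w t) $ s" .
    qed
    have tp: "trig_poly (d + q0) (\<lambda>t. sesq (H t) (w t) (w t))"
      unfolding w_def by (rule trig_poly_sesq) (rule trig)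
    have cont: "continuous_on UNIV (\<lambda>t. sesq (H t) (w t) (w t))" by (rule trig_poly_continuous[OF tp])
    then have cont': "continuous_on UNIV (\<lambda>t. qf (H t) (w t))" unfolding qf_def by (intro continuous_intros)
    have nn: "qf (H t) (w t) \<ge> 0" for t using low[of "w t" t] c by (smt (verit) mult_nonneg_nonneg zero_le_power2)
    have "complex_of_real ((\<Sum>j<N. qf (H (\<theta> j)) (w (\<theta> j))) / real N) = (\<Sum>j<N. sesq (H (\<theta> j)) (w (\<theta> j)) (w (\<theta> j))) / of_nat N"
      by (simp add: hermitian_sesq_real[OF herm])
    \<comment> \<open>Here \<open>q0 < N - d\<close> is decisive: the integrand has degree at most
      \<open>d + q0\<close>, which is less than \<open>N\<close>.\<close>
    also have "\<dots> = (LINT t|circ. sesq (H t) (w t) (w t)) / (2*pi)"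
      unfolding \<theta>_def by (rule trig_poly_discrete_mean[OF tp]) (use iq N in auto)
    also have "\<dots> = complex_of_real ((LINT t|circ. qf (H t) (w t)) / (2*pi))"
      by (simp add: hermitian_sesq_real[OF herm])
    finally have mean: "(\<Sum>j<N. qf (H (\<theta> j)) (w (\<theta> j))) / real N = (LINT t|circ. qf (H t) (w t)) / (2*pi)"
      by (simp only: of_real_eq_iff)
    have "ennreal (2 * pi * qf H0 (a 0)) \<le> (\<integral>\<^sup>+t. ennreal (qf (H t) (w t)) \<partial>circ)"
      using sub unfolding submean_polys_def w_def by blast
    also have "\<dots> = ennreal (LINT t|circ. qf (H t) (w t))"
      by (rule nn_integral_eq_integral[OF continuous_integrable_circ[OF cont']]) (simp add: nn)
    finally have "2 * pi * qf H0 (a 0) \<le> (LINT t|circ. qf (H t) (w t))"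
      by (subst (asm) ennreal_le_iff) (auto intro!: integral_nonneg_AE nn)
    then have "qf H0 (a 0) \<le> (LINT t|circ. qf (H t) (w t)) / (2*pi)" by (simp add: field_simps)
    moreover have "\<delta>0 i \<le> qf H0 (a 0)"
    proof (rule d0(2))
      show "i < r" by (rule iq)
      show "a 0 $ f i = 1" using iq xb by (simp add: a_def gf)
      show "a 0 $ f j = 0" if "i < j" "j < r" for j
      proof -
        have "q0 * r + j < (q0 + 1) * r" using that by simp
        also have "(q0 + 1) * r \<le> n" unfolding n_def using iq by (intro mult_right_mono) auto
        finally have "x (q0 * r + j) = 0" using iq that by (intro x0) auto
        then show ?thesis using that by (simp add: a_def gf)
      qed
    qed
    ultimately have "\<delta>0 i \<le> (\<Sum>j<N. qf (H (\<theta> j)) (w (\<theta> j))) / real N" using mean by linarith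
    then show ?thesis unfolding form uw qf_cis i_def .
  qed
  obtain \<delta> :: "nat \<Rightarrow> real" where d:
    "\<And>b. b < n \<Longrightarrow> \<delta> b > 0"
    "\<And>b. b < n \<Longrightarrow> \<exists>x. x b = 1 \<and> (\<forall>j. b < j \<and> j < n \<longrightarrow> x j = 0) \<and> \<delta> b = Re (hform n G x x)"
    "Determinant.det (Matrix.mat n n (\<lambda>(i,j). G i j)) = of_real (\<Prod>b<n. \<delta> b)"
    by (rule hermitian_det_flag[of n G]) (use Gherm Gpos in blast)+
  define e where "e q i = (if q < N - d then \<delta>0 i else c)" for q i
  have "(\<Prod>b<n. e (b div r) (b mod r)) \<le> (\<Prod>b<n. \<delta> b)"
  proof (rule prod_mono)
    fix b assume "b \<in> {..<n}"
    then have b: "b < n" by simp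
    obtain x where x: "x b = 1" "\<And>j. b < j \<Longrightarrow> j < n \<Longrightarrow> x j = 0" "\<delta> b = Re (hform n G x x)"
      using d(2)[OF b] by blast
    have "b mod r < r" using r by simp
    then have "0 \<le> e (b div r) (b mod r)" using d0(1) c by (auto simp: e_def less_imp_le)
    moreover have "e (b div r) (b mod r) \<le> \<delta> b"
      using low2[OF b, of x] low1[OF b, of x] x by (auto simp: e_def)
    ultimately show "0 \<le> e (b div r) (b mod r) \<and> e (b div r) (b mod r) \<le> \<delta> b" ..
  qed
  also have "(\<Prod>b<n. e (b div r) (b mod r)) = (\<Prod>q<N. \<Prod>i<r. e q i)"
    unfolding n_def by (rule prod_div_mod[OF r])
  also have "\<dots> = (\<Prod>q<N. if q < N - d then (\<Prod>i<r. \<delta>0 i) else c ^ r)"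
    by (rule prod.cong[OF refl]) (simp add: e_def)
  also have "\<dots> = (\<Prod>q<N - d. (\<Prod>i<r. \<delta>0 i)) * (\<Prod>q=N-d..<N. c ^ r)"
  proof -
    have "{..<N} = {..<N-d} \<union> {N-d..<N}" by auto
    then show ?thesis by (simp add: prod.union_disjoint ivl_disj_int(2) del: prod_constant)
  qed
  also have "\<dots> = Re (det H0) ^ (N - d) * c ^ (CARD('r) * d)"
    unfolding d0(3) Re_complex_of_real using N by (simp add: r_def power_mult)
  finally have le: "Re (det H0) ^ (N - d) * c ^ (CARD('r) * d) \<le> (\<Prod>b<n. \<delta> b)" .
  have "complex_of_real (\<Prod>b<n. \<delta> b) = (\<Prod>q<N. Determinant.det (Matrix.mat r r (\<lambda>(i,j). B q i j)))"
    unfolding d(3)[symmetric] cong_det unfolding D_def n_def by (rule det_block_diag[OF r])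
  also have "\<dots> = (\<Prod>q<N. det (H (\<theta> q)))"
    unfolding det_eq_Determinant_det[OF f] B_def r_def ..
  also have "\<dots> = complex_of_real (\<Prod>q<N. Re (det (H (\<theta> q))))"
  proof -
    have "det (H t) = of_real (Re (det (H t)))" for t
    proof (rule hadamard_det_le(1)[OF herm])
      fix v :: "complex^'r" assume "v \<noteq> 0"
      then have "0 < c * (norm v)\<^sup>2" using c by simp
      then show "0 < qf (H t) v" using low[of v t] by linarith
    qed
    then show ?thesis unfolding of_real_prod by (rule prod.cong[OF refl])
  qed
  finally have "(\<Prod>b<n. \<delta> b) = (\<Prod>q<N. Re (det (H (\<theta> q))))" by (simp only: of_real_eq_iff)
  then show ?thesis using le by (simp add: \<theta>_def)
qed

section \<open>Orthonormal frames and comparison of determinants\<close>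

lemma sesq_add_left: "sesq M (v + v') w = sesq M v w + sesq M v' w"
  by (simp add: sesq_def algebra_simps sum.distrib)

lemma sesq_scale_left: "sesq M (c *s v) w = c * sesq M v w"
  by (simp add: sesq_def sum_distrib_left mult_ac)

lemma sesq_sum_left: "sesq M (\<Sum>i\<in>I. v i) w = (\<Sum>i\<in>I. sesq M (v i) w)"
proof (induction I rule: infinite_finite_induct)
  case (insert x F)
  then show ?case by (simp add: sesq_add_left)
qed (simp_all add: sesq_def)

lemma sesq_add_right: "sesq M v (w + w') = sesq M v w + sesq M v w'"
  by (simp add: sesq_def algebra_simps sum.distrib)

lemma sesq_scale_right: "sesq M v (c *s w) = cnj c * sesq M v w"
  by (simp add: sesq_def sum_distrib_left mult_ac)

lemma sesq_sum_right: "sesq M v (\<Sum>i\<in>I. w i) = (\<Sum>i\<in>I. sesq M v (w i))"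
proof (induction I rule: infinite_finite_induct)
  case (insert x F)
  then show ?case by (simp add: sesq_add_right)
qed (simp_all add: sesq_def)

lemma hermitian_sesq_cnj:
  assumes "hermitian M" shows "sesq M w v = cnj (sesq M v w)"
proof -
  have "sesq M w v = (\<Sum>j\<in>UNIV. \<Sum>i\<in>UNIV. M$i$j * w$i * cnj (v$j))"
    unfolding sesq_def by (rule sum.swap)
  also have "\<dots> = cnj (sesq M v w)"
    unfolding sesq_def cnj_sum
  proof (rule sum.cong[OF refl], rule sum.cong[OF refl])
    fix i j
    have "M$i$j = cnj (M$j$i)" using assms unfolding hermitian_def by blast
    then show "M$i$j * w$i * cnj (v$j) = cnj (M$j$i * v$j * cnj (w$i))" by simp
  qed
  finally show ?thesis .
qed

text \<open>Gram-Schmidt, one basis vector at a time. The invariant that the vectors built over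
  \<open>S\<close> are supported in \<open>S\<close> gives the new vector \<open>q\<close> the
  coordinate 1 at \<open>s\<close>, so it is nonzero and can be normalized.\<close>

lemma ex_orthonormal_frame:
  fixes M :: "complex^'r::finite^'r"
  assumes herm: "hermitian M" and pos: "\<And>v. v \<noteq> 0 \<Longrightarrow> qf M v > 0"
  obtains p :: "'r \<Rightarrow> complex^'r" where "\<And>i j. sesq M (p i) (p j) = (if i = j then 1 else 0)"
proof -
  have "\<exists>p :: 'r \<Rightarrow> complex^'r. (\<forall>i\<in>S. \<forall>j\<in>S. sesq M (p i) (p j) = (if i = j then 1 else 0)) \<and>
      (\<forall>i\<in>S. \<forall>k. k \<notin> S \<longrightarrow> p i $ k = 0)" if "finite S" for S :: "'r set"
    using that
  proof (induction S)
    case empty then show ?case by simp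
  next
    case (insert s S)
    then obtain p :: "'r \<Rightarrow> complex^'r" where
      p: "\<And>i j. i \<in> S \<Longrightarrow> j \<in> S \<Longrightarrow> sesq M (p i) (p j) = (if i = j then 1 else 0)"
      "\<And>i k. i \<in> S \<Longrightarrow> k \<notin> S \<Longrightarrow> p i $ k = 0" by blast
    define q where "q = axis s 1 + (\<Sum>i\<in>S. (- sesq M (axis s 1) (p i)) *s p i)"
    have qs: "q $ s = 1"
      using p(2) insert.hyps by (simp add: q_def sum_component axis_def)
    then have "q \<noteq> 0" by auto
    then have qpos: "qf M q > 0" by (rule pos)
    have qp: "sesq M q (p j) = 0" if "j \<in> S" for j
    proof -
      have "sesq M q (p j) = sesq M (axis s 1) (p j) + (\<Sum>i\<in>S. (- sesq M (axis s 1) (p i)) * sesq M (p i) (p j))"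
        unfolding q_def sesq_add_left sesq_sum_left sesq_scale_left ..
      also have "(\<Sum>i\<in>S. (- sesq M (axis s 1) (p i)) * sesq M (p i) (p j)) =
          (\<Sum>i\<in>S. if i = j then - sesq M (axis s 1) (p j) else 0)"
        using p(1) that by (intro sum.cong refl) auto
      finally show ?thesis using that insert.hyps by simp
    qed
    define t where "t = complex_of_real (1 / sqrt (qf M q))"
    have tt: "t * cnj t * sesq M q q = 1"
    proof -
      have "sqrt (qf M q) * sqrt (qf M q) = qf M q" using qpos by simp
      then have "(1 / sqrt (qf M q)) * (1 / sqrt (qf M q)) * qf M q = 1"
        using qpos by (simp add: field_simps)
      then have "complex_of_real ((1 / sqrt (qf M q)) * (1 / sqrt (qf M q)) * qf M q) = 1" by simp
      then show ?thesis
        unfolding t_def hermitian_sesq_real[OF herm] by (simp only: of_real_mult complex_cnj_complex_of_real)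
    qed
    define p' where "p' = p(s := t *s q)"
    have pq: "sesq M (p j) q = 0" if "j \<in> S" for j
      using hermitian_sesq_cnj[OF herm, of "p j" q] qp[OF that] by simp
    have *: "sesq M (p' i) (p' j) = (if i = j then 1 else 0)" if ij: "i \<in> insert s S" "j \<in> insert s S" for i j
    proof -
      consider "i = s" "j = s" | "i = s" "j \<in> S" "j \<noteq> s" | "i \<in> S" "j = s" "i \<noteq> s" | "i \<in> S" "j \<in> S" "i \<noteq> s" "j \<noteq> s"
        using ij insert.hyps by blast
      then show ?thesis
      proof cases
        case 1 then show ?thesis using tt by (simp add: p'_def sesq_scale)
      next
        case 2 then show ?thesis using qp[of j] sesq_scale[of M t q 1 "p j"] by (simp add: p'_def)
      next
        case 3 then show ?thesis using pq[of i] sesq_scale[of M 1 "p i" t q] by (simp add: p'_def)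
      next
        case 4 then show ?thesis using p(1) by (simp add: p'_def)
      qed
    qed
    moreover have "p' i $ k = 0" if "i \<in> insert s S" "k \<notin> insert s S" for i k
    proof (cases "i = s")
      case True
      then show ?thesis using that p(2) by (simp add: p'_def q_def sum_component axis_def)
    next
      case False
      then show ?thesis using that p(2) by (simp add: p'_def)
    qed
    ultimately show ?case by blast
  qed
  from this[of UNIV] that show ?thesis by auto
qed

definition frame_matrix :: "('r \<Rightarrow> complex^'r) \<Rightarrow> complex^'r^'r" where
  "frame_matrix p = (\<chi> k i. p i $ k)"

definition frame_gram :: "complex^'r^'r \<Rightarrow> ('r \<Rightarrow> complex^'r) \<Rightarrow> complex^'r^'r" where
  "frame_gram M p = (\<chi> i j. sesq M (p i) (p j))"

lemma det_frame_gram: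
  fixes M :: "complex^'r::finite^'r"
  shows "det (frame_gram M p) = det M * of_real ((cmod (det (frame_matrix p)))\<^sup>2)"
proof -
  let ?P = "frame_matrix p" and ?C = "(\<chi> k i. cnj (p i $ k)) :: complex^'r^'r"
  have "frame_gram M p = transpose ?P ** M ** ?C"
    unfolding Finite_Cartesian_Product.vec_eq_iff
  proof (intro allI)
    fix i j
    have "frame_gram M p $ i $ j = (\<Sum>l\<in>UNIV. \<Sum>k\<in>UNIV. M$k$l * p i $ k * cnj (p j $ l))"
      unfolding frame_gram_def by (simp add: sesq_def) (rule sum.swap)
    also have "\<dots> = (transpose ?P ** M ** ?C) $ i $ j"
      by (simp add: matrix_matrix_mult_def transpose_def frame_matrix_def sum_distrib_left sum_distrib_right mult_ac)
    finally show "frame_gram M p $ i $ j = (transpose ?P ** M ** ?C) $ i $ j" .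
  qed
  moreover have "det ?C = cnj (det ?P)"
    by (simp add: Determinants.det_def frame_matrix_def cnj_prod)
  ultimately have "det (frame_gram M p) = det ?P * det M * cnj (det ?P)"
    by (simp add: det_mul)
  then have "det (frame_gram M p) = det M * (det ?P * cnj (det ?P))" by simp
  then show ?thesis by (simp only: complex_norm_square)
qed

lemma hermitian_frame_gram: "hermitian M \<Longrightarrow> hermitian (frame_gram M p)"
proof -
  assume "hermitian M"
  then have "sesq M (p j) (p i) = cnj (sesq M (p i) (p j))" for i j by (rule hermitian_sesq_cnj)
  then show ?thesis unfolding hermitian_def frame_gram_def vec_lambda_beta by blast
qed

lemma sesq_frame_gram: "sesq (frame_gram M p) v w = sesq M (frame_matrix p *v v) (frame_matrix p *v w)"
proof -
  have e: "frame_matrix p *v v = (\<Sum>i\<in>UNIV. v$i *s p i)" for v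
    by (simp add: Finite_Cartesian_Product.vec_eq_iff matrix_vector_mult_def frame_matrix_def sum_component mult.commute)
  have "sesq M (frame_matrix p *v v) (frame_matrix p *v w) =
      (\<Sum>j\<in>UNIV. cnj (w$j) * (\<Sum>i\<in>UNIV. v$i * sesq M (p i) (p j)))"
    unfolding e sesq_sum_right sesq_sum_left sesq_scale_left sesq_scale_right ..
  also have "\<dots> = (\<Sum>i\<in>UNIV. \<Sum>j\<in>UNIV. cnj (w$j) * (v$i * sesq M (p i) (p j)))"
    unfolding sum_distrib_left by (rule sum.swap)
  also have "\<dots> = sesq (frame_gram M p) v w"
    unfolding sesq_def[of "frame_gram M p"] by (simp add: frame_gram_def mult_ac)
  finally show ?thesis by (rule sym)
qed

text \<open>Hadamard's inequality for \<open>H\<close> in a frame that is orthonormal for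
  \<open>M\<close>, where the determinant of \<open>M\<close> becomes 1. It needs only finitely many
  values of the quadratic form of \<open>H\<close>; in this way semicontinuity of norms of single
  vectors passes to the determinant.\<close>

lemma det_ratio_le:
  fixes M H :: "complex^'r::finite^'r" and p :: "'r \<Rightarrow> complex^'r"
  assumes M: "hermitian M" and p: "\<And>i j. sesq M (p i) (p j) = (if i = j then 1 else 0)"
    and H: "hermitian H" "\<And>v. v \<noteq> 0 \<Longrightarrow> qf H v > 0"
  shows "Re (det H) \<le> Re (det M) * (\<Prod>i\<in>UNIV. qf H (p i))" "det M \<noteq> 0"
proof -
  define D where "D = (cmod (det (frame_matrix p)))\<^sup>2"
  have "frame_gram M p = Finite_Cartesian_Product.mat 1"
    by (simp add: frame_gram_def p Finite_Cartesian_Product.mat_def)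
  then have 1: "det M * of_real D = 1" using det_frame_gram[of M p] by (simp add: D_def)
  then have D0: "D \<noteq> 0" by auto
  then have D: "D > 0" unfolding D_def by simp
  show "det M \<noteq> 0" using 1 by auto
  have inj: "frame_matrix p *v v \<noteq> 0" if "v \<noteq> 0" for v
  proof -
    have "det (frame_matrix p) \<noteq> 0" using D0 by (auto simp: D_def)
    then have "invertible (frame_matrix p)" by (simp add: invertible_det_nz)
    then obtain Q where "Q ** frame_matrix p = Finite_Cartesian_Product.mat 1" unfolding invertible_def by blast
    then have "v = Q *v (frame_matrix p *v v)" by (simp add: matrix_vector_mul_assoc)
    then show ?thesis using that by auto
  qed
  have "Re (det (frame_gram H p)) \<le> (\<Prod>i\<in>UNIV. Re (frame_gram H p $ i $ i))"
  proof (rule hadamard_det_le(3))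
    show "hermitian (frame_gram H p)" by (rule hermitian_frame_gram[OF H(1)])
    show "0 < qf (frame_gram H p) v" if "v \<noteq> 0" for v
      using H(2)[OF inj[OF that]] by (simp add: qf_def sesq_frame_gram)
  qed
  also have "\<dots> = (\<Prod>i\<in>UNIV. qf H (p i))" by (simp add: frame_gram_def qf_def)
  finally have 2: "Re (det H) * D \<le> (\<Prod>i\<in>UNIV. qf H (p i))"
    unfolding det_frame_gram D_def[symmetric] by simp
  have 3: "Re (det M) * D = 1" using arg_cong[OF 1, of Re] by simp
  have "Re (det M) = 1 / D" using 3 D by (simp add: field_simps)
  then have 4: "Re (det M) * y = y / D" for y by simp
  then show "Re (det H) \<le> Re (det M) * (\<Prod>i\<in>UNIV. qf H (p i))"
    unfolding 4 using 2 D by (simp add: pos_le_divide_eq)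
qed

lemma continuous_on_det:
  fixes H :: "'a::topological_space \<Rightarrow> complex^'r::finite^'r"
  assumes "\<And>i j. continuous_on S (\<lambda>x. H x $ i $ j)"
  shows "continuous_on S (\<lambda>x. det (H x))"
  unfolding Determinants.det_def by (intro continuous_intros assms)

lemma borel_measurable_det:
  fixes H :: "'a \<Rightarrow> complex^'r::finite^'r"
  assumes "\<And>i j. (\<lambda>x. H x $ i $ j) \<in> borel_measurable N"
  shows "(\<lambda>x. det (H x)) \<in> borel_measurable N"
  unfolding Determinants.det_def
  by (intro borel_measurable_sum borel_measurable_times borel_measurable_prod assms borel_measurable_const)

lemma borel_measurable_cnj: "f \<in> borel_measurable N \<Longrightarrow> (\<lambda>x. cnj (f x)) \<in> borel_measurable N"
  by (rule measurable_compose[of f N borel cnj borel])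
     (auto intro!: borel_measurable_continuous_onI continuous_intros)

lemma borel_measurable_qf:
  fixes H :: "'a \<Rightarrow> complex^'r::finite^'r"
  assumes "\<And>i j. (\<lambda>x. H x $ i $ j) \<in> borel_measurable N" "\<And>i. (\<lambda>x. v x $ i) \<in> borel_measurable N"
  shows "(\<lambda>x. qf (H x) (v x)) \<in> borel_measurable N"
proof -
  have "(\<lambda>x. sesq (H x) (v x) (v x)) \<in> borel_measurable N"
    unfolding sesq_def using assms
    by (intro borel_measurable_sum borel_measurable_times) (auto intro: borel_measurable_cnj)
  then show ?thesis unfolding qf_def by simp
qed

text \<open>Reduced to the nonnegative case by adding a bound \<open>B\<close>; the interval
  \<open>{0..4*pi}\<close> contains all the shifted arguments.\<close>

lemma integral_circ_shift:
  fixes F :: "real \<Rightarrow> real"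
  assumes F: "continuous_on UNIV F" and per: "\<And>\<theta>. F (\<theta> + 2*pi) = F \<theta>"
    and \<phi>: "\<phi> \<in> {0..2*pi}"
  shows "(LINT \<theta>|circ. F (\<theta> + \<phi>)) = (LINT \<theta>|circ. F \<theta>)"
proof -
  have "compact (F ` {0..4*pi})"
    using F by (intro compact_continuous_image) (auto intro: continuous_on_subset)
  then obtain B where B: "\<And>y. y \<in> F ` {0..4*pi} \<Longrightarrow> \<bar>y\<bar> \<le> B"
    using compact_imp_bounded bounded_real by metis
  have cF: "continuous_on UNIV (\<lambda>\<theta>. F (\<theta> + \<phi>))"
    by (rule continuous_on_compose2[OF F]) (auto intro!: continuous_intros)
  have i1: "integrable circ F" and i2: "integrable circ (\<lambda>\<theta>. F (\<theta> + \<phi>))"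
    using F cF by (auto intro: continuous_integrable_circ)
  have c: "integrable circ (\<lambda>_. B)" by (rule continuous_integrable_circ) auto
  have p1: "0 \<le> F \<theta> + B" if "\<theta> \<in> space circ" for \<theta>
    using B[of "F \<theta>"] that by (simp add: abs_le_iff)
  have p2: "0 \<le> F (\<theta> + \<phi>) + B" if "\<theta> \<in> space circ" for \<theta>
  proof -
    have "\<theta> + \<phi> \<in> {0..4*pi}" using that \<phi> by auto
    then show ?thesis using B[of "F (\<theta> + \<phi>)"] by (auto simp: abs_le_iff)
  qed
  have "ennreal (LINT \<theta>|circ. F (\<theta> + \<phi>) + B) = (\<integral>\<^sup>+\<theta>. ennreal (F (\<theta> + \<phi>) + B) \<partial>circ)"
    by (rule nn_integral_eq_integral[symmetric]) (use i2 c p2 in \<open>auto intro!: AE_I2\<close>)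
  also have "\<dots> = (\<integral>\<^sup>+\<theta>. ennreal (F \<theta> + B) \<partial>circ)"
  proof (rule nn_integral_circ_shift[OF _ _ \<phi>, of "\<lambda>\<theta>. ennreal (F \<theta> + B)"])
    have "F \<in> borel_measurable borel" using F by (rule borel_measurable_continuous_onI)
    then show "(\<lambda>\<theta>. ennreal (F \<theta> + B)) \<in> borel_measurable borel" by simp
  qed (simp add: per)
  also have "\<dots> = ennreal (LINT \<theta>|circ. F \<theta> + B)"
    by (rule nn_integral_eq_integral) (use i1 c p1 in \<open>auto intro!: AE_I2\<close>)
  finally have "(LINT \<theta>|circ. F (\<theta> + \<phi>) + B) = (LINT \<theta>|circ. F \<theta> + B)"
    using p1 p2 by (subst (asm) ennreal_inj) (auto intro!: integral_nonneg_AE AE_I2)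
  then show ?thesis using i1 i2 c by simp
qed

definition periodic :: "(real \<Rightarrow> 'a) \<Rightarrow> bool" where
  "periodic F \<longleftrightarrow> (\<forall>\<theta>. F (\<theta> + 2*pi) = F \<theta>)"

lemma cis_nat_periodic: "cis (real k * (\<theta> + 2*pi)) = cis (real k * \<theta>)"
proof -
  have "cis (real k * (\<theta> + 2*pi)) = cis (real k * \<theta>) * cis (of_int (int k) * (2*pi))"
    by (simp add: distrib_left cis_mult)
  then show ?thesis by (simp only: cis_int_2pi) simp
qed

text \<open>Rotating the metric by \<open>\<phi>\<close> amounts to rotating the coefficient
  \<open>a k\<close> by \<open>k\<close> times the opposite angle, which leaves the value
  \<open>a 0\<close> at the center unchanged.\<close>

lemma submean_polys_rotate:
  fixes H :: "real \<Rightarrow> complex^'r::finite^'r"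
  assumes sub: "submean_polys H H0" and meas: "\<And>i j. (\<lambda>\<theta>. H \<theta> $ i $ j) \<in> borel_measurable borel"
    and per: "periodic H" and \<phi>: "\<phi> \<in> {0..2*pi}"
  shows "submean_polys (\<lambda>\<theta>. H (\<theta> + \<phi>)) H0"
  unfolding submean_polys_def
proof (intro allI)
  fix m and a :: "nat \<Rightarrow> complex^'r"
  define a' where "a' k = cis (- (real k * \<phi>)) *s a k" for k
  define F where "F \<theta> = ennreal (qf (H \<theta>) (\<Sum>k\<le>m. cis (real k * \<theta>) *s a' k))" for \<theta>
  have "ennreal (2 * pi * qf H0 (a 0)) = ennreal (2 * pi * qf H0 (a' 0))" by (simp add: a'_def)
  also have "\<dots> \<le> (\<integral>\<^sup>+\<theta>. F \<theta> \<partial>circ)"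
    using sub unfolding submean_polys_def F_def by blast
  also have "\<dots> = (\<integral>\<^sup>+\<theta>. F (\<theta> + \<phi>) \<partial>circ)"
  proof (rule nn_integral_circ_shift[OF _ _ \<phi>, symmetric])
    have "(\<lambda>\<theta>. cis (real k * \<theta>)) \<in> borel_measurable borel" for k
      by (rule borel_measurable_continuous_onI) (auto intro!: continuous_intros continuous_on_cis)
    then have "(\<lambda>\<theta>. (\<Sum>k\<le>m. cis (real k * \<theta>) *s a' k) $ i) \<in> borel_measurable borel" for i
      by (simp add: sum_component)
    then have "(\<lambda>\<theta>. qf (H \<theta>) (\<Sum>k\<le>m. cis (real k * \<theta>) *s a' k)) \<in> borel_measurable borel"
      by (rule borel_measurable_qf[OF meas])
    then show "F \<in> borel_measurable borel" unfolding F_def by simp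
    show "F (\<theta> + 2*pi) = F \<theta>" for \<theta>
      using per unfolding F_def periodic_def by (simp only: cis_nat_periodic)
  qed
  also have "\<dots> = (\<integral>\<^sup>+\<theta>. ennreal (qf (H (\<theta> + \<phi>)) (\<Sum>k\<le>m. cis (real k * \<theta>) *s a k)) \<partial>circ)"
  proof -
    have "cis (real k * (\<theta> + \<phi>)) *s a' k = cis (real k * \<theta>) *s a k" for k \<theta>
      unfolding a'_def by (simp add: cis_mult distrib_left)
    then show ?thesis unfolding F_def by simp
  qed
  finally show "ennreal (2 * pi * qf H0 (a 0)) \<le>
      (\<integral>\<^sup>+\<theta>. ennreal (qf (H (\<theta> + \<phi>)) (\<Sum>k\<le>m. cis (real k * \<theta>) *s a k)) \<partial>circ)" .
qed

text \<open>The discrete bound is applied to all rotations of \<open>H\<close> and integrated over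
  the angle. For every single \<open>N\<close>, this turns the sum over the roots of unity into
  \<open>N\<close> copies of the circle integral. The terms of the \<open>d\<close> exceptional
  blocks do not grow with \<open>N\<close>, so they are negligible in the limit.\<close>

lemma log_det_submean_trig:
  fixes H :: "real \<Rightarrow> complex^'r::finite^'r"
  assumes trig: "\<And>i j. trig_poly d (\<lambda>\<theta>. H \<theta> $ i $ j)"
    and herm: "\<And>\<theta>. hermitian (H \<theta>)"
    and c: "c > 0" and low: "\<And>\<theta> v. c * (norm v)\<^sup>2 \<le> qf (H \<theta>) v"
    and H0: "hermitian H0" "\<And>v. v \<noteq> 0 \<Longrightarrow> qf H0 v > 0"
    and sub: "submean_polys H H0"
  shows "2 * pi * ln (Re (det H0)) \<le> (LINT \<theta>|circ. ln (Re (det (H \<theta>))))"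
proof -
  define L where "L \<theta> = ln (Re (det (H \<theta>)))" for \<theta>
  define I where "I = (LINT \<theta>|circ. L \<theta>)"
  define A where "A = ln (Re (det H0))"
  define r where "r = CARD('r)"
  have cont: "continuous_on UNIV (\<lambda>\<theta>. H \<theta> $ i $ j)" for i j by (rule trig_poly_continuous[OF trig])
  have hpos: "qf (H t) v > 0" if "v \<noteq> 0" for t v
  proof -
    have "0 < c * (norm v)\<^sup>2" using c that by simp
    then show "0 < qf (H t) v" using low[of v t] by linarith
  qed
  have dpos: "Re (det (H \<theta>)) > 0" for \<theta> by (rule hadamard_det_le(2)[OF herm hpos])
  have d0pos: "Re (det H0) > 0" by (rule hadamard_det_le(2)[OF H0])
  have Lc: "continuous_on UNIV L"
    unfolding L_def using dpos
    by (intro continuous_on_ln continuous_on_Re continuous_on_det cont) (auto simp: less_imp_neq[symmetric])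
  have Hper: "H (\<theta> + 2*pi) = H \<theta>" for \<theta>
    unfolding Finite_Cartesian_Product.vec_eq_iff using trig_poly_periodic[OF trig] by blast
  then have Lper: "L (\<theta> + 2*pi) = L \<theta>" for \<theta> by (simp add: L_def)
  have meas: "(\<lambda>\<theta>. H \<theta> $ i $ j) \<in> borel_measurable borel" for i j
    by (rule borel_measurable_continuous_onI[OF cont])
  have per: "periodic H" using Hper by (simp add: periodic_def)
  have main: "2 * pi * (real (N - d) * A + real (r * d) * ln c) \<le> real N * I" if N: "d < N" for N
  proof -
    define s where "s j = 2*pi*real j / real N" for j
    have s: "s j \<in> {0..2*pi}" if "j < N" for j
      using that N by (auto simp: s_def divide_le_eq)
    have b: "real (N - d) * A + real (r * d) * ln c \<le> (\<Sum>j<N. L (\<phi> + s j))"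
      if \<phi>: "\<phi> \<in> {0..2*pi}" for \<phi>
    proof -
      have "Re (det H0) ^ (N - d) * c ^ (r * d) \<le> (\<Prod>j<N. Re (det (H (s j + \<phi>))))"
        unfolding r_def s_def
        by (rule discrete_det_bound[where H = "\<lambda>\<theta>. H (\<theta> + \<phi>)"])
           (use trig_poly_shift[OF trig] herm c low H0 N submean_polys_rotate[OF sub meas per \<phi>] in auto)
      then have "ln (Re (det H0) ^ (N - d) * c ^ (r * d)) \<le> ln (\<Prod>j<N. Re (det (H (s j + \<phi>))))"
        using d0pos c by (subst ln_le_cancel_iff) (auto intro!: prod_pos dpos)
      also have "\<dots> = (\<Sum>j<N. L (\<phi> + s j))"
        unfolding L_def by (subst ln_prod) (auto simp: dpos add.commute less_imp_neq[OF dpos, symmetric])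
      also have "ln (Re (det H0) ^ (N - d) * c ^ (r * d)) = real (N - d) * A + real (r * d) * ln c"
        using d0pos c by (simp add: ln_mult ln_realpow A_def)
      finally show ?thesis .
    qed
    have Ls: "continuous_on UNIV (\<lambda>\<phi>. L (\<phi> + s j))" for j
      by (rule continuous_on_compose2[OF Lc]) (auto intro!: continuous_intros)
    have "2 * pi * (real (N - d) * A + real (r * d) * ln c) = (LINT \<phi>|circ. real (N - d) * A + real (r * d) * ln c)"
      using measure_circ by simp
    also have "\<dots> \<le> (LINT \<phi>|circ. (\<Sum>j<N. L (\<phi> + s j)))"
      by (rule integral_mono) (use b in \<open>auto intro!: continuous_integrable_circ continuous_intros Ls\<close>)
    also have "\<dots> = (\<Sum>j<N. (LINT \<phi>|circ. L (\<phi> + s j)))"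
      by (rule Bochner_Integration.integral_sum) (auto intro!: continuous_integrable_circ Ls)
    also have "\<dots> = (\<Sum>j<N. I)"
      unfolding I_def by (rule sum.cong[OF refl]) (use s integral_circ_shift[OF Lc Lper] in auto)
    finally show ?thesis by simp
  qed
  have "2 * pi * A \<le> I"
  proof (rule ccontr)
    assume "\<not> 2 * pi * A \<le> I"
    then have "2 * pi * A - I > 0" by simp
    then obtain n where n: "2 * pi * real d * A - 2 * pi * (real (r * d) * ln c) < real n * (2 * pi * A - I)"
      using reals_Archimedean3 by blast
    have ge: "real (n + d + 1) * (2 * pi * A - I) \<ge> real n * (2 * pi * A - I)"
      using \<open>2 * pi * A - I > 0\<close> by (intro mult_right_mono) auto
    have "real (n + d + 1 - d) = real (n + d + 1) - real d" by simp
    with main[of "n + d + 1"] have "2 * pi * ((real (n + d + 1) - real d) * A + real (r * d) * ln c) \<le> real (n + d + 1) * I"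
      by simp
    then have "real (n + d + 1) * (2 * pi * A - I) \<le> 2 * pi * real d * A - 2 * pi * (real (r * d) * ln c)"
      by (simp add: algebra_simps)
    then show False using n ge by linarith
  qed
  then show ?thesis by (simp add: A_def I_def L_def)
qed

section \<open>Submean inequality for the logarithm of the determinant\<close>

text \<open>The kernel (1 + cos t)^d is a positive trigonometric polynomial that concentrates at 0.\<close>

definition ckernel :: "nat \<Rightarrow> real \<Rightarrow> real" where "ckernel d t = (1 + cos t) ^ d"

definition cmass :: "nat \<Rightarrow> real" where "cmass d = (LINT t|circ. ckernel d t)"

lemma continuous_ckernel: "continuous_on UNIV (ckernel d)"
  unfolding ckernel_def by (intro continuous_intros)

lemma ckernel_nonneg: "0 \<le> ckernel d t"
  unfolding ckernel_def by (intro zero_le_power) (use cos_ge_minus_one[of t] in linarith)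

lemma ckernel_meas [measurable]: "ckernel d \<in> borel_measurable borel"
  by (rule borel_measurable_continuous_onI[OF continuous_ckernel])

lemma integrable_ckernel: "integrable circ (ckernel d)"
  by (rule continuous_integrable_circ[OF continuous_ckernel])

lemma ckernel_periodic: "ckernel d (t + 2*pi) = ckernel d t"
  by (simp add: ckernel_def)

lemma cmass_lower:
  assumes "0 < \<delta>" "\<delta> \<le> pi"
  shows "(\<delta>/2) * (1 + cos (\<delta>/2)) ^ d \<le> cmass d"
proof -
  have "(\<delta>/2) * (1 + cos (\<delta>/2)) ^ d = (LINT t|circ. indicator {0..\<delta>/2} t * (1 + cos (\<delta>/2)) ^ d)"
  proof -
    have "measure circ {0..\<delta>/2} = \<delta>/2"
      unfolding circ_def using assms by (subst measure_restrict_space) auto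
    moreover have "{0..\<delta>/2} \<in> sets circ"
      unfolding circ_def using assms by (auto simp: sets_restrict_space image_iff intro!: bexI[of _ "{0..\<delta>/2}"])
    moreover have "{0..\<delta>/2} \<inter> space circ = {0..\<delta>/2}" using assms by auto
    moreover have "(LINT t|circ. indicator {0..\<delta>/2} t * (1 + cos (\<delta>/2)) ^ d) =
      measure circ ({0..\<delta>/2} \<inter> space circ) * (1 + cos (\<delta>/2)) ^ d"
      by (simp only: integral_mult_left_zero Bochner_Integration.integral_indicator)
    ultimately show ?thesis by (simp only:)
  qed
  also have "\<dots> \<le> (LINT t|circ. ckernel d t)"
  proof (rule integral_mono[OF _ integrable_ckernel])
    show "integrable circ (\<lambda>t. indicator {0..\<delta>/2} t * (1 + cos (\<delta>/2)) ^ d)"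
    proof (rule integrable_circ[where B = "\<bar>(1 + cos (\<delta>/2)) ^ d\<bar>"])
      show "norm (indicator {0..\<delta>/2} t * (1 + cos (\<delta>/2)) ^ d) \<le> \<bar>(1 + cos (\<delta>/2)) ^ d\<bar>" for t
        by (auto simp: indicator_def)
    qed measurable
    show "indicator {0..\<delta>/2} t * (1 + cos (\<delta>/2)) ^ d \<le> ckernel d t" if "t \<in> space circ" for t
    proof (cases "t \<in> {0..\<delta>/2}")
      case True
      then have "cos (\<delta>/2) \<le> cos t" using assms by (intro cos_monotone_0_pi_le) auto
      moreover have "0 \<le> 1 + cos (\<delta>/2)" using cos_ge_minus_one[of "\<delta>/2"] by linarith
      ultimately have "(1 + cos (\<delta>/2)) ^ d \<le> ckernel d t" unfolding ckernel_def by (intro power_mono) auto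
      then show ?thesis using True by simp
    next
      case False
      then show ?thesis by (simp add: ckernel_nonneg)
    qed
  qed
  finally show ?thesis unfolding cmass_def .
qed

lemma cmass_pos: "cmass d > 0"
proof -
  have "0 < (pi/2) * (1 + cos (pi/2)) ^ d" by simp
  then show ?thesis using cmass_lower[of pi d] pi_gt_zero by linarith
qed

text \<open>On the tail the kernel is at most \<open>(1 + cos \<delta>) ^ d\<close>, whereas
  \<open>cmass_lower\<close>, which uses half the angle, bounds the mass below by a multiple of
  \<open>(1 + cos (\<delta>/2)) ^ d\<close>. The quotient decays geometrically.\<close>

lemma ckernel_tail:
  assumes "0 < \<delta>" "\<delta> \<le> pi"
  shows "(\<lambda>d. (LINT t|circ. ckernel d t * indicator {\<delta>..2*pi-\<delta>} t) / cmass d) \<longlonglongrightarrow> 0"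
proof -
  define q where "q = (1 + cos \<delta>) / (1 + cos (\<delta>/2))"
  have c: "cos \<delta> < cos (\<delta>/2)" using assms by (intro cos_monotone_0_pi) auto
  have c1: "0 < 1 + cos (\<delta>/2)" using c cos_ge_minus_one[of \<delta>] by linarith
  have c0: "0 \<le> 1 + cos \<delta>" using cos_ge_minus_one[of \<delta>] by linarith
  have q: "0 \<le> q" "q < 1"
    unfolding q_def pos_divide_less_eq[OF c1] using c c0 c1 by (auto intro: divide_nonneg_pos)
  have bound: "(LINT t|circ. ckernel d t * indicator {\<delta>..2*pi-\<delta>} t) \<le> 2 * pi * (1 + cos \<delta>) ^ d" for d
  proof -
    have "(LINT t|circ. ckernel d t * indicator {\<delta>..2*pi-\<delta>} t) \<le> (LINT t|circ. (1 + cos \<delta>) ^ d)"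
    proof (rule integral_mono)
      show "integrable circ (\<lambda>t. ckernel d t * indicator {\<delta>..2*pi-\<delta>} t)"
      proof (rule integrable_circ[where B = "2^d"])
        show "norm (ckernel d t * indicator {\<delta>..2*pi-\<delta>} t) \<le> 2 ^ d" for t
        proof -
          have "ckernel d t \<le> 2 ^ d" unfolding ckernel_def
            using cos_le_one[of t] cos_ge_minus_one[of t] by (intro power_mono; linarith)
          then show ?thesis using ckernel_nonneg[of d t] by (auto simp: indicator_def)
        qed
      qed measurable
      show "integrable circ (\<lambda>t. (1 + cos \<delta>) ^ d)" by (rule continuous_integrable_circ) auto
      show "ckernel d t * indicator {\<delta>..2*pi-\<delta>} t \<le> (1 + cos \<delta>) ^ d" for t
      proof (cases "t \<in> {\<delta>..2*pi-\<delta>}")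
        case True
        have "cos t \<le> cos \<delta>"
        proof (cases "t \<le> pi")
          case True then show ?thesis using \<open>t \<in> _\<close> assms by (intro cos_monotone_0_pi_le) auto
        next
          case False
          have "cos t = cos (2*pi - t)" by (simp add: cos_2pi_minus)
          also have "\<dots> \<le> cos \<delta>" using False \<open>t \<in> _\<close> assms by (intro cos_monotone_0_pi_le) auto
          finally show ?thesis .
        qed
        moreover have "0 \<le> 1 + cos t" using cos_ge_minus_one[of t] by linarith
        ultimately have "ckernel d t \<le> (1 + cos \<delta>) ^ d" unfolding ckernel_def by (intro power_mono) auto
        then show ?thesis using True by simp
      next
        case False
        then show ?thesis using c0 by simp
      qed
    qed
    also have "\<dots> = 2 * pi * (1 + cos \<delta>) ^ d" using measure_circ by simp
    finally show ?thesis .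
  qed
  show ?thesis
  proof (rule tendsto_sandwich[of "\<lambda>_. 0" _ _ "\<lambda>d. (4 * pi / \<delta>) * q ^ d"])
    show "eventually (\<lambda>d. 0 \<le> (LINT t|circ. ckernel d t * indicator {\<delta>..2*pi-\<delta>} t) / cmass d) sequentially"
      using cmass_pos by (intro always_eventually allI divide_nonneg_pos integral_nonneg_AE AE_I2) (auto simp: ckernel_nonneg)
    show "eventually (\<lambda>d. (LINT t|circ. ckernel d t * indicator {\<delta>..2*pi-\<delta>} t) / cmass d \<le> (4 * pi / \<delta>) * q ^ d) sequentially"
    proof (intro always_eventually allI)
      fix d
      have "(LINT t|circ. ckernel d t * indicator {\<delta>..2*pi-\<delta>} t) / cmass d \<le> 2 * pi * (1 + cos \<delta>) ^ d / ((\<delta>/2) * (1 + cos (\<delta>/2)) ^ d)"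
        using bound[of d] cmass_lower[OF assms, of d] c1 c0 assms
        by (intro frac_le) auto
      also have "\<dots> = (4 * pi / \<delta>) * q ^ d" by (simp add: q_def power_divide)
      finally show "(LINT t|circ. ckernel d t * indicator {\<delta>..2*pi-\<delta>} t) / cmass d \<le> (4 * pi / \<delta>) * q ^ d" .
    qed
    show "(\<lambda>d. (4 * pi / \<delta>) * q ^ d) \<longlonglongrightarrow> 0"
      by (rule tendsto_mult_right_zero[OF LIMSEQ_realpow_zero[OF q]])
  qed simp
qed

lemma trig_poly_ckernel: "trig_poly d (\<lambda>t. of_real (ckernel d t))"
proof (induction d)
  case 0
  then show ?case using trig_poly_const[of 0 1] by (simp add: ckernel_def)
next
  case (Suc d)
  have "trig_poly 1 (\<lambda>t. 1 + (1/2 * cis (of_int 1 * t) + 1/2 * cis (of_int (-1) * t)))"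
    by (intro trig_poly_add trig_poly_const trig_poly_cis) auto
  also have "(\<lambda>t. 1 + (1/2 * cis (of_int 1 * t) + 1/2 * cis (of_int (-1) * t))) = (\<lambda>t. complex_of_real (1 + cos t))"
    by (auto simp: complex_eq_iff)
  finally have "trig_poly (d + 1) (\<lambda>t. complex_of_real (ckernel d t) * complex_of_real (1 + cos t))"
    by (rule trig_poly_mult[OF Suc])
  also have "(\<lambda>t. complex_of_real (ckernel d t) * complex_of_real (1 + cos t)) = (\<lambda>t. complex_of_real (ckernel (Suc d) t))"
    by (simp add: ckernel_def mult.commute)
  finally show ?case by simp
qed

text \<open>The convolution contains only frequencies of the kernel, whatever \<open>m\<close> is:
  its coefficients are those of the kernel multiplied by Fourier integrals of
  \<open>m\<close>.\<close>

lemma trig_poly_convolution: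
  assumes K: "trig_poly d (\<lambda>t. of_real (K t))" and m: "integrable circ m"
    and mm: "\<And>l. integrable circ (\<lambda>s. cis (of_int l * s) * m s)"
  shows "trig_poly d (\<lambda>\<theta>. LINT s|circ. of_real (K (s - \<theta>)) * m s)"
proof -
  obtain c where c: "\<And>t. complex_of_real (K t) = (\<Sum>l\<in>{-int d..int d}. c l * cis (of_int l * t))"
    using K unfolding trig_poly_def by blast
  have "(LINT s|circ. of_real (K (s - \<theta>)) * m s) =
    (\<Sum>l\<in>{-int d..int d}. (c l * (LINT s|circ. cis (of_int l * s) * m s)) * cis (of_int (-l) * \<theta>))" for \<theta>
  proof -
    have "(LINT s|circ. of_real (K (s - \<theta>)) * m s) =
      (LINT s|circ. (\<Sum>l\<in>{-int d..int d}. (c l * cis (of_int (-l) * \<theta>)) * (cis (of_int l * s) * m s)))"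
    proof (rule Bochner_Integration.integral_cong[OF refl])
      fix s
      have e: "cis (of_int l * (s - \<theta>)) = cis (of_int (-l) * \<theta>) * cis (of_int l * s)" for l
        by (simp add: cis_mult algebra_simps)
      show "of_real (K (s - \<theta>)) * m s = (\<Sum>l\<in>{-int d..int d}. (c l * cis (of_int (-l) * \<theta>)) * (cis (of_int l * s) * m s))"
        unfolding c sum_distrib_right by (rule sum.cong[OF refl]) (simp only: e mult.assoc)
    qed
    also have "\<dots> = (\<Sum>l\<in>{-int d..int d}. (c l * cis (of_int (-l) * \<theta>)) * (LINT s|circ. cis (of_int l * s) * m s))"
      by (subst Bochner_Integration.integral_sum) (auto intro!: mm)
    finally show ?thesis by (simp add: mult_ac)
  qed
  moreover have "trig_poly d (\<lambda>\<theta>. \<Sum>l\<in>{-int d..int d}. (c l * (LINT s|circ. cis (of_int l * s) * m s)) * cis (of_int (-l) * \<theta>))"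
    by (intro trig_poly_sum trig_poly_cis) auto
  ultimately show ?thesis by simp
qed

lemma norm_axis: "norm (axis i x :: 'a::real_normed_vector^'n) = norm x"
proof -
  have "(\<Sum>j\<in>(UNIV::'n set). (norm (axis i x $ j))\<^sup>2) = (\<Sum>j\<in>UNIV. if j = i then (norm x)\<^sup>2 else 0)"
    by (intro sum.cong refl) (auto simp: axis_def)
  then show ?thesis by (simp add: norm_vec_def L2_set_def)
qed

text \<open>With \<open>u\<close> the phase of the entry, the form at
  \<open>axis i 1 + u *s axis j 1\<close> is twice the modulus of the entry plus nonnegative
  diagonal terms, and this vector has norm at most 2.\<close>

lemma hermitian_entry_bound:
  fixes M :: "complex^'r::finite^'r"
  assumes herm: "hermitian M" and nonneg: "\<And>v. 0 \<le> qf M v" and up: "\<And>v. qf M v \<le> K * (norm v)\<^sup>2"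
    and K: "0 \<le> K"
  shows "cmod (M $ i $ j) \<le> 2 * K"
proof -
  define u where "u = sgn (M $ i $ j)"
  have u: "Re (M $ i $ j * cnj u) = cmod (M $ i $ j)"
  proof -
    have "M $ i $ j * cnj (sgn (M $ i $ j)) = of_real (cmod (M $ i $ j))"
    proof (cases "M $ i $ j = 0")
      case False
      have "M $ i $ j * cnj (sgn (M $ i $ j)) = (M $ i $ j * cnj (M $ i $ j)) / of_real (cmod (M $ i $ j))"
        by (simp add: sgn_eq)
      also have "\<dots> = of_real ((cmod (M $ i $ j))\<^sup>2) / of_real (cmod (M $ i $ j))"
        by (simp only: complex_norm_square)
      finally show ?thesis using False by (simp add: power2_eq_square)
    qed simp
    then show ?thesis by (simp add: u_def)
  qed
  have u1: "cmod u \<le> 1" by (simp add: u_def norm_sgn)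
  have Mji: "M $ j $ i = cnj (M $ i $ j)" using herm unfolding hermitian_def by blast
  have e: "Re (M $ i $ i) = qf M (axis i 1)" for i by (simp add: qf_def)
  have "qf M (axis i 1 + u *s axis j 1) = Re (M $ i $ i) + Re (M $ i $ j * cnj u) + Re (u * M $ j $ i) + Re (u * cnj u * M $ j $ j)"
    unfolding qf_def sesq_add_left sesq_add_right sesq_scale_left sesq_scale_right sesq_axis by (simp add: algebra_simps)
  also have "Re (u * M $ j $ i) = Re (M $ i $ j * cnj u)" unfolding Mji by simp
  also have "Re (u * cnj u * M $ j $ j) = (cmod u)\<^sup>2 * Re (M $ j $ j)"
    unfolding complex_norm_square[symmetric] by simp
  finally have exp: "qf M (axis i 1 + u *s axis j 1) =
      Re (M $ i $ i) + Re (M $ i $ j * cnj u) + Re (M $ i $ j * cnj u) + (cmod u)\<^sup>2 * Re (M $ j $ j)" .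
  have "0 \<le> Re (M $ i $ i)" "0 \<le> (cmod u)\<^sup>2 * Re (M $ j $ j)" unfolding e using nonneg by auto
  then have "2 * cmod (M $ i $ j) \<le> qf M (axis i 1 + u *s axis j 1)"
    unfolding exp u by linarith
  also have "\<dots> \<le> K * (norm (axis i 1 + u *s axis j 1 :: complex^'r))\<^sup>2" by (rule up)
  also have "\<dots> \<le> K * 2\<^sup>2"
  proof (intro mult_left_mono power_mono)
    have us: "u *s axis j 1 = axis j u"
      by (simp add: Finite_Cartesian_Product.vec_eq_iff axis_def)
    have "norm (axis i 1 + u *s axis j 1 :: complex^'r) \<le> norm (axis i (1::complex) :: complex^'r) + norm (axis j u :: complex^'r)"
      unfolding us by (rule norm_triangle_ineq)
    then show "norm (axis i 1 + u *s axis j 1 :: complex^'r) \<le> 2" using u1 by (simp add: norm_axis)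
  qed (use K in auto)
  finally show ?thesis by simp
qed

lemma nn_integral_circ_rotate:
  fixes F :: "real \<Rightarrow> ennreal"
  assumes F: "F \<in> borel_measurable borel" and per: "\<And>\<theta>. F (\<theta> + 2*pi) = F \<theta>"
  shows "(\<integral>\<^sup>+\<theta>. F (\<theta> + \<phi>) \<partial>circ) = (\<integral>\<^sup>+\<theta>. F \<theta> \<partial>circ)"
proof -
  have pn: "F (\<theta> + 2*pi*real n) = F \<theta>" for \<theta> n
  proof (induction n)
    case (Suc n)
    have "F (\<theta> + 2*pi*real (Suc n)) = F ((\<theta> + 2*pi*real n) + 2*pi)" by (simp add: algebra_simps)
    then show ?case using per Suc by simp
  qed simp
  define k where "k = \<lfloor>\<phi> / (2*pi)\<rfloor>"
  define \<psi> where "\<psi> = \<phi> - 2*pi * of_int k"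
  have "of_int k \<le> \<phi> / (2*pi)" "\<phi> / (2*pi) < of_int k + 1" unfolding k_def by linarith+
  then have \<psi>: "\<psi> \<in> {0..2*pi}" unfolding \<psi>_def by (auto simp: field_simps)
  have "F (\<theta> + \<phi>) = F (\<theta> + \<psi>)" for \<theta>
  proof (cases "k \<ge> 0")
    case True
    then have "\<theta> + \<phi> = (\<theta> + \<psi>) + 2*pi*real (nat k)" by (simp add: \<psi>_def)
    then show ?thesis using pn by metis
  next
    case False
    then have "\<theta> + \<psi> = (\<theta> + \<phi>) + 2*pi*real (nat (-k))" by (simp add: \<psi>_def)
    then show ?thesis using pn by metis
  qed
  then show ?thesis using nn_integral_circ_shift[OF F per \<psi>] by simp
qed

lemma liminf_ge_of_eps:
  fixes A :: real
  assumes "\<And>\<epsilon>. \<epsilon> > 0 \<Longrightarrow> eventually (\<lambda>d. A - \<epsilon> \<le> f d) sequentially"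
  shows "ennreal A \<le> liminf (\<lambda>d. ennreal (f d))"
proof -
  have "ennreal (A - inverse (real (Suc n))) \<le> liminf (\<lambda>d. ennreal (f d))" for n
    by (rule Liminf_bounded, rule eventually_mono[OF assms[of "inverse (real (Suc n))"]]) (auto intro: ennreal_leI)
  moreover have "(\<lambda>n. ennreal (A - inverse (real (Suc n)))) \<longlonglongrightarrow> ennreal A"
    using tendsto_diff[OF tendsto_const LIMSEQ_inverse_real_of_nat, of A] by (intro tendsto_ennrealI) simp
  ultimately show ?thesis by (intro LIMSEQ_le_const2) auto
qed

text \<open>The convolutions \<open>H d\<close> are trigonometric polynomials, so
  \<open>log_det_submean_trig\<close> applies to them. Semicontinuity gives only an upper estimate
  of the forms of \<open>H d\<close> by those of \<open>M\<close> in the limit. Through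
  \<open>det_ratio_le\<close> this becomes an upper estimate of determinants, that is, a lower
  estimate of \<open>b - ln\<close>, which is the direction of Fatou's lemma.\<close>

theorem log_det_submean:
  fixes M :: "real \<Rightarrow> complex^'r::finite^'r"
  assumes meas: "\<And>i j. (\<lambda>\<theta>. M \<theta> $ i $ j) \<in> borel_measurable borel"
    and per: "periodic M" and herm: "\<And>\<theta>. hermitian (M \<theta>)"
    and c: "c > 0" and low: "\<And>\<theta> v. c * (norm v)\<^sup>2 \<le> qf (M \<theta>) v"
    and up: "\<And>\<theta> v. qf (M \<theta>) v \<le> K * (norm v)\<^sup>2"
    and usc: "\<And>v \<theta> \<epsilon>. \<epsilon> > 0 \<Longrightarrow> \<exists>\<delta>>0. \<forall>t. \<bar>t\<bar> < \<delta> \<longrightarrow> qf (M (\<theta> + t)) v \<le> qf (M \<theta>) v + \<epsilon>"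
    and M0: "hermitian M0" "\<And>v. v \<noteq> 0 \<Longrightarrow> qf M0 v > 0"
    and sub: "submean_polys M M0"
    and b: "real CARD('r) * ln K \<le> b"
  shows "(\<integral>\<^sup>+\<theta>. ennreal (b - ln (Re (det (M \<theta>)))) \<partial>circ) \<le> ennreal (2 * pi * (b - ln (Re (det M0))))"
proof -
  have K: "K > 0"
  proof -
    have "c \<le> K" using low[of "axis (undefined::'r) 1" 0] up[of 0 "axis (undefined::'r) 1"] by (simp add: norm_axis)
    then show ?thesis using c by simp
  qed
  have nonneg: "0 \<le> qf (M \<theta>) v" for \<theta> v using low[of v \<theta>] c by (smt (verit) mult_nonneg_nonneg zero_le_power2)
  have entry: "cmod (M \<theta> $ i $ j) \<le> 2 * K" for \<theta> i j
    by (rule hermitian_entry_bound[OF herm nonneg up]) (use K in simp)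
  have Mper: "M (\<theta> + 2*pi) = M \<theta>" for \<theta> using per by (simp add: periodic_def)
  have qmeas [measurable]: "(\<lambda>\<theta>. qf (M \<theta>) v) \<in> borel_measurable borel" for v
    by (rule borel_measurable_qf[OF meas]) simp
  \<comment> \<open>Convolution in the angle, normalized to total mass 1. Being an average of
    rotations of \<open>M\<close>, it inherits the bounds \<open>c\<close> and
    \<open>K\<close>.\<close>
  define H where "H d \<theta> = (\<chi> i j. (LINT s|circ. complex_of_real (ckernel d (s - \<theta>)) * M s $ i $ j) / complex_of_real (cmass d))" for d \<theta>
  have kb: "0 \<le> ckernel d t \<and> ckernel d t \<le> 2 ^ d" for d t
  proof
    show "0 \<le> ckernel d t" by (rule ckernel_nonneg)
    have "0 \<le> 1 + cos t" "1 + cos t \<le> 2" using cos_ge_minus_one[of t] cos_le_one[of t] by linarith+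
    then show "ckernel d t \<le> 2 ^ d" unfolding ckernel_def by (intro power_mono)
  qed
  have int_entry: "integrable circ (\<lambda>s. complex_of_real (ckernel d (s - \<theta>)) * M s $ i $ j)" for d \<theta> i j
  proof (rule integrable_circ[where B = "2 ^ d * (2 * K)"])
    have [measurable]: "(\<lambda>s. M s $ i $ j) \<in> borel_measurable borel" by (rule meas)
    show "(\<lambda>s. complex_of_real (ckernel d (s - \<theta>)) * M s $ i $ j) \<in> borel_measurable borel" by measurable
    show "norm (complex_of_real (ckernel d (s - \<theta>)) * M s $ i $ j) \<le> 2 ^ d * (2 * K)" for s
      unfolding norm_mult using kb[of d "s - \<theta>"] entry[of s i j] by (intro mult_mono) auto
  qed
  have sesqH: "sesq (H d \<theta>) v w = (LINT s|circ. complex_of_real (ckernel d (s - \<theta>)) * sesq (M s) v w) / complex_of_real (cmass d)" for d \<theta> v w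
  proof -
    have "(LINT s|circ. complex_of_real (ckernel d (s - \<theta>)) * sesq (M s) v w) =
      (LINT s|circ. (\<Sum>i\<in>UNIV. \<Sum>j\<in>UNIV. (complex_of_real (ckernel d (s - \<theta>)) * M s $ i $ j) * (v $ i * cnj (w $ j))))"
      unfolding sesq_def by (simp add: sum_distrib_left mult_ac)
    also have "\<dots> = (\<Sum>i\<in>UNIV. \<Sum>j\<in>UNIV. (LINT s|circ. (complex_of_real (ckernel d (s - \<theta>)) * M s $ i $ j) * (v $ i * cnj (w $ j))))"
      by (subst Bochner_Integration.integral_sum, intro Bochner_Integration.integrable_sum integrable_mult_left int_entry,
          intro sum.cong refl Bochner_Integration.integral_sum integrable_mult_left int_entry)
    also have "\<dots> = (\<Sum>i\<in>UNIV. \<Sum>j\<in>UNIV. (LINT s|circ. (complex_of_real (ckernel d (s - \<theta>)) * M s $ i $ j)) * (v $ i * cnj (w $ j)))"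
      by (simp only: integral_mult_left_zero)
    also have "\<dots> / complex_of_real (cmass d) = sesq (H d \<theta>) v w"
      unfolding sesq_def H_def by (simp add: sum_divide_distrib mult_ac)
    finally show ?thesis by simp
  qed
  have int_kq: "integrable circ (\<lambda>t. ckernel d (t + s) * qf (M (t + \<theta>)) v)" for d s \<theta> v
  proof (rule integrable_circ[where B = "2 ^ d * (K * (norm v)\<^sup>2)"])
    have "(\<lambda>t. qf (M (t + \<theta>)) v) \<in> borel_measurable borel"
      by (rule measurable_compose[OF _ qmeas]) measurable
    then show "(\<lambda>t. ckernel d (t + s) * qf (M (t + \<theta>)) v) \<in> borel_measurable borel" by measurable
    show "norm (ckernel d (t + s) * qf (M (t + \<theta>)) v) \<le> 2 ^ d * (K * (norm v)\<^sup>2)" for t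
      unfolding norm_mult using kb[of d "t + s"] nonneg up by (intro mult_mono) auto
  qed
  have qfH: "qf (H d \<theta>) v = (LINT t|circ. ckernel d t * qf (M (t + \<theta>)) v) / cmass d" for d \<theta> v
  proof -
    have i1: "integrable circ (\<lambda>s. ckernel d (s - \<theta>) * qf (M s) v)" using int_kq[of d "-\<theta>" 0 v] by simp
    have i2: "integrable circ (\<lambda>s. ckernel d s * qf (M (s + \<theta>)) v)" using int_kq[of d 0 \<theta> v] by simp
    have p: "0 \<le> ckernel d s * qf (M s') v" for s s' using nonneg ckernel_nonneg by (intro mult_nonneg_nonneg)
    have "sesq (H d \<theta>) v v = of_real ((LINT s|circ. ckernel d (s - \<theta>) * qf (M s) v) / cmass d)"
      unfolding sesqH hermitian_sesq_real[OF herm] by (simp flip: of_real_mult)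
    then have 1: "qf (H d \<theta>) v = (LINT s|circ. ckernel d (s - \<theta>) * qf (M s) v) / cmass d"
      unfolding qf_def[of "H d \<theta>"] by simp
    have "ennreal (LINT s|circ. ckernel d (s - \<theta>) * qf (M s) v) = (\<integral>\<^sup>+s. ennreal (ckernel d (s - \<theta>) * qf (M s) v) \<partial>circ)"
      by (rule nn_integral_eq_integral[OF i1, symmetric]) (simp add: p)
    also have "\<dots> = (\<integral>\<^sup>+s. ennreal (ckernel d (s + \<theta> - \<theta>) * qf (M (s + \<theta>)) v) \<partial>circ)"
    proof (rule nn_integral_circ_rotate[symmetric, where F = "\<lambda>s. ennreal (ckernel d (s - \<theta>) * qf (M s) v)"])
      show "(\<lambda>s. ennreal (ckernel d (s - \<theta>) * qf (M s) v)) \<in> borel_measurable borel" by measurable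
      show "ennreal (ckernel d (s + 2*pi - \<theta>) * qf (M (s + 2*pi)) v) = ennreal (ckernel d (s - \<theta>) * qf (M s) v)" for s
        using ckernel_periodic[of d "s - \<theta>"] Mper[of s] by (simp add: algebra_simps)
    qed
    also have "\<dots> = ennreal (LINT s|circ. ckernel d s * qf (M (s + \<theta>)) v)"
      using nn_integral_eq_integral[OF i2] by (simp add: p)
    finally show ?thesis
      unfolding 1 by (subst (asm) ennreal_inj) (auto intro!: integral_nonneg_AE AE_I2 p)
  qed
  have int0: "integrable circ (\<lambda>t. ckernel d t * qf (M (t + \<theta>)) v)" for d \<theta> v using int_kq[of d 0 \<theta> v] by simp
  have lowH: "c * (norm v)\<^sup>2 \<le> qf (H d \<theta>) v" for d \<theta> v
  proof -
    have "cmass d * (c * (norm v)\<^sup>2) = (LINT t|circ. ckernel d t * (c * (norm v)\<^sup>2))" by (simp add: cmass_def)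
    also have "\<dots> \<le> (LINT t|circ. ckernel d t * qf (M (t + \<theta>)) v)"
      by (rule integral_mono) (auto intro!: int0 integrable_ckernel mult_left_mono low ckernel_nonneg)
    finally show ?thesis unfolding qfH using cmass_pos[of d] by (simp add: pos_le_divide_eq mult.commute)
  qed
  have upH: "qf (H d \<theta>) v \<le> K * (norm v)\<^sup>2" for d \<theta> v
  proof -
    have "(LINT t|circ. ckernel d t * qf (M (t + \<theta>)) v) \<le> (LINT t|circ. ckernel d t * (K * (norm v)\<^sup>2))"
      by (rule integral_mono) (auto intro!: int0 integrable_ckernel mult_left_mono up ckernel_nonneg)
    also have "\<dots> = cmass d * (K * (norm v)\<^sup>2)" by (simp add: cmass_def)
    finally show ?thesis unfolding qfH using cmass_pos[of d] by (simp add: pos_divide_le_eq mult.commute)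
  qed
  have posH: "qf (H d \<theta>) v > 0" if "v \<noteq> 0" for d \<theta> v
  proof -
    have "0 < c * (norm v)\<^sup>2" using c that by simp
    then show ?thesis using lowH[of v d \<theta>] by linarith
  qed
  have hermH: "hermitian (H d \<theta>)" for d \<theta>
    unfolding hermitian_def
  proof (intro allI)
    fix i j
    have ij: "M s $ j $ i = cnj (M s $ i $ j)" for s using herm[of s] unfolding hermitian_def by blast
    have "(LINT s|circ. complex_of_real (ckernel d (s - \<theta>)) * M s $ j $ i) =
        (LINT s|circ. cnj (complex_of_real (ckernel d (s - \<theta>)) * M s $ i $ j))"
      unfolding ij by simp
    also have "\<dots> = cnj (LINT s|circ. complex_of_real (ckernel d (s - \<theta>)) * M s $ i $ j)"
      by (rule integral_bounded_linear[OF bounded_linear_cnj int_entry])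
    finally show "H d \<theta> $ j $ i = cnj (H d \<theta> $ i $ j)" unfolding H_def by simp
  qed
  have trigH: "trig_poly d (\<lambda>\<theta>. H d \<theta> $ i $ j)" for d i j
  proof -
    have [measurable]: "(\<lambda>s. M s $ i $ j) \<in> borel_measurable borel" by (rule meas)
    have [measurable]: "(\<lambda>s. cis (of_int l * s)) \<in> borel_measurable borel" for l
      by (rule borel_measurable_continuous_onI) (auto intro!: continuous_intros continuous_on_cis)
    have "trig_poly d (\<lambda>\<theta>. LINT s|circ. of_real (ckernel d (s - \<theta>)) * M s $ i $ j)"
    proof (rule trig_poly_convolution[OF trig_poly_ckernel])
      show "integrable circ (\<lambda>s. M s $ i $ j)" by (rule integrable_circ[OF meas]) (rule entry)
      show "integrable circ (\<lambda>s. cis (of_int l * s) * M s $ i $ j)" for l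
        by (rule integrable_circ[where B = "2 * K"]) (use entry in \<open>auto simp: norm_mult\<close>)
    qed
    from trig_poly_cmult[OF this, of "1 / complex_of_real (cmass d)"] show ?thesis
      unfolding H_def by simp
  qed
  \<comment> \<open>Every rotation of \<open>M\<close> satisfies the inequality with the same center
    matrix \<open>M0\<close>. The weighted average of these inequalities has total weight 1 on the
    left, and Fubini identifies the right-hand side with the integral for
    \<open>H d\<close>.\<close>
  have subH: "submean_polys (H d) M0" for d
    unfolding submean_polys_def
  proof (intro allI)
    fix m and a :: "nat \<Rightarrow> complex^'r"
    define u where "u \<theta> = (\<Sum>k\<le>m. cis (real k * \<theta>) *s a k)" for \<theta>
    define C where "C = ennreal (2 * pi * qf M0 (a 0))"
    define W where "W \<theta> t = ennreal (ckernel d t / cmass d) * ennreal (qf (M (\<theta> + t)) (u \<theta>))" for \<theta> t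
    have sf: "sigma_finite_measure circ" using finite_measure_circ by (simp add: finite_measure_def)
    interpret pair_sigma_finite circ circ by (simp add: pair_sigma_finite_def sf)
    have [measurable]: "(\<lambda>s. s) \<in> borel_measurable circ" by (rule borel_measurable_circ) simp
    have ucomp: "(\<lambda>x. u (fst x) $ i) \<in> borel_measurable (circ \<Otimes>\<^sub>M circ)" for i
    proof -
      have "(\<lambda>\<theta>. cis (real k * \<theta>)) \<in> borel_measurable borel" for k
        by (rule borel_measurable_continuous_onI) (auto intro!: continuous_intros continuous_on_cis)
      then have "(\<lambda>\<theta>. u \<theta> $ i) \<in> borel_measurable borel" by (simp add: u_def sum_component)
      then show ?thesis by (rule measurable_compose[rotated]) measurable
    qed
    have Mcomp: "(\<lambda>x. M (fst x + snd x) $ i $ j) \<in> borel_measurable (circ \<Otimes>\<^sub>M circ)" for i j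
      by (rule measurable_compose[OF _ meas[of i j]]) measurable
    have Wm: "(\<lambda>x. W (fst x) (snd x)) \<in> borel_measurable (circ \<Otimes>\<^sub>M circ)"
    proof -
      have "(\<lambda>x. qf (M (fst x + snd x)) (u (fst x))) \<in> borel_measurable (circ \<Otimes>\<^sub>M circ)"
        by (rule borel_measurable_qf[OF Mcomp ucomp])
      moreover have "(\<lambda>x. ckernel d (snd x)) \<in> borel_measurable (circ \<Otimes>\<^sub>M circ)"
        by (rule measurable_compose[OF _ ckernel_meas]) measurable
      ultimately show ?thesis unfolding W_def by measurable
    qed
    have mass1: "(\<integral>\<^sup>+t. ennreal (ckernel d t / cmass d) \<partial>circ) = 1"
    proof -
      have "(\<integral>\<^sup>+t. ennreal (ckernel d t / cmass d) \<partial>circ) = ennreal (LINT t|circ. ckernel d t / cmass d)"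
        by (rule nn_integral_eq_integral)
           (use integrable_ckernel cmass_pos[of d] in \<open>auto simp: ckernel_nonneg divide_nonneg_pos\<close>)
      also have "(LINT t|circ. ckernel d t / cmass d) = 1"
        using cmass_pos[of d] by (simp add: cmass_def[symmetric])
      finally show ?thesis by simp
    qed
    have "C = (\<integral>\<^sup>+t. ennreal (ckernel d t / cmass d) * C \<partial>circ)"
      using mass1 by (subst nn_integral_multc) (auto intro!: borel_measurable_circ)
    also have "\<dots> \<le> (\<integral>\<^sup>+t. (\<integral>\<^sup>+\<theta>. W \<theta> t \<partial>circ) \<partial>circ)"
    proof (rule nn_integral_mono)
      fix t assume "t \<in> space circ"
      then have "submean_polys (\<lambda>\<theta>. M (\<theta> + t)) M0"
        by (intro submean_polys_rotate[OF sub meas per]) simp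
      then have "C \<le> (\<integral>\<^sup>+\<theta>. ennreal (qf (M (\<theta> + t)) (u \<theta>)) \<partial>circ)"
        unfolding submean_polys_def C_def u_def by blast
      then have "ennreal (ckernel d t / cmass d) * C \<le> ennreal (ckernel d t / cmass d) * (\<integral>\<^sup>+\<theta>. ennreal (qf (M (\<theta> + t)) (u \<theta>)) \<partial>circ)"
        by (rule mult_left_mono) simp
      also have "\<dots> = (\<integral>\<^sup>+\<theta>. W \<theta> t \<partial>circ)"
        unfolding W_def
      proof (rule nn_integral_cmult[symmetric])
        have m1: "(\<lambda>\<theta>. M (\<theta> + t) $ i $ j) \<in> borel_measurable circ" for i j
          by (rule measurable_compose[OF _ meas[of i j]]) measurable
        have m2: "(\<lambda>\<theta>. u \<theta> $ i) \<in> borel_measurable circ" for i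
        proof -
          have "(\<lambda>\<theta>. cis (real k * \<theta>)) \<in> borel_measurable borel" for k
            by (rule borel_measurable_continuous_onI) (auto intro!: continuous_intros continuous_on_cis)
          then have "(\<lambda>\<theta>. u \<theta> $ i) \<in> borel_measurable borel" by (simp add: u_def sum_component)
          then show ?thesis by (rule borel_measurable_circ)
        qed
        have "(\<lambda>\<theta>. qf (M (\<theta> + t)) (u \<theta>)) \<in> borel_measurable circ"
          by (rule borel_measurable_qf) (rule m1, rule m2)
        then show "(\<lambda>\<theta>. ennreal (qf (M (\<theta> + t)) (u \<theta>))) \<in> borel_measurable circ"
          by (rule measurable_compose[OF _ measurable_ennreal])
      qed
      finally show "ennreal (ckernel d t / cmass d) * C \<le> (\<integral>\<^sup>+\<theta>. W \<theta> t \<partial>circ)" .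
    qed
    also have "\<dots> = (\<integral>\<^sup>+\<theta>. (\<integral>\<^sup>+t. W \<theta> t \<partial>circ) \<partial>circ)"
      using Fubini'[of W] Wm by (simp add: case_prod_beta')
    also have "\<dots> = (\<integral>\<^sup>+\<theta>. ennreal (qf (H d \<theta>) (u \<theta>)) \<partial>circ)"
    proof (rule nn_integral_cong)
      fix \<theta>
      have "(\<integral>\<^sup>+t. W \<theta> t \<partial>circ) = (\<integral>\<^sup>+t. ennreal (ckernel d t * qf (M (t + \<theta>)) (u \<theta>) / cmass d) \<partial>circ)"
        unfolding W_def using nonneg ckernel_nonneg cmass_pos[of d]
        by (intro nn_integral_cong) (simp add: ennreal_mult'[symmetric] add.commute)
      also have "\<dots> = ennreal (LINT t|circ. ckernel d t * qf (M (t + \<theta>)) (u \<theta>) / cmass d)"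
        by (rule nn_integral_eq_integral)
           (use int0 nonneg ckernel_nonneg cmass_pos[of d] in \<open>auto intro!: divide_nonneg_pos mult_nonneg_nonneg\<close>)
      also have "\<dots> = ennreal (qf (H d \<theta>) (u \<theta>))" unfolding qfH by simp
      finally show "(\<integral>\<^sup>+t. W \<theta> t \<partial>circ) = ennreal (qf (H d \<theta>) (u \<theta>))" .
    qed
    finally show "ennreal (2 * pi * qf M0 (a 0)) \<le>
        (\<integral>\<^sup>+\<theta>. ennreal (qf (H d \<theta>) (\<Sum>k\<le>m. cis (real k * \<theta>) *s a k)) \<partial>circ)"
      unfolding C_def u_def .
  qed
  \<comment> \<open>Semicontinuity controls the part of the average near the angle 0; on the rest,
    the bound \<open>K\<close> is multiplied by a mass that tends to 0 by
    \<open>ckernel_tail\<close>.\<close>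
  have limH: "eventually (\<lambda>d. qf (H d \<theta>) v \<le> qf (M \<theta>) v + \<epsilon>) sequentially" if \<epsilon>: "\<epsilon> > 0" for \<theta> v \<epsilon>
  proof -
    obtain \<delta>' where d': "\<delta>' > 0" "\<And>t. \<bar>t\<bar> < \<delta>' \<Longrightarrow> qf (M (\<theta> + t)) v \<le> qf (M \<theta>) v + \<epsilon>/2"
      using usc[of "\<epsilon>/2" \<theta> v] \<epsilon> by auto
    define \<delta> where "\<delta> = min \<delta>' pi"
    have \<delta>: "0 < \<delta>" "\<delta> \<le> pi" "\<delta> \<le> \<delta>'" using d' by (auto simp: \<delta>_def)
    define \<eta> where "\<eta> d = (LINT t|circ. ckernel d t * indicator {\<delta>..2*pi-\<delta>} t) / cmass d" for d
    have bound: "qf (H d \<theta>) v \<le> qf (M \<theta>) v + \<epsilon>/2 + K * (norm v)\<^sup>2 * \<eta> d" for d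
    proof -
      have ii: "integrable circ (\<lambda>t. ckernel d t * indicator {\<delta>..2*pi-\<delta>} t)"
      proof (rule integrable_circ[where B = "2^d"])
        show "norm (ckernel d t * indicator {\<delta>..2*pi-\<delta>} t) \<le> 2 ^ d" for t
          using kb[of d t] by (auto simp: indicator_def)
      qed measurable
      have "(LINT t|circ. ckernel d t * qf (M (t + \<theta>)) v) \<le>
        (LINT t|circ. ckernel d t * (qf (M \<theta>) v + \<epsilon>/2) + (ckernel d t * indicator {\<delta>..2*pi-\<delta>} t) * (K * (norm v)\<^sup>2))"
      proof (rule integral_mono)
        show "integrable circ (\<lambda>t. ckernel d t * (qf (M \<theta>) v + \<epsilon>/2) + (ckernel d t * indicator {\<delta>..2*pi-\<delta>} t) * (K * (norm v)\<^sup>2))"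
          using ii integrable_ckernel by auto
        fix t assume t: "t \<in> space circ"
        show "ckernel d t * qf (M (t + \<theta>)) v \<le> ckernel d t * (qf (M \<theta>) v + \<epsilon>/2) + (ckernel d t * indicator {\<delta>..2*pi-\<delta>} t) * (K * (norm v)\<^sup>2)"
        proof (cases "t \<in> {\<delta>..2*pi-\<delta>}")
          case True
          have "ckernel d t * qf (M (t + \<theta>)) v \<le> ckernel d t * (K * (norm v)\<^sup>2)"
            using up ckernel_nonneg by (rule mult_left_mono)
          moreover have "0 \<le> ckernel d t * (qf (M \<theta>) v + \<epsilon>/2)"
            using nonneg ckernel_nonneg \<epsilon> by (intro mult_nonneg_nonneg add_nonneg_nonneg) auto
          ultimately show ?thesis using True by simp
        next
          case False
          have "qf (M (t + \<theta>)) v \<le> qf (M \<theta>) v + \<epsilon>/2"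
          proof (cases "t < \<delta>")
            case True
            then show ?thesis using d'(2)[of t] t \<delta> by (simp add: add.commute)
          next
            case f: False
            \<comment> \<open>Angles just below \<open>2*pi\<close> are also close to 0 on the
              circle; periodicity moves them there.\<close>
            have "M (t + \<theta>) = M (\<theta> + (t - 2*pi))" using Mper[of "\<theta> + (t - 2*pi)"] by (simp add: algebra_simps)
            moreover have "\<bar>t - 2*pi\<bar> < \<delta>'" using f False t \<delta> by auto
            ultimately show ?thesis using d'(2)[of "t - 2*pi"] by simp
          qed
          then have "ckernel d t * qf (M (t + \<theta>)) v \<le> ckernel d t * (qf (M \<theta>) v + \<epsilon>/2)"
            using ckernel_nonneg by (rule mult_left_mono)
          then show ?thesis using False by simp
        qed
      qed (rule int0)
      also have "\<dots> = cmass d * (qf (M \<theta>) v + \<epsilon>/2) + (LINT t|circ. ckernel d t * indicator {\<delta>..2*pi-\<delta>} t) * (K * (norm v)\<^sup>2)"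
        using ii integrable_ckernel by (subst Bochner_Integration.integral_add) (auto simp: cmass_def)
      finally have "(LINT t|circ. ckernel d t * qf (M (t + \<theta>)) v) / cmass d \<le>
         (cmass d * (qf (M \<theta>) v + \<epsilon>/2) + (LINT t|circ. ckernel d t * indicator {\<delta>..2*pi-\<delta>} t) * (K * (norm v)\<^sup>2)) / cmass d"
        by (rule divide_right_mono) (use cmass_pos[of d] in simp)
      also have "\<dots> = qf (M \<theta>) v + \<epsilon>/2 + K * (norm v)\<^sup>2 * \<eta> d"
        using cmass_pos[of d] by (simp add: \<eta>_def add_divide_distrib mult_ac)
      finally show ?thesis unfolding qfH .
    qed
    have "\<eta> \<longlonglongrightarrow> 0" unfolding \<eta>_def by (rule ckernel_tail[OF \<delta>(1,2)])
    then have "(\<lambda>d. K * (norm v)\<^sup>2 * \<eta> d) \<longlonglongrightarrow> 0" by (rule tendsto_mult_right_zero)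
    then have "eventually (\<lambda>d. K * (norm v)\<^sup>2 * \<eta> d < \<epsilon>/2) sequentially"
      by (rule order_tendstoD) (use \<epsilon> in simp)
    then show ?thesis
    proof eventually_elim
      case (elim d)
      then show ?case using bound[of d] by linarith
    qed
  qed
  have posM: "qf (M \<theta>) v > 0" if "v \<noteq> 0" for \<theta> v
  proof -
    have "0 < c * (norm v)\<^sup>2" using c that by simp
    then show ?thesis using low[of v \<theta>] by linarith
  qed
  have dM: "Re (det (M \<theta>)) > 0" for \<theta> by (rule hadamard_det_le(2)[OF herm posM])
  have dH: "Re (det (H d \<theta>)) > 0" for d \<theta> by (rule hadamard_det_le(2)[OF hermH posH])
  have point: "ennreal (b - ln (Re (det (M \<theta>)))) \<le> liminf (\<lambda>d. ennreal (b - ln (Re (det (H d \<theta>)))))" for \<theta>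
  proof (rule liminf_ge_of_eps)
    fix \<epsilon> :: real assume \<epsilon>: "\<epsilon> > 0"
    \<comment> \<open>The frame depends on \<open>\<theta>\<close> but not on \<open>d\<close>, so
      the pointwise limit is applied to finitely many fixed vectors. Each of the \<open>r\<close>
      factors may exceed 1 by \<open>\<epsilon>/r\<close>.\<close>
    obtain p :: "'r \<Rightarrow> complex^'r" where p: "\<And>i j. sesq (M \<theta>) (p i) (p j) = (if i = j then 1 else 0)"
      by (rule ex_orthonormal_frame[OF herm[of \<theta>] posM]) blast+
    define r where "r = real CARD('r)"
    have r: "r > 0" by (simp add: r_def)
    have "eventually (\<lambda>d. \<forall>i. qf (H d \<theta>) (p i) \<le> qf (M \<theta>) (p i) + \<epsilon>/r) sequentially"
      using limH[of "\<epsilon>/r"] \<epsilon> r by (auto simp: eventually_all_finite)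
    then show "eventually (\<lambda>d. b - ln (Re (det (M \<theta>))) - \<epsilon> \<le> b - ln (Re (det (H d \<theta>)))) sequentially"
    proof eventually_elim
      case (elim d)
      have q1: "qf (M \<theta>) (p i) = 1" for i by (simp add: qf_def p)
      have "Re (det (H d \<theta>)) \<le> Re (det (M \<theta>)) * (\<Prod>i\<in>UNIV. qf (H d \<theta>) (p i))"
        by (rule det_ratio_le(1)[OF herm p hermH posH])
      also have "(\<Prod>i\<in>UNIV. qf (H d \<theta>) (p i)) \<le> (\<Prod>i\<in>(UNIV::'r set). 1 + \<epsilon>/r)"
        using elim q1 by (intro prod_mono) (auto intro!: order_trans[OF _ lowH] mult_nonneg_nonneg simp: c less_imp_le)
      finally have "Re (det (H d \<theta>)) \<le> Re (det (M \<theta>)) * (1 + \<epsilon>/r) ^ CARD('r)"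
        using dM[of \<theta>] by simp
      then have "ln (Re (det (H d \<theta>))) \<le> ln (Re (det (M \<theta>)) * (1 + \<epsilon>/r) ^ CARD('r))"
        using dH by (intro ln_mono) (auto intro: order_less_le_trans)
      also have "\<dots> = ln (Re (det (M \<theta>))) + r * ln (1 + \<epsilon>/r)"
      proof -
        have "1 + \<epsilon>/r > 0" using \<epsilon> r by (simp add: add_pos_pos)
        then show ?thesis using dM[of \<theta>] by (simp add: ln_mult ln_realpow r_def)
      qed
      also have "r * ln (1 + \<epsilon>/r) \<le> r * (\<epsilon>/r)"
        using \<epsilon> r by (intro mult_left_mono ln_add_one_self_le_self) auto
      finally show ?case using r by simp
    qed
  qed
  \<comment> \<open>The bound \<open>K\<close> passes to \<open>H d\<close>, so
    \<open>b - ln\<close> is nonnegative and \<open>ennreal\<close> does not truncate it.\<close>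
  have ub: "ln (Re (det (H d \<theta>))) \<le> b" for d \<theta>
  proof -
    have "Re (det (H d \<theta>)) \<le> (\<Prod>i\<in>UNIV. Re (H d \<theta> $ i $ i))" by (rule hadamard_det_le(3)[OF hermH posH])
    also have "\<dots> = (\<Prod>i\<in>UNIV. qf (H d \<theta>) (axis i 1))" by (simp add: qf_def)
    also have "\<dots> \<le> (\<Prod>i\<in>(UNIV::'r set). K)"
    proof (rule prod_mono)
      fix i :: 'r
      have "0 \<le> c * (norm (axis i 1 :: complex^'r))\<^sup>2" using c by simp
      then show "0 \<le> qf (H d \<theta>) (axis i 1) \<and> qf (H d \<theta>) (axis i 1) \<le> K"
        using lowH[of "axis i 1" d \<theta>] upH[of d \<theta> "axis i 1"] by (simp add: norm_axis)
    qed
    finally have "ln (Re (det (H d \<theta>))) \<le> ln (K ^ CARD('r))"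
      using dH by (intro ln_mono) (auto intro: order_less_le_trans)
    also have "\<dots> = real CARD('r) * ln K" using K by (simp add: ln_realpow)
    finally show ?thesis using b by linarith
  qed
  have Lc: "continuous_on UNIV (\<lambda>\<theta>. ln (Re (det (H d \<theta>))))" for d
    using dH by (intro continuous_on_ln continuous_on_Re continuous_on_det trig_poly_continuous[OF trigH])
      (auto simp: less_imp_neq[symmetric])
  have each: "(\<integral>\<^sup>+\<theta>. ennreal (b - ln (Re (det (H d \<theta>)))) \<partial>circ) \<le> ennreal (2 * pi * (b - ln (Re (det M0))))" for d
  proof -
    have ic: "integrable circ (\<lambda>\<theta>. ln (Re (det (H d \<theta>))))" by (rule continuous_integrable_circ[OF Lc])
    have icb: "integrable circ (\<lambda>\<theta>. b)" by (rule continuous_integrable_circ) auto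
    have "(\<integral>\<^sup>+\<theta>. ennreal (b - ln (Re (det (H d \<theta>)))) \<partial>circ) = ennreal (LINT \<theta>|circ. b - ln (Re (det (H d \<theta>))))"
      by (rule nn_integral_eq_integral) (use ic icb ub in auto)
    also have "(LINT \<theta>|circ. b - ln (Re (det (H d \<theta>)))) = 2 * pi * b - (LINT \<theta>|circ. ln (Re (det (H d \<theta>))))"
      using ic icb measure_circ by simp
    also have "ennreal \<dots> \<le> ennreal (2 * pi * (b - ln (Re (det M0))))"
      using log_det_submean_trig[OF trigH hermH c lowH M0 subH, of d]
      by (intro ennreal_leI) (simp add: right_diff_distrib)
    finally show ?thesis .
  qed
  have "(\<integral>\<^sup>+\<theta>. ennreal (b - ln (Re (det (M \<theta>)))) \<partial>circ) \<le> (\<integral>\<^sup>+\<theta>. liminf (\<lambda>d. ennreal (b - ln (Re (det (H d \<theta>))))) \<partial>circ)"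
    by (rule nn_integral_mono) (rule point)
  also have "\<dots> \<le> liminf (\<lambda>d. \<integral>\<^sup>+\<theta>. ennreal (b - ln (Re (det (H d \<theta>)))) \<partial>circ)"
  proof (rule nn_integral_liminf)
    fix d
    have "(\<lambda>\<theta>. ln (Re (det (H d \<theta>)))) \<in> borel_measurable circ"
      by (rule borel_measurable_circ[OF borel_measurable_continuous_onI[OF Lc]])
    then show "(\<lambda>\<theta>. ennreal (b - ln (Re (det (H d \<theta>))))) \<in> borel_measurable circ" by measurable
  qed
  also have "\<dots> \<le> ennreal (2 * pi * (b - ln (Re (det M0))))"
    by (rule order_trans[OF Liminf_le_Limsup Limsup_bounded]) (auto intro!: always_eventually each)
  finally show ?thesis .
qed

section \<open>Square integrability from the submean inequality\<close>

definition disc_mean :: "real \<Rightarrow> (complex \<Rightarrow> real) \<Rightarrow> complex \<Rightarrow> real" where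
  "disc_mean s f a = (LINT w|lborel. indicator (ball 0 s) w * f (a + w)) / (pi * s\<^sup>2)"

text \<open>Superharmonicity as a bare inequality for means, without semicontinuity. The condition
  on \<open>R\<close> places the closed disc in the open ball of radius \<open>R\<close> about
  0.\<close>

definition supermean :: "(complex \<Rightarrow> real) \<Rightarrow> real \<Rightarrow> bool" where
  "supermean f R \<longleftrightarrow> (\<forall>a s. 0 < s \<longrightarrow> cmod a + s < R \<longrightarrow> disc_mean s f a \<le> f a)"

lemma measure_ball_complex: "0 \<le> s \<Longrightarrow> measure lborel (ball (a::complex) s) = pi * s\<^sup>2"
  using content_ball[of s a] by (simp add: unit_ball_vol_2 measure_completion)

lemma emeasure_ball_complex: "0 \<le> s \<Longrightarrow> emeasure lborel (ball (a::complex) s) = ennreal (pi * s\<^sup>2)"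
  using measure_ball_complex[of s a] emeasure_lborel_ball_finite[of a s]
  by (subst emeasure_eq_ennreal_measure) auto

lemma integrable_bounded_support:
  fixes f :: "complex \<Rightarrow> real"
  assumes [measurable]: "f \<in> borel_measurable borel" and b: "\<And>z. \<bar>f z\<bar> \<le> B" and s: "\<And>z. z \<notin> ball a s \<Longrightarrow> f z = 0"
  shows "integrable lborel f"
proof (rule Bochner_Integration.integrable_bound[where f = "\<lambda>z. B * indicator (ball a s) z"])
  show "integrable lborel (\<lambda>z. B * indicator (ball a s) z :: real)"
    using emeasure_lborel_ball_finite[of a s] by (intro integrable_mult_right integrable_real_indicator) auto
  show "AE z in lborel. norm (f z) \<le> norm (B * indicator (ball a s) z :: real)"
    using b s by (intro AE_I2) (auto simp: indicator_def intro: order_trans[OF b abs_ge_self])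
qed simp

lemma lborel_integral_translate:
  fixes f :: "complex \<Rightarrow> real"
  assumes [measurable]: "f \<in> borel_measurable borel"
  shows "(LINT w|lborel. f (a + w)) = (LINT w|lborel. f w)"
proof -
  have "(LINT w|lborel. f w) = (LINT w|distr lborel borel ((+) a). f w)" by (simp add: lborel_distr_plus)
  also have "\<dots> = (LINT w|lborel. f (a + w))" by (rule integral_distr) auto
  finally show ?thesis by simp
qed

lemma lborel_nn_integral_translate:
  fixes f :: "'a::euclidean_space \<Rightarrow> ennreal"
  assumes [measurable]: "f \<in> borel_measurable borel"
  shows "(\<integral>\<^sup>+w. f (a + w) \<partial>lborel) = (\<integral>\<^sup>+w. f w \<partial>lborel)"
proof -
  have "(\<integral>\<^sup>+w. f w \<partial>lborel) = (\<integral>\<^sup>+w. f w \<partial>distr lborel borel ((+) a))" by (simp add: lborel_distr_plus)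
  also have "\<dots> = (\<integral>\<^sup>+w. f (a + w) \<partial>lborel)" by (rule nn_integral_distr) auto
  finally show ?thesis by simp
qed

text \<open>Uniqueness of Haar measure, by integrating 1_A(Tx) 1_B(Tx - y) over x and y for the unit ball B.\<close>

lemma distr_lborel_isometry:
  fixes T :: "'a::euclidean_space \<Rightarrow> 'a"
  assumes lin: "linear T" and iso: "\<And>x. norm (T x) = norm x"
  shows "distr lborel borel T = lborel"
proof (rule measure_eqI)
  have [measurable]: "T \<in> borel_measurable borel"
    by (rule borel_measurable_continuous_onI[OF linear_continuous_on]) (use lin in \<open>simp add: linear_conv_bounded_linear\<close>)
  have inj: "inj T"
    using lin iso by (metis linear_injective_0 norm_eq_zero)
  then have surj: "surj T" using lin linear_injective_imp_surjective by blast
  fix A assume "A \<in> sets (distr lborel borel T)"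
  then have A [measurable]: "A \<in> sets borel" by simp
  define B where "B = ball (0::'a) 1"
  have [measurable]: "B \<in> sets borel" by (simp add: B_def)
  define b where "b = emeasure lborel B"
  have b: "b \<noteq> 0" "b \<noteq> \<infinity>"
  proof -
    show "b \<noteq> \<infinity>" using emeasure_lborel_ball_finite[of "0::'a" 1] by (simp add: b_def B_def)
    have "measure lborel B > 0" unfolding B_def using content_ball_pos[of 1 "0::'a"] by (simp add: measure_completion)
    then show "b \<noteq> 0" unfolding b_def measure_def by auto
  qed
  have Bb: "(\<integral>\<^sup>+y. indicator B (a - y) \<partial>lborel) = b" for a :: 'a
  proof -
    have "(\<integral>\<^sup>+y. indicator B (a - y) \<partial>lborel) = (\<integral>\<^sup>+y. indicator (ball a 1) y \<partial>lborel)"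
      by (rule nn_integral_cong) (simp add: indicator_def B_def dist_norm norm_minus_commute)
    also have "\<dots> = (\<integral>\<^sup>+y. indicator (ball a 1) (a + y) \<partial>lborel)"
      by (rule lborel_nn_integral_translate[symmetric]) (intro borel_measurable_indicator, simp)
    also have "\<dots> = (\<integral>\<^sup>+y. indicator B y \<partial>lborel)"
      by (rule nn_integral_cong) (simp add: indicator_def B_def dist_norm)
    finally show ?thesis by (simp add: b_def)
  qed
  have "emeasure (distr lborel borel T) A * b = (\<integral>\<^sup>+x. indicator A (T x) \<partial>lborel) * b"
    by (subst nn_integral_distr[symmetric, of T lborel borel]) simp_all
  also have "\<dots> = (\<integral>\<^sup>+x. indicator A (T x) * (\<integral>\<^sup>+y. indicator B (T x - y) \<partial>lborel) \<partial>lborel)"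
    unfolding Bb by (rule nn_integral_multc[symmetric]) measurable
  also have "\<dots> = (\<integral>\<^sup>+x. (\<integral>\<^sup>+y. indicator A (T x) * indicator B (T x - y) \<partial>lborel) \<partial>lborel)"
    by (rule nn_integral_cong, rule nn_integral_cmult[symmetric]) measurable
  also have "\<dots> = (\<integral>\<^sup>+y. (\<integral>\<^sup>+x. indicator A (T x) * indicator B (T x - y) \<partial>lborel) \<partial>lborel)"
    by (rule lborel_pair.Fubini'[symmetric]) (simp add: case_prod_beta', measurable)
  also have "\<dots> = (\<integral>\<^sup>+y. (\<integral>\<^sup>+x. indicator A (T x + y) * indicator B (T x) \<partial>lborel) \<partial>lborel)"
  proof (rule nn_integral_cong)
    fix y :: 'a
    obtain z where z: "T z = y" using surj by (metis surjD)
    have "(\<integral>\<^sup>+x. indicator A (T x) * indicator B (T x - y) \<partial>lborel) = (\<integral>\<^sup>+x. indicator A (T (z + x)) * indicator B (T (z + x) - y) \<partial>lborel)"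
      by (rule lborel_nn_integral_translate[symmetric]) measurable
    also have "\<dots> = (\<integral>\<^sup>+x. indicator A (T x + y) * indicator B (T x) \<partial>lborel)"
      using z by (simp add: linear_add[OF lin] add.commute)
    finally show "(\<integral>\<^sup>+x. indicator A (T x) * indicator B (T x - y) \<partial>lborel) = (\<integral>\<^sup>+x. indicator A (T x + y) * (indicator B (T x) :: ennreal) \<partial>lborel)" .
  qed
  also have "\<dots> = (\<integral>\<^sup>+x. (\<integral>\<^sup>+y. indicator A (T x + y) * indicator B (T x) \<partial>lborel) \<partial>lborel)"
    by (rule lborel_pair.Fubini') (simp add: case_prod_beta', measurable)
  also have "\<dots> = (\<integral>\<^sup>+x. emeasure lborel A * indicator B x \<partial>lborel)"
  proof (rule nn_integral_cong)
    fix x :: 'a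
    have "(\<integral>\<^sup>+y. indicator A (T x + y) * indicator B (T x) \<partial>lborel) = (\<integral>\<^sup>+y. indicator A (T x + y) \<partial>lborel) * indicator B (T x)"
      by (rule nn_integral_multc) measurable
    also have "(\<integral>\<^sup>+y. indicator A (T x + y) \<partial>lborel) = (\<integral>\<^sup>+y. indicator A y \<partial>lborel)"
      by (rule lborel_nn_integral_translate) measurable
    finally have "(\<integral>\<^sup>+y. indicator A (T x + y) * indicator B (T x) \<partial>lborel) = emeasure lborel A * (indicator B (T x) :: ennreal)" by simp
    moreover have "indicator B (T x) = (indicator B x :: ennreal)" by (simp add: B_def indicator_def iso)
    ultimately show "(\<integral>\<^sup>+y. indicator A (T x + y) * indicator B (T x) \<partial>lborel) = emeasure lborel A * (indicator B x :: ennreal)" by (simp only:)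
  qed
  also have "\<dots> = emeasure lborel A * b" unfolding b_def by (rule nn_integral_cmult_indicator) simp
  finally show "emeasure (distr lborel borel T) A = emeasure lborel A"
    using b by (simp add: mult.commute[of _ b] ennreal_mult_cancel_left)
qed simp

lemma distr_lborel_uminus: "distr lborel borel (uminus :: 'a \<Rightarrow> 'a::euclidean_space) = lborel"
  by (rule distr_lborel_isometry) (auto intro: linearI)

lemma pred_in_ball [measurable]: "Measurable.pred borel (\<lambda>x. x \<in> ball (a::complex) s)"
  by (simp add: pred_def)

text \<open>The bound \<open>K\<close> secures integrability and must not enter the final estimates:
  \<open>supermean_square_integral\<close> is applied to a family of functions that are bounded
  individually but not uniformly.\<close>

locale bdd_fun =
  fixes f :: "complex \<Rightarrow> real" and K :: real
  assumes meas [measurable]: "f \<in> borel_measurable borel" and nonneg: "\<And>z. 0 \<le> f z" and le: "\<And>z. f z \<le> K"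
begin

lemma K_nonneg: "0 \<le> K" using nonneg[of 0] le[of 0] by linarith

lemma integrable_ball: "integrable lborel (\<lambda>w. indicator (ball c s) w * f (a + w))"
  by (rule integrable_bounded_support[where B = K and a = c and s = s])
     (use nonneg le K_nonneg in \<open>auto simp: indicator_def\<close>)

lemma integrable_ball': "integrable lborel (\<lambda>w. indicator (ball c s) w * f w)"
  using integrable_ball[of c s 0] by simp

lemma disc_mean_alt: "disc_mean s f a = (LINT w|lborel. indicator (ball a s) w * f w) / (pi * s\<^sup>2)"
proof -
  have "(LINT w|lborel. indicator (ball a s) w * f w) = (LINT w|lborel. indicator (ball a s) (a + w) * f (a + w))"
    by (rule lborel_integral_translate[symmetric]) measurable
  also have "\<dots> = (LINT w|lborel. indicator (ball 0 s) w * f (a + w))"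
    by (rule Bochner_Integration.integral_cong) (auto simp: indicator_def dist_norm)
  finally show ?thesis by (simp add: disc_mean_def)
qed

lemma disc_mean_nonneg: "0 \<le> disc_mean s f a"
  unfolding disc_mean_def by (intro divide_nonneg_nonneg integral_nonneg_AE AE_I2 mult_nonneg_nonneg nonneg) auto

lemma disc_mean_le: "s > 0 \<Longrightarrow> disc_mean s f a \<le> K"
proof -
  assume s: "s > 0"
  have "(LINT w|lborel. indicator (ball 0 s) w * f (a + w)) \<le> (LINT w|lborel. indicator (ball (0::complex) s) w * K)"
    using emeasure_lborel_ball_finite[of "0::complex" s]
    by (intro integral_mono integrable_ball integrable_mult_left integrable_real_indicator mult_left_mono le) auto
  also have "\<dots> = pi * s\<^sup>2 * K" using s measure_ball_complex[of s 0] by simp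
  finally show ?thesis unfolding disc_mean_def using s by (simp add: pos_divide_le_eq mult_ac)
qed

lemma nn_disc_mean:
  assumes "s > 0"
  shows "ennreal (disc_mean s f a * (pi * s\<^sup>2)) = (\<integral>\<^sup>+w. ennreal (indicator (ball 0 s) w * f (a + w)) \<partial>lborel)"
proof -
  have "(\<integral>\<^sup>+w. ennreal (indicator (ball 0 s) w * f (a + w)) \<partial>lborel) = ennreal (LINT w|lborel. indicator (ball 0 s) w * f (a + w))"
    by (rule nn_integral_eq_integral[OF integrable_ball]) (auto intro!: AE_I2 mult_nonneg_nonneg nonneg)
  then show ?thesis using assms by (simp add: disc_mean_def)
qed

lemma disc_mean_meas: "disc_mean s f \<in> borel_measurable borel"
proof -
  have "(\<lambda>a. LINT w|lborel. indicator (ball 0 s) w * f (a + w)) \<in> borel_measurable borel"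
    by (rule sigma_finite_measure.borel_measurable_lebesgue_integral[OF sigma_finite_lborel]) (simp add: case_prod_beta', measurable)
  then show ?thesis unfolding disc_mean_def[abs_def] by simp
qed

lemma bdd_fun_disc_mean: "s > 0 \<Longrightarrow> bdd_fun (disc_mean s f) K"
  by unfold_locales (auto intro: disc_mean_meas disc_mean_nonneg disc_mean_le)

text \<open>For \<open>z\<close> in \<open>ball a s\<close>, the disc of radius
  \<open>3/2 * s\<close> about \<open>z\<close> contains \<open>ball a (s/2)\<close>, so
  \<open>f z\<close> is at least \<open>I / (pi * (3/2 * s)^2)\<close>. Integrated over the annulus
  \<open>D\<close>, which has 3/4 of the area of the disc, this gives \<open>I / 3\<close>. Hence
  the inner disc carries at most 3/4 of the integral, and the area ratio 4 turns this into the
  factor 3. The radius \<open>5/2 * s\<close> is the sum of \<open>s\<close> and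
  \<open>3/2 * s\<close>.\<close>

lemma disc_mean_growth:
  assumes sm: "supermean f R" and s: "s > 0" and R: "cmod a + 5/2 * s < R"
  shows "disc_mean (s/2) f a \<le> 3 * disc_mean s f a"
proof -
  define I where "I = (LINT w|lborel. indicator (ball a (s/2)) w * f w)"
  define D where "D = ball a s - ball a (s/2)"
  have sub: "ball a (s/2) \<subseteq> ball a s" using s by (intro subset_ball) simp
  have mD: "measure lborel D = pi * s\<^sup>2 * (3/4)"
  proof -
    have "measure lborel D = measure lborel (ball a s) - measure lborel (ball a (s/2))"
      unfolding D_def using sub emeasure_lborel_ball_finite[of a s] by (intro measure_Diff) auto
    then show ?thesis using s by (simp add: measure_ball_complex power_divide field_simps)
  qed
  have fD: "emeasure lborel D < \<infinity>"
    using emeasure_mono[of D "ball a s" lborel] emeasure_lborel_ball_finite[of a s] unfolding D_def by (auto simp: less_top[symmetric] top_unique)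
  have low: "I / (pi * (3/2 * s)\<^sup>2) \<le> f z" if z: "z \<in> ball a s" for z
  proof -
    have "I \<le> (LINT w|lborel. indicator (ball z (3/2 * s)) w * f w)"
      unfolding I_def
    proof (rule integral_mono[OF integrable_ball' integrable_ball'])
      fix w
      have "w \<in> ball z (3/2 * s)" if "w \<in> ball a (s/2)"
        using that z dist_triangle[of z w a] by (auto simp: dist_commute)
      then show "indicator (ball a (s/2)) w * f w \<le> indicator (ball z (3/2 * s)) w * f w"
        using nonneg[of w] by (auto simp: indicator_def)
    qed
    then have "I / (pi * (3/2 * s)\<^sup>2) \<le> disc_mean (3/2 * s) f z"
      unfolding disc_mean_alt by (rule divide_right_mono) simp
    also have "\<dots> \<le> f z"
    proof -
      have "cmod z \<le> cmod a + dist a z" using norm_triangle_sub[of z a] by (simp add: dist_norm norm_minus_commute)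
      then have "cmod z + 3/2 * s < R" using z R by simp
      then show ?thesis using sm s unfolding supermean_def by simp
    qed
    finally show ?thesis .
  qed
  have iD: "integrable lborel (\<lambda>w. indicator D w * f w)"
    by (rule integrable_bounded_support[where B = K and a = a and s = s])
       (use nonneg le K_nonneg in \<open>auto simp: indicator_def D_def\<close>)
  have "(LINT w|lborel. indicator D w * (I / (pi * (3/2 * s)\<^sup>2))) \<le> (LINT w|lborel. indicator D w * f w)"
    using fD low by (intro integral_mono iD integrable_mult_left integrable_real_indicator)
      (auto simp: D_def indicator_def)
  moreover have "(LINT w|lborel. indicator D w * (I / (pi * (3/2 * s)\<^sup>2))) = I / 3"
  proof -
    have "(LINT w|lborel. indicator D w * (I / (pi * (3/2 * s)\<^sup>2))) = measure lborel D * (I / (pi * (3/2 * s)\<^sup>2))"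
      by simp
    also have "\<dots> = I / 3" unfolding mD using s by (simp add: power2_eq_square)
    finally show ?thesis .
  qed
  ultimately have 1: "I / 3 \<le> (LINT w|lborel. indicator D w * f w)" by (simp only:)
  have "(LINT w|lborel. indicator (ball a s) w * f w) = (LINT w|lborel. indicator (ball a (s/2)) w * f w + indicator D w * f w)"
    by (rule Bochner_Integration.integral_cong) (use sub in \<open>auto simp: indicator_def D_def\<close>)
  also have "\<dots> = I + (LINT w|lborel. indicator D w * f w)"
    unfolding I_def by (rule Bochner_Integration.integral_add[OF integrable_ball' iD])
  finally have "I \<le> 3/4 * (LINT w|lborel. indicator (ball a s) w * f w)" using 1 by linarith
  then have "I / (pi * (s/2)\<^sup>2) \<le> 3/4 * (LINT w|lborel. indicator (ball a s) w * f w) / (pi * (s/2)\<^sup>2)"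
    by (rule divide_right_mono) simp
  also have "\<dots> = 3 * ((LINT w|lborel. indicator (ball a s) w * f w) / (pi * s\<^sup>2))"
    using s by (simp add: power_divide field_simps)
  finally show ?thesis unfolding disc_mean_alt I_def .
qed

text \<open>The start compares \<open>ball a 1\<close> with \<open>ball 0 2\<close>, which has four
  times its area and on which the supermean inequality at 0 applies. Each halving then costs a
  factor 3.\<close>

lemma disc_mean_dyadic:
  assumes sm: "supermean f 6" and a: "cmod a \<le> 1"
  shows "disc_mean (1/2^k) f a \<le> 4 * 3^k * f 0"
proof (induction k)
  case 0
  have "(LINT w|lborel. indicator (ball a 1) w * f w) \<le> (LINT w|lborel. indicator (ball 0 2) w * f w)"
  proof (rule integral_mono[OF integrable_ball' integrable_ball'])
    fix w
    have "w \<in> ball 0 2" if "w \<in> ball a 1"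
      using that a norm_triangle_sub[of w a] by (simp add: dist_norm norm_minus_commute)
    then show "indicator (ball a 1) w * f w \<le> indicator (ball 0 2) w * f w"
      using nonneg[of w] by (auto simp: indicator_def)
  qed
  then have "(LINT w|lborel. indicator (ball a 1) w * f w) / pi \<le> (LINT w|lborel. indicator (ball 0 2) w * f w) / pi"
    by (rule divide_right_mono) simp
  then have "disc_mean 1 f a \<le> 4 * disc_mean 2 f 0" unfolding disc_mean_alt by simp
  also have "disc_mean 2 f 0 \<le> f 0" using sm unfolding supermean_def by simp
  finally show ?case by simp
next
  case (Suc k)
  have "(1::real) / 2^k \<le> 1" by (simp add: divide_le_eq)
  then have "cmod a + 5/2 * (1/2^k) < 6" using a by linarith
  then have "disc_mean (1/2^k/2) f a \<le> 3 * disc_mean (1/2^k) f a"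
    by (intro disc_mean_growth[OF sm]) auto
  also have "\<dots> \<le> 3 * (4 * 3^k * f 0)" using Suc by (intro mult_left_mono) auto
  also have "\<dots> = 4 * 3^Suc k * f 0" by simp
  also have "1/2^k/2 = (1::real)/2^Suc k" by simp
  finally show ?case .
qed

text \<open>Averages over discs commute, so it suffices to average the inequality for
  \<open>f\<close> over the centers \<open>a + w\<close>. These move by up to \<open>s\<close>,
  which is the loss in the radius.\<close>

lemma supermean_disc_mean:
  assumes sm: "supermean f R" and s: "s > 0"
  shows "supermean (disc_mean s f) (R - s)"
  unfolding supermean_def
proof (intro allI impI)
  fix a r assume r: "0 < r" and R: "cmod a + r < R - s"
  interpret T: bdd_fun "disc_mean s f" K by (rule bdd_fun_disc_mean[OF s])
  note [measurable] = T.meas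
  have "ennreal (disc_mean r (disc_mean s f) a * (pi * r\<^sup>2) * (pi * s\<^sup>2)) =
     (\<integral>\<^sup>+z. ennreal (indicator (ball 0 r) z * disc_mean s f (a + z)) \<partial>lborel) * ennreal (pi * s\<^sup>2)"
    unfolding T.nn_disc_mean[OF r, symmetric] by (rule ennreal_mult'') simp
  also have "\<dots> = (\<integral>\<^sup>+z. ennreal (indicator (ball 0 r) z * disc_mean s f (a + z)) * ennreal (pi * s\<^sup>2) \<partial>lborel)"
    by (rule nn_integral_multc[symmetric]) measurable
  also have "\<dots> = (\<integral>\<^sup>+z. (\<integral>\<^sup>+w. ennreal (indicator (ball 0 r) z * (indicator (ball 0 s) w * f (a + z + w))) \<partial>lborel) \<partial>lborel)"
  proof (rule nn_integral_cong)
    fix z :: complex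
    have "ennreal (indicator (ball 0 r) z * disc_mean s f (a + z)) * ennreal (pi * s\<^sup>2) =
       ennreal (indicator (ball 0 r) z) * ennreal (disc_mean s f (a + z) * (pi * s\<^sup>2))"
      by (simp add: ennreal_mult'' disc_mean_nonneg ennreal_mult mult.assoc del: ennreal_indicator)
    also have "\<dots> = (\<integral>\<^sup>+w. ennreal (indicator (ball 0 r) z) * ennreal (indicator (ball 0 s) w * f (a + z + w)) \<partial>lborel)"
      unfolding nn_disc_mean[OF s] by (rule nn_integral_cmult[symmetric]) measurable
    also have "\<dots> = (\<integral>\<^sup>+w. ennreal (indicator (ball 0 r) z * (indicator (ball 0 s) w * f (a + z + w))) \<partial>lborel)"
      by (rule nn_integral_cong) (simp add: ennreal_mult' nonneg del: ennreal_indicator)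
    finally show "ennreal (indicator (ball 0 r) z * disc_mean s f (a + z)) * ennreal (pi * s\<^sup>2) =
       (\<integral>\<^sup>+w. ennreal (indicator (ball 0 r) z * (indicator (ball 0 s) w * f (a + z + w))) \<partial>lborel)" .
  qed
  also have "\<dots> = (\<integral>\<^sup>+w. (\<integral>\<^sup>+z. ennreal (indicator (ball 0 r) z * (indicator (ball 0 s) w * f (a + z + w))) \<partial>lborel) \<partial>lborel)"
    by (rule lborel_pair.Fubini'[symmetric]) (simp add: case_prod_beta', measurable)
  also have "\<dots> \<le> (\<integral>\<^sup>+w. ennreal (indicator (ball 0 s) w * f (a + w)) * ennreal (pi * r\<^sup>2) \<partial>lborel)"
  proof (rule nn_integral_mono)
    fix w :: complex
    show "(\<integral>\<^sup>+z. ennreal (indicator (ball 0 r) z * (indicator (ball 0 s) w * f (a + z + w))) \<partial>lborel) \<le>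
      ennreal (indicator (ball 0 s) w * f (a + w)) * ennreal (pi * r\<^sup>2)"
    proof (cases "w \<in> ball 0 s")
      case True
      then have "cmod (a + w) + r < R" using R norm_triangle_ineq[of a w] by simp
      then have "disc_mean r f (a + w) \<le> f (a + w)" using sm r unfolding supermean_def by blast
      then have "ennreal (disc_mean r f (a + w) * (pi * r\<^sup>2)) \<le> ennreal (f (a + w) * (pi * r\<^sup>2))"
        by (intro ennreal_leI mult_right_mono) auto
      then show ?thesis unfolding nn_disc_mean[OF r] using True
        by (simp add: ennreal_mult'' nonneg algebra_simps)
    qed simp
  qed
  also have "\<dots> = (\<integral>\<^sup>+w. ennreal (indicator (ball 0 s) w * f (a + w)) \<partial>lborel) * ennreal (pi * r\<^sup>2)"
    by (rule nn_integral_multc) measurable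
  also have "\<dots> = ennreal (disc_mean s f a * (pi * s\<^sup>2) * (pi * r\<^sup>2))"
    unfolding nn_disc_mean[OF s, symmetric] by (rule ennreal_mult''[symmetric]) simp
  finally have "disc_mean r (disc_mean s f) a * (pi * r\<^sup>2) * (pi * s\<^sup>2) \<le> disc_mean s f a * (pi * s\<^sup>2) * (pi * r\<^sup>2)"
    by (subst (asm) ennreal_le_iff) (auto intro!: mult_nonneg_nonneg disc_mean_nonneg)
  then have "disc_mean r (disc_mean s f) a * ((pi * r\<^sup>2) * (pi * s\<^sup>2)) \<le> disc_mean s f a * ((pi * r\<^sup>2) * (pi * s\<^sup>2))"
    by (simp add: mult_ac)
  then show "disc_mean r (disc_mean s f) a \<le> disc_mean s f a"
    using r s by (subst (asm) mult_le_cancel_right_pos) auto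
qed

end

section \<open>A weight on the unit disc and the mean defect\<close>

definition bump :: "complex \<Rightarrow> real" where "bump z = (max 0 (1 - (cmod z)\<^sup>2))\<^sup>2"

lemma bump_nonneg: "0 \<le> bump z" by (simp add: bump_def)

lemma bump_le: "bump z \<le> 1"
proof -
  have "max 0 (1 - (cmod z)\<^sup>2) ^ 2 \<le> (1::real) ^ 2" by (intro power_mono) auto
  then show ?thesis by (simp add: bump_def)
qed

lemma bump_zero: "1 \<le> cmod z \<Longrightarrow> bump z = 0"
proof -
  assume "1 \<le> cmod z"
  then have "1\<^sup>2 \<le> (cmod z)\<^sup>2" by (intro power_mono) auto
  then have "max 0 (1 - (cmod z)\<^sup>2) = 0" by simp
  then show ?thesis by (simp add: bump_def)
qed

lemma bump_meas [measurable]: "bump \<in> borel_measurable borel"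
  unfolding bump_def by (intro borel_measurable_continuous_onI continuous_intros)

text \<open>The tangent inequality at \<open>x\<close> for the convex function that sends
  \<open>t\<close> to \<open>(max 0 t)\<^sup>2\<close>.\<close>

lemma sq_pos_part_convex: "(max 0 (x - y))\<^sup>2 \<ge> (max 0 x)\<^sup>2 - 2 * max 0 x * (y::real)"
proof (cases "x \<le> 0")
  case True then show ?thesis by (simp add: max_def)
next
  case False
  then have m: "max 0 x = x" by simp
  show ?thesis
  proof (cases "x - y \<ge> 0")
    case True
    have "x\<^sup>2 - 2 * x * y \<le> (x - y)\<^sup>2" by (simp add: power2_diff)
    then show ?thesis using m True by simp
  next
    case False
    then have "x * x \<le> x * y" using \<open>\<not> x \<le> 0\<close> by (intro mult_left_mono) auto
    then have "x\<^sup>2 - 2 * x * y \<le> 0" using \<open>\<not> x \<le> 0\<close> False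
      by (simp add: power2_eq_square)
    then show ?thesis using m by (smt (verit) zero_le_power2)
  qed
qed

text \<open>The terms linear in \<open>w\<close> cancel in the sum of the two tangent inequalities,
  and only a quadratic loss remains; \<open>max 0 x \<le> 1\<close> gives the constant 4.\<close>

lemma bump_symmetric_difference: "bump (z + w) + bump (z - w) \<ge> 2 * bump z - 4 * (cmod w)\<^sup>2"
proof -
  define x where "x = 1 - (cmod z)\<^sup>2"
  define p where "p = 2 * (z \<bullet> w)"
  have a: "1 - (cmod (z + w))\<^sup>2 = x - ((cmod w)\<^sup>2 + p)" and b: "1 - (cmod (z - w))\<^sup>2 = x - ((cmod w)\<^sup>2 - p)"
    unfolding x_def p_def by (simp_all add: power2_norm_eq_inner inner_add_left inner_add_right inner_diff_left inner_diff_right inner_commute)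
  have "max 0 x \<le> 1" by (simp add: x_def)
  then have "max 0 x * (cmod w)\<^sup>2 \<le> 1 * (cmod w)\<^sup>2" by (rule mult_right_mono) simp
  moreover have "bump (z + w) \<ge> (max 0 x)\<^sup>2 - 2 * max 0 x * ((cmod w)\<^sup>2 + p)"
    unfolding bump_def a by (rule sq_pos_part_convex)
  moreover have "bump (z - w) \<ge> (max 0 x)\<^sup>2 - 2 * max 0 x * ((cmod w)\<^sup>2 - p)"
    unfolding bump_def b by (rule sq_pos_part_convex)
  moreover have "bump z = (max 0 x)\<^sup>2" by (simp add: bump_def x_def)
  ultimately show ?thesis by (simp add: algebra_simps)
qed

interpretation bump: bdd_fun bump 1
  by unfold_locales (auto simp: bump_nonneg bump_le)

text \<open>Since the disc is symmetric, \<open>bump (z - w)\<close> and \<open>bump (z + w)\<close>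
  have the same average over it, so the bound on symmetric differences can be integrated.\<close>

lemma bump_disc_mean:
  assumes s: "s > 0"
  shows "bump z \<le> disc_mean s bump z + 2 * s\<^sup>2"
proof -
  let ?b = "indicator (ball (0::complex) s) :: complex \<Rightarrow> real"
  have i1: "integrable lborel (\<lambda>w. ?b w * bump (z + w))" by (rule bump.integrable_ball)
  have i2: "integrable lborel (\<lambda>w. ?b w * bump (z - w))"
    by (rule integrable_bounded_support[where B = 1 and a = 0 and s = s])
       (use bump_nonneg bump_le in \<open>auto simp: indicator_def\<close>)
  have i0: "integrable lborel ?b" using emeasure_lborel_ball_finite[of "0::complex" s] by (intro integrable_real_indicator) auto
  have mi: "(LINT w|lborel. ?b w) = pi * s\<^sup>2" using measure_ball_complex[of s 0] s by simp
  have refl: "(LINT w|lborel. ?b w * bump (z - w)) = (LINT w|lborel. ?b w * bump (z + w))"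
  proof -
    have "(LINT w|lborel. ?b w * bump (z + w)) = (LINT w|distr lborel borel uminus. ?b w * bump (z + w))"
      by (simp add: distr_lborel_uminus)
    also have "\<dots> = (LINT w|lborel. ?b (- w) * bump (z + - w))" by (rule integral_distr) measurable
    also have "\<dots> = (LINT w|lborel. ?b w * bump (z - w))"
      by (rule Bochner_Integration.integral_cong) (auto simp: indicator_def)
    finally show ?thesis by simp
  qed
  have "(LINT w|lborel. ?b w * (2 * bump z - 4 * s\<^sup>2)) \<le> (LINT w|lborel. ?b w * bump (z + w) + ?b w * bump (z - w))"
  proof (rule integral_mono)
    fix w
    show "?b w * (2 * bump z - 4 * s\<^sup>2) \<le> ?b w * bump (z + w) + ?b w * bump (z - w)"
    proof (cases "w \<in> ball 0 s")
      case True
      then have "(cmod w)\<^sup>2 \<le> s\<^sup>2" by (intro power_mono) auto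
      then show ?thesis using True bump_symmetric_difference[of z w] by simp
    qed simp
  qed (use i0 i1 i2 in auto)
  also have "\<dots> = 2 * (LINT w|lborel. ?b w * bump (z + w))"
    using i1 i2 refl by simp
  finally have "(LINT w|lborel. ?b w * (2 * bump z - 4 * s\<^sup>2)) \<le> 2 * (LINT w|lborel. ?b w * bump (z + w))" .
  then have "pi * s\<^sup>2 * (bump z - 2 * s\<^sup>2) \<le> (LINT w|lborel. ?b w * bump (z + w))"
  proof -
    have "(LINT w|lborel. ?b w * (2 * bump z - 4 * s\<^sup>2)) = pi * s\<^sup>2 * (2 * bump z - 4 * s\<^sup>2)"
      unfolding mi[symmetric] by (rule integral_mult_left_zero)
    then show ?thesis using \<open>(LINT w|lborel. ?b w * (2 * bump z - 4 * s\<^sup>2)) \<le> 2 * (LINT w|lborel. ?b w * bump (z + w))\<close>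
      by (simp only:) (simp add: algebra_simps)
  qed
  then have "bump z - 2 * s\<^sup>2 \<le> disc_mean s bump z"
    unfolding disc_mean_def using s by (simp add: pos_le_divide_eq mult.commute)
  then show ?thesis by simp
qed

context bdd_fun
begin

text \<open>The averaging kernel is even. This moves the average from \<open>f\<close>, about whose
  regularity nothing is known, onto the weight.\<close>

lemma disc_mean_selfadjoint:
  assumes s: "s > 0"
  shows "(\<integral>\<^sup>+z. ennreal (bump z * disc_mean s f z) \<partial>lborel) = (\<integral>\<^sup>+z. ennreal (f z * disc_mean s bump z) \<partial>lborel)"
proof -
  let ?c = "ennreal (pi * s\<^sup>2)"
  have c: "?c \<noteq> 0" "?c \<noteq> \<infinity>" using s by auto
  have e1: "ennreal (bump z * disc_mean s f z) * ?c = (\<integral>\<^sup>+w. ennreal (bump z * (indicator (ball 0 s) w * f (z + w))) \<partial>lborel)" for z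
  proof -
    have "ennreal (bump z * disc_mean s f z) * ?c = ennreal (bump z) * ennreal (disc_mean s f z * (pi * s\<^sup>2))"
      by (simp add: ennreal_mult bump_nonneg disc_mean_nonneg mult.assoc)
    also have "\<dots> = (\<integral>\<^sup>+w. ennreal (bump z) * ennreal (indicator (ball 0 s) w * f (z + w)) \<partial>lborel)"
      unfolding nn_disc_mean[OF s] by (rule nn_integral_cmult[symmetric]) measurable
    finally show ?thesis by (simp add: ennreal_mult' bump_nonneg)
  qed
  have e2: "ennreal (f z * disc_mean s bump z) * ?c = (\<integral>\<^sup>+w. ennreal (f z * (indicator (ball 0 s) w * bump (z + w))) \<partial>lborel)" for z
  proof -
    have "ennreal (f z * disc_mean s bump z) * ?c = ennreal (f z) * ennreal (disc_mean s bump z * (pi * s\<^sup>2))"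
      by (simp add: ennreal_mult nonneg bump.disc_mean_nonneg mult.assoc)
    also have "\<dots> = (\<integral>\<^sup>+w. ennreal (f z) * ennreal (indicator (ball 0 s) w * bump (z + w)) \<partial>lborel)"
      unfolding bump.nn_disc_mean[OF s] by (rule nn_integral_cmult[symmetric]) measurable
    finally show ?thesis by (simp add: ennreal_mult' nonneg)
  qed
  note [measurable] = disc_mean_meas bump.disc_mean_meas
  have "(\<integral>\<^sup>+z. ennreal (bump z * disc_mean s f z) \<partial>lborel) * ?c = (\<integral>\<^sup>+z. ennreal (bump z * disc_mean s f z) * ?c \<partial>lborel)"
    by (rule nn_integral_multc[symmetric]) measurable
  also have "\<dots> = (\<integral>\<^sup>+z. (\<integral>\<^sup>+w. ennreal (bump z * (indicator (ball 0 s) w * f (z + w))) \<partial>lborel) \<partial>lborel)"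
    unfolding e1 ..
  also have "\<dots> = (\<integral>\<^sup>+w. (\<integral>\<^sup>+z. ennreal (bump z * (indicator (ball 0 s) w * f (z + w))) \<partial>lborel) \<partial>lborel)"
    by (rule lborel_pair.Fubini'[symmetric]) (simp add: case_prod_beta', measurable)
  also have "\<dots> = (\<integral>\<^sup>+w. (\<integral>\<^sup>+z. ennreal (bump (z - w) * (indicator (ball 0 s) w * f z)) \<partial>lborel) \<partial>lborel)"
  proof (rule nn_integral_cong)
    fix w :: complex
    have "(\<integral>\<^sup>+z. ennreal (bump (z - w) * (indicator (ball 0 s) w * f z)) \<partial>lborel) =
      (\<integral>\<^sup>+z. ennreal (bump (w + z - w) * (indicator (ball 0 s) w * f (w + z))) \<partial>lborel)"
      by (rule lborel_nn_integral_translate[symmetric]) measurable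
    then show "(\<integral>\<^sup>+z. ennreal (bump z * (indicator (ball 0 s) w * f (z + w))) \<partial>lborel) =
      (\<integral>\<^sup>+z. ennreal (bump (z - w) * (indicator (ball 0 s) w * f z)) \<partial>lborel)"
      by (simp add: add.commute)
  qed
  also have "\<dots> = (\<integral>\<^sup>+z. (\<integral>\<^sup>+w. ennreal (bump (z - w) * (indicator (ball 0 s) w * f z)) \<partial>lborel) \<partial>lborel)"
    by (rule lborel_pair.Fubini') (simp add: case_prod_beta', measurable)
  also have "\<dots> = (\<integral>\<^sup>+z. ennreal (f z * disc_mean s bump z) * ?c \<partial>lborel)"
  proof (rule nn_integral_cong)
    fix z :: complex
    have "(\<integral>\<^sup>+w. ennreal (bump (z - w) * (indicator (ball 0 s) w * f z)) \<partial>lborel) =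
       (\<integral>\<^sup>+w. ennreal (bump (z - w) * (indicator (ball 0 s) w * f z)) \<partial>distr lborel borel uminus)"
      by (simp add: distr_lborel_uminus)
    also have "\<dots> = (\<integral>\<^sup>+w. ennreal (bump (z - - w) * (indicator (ball 0 s) (- w) * f z)) \<partial>lborel)"
      by (rule nn_integral_distr) measurable
    also have "\<dots> = (\<integral>\<^sup>+w. ennreal (f z * (indicator (ball 0 s) w * bump (z + w))) \<partial>lborel)"
      by (rule nn_integral_cong) (auto simp: indicator_def mult.commute)
    finally show "(\<integral>\<^sup>+w. ennreal (bump (z - w) * (indicator (ball 0 s) w * f z)) \<partial>lborel) = ennreal (f z * disc_mean s bump z) * ?c"
      unfolding e2 .
  qed
  also have "\<dots> = (\<integral>\<^sup>+z. ennreal (f z * disc_mean s bump z) \<partial>lborel) * ?c"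
    by (rule nn_integral_multc) measurable
  finally have "?c * (\<integral>\<^sup>+z. ennreal (bump z * disc_mean s f z) \<partial>lborel) = ?c * (\<integral>\<^sup>+z. ennreal (f z * disc_mean s bump z) \<partial>lborel)"
    by (simp only: mult.commute)
  then show ?thesis using c by (simp only: ennreal_mult_cancel_left) auto
qed

lemma integrable_bump_mult:
  assumes [measurable]: "g \<in> borel_measurable borel" and g: "\<And>z. 0 \<le> g z" "\<And>z. g z \<le> B"
  shows "integrable lborel (\<lambda>z. bump z * g z)"
proof (rule integrable_bounded_support[where B = B and a = 0 and s = 1])
  fix z
  have "bump z * g z \<le> 1 * B" using bump_le bump_nonneg g by (intro mult_mono) auto
  then show "\<bar>bump z * g z\<bar> \<le> B" using bump_nonneg[of z] g by simp
  show "bump z * g z = 0" if "z \<notin> ball 0 1" using that by (simp add: bump_zero)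
qed measurable

text \<open>Once the average sits on \<open>bump\<close>, the defect is at most
  \<open>2 * s^2\<close> times the integral of \<open>f\<close> over \<open>ball 0 2\<close>, and
  the supermean inequality at 0 bounds that integral by \<open>4 * pi * f 0\<close>.\<close>

lemma bump_defect:
  assumes sm: "supermean f 6" and s: "0 < s" "s \<le> 1"
  shows "(LINT z|lborel. bump z * (f z - disc_mean s f z)) \<le> 8 * pi * s\<^sup>2 * f 0"
proof -
  interpret T: bdd_fun "disc_mean s f" K by (rule bdd_fun_disc_mean[OF s(1)])
  note [measurable] = T.meas bump.disc_mean_meas
  have i1: "integrable lborel (\<lambda>z. bump z * f z)" by (rule integrable_bump_mult[OF meas nonneg le])
  have i2: "integrable lborel (\<lambda>z. bump z * disc_mean s f z)" by (rule integrable_bump_mult[OF T.meas T.nonneg T.le])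
  have "ennreal (LINT z|lborel. bump z * f z) = (\<integral>\<^sup>+z. ennreal (bump z * f z) \<partial>lborel)"
    by (rule nn_integral_eq_integral[OF i1, symmetric]) (auto intro!: AE_I2 mult_nonneg_nonneg bump_nonneg nonneg)
  also have "\<dots> \<le> (\<integral>\<^sup>+z. ennreal (f z * disc_mean s bump z) + ennreal (2 * s\<^sup>2) * ennreal (indicator (ball 0 2) z * f (0 + z)) \<partial>lborel)"
  proof (rule nn_integral_mono)
    fix z
    show "ennreal (bump z * f z) \<le> ennreal (f z * disc_mean s bump z) + ennreal (2 * s\<^sup>2) * ennreal (indicator (ball 0 2) z * f (0 + z))"
    proof (cases "z \<in> ball 0 2")
      case True
      have "bump z * f z \<le> (disc_mean s bump z + 2 * s\<^sup>2) * f z"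
        by (rule mult_right_mono[OF bump_disc_mean[OF s(1)] nonneg])
      then have "ennreal (bump z * f z) \<le> ennreal (f z * disc_mean s bump z + (2 * s\<^sup>2) * f z)"
        by (intro ennreal_leI) (simp add: algebra_simps)
      also have "\<dots> = ennreal (f z * disc_mean s bump z) + ennreal (2 * s\<^sup>2) * ennreal (f z)"
        using nonneg bump.disc_mean_nonneg by (subst ennreal_plus) (auto simp: ennreal_mult)
      finally show ?thesis using True by simp
    next
      case False
      then have "bump z = 0" by (intro bump_zero) simp
      then show ?thesis by simp
    qed
  qed
  also have "\<dots> = (\<integral>\<^sup>+z. ennreal (f z * disc_mean s bump z) \<partial>lborel) + (\<integral>\<^sup>+z. ennreal (2 * s\<^sup>2) * ennreal (indicator (ball 0 2) z * f (0 + z)) \<partial>lborel)"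
    by (rule nn_integral_add) measurable
  also have "(\<integral>\<^sup>+z. ennreal (2 * s\<^sup>2) * ennreal (indicator (ball 0 2) z * f (0 + z)) \<partial>lborel) = ennreal (2 * s\<^sup>2) * ennreal (disc_mean 2 f 0 * (pi * 2\<^sup>2))"
    unfolding nn_disc_mean[of 2 0, OF zero_less_numeral] by (rule nn_integral_cmult) measurable
  also have "(\<integral>\<^sup>+z. ennreal (f z * disc_mean s bump z) \<partial>lborel) = (\<integral>\<^sup>+z. ennreal (bump z * disc_mean s f z) \<partial>lborel)"
    by (rule disc_mean_selfadjoint[OF s(1), symmetric])
  also have "\<dots> = ennreal (LINT z|lborel. bump z * disc_mean s f z)"
    by (rule nn_integral_eq_integral[OF i2]) (auto intro!: AE_I2 mult_nonneg_nonneg bump_nonneg T.nonneg)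
  also have "ennreal (LINT z|lborel. bump z * disc_mean s f z) + ennreal (2 * s\<^sup>2) * ennreal (disc_mean 2 f 0 * (pi * 2\<^sup>2)) =
     ennreal ((LINT z|lborel. bump z * disc_mean s f z) + 2 * s\<^sup>2 * (disc_mean 2 f 0 * (pi * 2\<^sup>2)))"
  proof -
    have "ennreal (2 * s\<^sup>2) * ennreal (disc_mean 2 f 0 * (pi * 2\<^sup>2)) = ennreal (2 * s\<^sup>2 * (disc_mean 2 f 0 * (pi * 2\<^sup>2)))"
      by (rule ennreal_mult[symmetric]) (auto intro!: mult_nonneg_nonneg disc_mean_nonneg)
    then show ?thesis
      by (simp only:) (rule ennreal_plus[symmetric], auto intro!: integral_nonneg_AE AE_I2 mult_nonneg_nonneg bump_nonneg T.nonneg disc_mean_nonneg)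
  qed
  finally have "(LINT z|lborel. bump z * f z) \<le> (LINT z|lborel. bump z * disc_mean s f z) + 2 * s\<^sup>2 * (disc_mean 2 f 0 * (pi * 2\<^sup>2))"
    by (subst (asm) ennreal_le_iff)
       (auto intro!: add_nonneg_nonneg integral_nonneg_AE AE_I2 mult_nonneg_nonneg bump_nonneg T.nonneg disc_mean_nonneg)
  moreover have "disc_mean 2 f 0 \<le> f 0" using sm unfolding supermean_def by simp
  then have "2 * s\<^sup>2 * (disc_mean 2 f 0 * (pi * 2\<^sup>2)) \<le> 2 * s\<^sup>2 * (f 0 * (pi * 2\<^sup>2))"
    by (intro mult_left_mono mult_right_mono) auto
  moreover have "(LINT z|lborel. bump z * (f z - disc_mean s f z)) = (LINT z|lborel. bump z * f z) - (LINT z|lborel. bump z * disc_mean s f z)"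
    using i1 i2 by (simp add: right_diff_distrib)
  moreover have "2 * s\<^sup>2 * (f 0 * (pi * 2\<^sup>2)) = 8 * pi * s\<^sup>2 * f 0" by simp
  ultimately show ?thesis by linarith
qed

text \<open>With \<open>g\<close> the disc mean,
  \<open>f\<^sup>2 - g\<^sup>2 = (f - g) * (f + g)\<close>, and
  \<open>0 \<le> g \<le> f \<le> S\<close> holds on the unit disc. A bound on the supremum thus
  converts the defect of \<open>f\<close> into a defect of its square.\<close>

lemma bump_square_step:
  assumes sm: "supermean f 6" and s: "0 < s" "s \<le> 1" and S: "\<And>z. cmod z < 1 \<Longrightarrow> f z \<le> S"
  shows "(LINT z|lborel. bump z * (f z)\<^sup>2) \<le> (LINT z|lborel. bump z * (disc_mean s f z)\<^sup>2) + 2 * S * (8 * pi * s\<^sup>2 * f 0)"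
proof -
  interpret T: bdd_fun "disc_mean s f" K by (rule bdd_fun_disc_mean[OF s(1)])
  note [measurable] = T.meas
  have S0: "0 \<le> S" using S[of 0] nonneg[of 0] by simp
  have sq: "g z * g z \<le> K * K" if "bdd_fun g K" for g z
    using bdd_fun.nonneg[OF that, of z] bdd_fun.le[OF that, of z] by (intro mult_mono) auto
  have i1: "integrable lborel (\<lambda>z. bump z * (f z)\<^sup>2)"
    by (rule integrable_bump_mult[where B = "K*K"]) (auto simp: power2_eq_square intro!: sq bdd_fun_axioms)
  have i2: "integrable lborel (\<lambda>z. bump z * (disc_mean s f z)\<^sup>2)"
    by (rule integrable_bump_mult[where B = "K*K"]) (auto simp: power2_eq_square intro!: sq T.bdd_fun_axioms)
  have i3: "integrable lborel (\<lambda>z. bump z * (f z - disc_mean s f z))"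
    using integrable_bump_mult[OF meas nonneg le] integrable_bump_mult[OF T.meas T.nonneg T.le]
    by (simp add: right_diff_distrib)
  have "(LINT z|lborel. bump z * (f z)\<^sup>2) \<le> (LINT z|lborel. bump z * (disc_mean s f z)\<^sup>2 + 2 * S * (bump z * (f z - disc_mean s f z)))"
  proof (rule integral_mono)
    fix z
    show "bump z * (f z)\<^sup>2 \<le> bump z * (disc_mean s f z)\<^sup>2 + 2 * S * (bump z * (f z - disc_mean s f z))"
    proof (cases "cmod z < 1")
      case True
      then have d: "disc_mean s f z \<le> f z" using sm s unfolding supermean_def by simp
      have "(f z - disc_mean s f z) * (f z + disc_mean s f z) \<le> (f z - disc_mean s f z) * (2 * S)"
        using d S[OF True] by (intro mult_left_mono) auto
      then have "(f z)\<^sup>2 \<le> (disc_mean s f z)\<^sup>2 + 2 * S * (f z - disc_mean s f z)"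
        by (simp add: algebra_simps power2_eq_square)
      then have "bump z * (f z)\<^sup>2 \<le> bump z * ((disc_mean s f z)\<^sup>2 + 2 * S * (f z - disc_mean s f z))"
        using bump_nonneg by (rule mult_left_mono)
      then show ?thesis by (simp add: algebra_simps)
    next
      case False then show ?thesis by (simp add: bump_zero)
    qed
  qed (use i1 i2 i3 in auto)
  also have "\<dots> = (LINT z|lborel. bump z * (disc_mean s f z)\<^sup>2) + 2 * S * (LINT z|lborel. bump z * (f z - disc_mean s f z))"
    using i2 i3 by simp
  also have "\<dots> \<le> (LINT z|lborel. bump z * (disc_mean s f z)\<^sup>2) + 2 * S * (8 * pi * s\<^sup>2 * f 0)"
    using bump_defect[OF sm s] S0 by (intro add_left_mono mult_left_mono) auto
  finally show ?thesis .
qed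

text \<open>Iterated averages over discs of radius 1/2^(N-1), ..., 1/2, 1, from the inside out. Unlike the
  averages of \<open>f\<close> itself, they are monotone in the number of steps without any regularity.\<close>

primrec iter_mean :: "nat \<Rightarrow> nat \<Rightarrow> complex \<Rightarrow> real" where
  "iter_mean N 0 = f"
| "iter_mean N (Suc j) = disc_mean (1 / 2 ^ (N - Suc j)) (iter_mean N j)"

lemma bdd_fun_iter_mean: "bdd_fun (iter_mean N j) K"
proof (induction j)
  case 0 show ?case by (simp add: bdd_fun_axioms)
next
  case (Suc j)
  then interpret g: bdd_fun "iter_mean N j" K .
  show ?case unfolding iter_mean.simps by (rule g.bdd_fun_disc_mean) simp
qed

lemma supermean_antimono: "supermean g R \<Longrightarrow> R' \<le> R \<Longrightarrow> supermean g R'"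
  unfolding supermean_def by force

text \<open>After \<open>j\<close> steps the radii \<open>1/2^(N-1)\<close>, ...,
  \<open>1/2^(N-j)\<close> have been lost. Their sum is less than \<open>2/2^(N-j)\<close>, so a
  radius of at least 6 always remains.\<close>

lemma supermean_iter_mean:
  assumes "supermean f 8" "j \<le> N"
  shows "supermean (iter_mean N j) (8 - 2 / 2 ^ (N - j))"
  using assms(2)
proof (induction j)
  case 0
  have "0 \<le> (2::real) / 2 ^ N" by simp
  then show ?case using assms(1) by (auto intro: supermean_antimono)
next
  case (Suc j)
  interpret g: bdd_fun "iter_mean N j" K by (rule bdd_fun_iter_mean)
  have e: "N - j = Suc (N - Suc j)" using Suc.prems by simp
  have "supermean (iter_mean N j) (8 - 2 / 2 ^ (N - j))" using Suc by simp
  then have "supermean (disc_mean (1 / 2 ^ (N - Suc j)) (iter_mean N j)) (8 - 2 / 2 ^ (N - j) - 1 / 2 ^ (N - Suc j))"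
    by (rule g.supermean_disc_mean) simp
  also have "8 - 2 / 2 ^ (N - j) - 1 / 2 ^ (N - Suc j) = 8 - 2 / (2::real) ^ (N - Suc j)"
    unfolding e by simp
  finally show ?case by simp
qed

lemma supermean_iter_mean6: "supermean f 8 \<Longrightarrow> j \<le> N \<Longrightarrow> supermean (iter_mean N j) 6"
proof (rule supermean_antimono[OF supermean_iter_mean])
  have "(2::real) / 2 ^ (N - j) \<le> 2" by (simp add: divide_le_eq)
  then show "(6::real) \<le> 8 - 2 / 2 ^ (N - j)" by simp
qed

lemma iter_mean_0: "supermean f 8 \<Longrightarrow> j \<le> N \<Longrightarrow> iter_mean N j 0 \<le> f 0"
proof (induction j)
  case (Suc j)
  have "supermean (iter_mean N j) 6" using Suc.prems by (intro supermean_iter_mean6) auto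
  moreover have "(1::real) / 2 ^ (N - Suc j) < 6"
  proof -
    have "(1::real) / 2 ^ (N - Suc j) \<le> 1" by (simp add: divide_le_eq)
    then show ?thesis by linarith
  qed
  ultimately have "iter_mean N (Suc j) 0 \<le> iter_mean N j 0" unfolding supermean_def by simp
  then show ?case using Suc by simp
qed simp

text \<open>The last average has radius \<open>1/2^k\<close> with \<open>k = N - Suc j\<close>, so
  \<open>disc_mean_dyadic\<close> applies to the function averaged in this step, whose value at 0 is
  at most \<open>f 0\<close>.\<close>

lemma iter_mean_growth:
  assumes "supermean f 8" "Suc j \<le> N" "cmod a \<le> 1"
  shows "iter_mean N (Suc j) a \<le> 4 * 3 ^ (N - Suc j) * f 0"
proof -
  interpret g: bdd_fun "iter_mean N j" K by (rule bdd_fun_iter_mean)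
  have "iter_mean N (Suc j) a \<le> 4 * 3 ^ (N - Suc j) * iter_mean N j 0"
    unfolding iter_mean.simps
    by (rule g.disc_mean_dyadic) (use assms in \<open>auto intro: supermean_iter_mean6\<close>)
  also have "\<dots> \<le> 4 * 3 ^ (N - Suc j) * f 0"
    using assms by (intro mult_left_mono iter_mean_0) auto
  finally show ?thesis .
qed

text \<open>The squares are compared along the iterated averages. When the next radius is
  \<open>1/2^k\<close>, the supremum is at most \<open>4 * 3^(k+1) * f 0\<close> and the defect at
  most \<open>8 * pi * f 0 / 4^k\<close>, so the loss is
  \<open>192 * pi * (3/4)^k * (f 0)^2\<close>. The geometric series has sum 4, which gives 768.
  After the last average the function is at most \<open>4 * f 0\<close>, which gives 16, and the
  total is 784.\<close>

theorem supermean_square_integral: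
  assumes sm: "supermean f 8"
  shows "(LINT z|lborel. bump z * (f z)\<^sup>2) \<le> 784 * pi * (f 0)\<^sup>2"
proof -
  define I where "I N j = (LINT z|lborel. bump z * (iter_mean N j z)\<^sup>2)" for N j
  have f0: "0 \<le> f 0" by (rule nonneg)
  have baseN: "I N N \<le> 16 * pi * (f 0)\<^sup>2" if N1: "N \<ge> 1" for N
  proof -
    obtain m where N: "N = Suc m" using N1 by (cases N) auto
    interpret g: bdd_fun "iter_mean N N" K by (rule bdd_fun_iter_mean)
    have "I N N \<le> (LINT z|lborel. indicator (ball (0::complex) 1) z * (4 * f 0)\<^sup>2)"
      unfolding I_def
    proof (rule integral_mono)
      show "integrable lborel (\<lambda>z. bump z * (iter_mean N N z)\<^sup>2)"
        using g.nonneg g.le by (intro integrable_bump_mult[where B = "K*K"]) (auto simp: power2_eq_square intro!: mult_mono intro: order_trans)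
      show "integrable lborel (\<lambda>z. indicator (ball (0::complex) 1) z * (4 * f 0)\<^sup>2)"
        using emeasure_lborel_ball_finite[of "0::complex" 1] by (intro integrable_mult_left integrable_real_indicator) auto
      fix z
      show "bump z * (iter_mean N N z)\<^sup>2 \<le> indicator (ball 0 1) z * (4 * f 0)\<^sup>2"
      proof (cases "cmod z < 1")
        case True
        have "iter_mean N N z \<le> 4 * f 0" using iter_mean_growth[OF sm, of m N z] True N by simp
        then have "(iter_mean N N z)\<^sup>2 \<le> (4 * f 0)\<^sup>2" using g.nonneg by (intro power_mono)
        then have "bump z * (iter_mean N N z)\<^sup>2 \<le> 1 * (4 * f 0)\<^sup>2"
          using bump_le bump_nonneg by (intro mult_mono) auto
        then show ?thesis using True by simp
      qed (simp add: bump_zero)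
    qed
    also have "\<dots> = 16 * pi * (f 0)\<^sup>2" using measure_ball_complex[of 1 0] by (simp add: power_mult_distrib)
    finally show ?thesis .
  qed
  have stepN: "I N j \<le> I N (Suc j) + 192 * pi * (3/4) ^ (N - Suc j) * (f 0)\<^sup>2" if j: "1 \<le> j" "Suc j \<le> N" for N j
  proof -
    interpret g: bdd_fun "iter_mean N j" K by (rule bdd_fun_iter_mean)
    define k where "k = N - Suc j"
    have e: "N - j = Suc k" using j by (simp add: k_def)
    have S: "iter_mean N j z \<le> 4 * 3 ^ Suc k * f 0" if "cmod z < 1" for z
      using iter_mean_growth[OF sm, of "j - 1" N z] that j e by simp
    have "I N j \<le> I N (Suc j) + 2 * (4 * 3 ^ Suc k * f 0) * (8 * pi * (1/2^k)\<^sup>2 * iter_mean N j 0)"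
      unfolding I_def iter_mean.simps k_def[symmetric]
      by (rule g.bump_square_step[OF _ _ _ S]) (use j sm in \<open>auto intro: supermean_iter_mean6 simp: divide_le_eq\<close>)
    also have "2 * (4 * 3 ^ Suc k * f 0) * (8 * pi * (1/2^k)\<^sup>2 * iter_mean N j 0) \<le> 2 * (4 * 3 ^ Suc k * f 0) * (8 * pi * (1/2^k)\<^sup>2 * f 0)"
      using f0 j iter_mean_0[OF sm, of j N] by (intro mult_left_mono) auto
    also have "\<dots> = 192 * pi * (3/4) ^ k * (f 0)\<^sup>2"
      by (simp add: power2_eq_square power_divide flip: power_mult_distrib)
    finally show ?thesis by (simp add: k_def)
  qed
  have geo: "I N j \<le> 16 * pi * (f 0)\<^sup>2 + 192 * pi * (f 0)\<^sup>2 * (\<Sum>i<N - j. (3/4) ^ i)" if j: "1 \<le> j" "j \<le> N" for N j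
    using j(2,1)
  proof (induction j rule: inc_induct)
    case base
    show ?case using \<open>1 \<le> N\<close> baseN[of N] by simp
  next
    case (step n)
    have e: "N - n = Suc (N - Suc n)" using step.hyps by simp
    have "I N n \<le> I N (Suc n) + 192 * pi * (3/4) ^ (N - Suc n) * (f 0)\<^sup>2"
      by (rule stepN) (use step in auto)
    also have "I N (Suc n) \<le> 16 * pi * (f 0)\<^sup>2 + 192 * pi * (f 0)\<^sup>2 * (\<Sum>i<N - Suc n. (3/4) ^ i)"
      using step by simp
    finally show ?case unfolding e by (simp add: algebra_simps)
  qed
  have geom: "(\<Sum>i<n. (3/4::real) ^ i) \<le> 4" for n
  proof -
    have "(\<Sum>i<n. (3/4::real) ^ i) = (1 - (3/4) ^ n) * 4" by (simp add: sum_gp_strict)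
    also have "\<dots> \<le> 1 * 4" by (intro mult_right_mono) auto
    finally show ?thesis by simp
  qed
  have I1: "I N 1 \<le> 784 * pi * (f 0)\<^sup>2" if "1 \<le> N" for N
  proof -
    have "192 * pi * (f 0)\<^sup>2 * (\<Sum>i<N - 1. (3/4) ^ i) \<le> 192 * pi * (f 0)\<^sup>2 * 4"
      by (intro mult_left_mono geom) auto
    then show ?thesis using geo[of 1 N] that by linarith
  qed
  \<comment> \<open>For the innermost step, from \<open>f\<close> itself, no better bound on the
    supremum than \<open>K\<close> is available. Its radius \<open>1/2^n\<close> tends to 0, and
    with it the only term that contains \<open>K\<close>.\<close>
  have last: "(LINT z|lborel. bump z * (f z)\<^sup>2) \<le> 784 * pi * (f 0)\<^sup>2 + 16 * pi * K * f 0 * (1/4) ^ n" for n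
  proof -
    have "(LINT z|lborel. bump z * (f z)\<^sup>2) \<le> I (Suc n) 1 + 2 * K * (8 * pi * (1/2^n)\<^sup>2 * f 0)"
    proof -
      have "supermean f 6" by (rule supermean_antimono[OF sm]) simp
      from bump_square_step[OF this, where s = "1/2^n" and S = K, OF _ _ le]
      show ?thesis unfolding I_def by (simp add: divide_le_eq)
    qed
    also have "2 * K * (8 * pi * (1/2^n)\<^sup>2 * f 0) = 16 * pi * K * f 0 * (1/4) ^ n"
      by (simp add: power2_eq_square power_divide flip: power_mult_distrib)
    finally show ?thesis using I1[of "Suc n"] by linarith
  qed
  have "(\<lambda>n. 784 * pi * (f 0)\<^sup>2 + 16 * pi * K * f 0 * (1/4) ^ n) \<longlonglongrightarrow> 784 * pi * (f 0)\<^sup>2 + 0"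
    by (intro tendsto_add tendsto_const tendsto_mult_right_zero LIMSEQ_realpow_zero) auto
  then show ?thesis using last by (intro LIMSEQ_le_const) auto
qed

end

section \<open>Several variables\<close>

lemma bump_lower: "cmod z \<le> 1/2 \<Longrightarrow> 9/16 \<le> bump z"
proof -
  assume "cmod z \<le> 1/2"
  then have "(cmod z)\<^sup>2 \<le> (1/2)\<^sup>2" by (intro power_mono) auto
  then have "3/4 \<le> max 0 (1 - (cmod z)\<^sup>2)" by (simp add: power2_eq_square)
  then have "(3/4)\<^sup>2 \<le> (max 0 (1 - (cmod z)\<^sup>2))\<^sup>2" by (rule power_mono) simp
  then show ?thesis by (simp add: bump_def power2_eq_square)
qed

text \<open>In place of polar coordinates, the disc is rotated by every angle. This leaves its
  integral unchanged, and after exchanging the integrals each point of the disc contributes a circle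
  mean.\<close>

lemma (in bdd_fun) supermean_of_circles:
  assumes c: "\<And>a w. cmod a + cmod w < R \<Longrightarrow> (\<integral>\<^sup>+\<theta>. ennreal (f (a + cis \<theta> * w)) \<partial>circ) \<le> ennreal (2 * pi * f a)"
  shows "supermean f R"
  unfolding supermean_def
proof (intro allI impI)
  fix a s assume s: "0 < s" and R: "cmod a + s < R"
  have sf: "sigma_finite_measure circ" using finite_measure_circ by (simp add: finite_measure_def)
  interpret P: pair_sigma_finite circ "lborel :: complex measure" by (simp add: pair_sigma_finite_def sf sigma_finite_lborel)
  have rot: "(\<integral>\<^sup>+w. ennreal (indicator (ball 0 s) w * f (a + cis \<theta> * w)) \<partial>lborel) = ennreal (disc_mean s f a * (pi * s\<^sup>2))" for \<theta>
  proof -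
    have "distr lborel borel (\<lambda>w. cis \<theta> * w) = lborel"
      by (rule distr_lborel_isometry) (auto intro!: linearI simp: norm_mult distrib_left)
    then have "(\<integral>\<^sup>+w. ennreal (indicator (ball 0 s) w * f (a + w)) \<partial>lborel) =
      (\<integral>\<^sup>+w. ennreal (indicator (ball 0 s) w * f (a + w)) \<partial>distr lborel borel (\<lambda>w. cis \<theta> * w))" by simp
    also have "\<dots> = (\<integral>\<^sup>+w. ennreal (indicator (ball 0 s) (cis \<theta> * w) * f (a + cis \<theta> * w)) \<partial>lborel)"
      by (rule nn_integral_distr) measurable
    also have "\<dots> = (\<integral>\<^sup>+w. ennreal (indicator (ball 0 s) w * f (a + cis \<theta> * w)) \<partial>lborel)"
      by (rule nn_integral_cong) (simp add: indicator_def norm_mult)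
    finally show ?thesis by (simp only: nn_disc_mean[OF s])
  qed
  have [measurable]: "(\<lambda>\<theta>. \<theta>) \<in> borel_measurable circ" by (rule borel_measurable_circ) simp
  have [measurable]: "cis \<in> borel_measurable borel"
    by (rule borel_measurable_continuous_onI) (auto intro!: continuous_intros continuous_on_cis)
  have mm: "(\<lambda>x. ennreal (indicator (ball 0 s) (snd x) * f (a + cis (fst x) * snd x))) \<in> borel_measurable (circ \<Otimes>\<^sub>M lborel)"
  proof -
    have "(\<lambda>x. cis (fst x)) \<in> borel_measurable (circ \<Otimes>\<^sub>M (lborel :: complex measure))"
      by (rule measurable_compose[of fst _ circ]) (auto intro!: borel_measurable_circ)
    then show ?thesis by measurable
  qed
  have "ennreal (2*pi) * ennreal (disc_mean s f a * (pi * s\<^sup>2)) = (\<integral>\<^sup>+\<theta>. ennreal (disc_mean s f a * (pi * s\<^sup>2)) \<partial>circ)"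
    using emeasure_circ by (simp add: mult.commute)
  also have "\<dots> = (\<integral>\<^sup>+\<theta>. (\<integral>\<^sup>+w. ennreal (indicator (ball 0 s) w * f (a + cis \<theta> * w)) \<partial>lborel) \<partial>circ)"
    by (simp only: rot)
  also have "\<dots> = (\<integral>\<^sup>+w. (\<integral>\<^sup>+\<theta>. ennreal (indicator (ball 0 s) w * f (a + cis \<theta> * w)) \<partial>circ) \<partial>lborel)"
    by (rule P.Fubini'[symmetric]) (simp add: case_prod_beta' mm)
  also have "\<dots> \<le> (\<integral>\<^sup>+w. ennreal (2 * pi * f a) * indicator (ball (0::complex) s) w \<partial>lborel)"
  proof (rule nn_integral_mono)
    fix w
    show "(\<integral>\<^sup>+\<theta>. ennreal (indicator (ball 0 s) w * f (a + cis \<theta> * w)) \<partial>circ) \<le> ennreal (2 * pi * f a) * indicator (ball 0 s) w"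
      using c[of a w] R by (cases "w \<in> ball 0 s") auto
  qed
  also have "\<dots> = ennreal (2 * pi * f a) * ennreal (pi * s\<^sup>2)"
    using s by (simp add: nn_integral_cmult_indicator emeasure_ball_complex)
  finally have "2 * pi * (disc_mean s f a * (pi * s\<^sup>2)) \<le> 2 * pi * f a * (pi * s\<^sup>2)"
    using nonneg disc_mean_nonneg by (subst (asm) (1 2) ennreal_mult[symmetric]) (auto simp: ennreal_le_iff)
  then have "disc_mean s f a * (2 * pi * (pi * s\<^sup>2)) \<le> f a * (2 * pi * (pi * s\<^sup>2))" by (simp add: mult_ac)
  then show "disc_mean s f a \<le> f a" using s by (subst (asm) mult_le_cancel_right_pos) auto
qed

lemma norm_vector_scalar_mult: "norm (c *s (v :: complex^'n)) = cmod c * norm v"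
proof -
  have "(\<Sum>i\<in>UNIV. (cmod (c * v $ i))\<^sup>2) = (cmod c)\<^sup>2 * (\<Sum>i\<in>UNIV. (cmod (v $ i))\<^sup>2)"
    by (simp add: norm_mult power_mult_distrib sum_distrib_left)
  then show ?thesis by (simp add: norm_vec_def L2_set_def real_sqrt_mult)
qed

lemma continuous_vector_scalar_mult [continuous_intros]:
  fixes f :: "'a::topological_space \<Rightarrow> complex" and g :: "'a \<Rightarrow> complex^'n"
  assumes "continuous_on S f" "continuous_on S g"
  shows "continuous_on S (\<lambda>x. f x *s g x)"
proof -
  have "(\<lambda>x. f x *s g x) = (\<lambda>x. \<chi> i. f x * g x $ i)" by (simp add: Finite_Cartesian_Product.vec_eq_iff fun_eq_iff)
  then show ?thesis
    by (simp only:) (intro continuous_on_vec_lambda continuous_on_mult assms(1) continuous_on_component assms(2))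
qed

text \<open>The Jacobian of the substitution is a power of \<open>cmod \<zeta>\<close>, hence at
  most 1, and is dropped. To compute it, \<open>\<zeta>\<close> is split into the isometry given by
  \<open>u\<close> and a real dilation.\<close>

lemma nn_integral_lborel_dilate:
  fixes G :: "complex^'n::finite \<Rightarrow> ennreal"
  assumes [measurable]: "G \<in> borel_measurable borel" and \<zeta>: "\<zeta> \<noteq> 0" "cmod \<zeta> \<le> 1"
  shows "(\<integral>\<^sup>+w. G w \<partial>lborel) \<le> (\<integral>\<^sup>+w. G (\<zeta> *s w) \<partial>lborel)"
proof -
  define u where "u = \<zeta> / of_real (cmod \<zeta>)"
  have u: "cmod u = 1" "\<zeta> = of_real (cmod \<zeta>) * u" using \<zeta> by (auto simp: u_def norm_divide)
  have [measurable]: "(\<lambda>w::complex^'n. u *s w) \<in> borel_measurable borel"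
    by (intro borel_measurable_continuous_onI continuous_intros)
  have "distr lborel borel (\<lambda>w::complex^'n. u *s w) = lborel"
    by (rule distr_lborel_isometry)
       (auto intro!: linearI simp: norm_vector_scalar_mult u Finite_Cartesian_Product.vec_eq_iff distrib_left)
  then have "(\<integral>\<^sup>+w. G w \<partial>lborel) = (\<integral>\<^sup>+w. G w \<partial>distr lborel borel (\<lambda>w. u *s w))" by simp
  also have "\<dots> = (\<integral>\<^sup>+w. G (u *s w) \<partial>lborel)" by (rule nn_integral_distr) measurable
  also have "\<dots> = (\<integral>\<^sup>+w. G (u *s w) \<partial>density (distr lborel borel (\<lambda>x. 0 + cmod \<zeta> *\<^sub>R x)) (\<lambda>_. \<bar>cmod \<zeta>\<bar>^DIM(complex^'n)))"
    using \<zeta> by (subst lborel_affine[of "cmod \<zeta>" 0]) auto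
  also have "\<dots> = (\<integral>\<^sup>+w. ennreal (\<bar>cmod \<zeta>\<bar>^DIM(complex^'n)) * G (u *s w) \<partial>distr lborel borel (\<lambda>x. 0 + cmod \<zeta> *\<^sub>R x))"
    by (subst nn_integral_density) auto
  also have "\<dots> = (\<integral>\<^sup>+w. ennreal (\<bar>cmod \<zeta>\<bar>^DIM(complex^'n)) * G (u *s (0 + cmod \<zeta> *\<^sub>R w)) \<partial>lborel)"
    by (rule nn_integral_distr) measurable
  also have "\<dots> \<le> (\<integral>\<^sup>+w. G (\<zeta> *s w) \<partial>lborel)"
  proof (rule nn_integral_mono)
    fix w :: "complex^'n"
    have "u *s (0 + cmod \<zeta> *\<^sub>R w) = \<zeta> *s w"
    proof -
      have "\<zeta> *s w = (of_real (cmod \<zeta>) * u) *s w" using u(2) by simp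
      also have "\<dots> = u *s (0 + cmod \<zeta> *\<^sub>R w)"
        by (simp add: Finite_Cartesian_Product.vec_eq_iff scaleR_conv_of_real[where 'a = complex] mult_ac)
      finally show ?thesis by simp
    qed
    moreover have "ennreal (\<bar>cmod \<zeta>\<bar>^DIM(complex^'n)) \<le> 1"
      using \<zeta> by (simp add: power_le_one del: DIM_cart)
    then have "ennreal (\<bar>cmod \<zeta>\<bar>^DIM(complex^'n)) * G (\<zeta> *s w) \<le> 1 * G (\<zeta> *s w)"
      by (rule mult_right_mono) simp
    ultimately show "ennreal (\<bar>cmod \<zeta>\<bar>^DIM(complex^'n)) * G (u *s (0 + cmod \<zeta> *\<^sub>R w)) \<le> G (\<zeta> *s w)" by simp
  qed
  finally show ?thesis .
qed

text \<open>The square integral over a ball is averaged over the complex lines through the center: by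
  dilation invariance, the integral of F(a0 + \<zeta>w)^2 over w does not get smaller for small \<zeta>.\<close>

theorem plurisuper_square_integral:
  fixes F :: "complex^'n::finite \<Rightarrow> real"
  assumes F [measurable]: "F \<in> borel_measurable borel" and F0: "\<And>z. 0 \<le> F z" and FK: "\<And>z. F z \<le> K"
    and \<rho>: "\<rho> > 0"
    and circ: "\<And>p q. (\<And>\<zeta>. cmod \<zeta> \<le> 1 \<Longrightarrow> p + \<zeta> *s q \<in> ball a0 (8 * \<rho>)) \<Longrightarrow>
       (\<integral>\<^sup>+\<theta>. ennreal (F (p + cis \<theta> *s q)) \<partial>circ) \<le> ennreal (2 * pi * F p)"
  shows "(\<integral>\<^sup>+z. ennreal ((F z)\<^sup>2) * indicator (ball a0 (\<rho>/4)) z \<partial>lborel) * ennreal (3 * pi / 16) \<le>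
    emeasure lborel (ball (0::complex^'n) \<rho>) * ennreal (1400 * pi * (F a0)\<^sup>2)"
proof -
  \<comment> \<open>The outer radius ensures \<open>bump \<ge> 9/16\<close>. The inner radius 1/4
    ensures that \<open>\<zeta> *s w \<in> ball 0 (\<rho>/4)\<close> implies
    \<open>w \<in> ball 0 \<rho>\<close>, so that the discs of radius 8 in the directions
    \<open>w\<close> stay in the given ball.\<close>
  define Ann where "Ann = ball (0::complex) (1/2) - ball 0 (1/4)"
  have [measurable]: "Ann \<in> sets borel" by (simp add: Ann_def)
  have mAnn: "emeasure lborel Ann = ennreal (3 * pi / 16)"
  proof -
    have "emeasure lborel Ann = emeasure lborel (ball (0::complex) (1/2)) - emeasure lborel (ball (0::complex) (1/4))"
      unfolding Ann_def using emeasure_lborel_ball_finite[of "0::complex" "1/4"]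
      by (intro emeasure_Diff) (auto intro!: subset_ball)
    also have "\<dots> = ennreal (pi * (1/2)\<^sup>2) - ennreal (pi * (1/4)\<^sup>2)" by (simp add: emeasure_ball_complex)
    also have "\<dots> = ennreal (pi * (1/2)\<^sup>2 - pi * (1/4)\<^sup>2)" by (rule ennreal_minus) simp
    also have "pi * (1/2)\<^sup>2 - pi * (1/4)\<^sup>2 = 3 * pi / 16" by (simp add: power2_eq_square)
    finally show ?thesis .
  qed
  define G where "G z = ennreal ((F (a0 + z))\<^sup>2)" for z
  have [measurable]: "G \<in> borel_measurable borel" unfolding G_def by measurable
  have line: "(\<integral>\<^sup>+\<zeta>. G (\<zeta> *s w) * indicator Ann \<zeta> \<partial>lborel) \<le> ennreal (1400 * pi * (F a0)\<^sup>2)" if w: "w \<in> ball 0 \<rho>" for w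
  proof -
    define f where "f \<zeta> = F (a0 + \<zeta> *s w)" for \<zeta>
    have [measurable]: "(\<lambda>\<zeta>. \<zeta> *s w) \<in> borel_measurable borel"
      by (intro borel_measurable_continuous_onI continuous_intros)
    have fm [measurable]: "f \<in> borel_measurable borel" unfolding f_def by measurable
    interpret f: bdd_fun f K by unfold_locales (auto simp: f_def F0 FK fm)
    have "supermean f 8"
    proof (rule f.supermean_of_circles)
      fix a b :: complex assume ab: "cmod a + cmod b < 8"
      have "(\<integral>\<^sup>+\<theta>. ennreal (F ((a0 + a *s w) + cis \<theta> *s (b *s w))) \<partial>circ) \<le> ennreal (2 * pi * F (a0 + a *s w))"
      proof (rule circ)
        fix \<zeta> :: complex assume z: "cmod \<zeta> \<le> 1"
        have e: "(a0 + a *s w) + \<zeta> *s (b *s w) = a0 + (a + \<zeta> * b) *s w"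
          by (simp add: Finite_Cartesian_Product.vec_eq_iff algebra_simps)
        have "cmod (a + \<zeta> * b) \<le> cmod a + cmod \<zeta> * cmod b" by (metis norm_triangle_ineq norm_mult)
        also have "\<dots> \<le> cmod a + 1 * cmod b" using z by (intro add_left_mono mult_right_mono) auto
        finally have "cmod (a + \<zeta> * b) < 8" using ab by simp
        then have "cmod (a + \<zeta> * b) * norm w \<le> 8 * norm w" by (intro mult_right_mono) auto
        also have "\<dots> < 8 * \<rho>" using w by simp
        finally show "(a0 + a *s w) + \<zeta> *s (b *s w) \<in> ball a0 (8 * \<rho>)"
        proof -
          have d: "dist a0 (a0 + x) = norm x" for x :: "complex^'n" by (simp add: dist_norm)
          show "cmod (a + \<zeta> * b) * norm w < 8 * \<rho> \<Longrightarrow> (a0 + a *s w) + \<zeta> *s (b *s w) \<in> ball a0 (8 * \<rho>)"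
            by (simp only: e mem_ball d norm_vector_scalar_mult)
        qed
      qed
      moreover have "(a0 + a *s w) + cis \<theta> *s (b *s w) = a0 + (a + cis \<theta> * b) *s w" for \<theta>
        by (simp add: Finite_Cartesian_Product.vec_eq_iff algebra_simps)
      ultimately show "(\<integral>\<^sup>+\<theta>. ennreal (f (a + cis \<theta> * b)) \<partial>circ) \<le> ennreal (2 * pi * f a)"
        unfolding f_def by (simp only:)
    qed
    then have L: "(LINT z|lborel. bump z * (f z)\<^sup>2) \<le> 784 * pi * (f 0)\<^sup>2"
      by (rule f.supermean_square_integral)
    have int: "integrable lborel (\<lambda>z. bump z * (f z)\<^sup>2)"
    proof (rule f.integrable_bump_mult[where B = "K*K"])
      fix z show "(f z)\<^sup>2 \<le> K * K"
        unfolding power2_eq_square using f.nonneg[of z] f.le[of z] by (intro mult_mono) auto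
    qed auto
    have "(\<integral>\<^sup>+\<zeta>. G (\<zeta> *s w) * indicator Ann \<zeta> \<partial>lborel) \<le> (\<integral>\<^sup>+\<zeta>. ennreal (16/9) * ennreal (bump \<zeta> * (f \<zeta>)\<^sup>2) \<partial>lborel)"
    proof (rule nn_integral_mono)
      fix \<zeta>
      show "G (\<zeta> *s w) * indicator Ann \<zeta> \<le> ennreal (16/9) * ennreal (bump \<zeta> * (f \<zeta>)\<^sup>2)"
      proof (cases "\<zeta> \<in> Ann")
        case True
        then have "9/16 \<le> bump \<zeta>" by (intro bump_lower) (simp add: Ann_def)
        then have "9/16 * (f \<zeta>)\<^sup>2 \<le> bump \<zeta> * (f \<zeta>)\<^sup>2" by (rule mult_right_mono) simp
        then have "(f \<zeta>)\<^sup>2 \<le> 16/9 * (bump \<zeta> * (f \<zeta>)\<^sup>2)" by simp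
        then have "ennreal ((f \<zeta>)\<^sup>2) \<le> ennreal (16/9 * (bump \<zeta> * (f \<zeta>)\<^sup>2))" by (rule ennreal_leI)
        also have "\<dots> = ennreal (16/9) * ennreal (bump \<zeta> * (f \<zeta>)\<^sup>2)"
          by (rule ennreal_mult) (simp_all add: bump_nonneg)
        finally show ?thesis using True by (simp only: G_def f_def indicator_simps mult_1_right)
      qed simp
    qed
    also have "\<dots> = ennreal (16/9) * (\<integral>\<^sup>+\<zeta>. ennreal (bump \<zeta> * (f \<zeta>)\<^sup>2) \<partial>lborel)"
      by (rule nn_integral_cmult) measurable
    also have "(\<integral>\<^sup>+\<zeta>. ennreal (bump \<zeta> * (f \<zeta>)\<^sup>2) \<partial>lborel) = ennreal (LINT z|lborel. bump z * (f z)\<^sup>2)"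
      by (rule nn_integral_eq_integral[OF int]) (simp add: bump_nonneg)
    also have "ennreal (16/9) * \<dots> = ennreal (16/9 * (LINT z|lborel. bump z * (f z)\<^sup>2))"
      by (rule ennreal_mult[symmetric]) (auto intro!: integral_nonneg_AE simp: bump_nonneg)
    also have "\<dots> \<le> ennreal (1400 * pi * (F a0)\<^sup>2)"
    proof (rule ennreal_leI)
      have "f 0 = F a0" by (simp add: f_def)
      \<comment> \<open>The factor 16/9 undoes the lower bound of \<open>bump\<close> on
        \<open>Ann\<close>, and \<open>16/9 * 784\<close> is less than 1400.\<close>
      have "16/9 * (LINT z|lborel. bump z * (f z)\<^sup>2) \<le> 16/9 * (784 * (pi * (F a0)\<^sup>2))" using L \<open>f 0 = F a0\<close> by simp
      also have "\<dots> \<le> 1400 * (pi * (F a0)\<^sup>2)" by simp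
      finally show "16/9 * (LINT z|lborel. bump z * (f z)\<^sup>2) \<le> 1400 * pi * (F a0)\<^sup>2" by simp
    qed
    finally show ?thesis .
  qed
  have pb [measurable]: "Measurable.pred borel (\<lambda>x. x \<in> ball (a::complex^'n) s)" for a s by (simp add: pred_def)
  define J where "J = (\<integral>\<^sup>+w. G w * indicator (ball 0 (\<rho>/4)) w \<partial>lborel)"
  have "J * ennreal (3 * pi / 16) = (\<integral>\<^sup>+\<zeta>. J * indicator Ann \<zeta> \<partial>(lborel :: complex measure))"
    unfolding mAnn[symmetric] by (rule nn_integral_cmult_indicator[symmetric]) simp
  also have "\<dots> \<le> (\<integral>\<^sup>+\<zeta>. (\<integral>\<^sup>+w. G (\<zeta> *s w) * indicator (ball 0 \<rho>) w * indicator Ann \<zeta> \<partial>lborel) \<partial>lborel)"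
  proof (rule nn_integral_mono)
    fix \<zeta> :: complex
    show "J * indicator Ann \<zeta> \<le> (\<integral>\<^sup>+w. G (\<zeta> *s w) * indicator (ball 0 \<rho>) w * indicator Ann \<zeta> \<partial>lborel)"
    proof (cases "\<zeta> \<in> Ann")
      case True
      then have z: "1/4 \<le> cmod \<zeta>" "cmod \<zeta> \<le> 1" "\<zeta> \<noteq> 0" by (auto simp: Ann_def)
      have "J \<le> (\<integral>\<^sup>+w. G (\<zeta> *s w) * indicator (ball 0 (\<rho>/4)) (\<zeta> *s w) \<partial>lborel)"
        unfolding J_def by (rule nn_integral_lborel_dilate[of "\<lambda>w. G w * indicator (ball 0 (\<rho>/4)) w", OF _ z(3,2)]) measurable
      also have "\<dots> \<le> (\<integral>\<^sup>+w. G (\<zeta> *s w) * indicator (ball 0 \<rho>) w \<partial>lborel)"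
      proof (rule nn_integral_mono)
        fix w :: "complex^'n"
        have "w \<in> ball 0 \<rho>" if "\<zeta> *s w \<in> ball 0 (\<rho>/4)"
        proof -
          have "1/4 * norm w \<le> cmod \<zeta> * norm w" using z by (intro mult_right_mono) auto
          then show ?thesis using that by (simp add: norm_vector_scalar_mult)
        qed
        then show "G (\<zeta> *s w) * indicator (ball 0 (\<rho>/4)) (\<zeta> *s w) \<le> G (\<zeta> *s w) * indicator (ball 0 \<rho>) w"
          by (intro mult_left_mono) (auto simp: indicator_def)
      qed
      finally show ?thesis using True by simp
    qed simp
  qed
  also have "\<dots> = (\<integral>\<^sup>+w. (\<integral>\<^sup>+\<zeta>. G (\<zeta> *s w) * indicator (ball 0 \<rho>) w * indicator Ann \<zeta> \<partial>lborel) \<partial>lborel)"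
  proof (rule lborel_pair.Fubini')
    have "(\<lambda>x::(complex^'n) \<times> complex. snd x *s fst x) \<in> borel_measurable (borel \<Otimes>\<^sub>M borel)"
      unfolding borel_prod by (intro borel_measurable_continuous_onI continuous_intros)
    then show "(\<lambda>(w, \<zeta>). G (\<zeta> *s w) * indicator (ball 0 \<rho>) w * indicator Ann \<zeta>) \<in> borel_measurable (lborel \<Otimes>\<^sub>M lborel)"
      unfolding case_prod_beta' by measurable
  qed
  also have "\<dots> \<le> (\<integral>\<^sup>+w. ennreal (1400 * pi * (F a0)\<^sup>2) * indicator (ball (0::complex^'n) \<rho>) w \<partial>lborel)"
  proof (rule nn_integral_mono)
    fix w :: "complex^'n"
    show "(\<integral>\<^sup>+\<zeta>. G (\<zeta> *s w) * indicator (ball 0 \<rho>) w * indicator Ann \<zeta> \<partial>lborel) \<le> ennreal (1400 * pi * (F a0)\<^sup>2) * indicator (ball 0 \<rho>) w"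
      using line[of w] by (cases "w \<in> ball 0 \<rho>") auto
  qed
  also have "\<dots> = ennreal (1400 * pi * (F a0)\<^sup>2) * emeasure lborel (ball (0::complex^'n) \<rho>)"
    by (rule nn_integral_cmult_indicator) simp
  finally have main: "J * ennreal (3 * pi / 16) \<le> emeasure lborel (ball (0::complex^'n) \<rho>) * ennreal (1400 * pi * (F a0)\<^sup>2)"
    by (simp add: mult.commute)
  have "(\<integral>\<^sup>+z. ennreal ((F z)\<^sup>2) * indicator (ball a0 (\<rho>/4)) z \<partial>lborel) =
     (\<integral>\<^sup>+z. ennreal ((F (a0 + z))\<^sup>2) * indicator (ball a0 (\<rho>/4)) (a0 + z) \<partial>lborel)"
    by (rule lborel_nn_integral_translate[symmetric]) measurable
  also have "\<dots> = J" unfolding J_def G_def by (rule nn_integral_cong) (simp add: indicator_def dist_norm)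
  finally show ?thesis using main by simp
qed

section \<open>Local square integrability of the logarithm of the determinant\<close>

abbreviation smat :: "real \<Rightarrow> complex^'r::finite^'r" where
  "smat \<tau> \<equiv> Finite_Cartesian_Product.mat (complex_of_real \<tau>)"

lemma sesq_smat:
  fixes v w :: "complex^'a::finite"
  shows "sesq (smat \<tau>) v w = complex_of_real \<tau> * (\<Sum>i\<in>UNIV. v $ i * cnj (w $ i))"
proof -
  have "(\<Sum>j\<in>UNIV. (smat \<tau> :: complex^'a^'a) $ i $ j * v $ i * cnj (w $ j)) = complex_of_real \<tau> * (v $ i * cnj (w $ i))" for i
  proof -
    have "(\<Sum>j\<in>UNIV. (smat \<tau> :: complex^'a^'a) $ i $ j * v $ i * cnj (w $ j)) =
      (\<Sum>j\<in>UNIV. if i = j then complex_of_real \<tau> * (v $ i * cnj (w $ i)) else 0)"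
      by (rule sum.cong[OF refl]) (simp add: Finite_Cartesian_Product.mat_def)
    then show ?thesis by simp
  qed
  then show ?thesis by (simp add: sesq_def sum_distrib_left)
qed

lemma norm_sq_vec: "(norm (v :: complex^'r::finite))\<^sup>2 = Re (\<Sum>i\<in>UNIV. v $ i * cnj (v $ i))"
proof -
  have "(norm v)\<^sup>2 = (\<Sum>i\<in>UNIV. (cmod (v $ i))\<^sup>2)"
    by (simp add: norm_vec_def L2_set_def sum_nonneg)
  also have "\<dots> = (\<Sum>i\<in>UNIV. Re (v $ i * cnj (v $ i)))"
    by (simp add: complex_mult_cnj cmod_def)
  finally show ?thesis by simp
qed

lemma qf_smat: "qf (smat \<tau>) v = \<tau> * (norm v)\<^sup>2"
  unfolding qf_def sesq_smat norm_sq_vec by simp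

lemma sesq_add_matrix: "sesq (M + N) v w = sesq M v w + sesq N v w"
  by (simp add: sesq_def algebra_simps sum.distrib)

lemma qf_add_smat: "qf (M + smat \<tau>) v = qf M v + \<tau> * (norm v)\<^sup>2"
proof -
  have "qf (M + smat \<tau>) v = qf M v + qf (smat \<tau>) v" by (simp add: qf_def sesq_add_matrix)
  then show ?thesis by (simp only: qf_smat)
qed

lemma hermitian_smat: "hermitian (smat \<tau>)"
  by (auto simp: hermitian_def Finite_Cartesian_Product.mat_def)

lemma hermitian_add: "hermitian M \<Longrightarrow> hermitian N \<Longrightarrow> hermitian (M + N)"
proof -
  assume h: "hermitian M" "hermitian N"
  show ?thesis unfolding hermitian_def
  proof (intro allI)
    fix i j
    have "M $ j $ i = cnj (M $ i $ j)" "N $ j $ i = cnj (N $ i $ j)" using h unfolding hermitian_def by blast+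
    then show "(M + N) $ j $ i = cnj ((M + N) $ i $ j)" by (simp only: vector_add_component complex_cnj_add)
  qed
qed

lemma det_smat: "det (smat \<tau> :: complex^'r::finite^'r) = complex_of_real \<tau> ^ CARD('r)"
  by (subst det_diagonal) (auto simp: Finite_Cartesian_Product.mat_def)

text \<open>On a frame that is orthonormal for \<open>M\<close>, the form of
  \<open>smat \<tau>\<close> takes values at most 1, so \<open>det_ratio_le\<close> compares the two
  determinants.\<close>

lemma det_ge_power:
  fixes M :: "complex^'r::finite^'r"
  assumes herm: "hermitian M" and \<tau>: "\<tau> > 0" and low: "\<And>v. \<tau> * (norm v)\<^sup>2 \<le> qf M v"
  shows "\<tau> ^ CARD('r) \<le> Re (det M)"
proof -
  have pos: "qf M v > 0" if "v \<noteq> 0" for v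
  proof -
    have "0 < \<tau> * (norm v)\<^sup>2" using \<tau> that by simp
    then show ?thesis using low[of v] by linarith
  qed
  obtain p :: "'r \<Rightarrow> complex^'r" where p: "\<And>i j. sesq M (p i) (p j) = (if i = j then 1 else 0)"
    by (rule ex_orthonormal_frame[OF herm pos]) blast+
  have "Re (det (smat \<tau> :: complex^'r^'r)) \<le> Re (det M) * (\<Prod>i\<in>UNIV. qf (smat \<tau>) (p i))"
    by (rule det_ratio_le(1)[OF herm p hermitian_smat]) (use \<tau> in \<open>simp add: qf_smat\<close>)
  also have "\<dots> \<le> Re (det M) * 1"
  proof (rule mult_left_mono)
    show "(\<Prod>i\<in>UNIV. qf (smat \<tau>) (p i)) \<le> 1"
    proof (rule prod_le_1)
      fix i
      have "qf M (p i) = 1" by (simp add: qf_def p)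
      then show "0 \<le> qf (smat \<tau>) (p i) \<and> qf (smat \<tau>) (p i) \<le> 1"
        using low[of "p i"] \<tau> by (simp add: qf_smat)
    qed
    show "0 \<le> Re (det M)" using hadamard_det_le(2)[OF herm pos] by simp
  qed
  finally show ?thesis by (simp add: det_smat flip: of_real_power)
qed

lemma det_le_power:
  fixes M :: "complex^'r::finite^'r"
  assumes herm: "hermitian M" and pos: "\<And>v. v \<noteq> 0 \<Longrightarrow> qf M v > 0" and up: "\<And>v. qf M v \<le> K * (norm v)\<^sup>2"
  shows "Re (det M) \<le> K ^ CARD('r)"
proof -
  have "Re (det M) \<le> (\<Prod>i\<in>UNIV. Re (M $ i $ i))" by (rule hadamard_det_le(3)[OF herm pos])
  also have "\<dots> = (\<Prod>i\<in>UNIV. qf M (axis i 1))" by (simp add: qf_def)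
  also have "\<dots> \<le> (\<Prod>i\<in>(UNIV::'r set). K)"
  proof (rule prod_mono)
    fix i :: 'r
    have "axis i (1::complex) \<noteq> 0" by (simp add: axis_eq_0_iff)
    from pos[OF this] show "0 \<le> qf M (axis i 1) \<and> qf M (axis i 1) \<le> K"
      using up[of "axis i 1"] by (simp add: norm_axis)
  qed
  finally show ?thesis by simp
qed

text \<open>The submean inequality for a constant metric, so that it survives the addition of
  \<open>smat \<tau>\<close>. Since the mean of \<open>u\<close> is \<open>a 0\<close>, it follows
  by integrating \<open>|u|^2 >= 2 <u, a 0> - |a 0|^2\<close>, which is the positivity of
  \<open>|u - a 0|^2\<close>.\<close>

lemma circ_mean_norm:
  fixes a :: "nat \<Rightarrow> complex^'r::finite"
  shows "ennreal (2 * pi * (norm (a 0))\<^sup>2) \<le> (\<integral>\<^sup>+\<theta>. ennreal ((norm (\<Sum>k\<le>m. cis (real k * \<theta>) *s a k))\<^sup>2) \<partial>circ)"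
proof -
  define u where "u \<theta> = (\<Sum>k\<le>m. cis (real k * \<theta>) *s a k)" for \<theta>
  define s where "s k = sesq (smat 1) (a k) (a 0)" for k
  have inner: "v \<bullet> w = Re (sesq (smat 1) v w)" for v w :: "complex^'r"
    unfolding sesq_smat by (simp add: inner_vec_def inner_complex_def)
  have ui: "u \<theta> \<bullet> a 0 = Re (\<Sum>k\<le>m. cis (real k * \<theta>) * s k)" for \<theta>
    unfolding inner u_def sesq_sum_left sesq_scale_left s_def ..
  have ic: "integrable circ (\<lambda>\<theta>. cis (real k * \<theta>) * s k)" for k
    by (rule continuous_integrable_circ) (auto intro!: continuous_intros continuous_on_cis)
  have cu: "continuous_on UNIV u"
    unfolding u_def by (intro continuous_intros continuous_on_cis)
  have i1: "integrable circ (\<lambda>\<theta>. (norm (u \<theta>))\<^sup>2)" and i2: "integrable circ (\<lambda>\<theta>. u \<theta> \<bullet> a 0)"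
    and i3: "integrable circ (\<lambda>\<theta>. (norm (a 0))\<^sup>2)"
    by (auto intro!: continuous_integrable_circ continuous_intros cu)
  have "(LINT \<theta>|circ. (\<Sum>k\<le>m. cis (real k * \<theta>) * s k)) = (\<Sum>k\<le>m. (LINT \<theta>|circ. cis (real k * \<theta>)) * s k)"
    by (subst Bochner_Integration.integral_sum) (auto intro!: ic)
  also have "\<dots> = (\<Sum>k\<le>m. if k = 0 then 2 * pi * s 0 else 0)"
  proof (rule sum.cong[OF refl])
    fix k show "(LINT \<theta>|circ. cis (real k * \<theta>)) * s k = (if k = 0 then 2 * pi * s 0 else 0)"
      using integral_cis_circ[of "int k"] by simp
  qed
  also have "\<dots> = 2 * pi * s 0" by simp
  finally have L: "(LINT \<theta>|circ. (\<Sum>k\<le>m. cis (real k * \<theta>) * s k)) = 2 * pi * s 0" .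
  have "(LINT \<theta>|circ. u \<theta> \<bullet> a 0) = Re (LINT \<theta>|circ. (\<Sum>k\<le>m. cis (real k * \<theta>) * s k))"
    unfolding ui by (rule integral_Re) (intro Bochner_Integration.integrable_sum ic)
  also have "\<dots> = 2 * pi * (norm (a 0))\<^sup>2"
    unfolding L power2_norm_eq_inner inner by (simp add: s_def)
  finally have L2: "(LINT \<theta>|circ. u \<theta> \<bullet> a 0) = 2 * pi * (norm (a 0))\<^sup>2" .
  have "2 * pi * (norm (a 0))\<^sup>2 = (LINT \<theta>|circ. 2 * (u \<theta> \<bullet> a 0) - (norm (a 0))\<^sup>2)"
    using i2 i3 L2 measure_circ by simp
  also have "\<dots> \<le> (LINT \<theta>|circ. (norm (u \<theta>))\<^sup>2)"
  proof (rule integral_mono)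
    fix \<theta>
    have "0 \<le> (norm (u \<theta> - a 0))\<^sup>2" by simp
    also have "\<dots> = (norm (u \<theta>))\<^sup>2 - 2 * (u \<theta> \<bullet> a 0) + (norm (a 0))\<^sup>2"
      by (simp add: power2_norm_eq_inner inner_diff_left inner_diff_right inner_commute)
    finally show "2 * (u \<theta> \<bullet> a 0) - (norm (a 0))\<^sup>2 \<le> (norm (u \<theta>))\<^sup>2" by simp
  qed (use i1 i2 i3 in auto)
  finally have "ennreal (2 * pi * (norm (a 0))\<^sup>2) \<le> ennreal (LINT \<theta>|circ. (norm (u \<theta>))\<^sup>2)" by (rule ennreal_leI)
  also have "\<dots> = (\<integral>\<^sup>+\<theta>. ennreal ((norm (u \<theta>))\<^sup>2) \<partial>circ)"
    by (rule nn_integral_eq_integral[OF i1, symmetric]) simp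
  finally show ?thesis by (simp add: u_def)
qed

lemma entry_polarization:
  fixes M :: "complex^'r::finite^'r"
  assumes "hermitian M"
  shows "M $ i $ j = (of_real (qf M (axis i 1 + axis j 1)) - of_real (qf M (axis i 1 - axis j 1))
     + \<i> * of_real (qf M (axis i 1 + \<i> *s axis j 1)) - \<i> * of_real (qf M (axis i 1 - \<i> *s axis j 1))) / 4"
proof -
  have m: "v - w = v + (-1) *s w" for v w :: "complex^'r"
    by (simp add: Finite_Cartesian_Product.vec_eq_iff)
  show ?thesis
    unfolding hermitian_sesq_real[OF assms, symmetric] m
    unfolding sesq_add_left sesq_add_right sesq_scale_left sesq_scale_right sesq_axis
    by (simp add: algebra_simps)
qed

text \<open>Semicontinuity for each vector \<open>v\<close> separately. The points \<open>y\<close>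
  range over the whole space; for open \<open>S\<close> this is no restriction, as
  \<open>\<delta>\<close> can be decreased.\<close>

definition usc_forms :: "'a::metric_space set \<Rightarrow> ('a \<Rightarrow> complex^'r^'r) \<Rightarrow> bool" where
  "usc_forms S M \<longleftrightarrow> (\<forall>v. \<forall>z\<in>S. \<forall>\<epsilon>>0. \<exists>\<delta>>0. \<forall>y. dist y z < \<delta> \<longrightarrow> qf (M y) v \<le> qf (M z) v + \<epsilon>)"

text \<open>Sublevel sets of each form are open in \<open>\<Omega>\<close>, and polarization passes
  from the forms to the entries. Nothing is known outside \<open>\<Omega>\<close>, hence the
  extension by 0.\<close>

lemma borel_measurable_usc_forms:
  fixes M :: "'a::metric_space \<Rightarrow> complex^'r::finite^'r"
  assumes o: "open \<Omega>" and herm: "\<And>z. z \<in> \<Omega> \<Longrightarrow> hermitian (M z)" and usc: "usc_forms \<Omega> M"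
  shows "(\<lambda>z. (if z \<in> \<Omega> then M z else 0) $ i $ j) \<in> borel_measurable borel"
proof -
  define N where "N z = (if z \<in> \<Omega> then M z else 0)" for z
  have [measurable]: "\<Omega> \<in> sets borel" using o by simp
  have Nherm: "hermitian (N z)" for z using herm[of z] by (auto simp: N_def hermitian_def[of 0])
  have qmeas [measurable]: "(\<lambda>z. qf (N z) v) \<in> borel_measurable borel" for v
  proof (rule borel_measurableI_less)
    fix c :: real
    have op: "open {z\<in>\<Omega>. qf (M z) v < c}"
      unfolding open_dist
    proof
      fix z assume "z \<in> {z\<in>\<Omega>. qf (M z) v < c}"
      then have z: "z \<in> \<Omega>" "qf (M z) v < c" by auto
      then obtain \<delta> where \<delta>: "\<delta> > 0" "\<And>y. dist y z < \<delta> \<Longrightarrow> qf (M y) v \<le> qf (M z) v + (c - qf (M z) v)/2"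
        using usc unfolding usc_forms_def by (metis diff_gt_0_iff_gt half_gt_zero)
      obtain e where e: "e > 0" "\<And>y. dist y z < e \<Longrightarrow> y \<in> \<Omega>" using o z(1) unfolding open_dist by blast
      show "\<exists>e>0. \<forall>y. dist y z < e \<longrightarrow> y \<in> {z\<in>\<Omega>. qf (M z) v < c}"
      proof (intro exI[of _ "min \<delta> e"] conjI allI impI)
        fix y assume "dist y z < min \<delta> e"
        then show "y \<in> {z\<in>\<Omega>. qf (M z) v < c}" using e(2)[of y] \<delta>(2)[of y] z(2) by (simp add: field_simps)
      qed (use \<delta> e in simp)
    qed
    have "{z \<in> space borel. qf (N z) v < c} = {z\<in>\<Omega>. qf (M z) v < c} \<union> (if 0 < c then - \<Omega> else {})"
      by (auto simp: N_def qf_def[of 0] sesq_def[of 0])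
    also have "\<dots> \<in> sets borel" using op by (auto intro!: sets.Un borel_open)
    finally show "{z \<in> space borel. qf (N z) v < c} \<in> sets borel" .
  qed
  have emeas [measurable]: "(\<lambda>z. N z $ i $ j) \<in> borel_measurable borel" for i j
    by (subst entry_polarization[OF Nherm]) measurable
  show ?thesis using emeas[of i j] unfolding N_def .
qed

text \<open>The hypothesis on discs says that the squared norms of holomorphic sections which are
  polynomials in the coordinate of the disc have the submean property.\<close>

theorem log_det_square_integral:
  fixes M :: "complex^'n::finite \<Rightarrow> complex^'r::finite^'r" and \<rho> :: real
  assumes \<rho>: "\<rho> > 0" and K: "K \<ge> 0"
    and herm: "\<And>z. z \<in> ball a0 (8*\<rho>) \<Longrightarrow> hermitian (M z)"
    and psd: "\<And>z v. z \<in> ball a0 (8*\<rho>) \<Longrightarrow> 0 \<le> qf (M z) v"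
    and up: "\<And>z v. z \<in> ball a0 (8*\<rho>) \<Longrightarrow> qf (M z) v \<le> K * (norm v)\<^sup>2"
    and usc: "usc_forms (ball a0 (8*\<rho>)) M"
    and sub: "\<And>p q m a. q \<noteq> 0 \<Longrightarrow> (\<And>\<zeta>. cmod \<zeta> \<le> 1 \<Longrightarrow> p + \<zeta> *s q \<in> ball a0 (8*\<rho>)) \<Longrightarrow>
       ennreal (2 * pi * qf (M p) (a 0)) \<le>
       (\<integral>\<^sup>+\<theta>. ennreal (qf (M (p + cis \<theta> *s q)) (\<Sum>k\<le>m. cis (real k * \<theta>) *s a k)) \<partial>circ)"
    and nz: "\<And>v. v \<noteq> 0 \<Longrightarrow> qf (M a0) v > 0"
  shows "(\<integral>\<^sup>+z. (if Re (det (M z)) > 0 then ennreal ((real CARD('r) * ln (K+1) - ln (Re (det (M z))))\<^sup>2) else 0)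
      * indicator (ball a0 (\<rho>/4)) z \<partial>lborel) < \<infinity>"
proof -
  define \<Omega> where "\<Omega> = ball a0 (8*\<rho>)"
  define b where "b = real CARD('r) * ln (K+1)"
  define N where "N z = (if z \<in> \<Omega> then M z else 0)" for z
  \<comment> \<open>Adding \<open>smat (\<tau> k)\<close> makes all forms definite, hence
    \<open>F k\<close> bounded, while \<open>K + 1\<close> remains an upper bound for all
    \<open>k\<close>.\<close>
  define \<tau> where "\<tau> k = 1 / real (Suc k)" for k
  have \<tau>: "\<tau> k > 0" "\<tau> k \<le> 1" for k by (auto simp: \<tau>_def)
  have o: "open \<Omega>" and [measurable]: "\<Omega> \<in> sets borel" by (auto simp: \<Omega>_def)
  have Nherm: "hermitian (N z)" for z using herm[of z] by (auto simp: N_def \<Omega>_def hermitian_def[of 0])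
  have Npsd: "0 \<le> qf (N z) v" for z v using psd[of z v] by (auto simp: N_def \<Omega>_def qf_def sesq_def)
  have Nup: "qf (N z) v \<le> K * (norm v)\<^sup>2" for z v
    using up[of z v] K by (auto simp: N_def \<Omega>_def qf_def[of 0] sesq_def[of 0])
  have emeas [measurable]: "(\<lambda>z. N z $ i $ j) \<in> borel_measurable borel" for i j
    unfolding N_def using o herm usc by (intro borel_measurable_usc_forms) (auto simp: \<Omega>_def)
  define F where "F k z = (if z \<in> \<Omega> then b - ln (Re (det (N z + smat (\<tau> k)))) else 0)" for k z
  have Aherm: "hermitian (N z + smat (\<tau> k))" for z k by (intro hermitian_add Nherm hermitian_smat)
  have Alow: "\<tau> k * (norm v)\<^sup>2 \<le> qf (N z + smat (\<tau> k)) v" for z v k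
    using Npsd[of z v] by (simp add: qf_add_smat)
  have Apos: "qf (N z + smat (\<tau> k)) v > 0" if "v \<noteq> 0" for z v k
  proof -
    have "0 < \<tau> k * (norm v)\<^sup>2" using \<tau> that by simp
    then show ?thesis using Alow[of k v z] by linarith
  qed
  have Aup: "qf (N z + smat (\<tau> k)) v \<le> (K + 1) * (norm v)\<^sup>2" for z v k
  proof -
    have "\<tau> k * (norm v)\<^sup>2 \<le> 1 * (norm v)\<^sup>2" using \<tau> by (intro mult_right_mono) auto
    then show ?thesis using Nup[of z v] by (simp add: qf_add_smat distrib_right)
  qed
  have Adet: "Re (det (N z + smat (\<tau> k))) > 0" for z k by (rule hadamard_det_le(2)[OF Aherm Apos])
  have Fb: "0 \<le> b - ln (Re (det (N z + smat (\<tau> k))))" for z k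
  proof -
    have "ln (Re (det (N z + smat (\<tau> k)))) \<le> ln ((K + 1) ^ CARD('r))"
      by (rule ln_mono[OF _ Adet]) (rule det_le_power[OF Aherm Apos Aup])
    also have "\<dots> = b" using K by (simp add: b_def ln_realpow)
    finally show ?thesis by simp
  qed
  have Fb2: "b - ln (Re (det (N z + smat (\<tau> k)))) \<le> b - ln (\<tau> k ^ CARD('r))" for z k
    using det_ge_power[OF Aherm \<tau>(1) Alow] \<tau>(1)[of k] Adet by (simp del: ln_realpow)
  have Am: "(\<lambda>z. (N z + smat (\<tau> k)) $ i $ j) \<in> borel_measurable borel" for i j k
    unfolding vector_add_component by (intro borel_measurable_add emeas borel_measurable_const)
  have Fmeas: "F k \<in> borel_measurable borel" for k
  proof -
    have [measurable]: "(\<lambda>z. det (N z + smat (\<tau> k))) \<in> borel_measurable borel"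
      by (rule borel_measurable_det[OF Am])
    show ?thesis unfolding F_def by measurable
  qed
  have main: "(\<integral>\<^sup>+z. ennreal ((F k z)\<^sup>2) * indicator (ball a0 (\<rho>/4)) z \<partial>lborel) * ennreal (3 * pi / 16) \<le>
    emeasure lborel (ball (0::complex^'n) \<rho>) * ennreal (1400 * pi * (F k a0)\<^sup>2)" for k
  proof (rule plurisuper_square_integral[where F = "F k" and K = "b - ln (\<tau> k ^ CARD('r))"])
    show "F k \<in> borel_measurable borel" by (rule Fmeas)
    show "0 \<le> F k z" for z using Fb by (simp add: F_def)
    show "F k z \<le> b - ln (\<tau> k ^ CARD('r))" for z
      using Fb2[of z k] Fb[of z k] by (auto simp: F_def)
    show "\<rho> > 0" by (rule \<rho>)
    fix p q assume disc: "\<And>\<zeta>. cmod \<zeta> \<le> 1 \<Longrightarrow> p + \<zeta> *s q \<in> ball a0 (8 * \<rho>)"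
    have p: "p \<in> \<Omega>" using disc[of 0] by (simp add: \<Omega>_def)
    have pc: "p + cis \<theta> *s q \<in> \<Omega>" for \<theta> using disc[of "cis \<theta>"] by (simp add: \<Omega>_def)
    have cc: "continuous_on UNIV (\<lambda>\<theta>. p + cis \<theta> *s q)"
      by (intro continuous_intros continuous_on_cis)
    have [measurable]: "(\<lambda>\<theta>. p + cis \<theta> *s q) \<in> borel_measurable borel"
      by (rule borel_measurable_continuous_onI[OF cc])
    have "(\<integral>\<^sup>+\<theta>. ennreal (b - ln (Re (det (N (p + cis \<theta> *s q) + smat (\<tau> k))))) \<partial>circ) \<le>
       ennreal (2 * pi * (b - ln (Re (det (N p + smat (\<tau> k))))))" if q: "q \<noteq> 0"
    proof (rule log_det_submean[where c = "\<tau> k" and K = "K + 1"])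
      show "(\<lambda>\<theta>. (N (p + cis \<theta> *s q) + smat (\<tau> k)) $ i $ j) \<in> borel_measurable borel" for i j
        by (rule measurable_compose[OF _ Am]) measurable
      show "periodic (\<lambda>\<theta>. N (p + cis \<theta> *s q) + smat (\<tau> k))"
        unfolding periodic_def by (simp add: cis.ctr)
      show "hermitian (N (p + cis \<theta> *s q) + smat (\<tau> k))" for \<theta> by (rule Aherm)
      show "0 < \<tau> k" by (rule \<tau>)
      show "\<tau> k * (norm v)\<^sup>2 \<le> qf (N (p + cis \<theta> *s q) + smat (\<tau> k)) v" for \<theta> v by (rule Alow)
      show "qf (N (p + cis \<theta> *s q) + smat (\<tau> k)) v \<le> (K + 1) * (norm v)\<^sup>2" for \<theta> v by (rule Aup)
      show "hermitian (N p + smat (\<tau> k))" by (rule Aherm)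
      show "0 < qf (N p + smat (\<tau> k)) v" if "v \<noteq> 0" for v by (rule Apos[OF that])
      show "real CARD('r) * ln (K + 1) \<le> b" by (simp add: b_def)
      show "\<exists>\<delta>>0. \<forall>t. \<bar>t\<bar> < \<delta> \<longrightarrow> qf (N (p + cis (\<theta> + t) *s q) + smat (\<tau> k)) v \<le> qf (N (p + cis \<theta> *s q) + smat (\<tau> k)) v + \<epsilon>"
        if \<epsilon>: "\<epsilon> > 0" for v \<theta> \<epsilon>
      proof -
        obtain d where d: "d > 0" "\<And>y. dist y (p + cis \<theta> *s q) < d \<Longrightarrow> qf (M y) v \<le> qf (M (p + cis \<theta> *s q)) v + \<epsilon>"
          using usc pc[of \<theta>] \<epsilon> unfolding usc_forms_def \<Omega>_def by blast
        obtain \<delta> where \<delta>: "\<delta> > 0" "\<And>s. dist s \<theta> < \<delta> \<Longrightarrow> dist (p + cis s *s q) (p + cis \<theta> *s q) < d"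
          using cc d(1) unfolding continuous_on_iff by (meson UNIV_I)
        show ?thesis
        proof (intro exI[of _ \<delta>] conjI allI impI)
          fix t :: real assume "\<bar>t\<bar> < \<delta>"
          then have "dist (\<theta> + t) \<theta> < \<delta>" by (simp add: dist_norm)
          from d(2)[OF \<delta>(2)[OF this]]
          show "qf (N (p + cis (\<theta> + t) *s q) + smat (\<tau> k)) v \<le> qf (N (p + cis \<theta> *s q) + smat (\<tau> k)) v + \<epsilon>"
            using pc by (simp add: qf_add_smat N_def)
        qed (rule \<delta>)
      qed
      show "submean_polys (\<lambda>\<theta>. N (p + cis \<theta> *s q) + smat (\<tau> k)) (N p + smat (\<tau> k))"
        unfolding submean_polys_def
      proof (intro allI)
        fix m and a :: "nat \<Rightarrow> complex^'r"
        let ?u = "\<lambda>\<theta>. (\<Sum>j\<le>m. cis (real j * \<theta>) *s a j)"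
        have um: "(\<lambda>\<theta>. ?u \<theta> $ i) \<in> borel_measurable borel" for i
        proof -
          have "continuous_on UNIV (\<lambda>\<theta>. ?u \<theta>)" by (intro continuous_intros continuous_on_cis)
          then show ?thesis by (intro borel_measurable_continuous_onI continuous_on_component)
        qed
        have un: "(\<lambda>\<theta>. (norm (?u \<theta>))\<^sup>2) \<in> borel_measurable borel"
          by (intro borel_measurable_continuous_onI continuous_intros continuous_on_cis)
        have qm: "(\<lambda>\<theta>. qf (N (p + cis \<theta> *s q)) (?u \<theta>)) \<in> borel_measurable borel"
        proof (rule borel_measurable_qf[OF _ um])
          show "(\<lambda>\<theta>. N (p + cis \<theta> *s q) $ i $ j) \<in> borel_measurable borel" for i j
            by (rule measurable_compose[OF _ emeas]) measurable
        qed
        \<comment> \<open>The form splits into that of \<open>M\<close>, to which \<open>sub\<close>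
          applies, and a multiple of the squared norm, to which \<open>circ_mean_norm\<close>
          applies.\<close>
        have "ennreal (2 * pi * qf (N p + smat (\<tau> k)) (a 0)) = ennreal (2 * pi * qf (M p) (a 0)) + ennreal (\<tau> k) * ennreal (2 * pi * (norm (a 0))\<^sup>2)"
          using psd[of p "a 0"] p \<tau>[of k]
          by (simp add: qf_add_smat N_def \<Omega>_def ennreal_mult'[symmetric] ennreal_plus[symmetric] algebra_simps del: ennreal_plus)
        also have "\<dots> \<le> (\<integral>\<^sup>+\<theta>. ennreal (qf (M (p + cis \<theta> *s q)) (?u \<theta>)) \<partial>circ) + ennreal (\<tau> k) * (\<integral>\<^sup>+\<theta>. ennreal ((norm (?u \<theta>))\<^sup>2) \<partial>circ)"
          by (intro add_mono mult_left_mono sub q disc circ_mean_norm) auto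
        also have "\<dots> = (\<integral>\<^sup>+\<theta>. ennreal (qf (N (p + cis \<theta> *s q)) (?u \<theta>)) \<partial>circ) + (\<integral>\<^sup>+\<theta>. ennreal (\<tau> k) * ennreal ((norm (?u \<theta>))\<^sup>2) \<partial>circ)"
          using un pc by (subst nn_integral_cmult) (auto simp: N_def intro!: borel_measurable_circ measurable_compose[OF _ measurable_ennreal])
        also have "\<dots> = (\<integral>\<^sup>+\<theta>. ennreal (qf (N (p + cis \<theta> *s q)) (?u \<theta>)) + ennreal (\<tau> k) * ennreal ((norm (?u \<theta>))\<^sup>2) \<partial>circ)"
          using un qm by (intro nn_integral_add[symmetric]) (auto intro!: borel_measurable_times borel_measurable_circ measurable_compose[OF _ measurable_ennreal])
        also have "\<dots> = (\<integral>\<^sup>+\<theta>. ennreal (qf (N (p + cis \<theta> *s q) + smat (\<tau> k)) (?u \<theta>)) \<partial>circ)"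
          using Npsd \<tau>[of k] by (intro nn_integral_cong)
            (simp add: qf_add_smat ennreal_mult'[symmetric] ennreal_plus[symmetric] del: ennreal_plus)
        finally show "ennreal (2 * pi * qf (N p + smat (\<tau> k)) (a 0)) \<le>
          (\<integral>\<^sup>+\<theta>. ennreal (qf (N (p + cis \<theta> *s q) + smat (\<tau> k)) (?u \<theta>)) \<partial>circ)" .
      qed
    qed
    \<comment> \<open>\<open>sub\<close> excludes the degenerate disc, for which the circle mean is
      the value itself.\<close>
    moreover have "(\<integral>\<^sup>+\<theta>. ennreal (F k (p + cis \<theta> *s q)) \<partial>circ) = ennreal (2 * pi * F k p)" if "q = 0"
      using that emeasure_circ Fb p by (simp add: F_def mult.commute flip: ennreal_mult)
    ultimately show "(\<integral>\<^sup>+\<theta>. ennreal (F k (p + cis \<theta> *s q)) \<partial>circ) \<le> ennreal (2 * pi * F k p)"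
      using p pc by (cases "q = 0") (simp_all add: F_def)
  qed
  have detlim: "(\<lambda>k. Re (det (N z + smat (\<tau> k)))) \<longlonglongrightarrow> Re (det (N z))" for z
  proof -
    have t0: "\<tau> \<longlonglongrightarrow> 0" unfolding \<tau>_def using LIMSEQ_inverse_real_of_nat by (simp add: divide_inverse)
    have ent: "(\<lambda>k. (N z + smat (\<tau> k)) $ i $ j) \<longlonglongrightarrow> N z $ i $ j" for i j
    proof -
      have "(\<lambda>k. N z $ i $ j + (if i = j then complex_of_real (\<tau> k) else 0)) \<longlonglongrightarrow> N z $ i $ j + 0"
        using tendsto_of_real[OF t0, where 'a = complex] by (intro tendsto_add tendsto_const) (cases "i = j"; simp)
      then show ?thesis by (simp add: Finite_Cartesian_Product.mat_def)
    qed
    have "(\<lambda>k. det (N z + smat (\<tau> k))) \<longlonglongrightarrow> det (N z)"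
      unfolding Determinants.det_def by (intro tendsto_sum tendsto_mult tendsto_const tendsto_prod ent)
    then show ?thesis by (rule tendsto_Re)
  qed
  have Flim: "(\<lambda>k. (F k z)\<^sup>2) \<longlonglongrightarrow> (b - ln (Re (det (M z))))\<^sup>2" if "z \<in> \<Omega>" "Re (det (M z)) > 0" for z
    unfolding F_def using that detlim[of z] by (auto simp: N_def intro!: tendsto_intros)
  \<comment> \<open>Where the determinant vanishes, \<open>\<Psi>\<close> is 0. In applications this
    happens on a null set, and the pointwise comparison for Fatou's lemma is trivial there.\<close>
  define \<Psi> where Psi_def: "\<Psi> z = (if Re (det (M z)) > 0 then ennreal ((b - ln (Re (det (M z))))\<^sup>2) else 0) * indicator (ball a0 (\<rho>/4)) z" for z
  have a0: "a0 \<in> \<Omega>" using \<rho> by (simp add: \<Omega>_def)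
  \<comment> \<open>Definiteness at the center keeps the values \<open>F k a0\<close> bounded as
    \<open>\<tau> k\<close> tends to 0, which makes the estimates uniform in
    \<open>k\<close>.\<close>
  have d0: "Re (det (M a0)) > 0"
    by (rule hadamard_det_le(2)[OF herm nz]) (use \<rho> in auto)
  have "(\<integral>\<^sup>+z. \<Psi> z \<partial>lborel) \<le> (\<integral>\<^sup>+z. liminf (\<lambda>k. ennreal ((F k z)\<^sup>2) * indicator (ball a0 (\<rho>/4)) z) \<partial>lborel)"
  proof (rule nn_integral_mono)
    fix z
    show "\<Psi> z \<le> liminf (\<lambda>k. ennreal ((F k z)\<^sup>2) * indicator (ball a0 (\<rho>/4)) z)"
    proof (cases "z \<in> ball a0 (\<rho>/4) \<and> Re (det (M z)) > 0")
      case True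
      then have "z \<in> \<Omega>" using \<rho> by (auto simp: \<Omega>_def)
      then have "(\<lambda>k. ennreal ((F k z)\<^sup>2)) \<longlonglongrightarrow> ennreal ((b - ln (Re (det (M z))))\<^sup>2)"
        using True by (intro tendsto_ennrealI Flim) auto
      from lim_imp_Liminf[OF _ this] show ?thesis using True by (simp add: Psi_def)
    qed (auto simp: Psi_def)
  qed
  also have "\<dots> \<le> liminf (\<lambda>k. \<integral>\<^sup>+z. ennreal ((F k z)\<^sup>2) * indicator (ball a0 (\<rho>/4)) z \<partial>lborel)"
  proof (rule nn_integral_liminf)
    fix k
    note [measurable] = Fmeas[of k]
    have [measurable]: "Measurable.pred borel (\<lambda>x. x \<in> ball a0 (\<rho>/4))" by (simp add: pred_def)
    show "(\<lambda>z. ennreal ((F k z)\<^sup>2) * indicator (ball a0 (\<rho>/4)) z) \<in> borel_measurable lborel" by measurable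
  qed
  finally have 1: "(\<integral>\<^sup>+z. \<Psi> z \<partial>lborel) \<le> liminf (\<lambda>k. \<integral>\<^sup>+z. ennreal ((F k z)\<^sup>2) * indicator (ball a0 (\<rho>/4)) z \<partial>lborel)" .
  obtain B where B: "\<And>k. (F k a0)\<^sup>2 \<le> B"
  proof -
    have "convergent (\<lambda>k. (F k a0)\<^sup>2)" using Flim[OF a0 d0] by (auto simp: convergent_def)
    then have "Bseq (\<lambda>k. (F k a0)\<^sup>2)" by (rule convergent_imp_Bseq)
    then obtain B where "\<And>k. norm ((F k a0)\<^sup>2) \<le> B" unfolding Bseq_def by blast
    then show ?thesis using that[of B] by simp
  qed
  define V where "V = emeasure lborel (ball (0::complex^'n) \<rho>) * ennreal (1400 * pi * B)"
  have V: "V < \<infinity>" unfolding V_def using emeasure_lborel_ball_finite[of "0::complex^'n" \<rho>] by (simp add: ennreal_mult_less_top)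
  have "(\<integral>\<^sup>+z. ennreal ((F k z)\<^sup>2) * indicator (ball a0 (\<rho>/4)) z \<partial>lborel) \<le> V / ennreal (3 * pi / 16)" for k
  proof -
    have "(\<integral>\<^sup>+z. ennreal ((F k z)\<^sup>2) * indicator (ball a0 (\<rho>/4)) z \<partial>lborel) * ennreal (3 * pi / 16) \<le> V"
      unfolding V_def by (rule order_trans[OF main]) (intro mult_left_mono ennreal_leI, use B[of k] in auto)
    then have "(\<integral>\<^sup>+z. ennreal ((F k z)\<^sup>2) * indicator (ball a0 (\<rho>/4)) z \<partial>lborel) * ennreal (3 * pi / 16) / ennreal (3 * pi / 16) \<le> V / ennreal (3 * pi / 16)"
      by (rule divide_right_mono_ennreal)
    then show ?thesis by (subst (asm) ennreal_mult_divide_eq) auto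
  qed
  then have "liminf (\<lambda>k. \<integral>\<^sup>+z. ennreal ((F k z)\<^sup>2) * indicator (ball a0 (\<rho>/4)) z \<partial>lborel) \<le> V / ennreal (3 * pi / 16)"
    by (intro order_trans[OF Liminf_le_Limsup Limsup_bounded]) (auto intro!: always_eventually)
  also have "\<dots> < \<infinity>" using V by (simp add: ennreal_divide_eq_top_iff less_top[symmetric])
  finally have "(\<integral>\<^sup>+z. \<Psi> z \<partial>lborel) < \<infinity>" using 1 by (simp add: order.strict_trans1)
  then show ?thesis unfolding Psi_def b_def .
qed

section \<open>Bounds for Hermitian matrices\<close>

text \<open>Replacing the \<open>i\<close>-th basis vector by \<open>v\<close> gives a frame of
  determinant \<open>v $ i\<close>, and Hadamard's inequality in this frame bounds the determinant
  of \<open>M\<close> times the square of that component. Summing over \<open>i\<close> gives the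
  factor \<open>CARD('r)\<close>. This is a lower bound for the form without eigenvalues.\<close>

lemma det_norm_le_form:
  fixes M :: "complex^'r::finite^'r"
  assumes herm: "hermitian M" and pos: "\<And>v. v \<noteq> 0 \<Longrightarrow> qf M v > 0" and up: "\<And>v. qf M v \<le> C * (norm v)\<^sup>2"
  shows "Re (det M) * (norm v)\<^sup>2 \<le> real CARD('r) * C ^ (CARD('r) - 1) * qf M v"
proof -
  have C: "C > 0"
  proof -
    have "axis (undefined::'r) (1::complex) \<noteq> 0" by (simp add: axis_eq_0_iff)
    from pos[OF this] show ?thesis using up[of "axis undefined 1"] by (simp add: norm_axis)
  qed
  have comp: "Re (det M) * (cmod (v $ i))\<^sup>2 \<le> C ^ (CARD('r) - 1) * qf M v" for i
  proof (cases "v $ i = 0")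
    case True
    have "0 \<le> qf M v" using pos[of v] by (cases "v = 0") (auto simp: qf_def sesq_def)
    then show ?thesis using True C by simp
  next
    case False
    define p where "p j = (if j = i then v else axis j 1)" for j
    have "frame_matrix p = (\<chi> a b. if b = i then (Finite_Cartesian_Product.mat 1 *v v) $ a else Finite_Cartesian_Product.mat 1 $ a $ b)"
      unfolding matrix_vector_mul_lid
      by (simp add: frame_matrix_def p_def Finite_Cartesian_Product.vec_eq_iff axis_def Finite_Cartesian_Product.mat_def)
    then have d: "det (frame_matrix p) = v $ i"
      using cramer_lemma[where A = "Finite_Cartesian_Product.mat 1 :: complex^'r^'r" and x = v and k = i] by simp
    have inj: "frame_matrix p *v w \<noteq> 0" if "w \<noteq> 0" for w
    proof -
      have "invertible (frame_matrix p)" using d False by (simp add: invertible_det_nz)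
      then obtain Q where "Q ** frame_matrix p = Finite_Cartesian_Product.mat 1" unfolding invertible_def by blast
      then have "w = Q *v (frame_matrix p *v w)" by (simp add: matrix_vector_mul_assoc)
      then show ?thesis using that by auto
    qed
    have "Re (det (frame_gram M p)) \<le> (\<Prod>j\<in>UNIV. Re (frame_gram M p $ j $ j))"
    proof (rule hadamard_det_le(3))
      show "hermitian (frame_gram M p)" by (rule hermitian_frame_gram[OF herm])
      show "0 < qf (frame_gram M p) w" if "w \<noteq> 0" for w
        using pos[OF inj[OF that]] by (simp add: qf_def sesq_frame_gram)
    qed
    also have "\<dots> = (\<Prod>j\<in>UNIV. qf M (p j))" by (simp add: frame_gram_def qf_def)
    also have "\<dots> = qf M v * (\<Prod>j\<in>UNIV - {i}. qf M (axis j 1))"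
      by (subst prod.remove[of _ i]) (auto simp: p_def intro!: prod.cong)
    also have "\<dots> \<le> qf M v * (\<Prod>j\<in>UNIV - {i}. C)"
    proof (intro mult_left_mono prod_mono)
      show "0 \<le> qf M v" using pos[of v] False by fastforce
      fix j :: 'r
      have "axis j (1::complex) \<noteq> 0" by (simp add: axis_eq_0_iff)
      from pos[OF this] show "0 \<le> qf M (axis j 1) \<and> qf M (axis j 1) \<le> C"
        using up[of "axis j 1"] by (simp add: norm_axis)
    qed
    also have "\<dots> = qf M v * C ^ (CARD('r) - 1)" by (simp add: card_Diff_singleton)
    finally show ?thesis unfolding det_frame_gram d by (simp add: mult.commute)
  qed
  have "(norm v)\<^sup>2 = (\<Sum>i\<in>UNIV. (cmod (v $ i))\<^sup>2)" by (simp add: norm_vec_def L2_set_def sum_nonneg)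
  then have "Re (det M) * (norm v)\<^sup>2 = (\<Sum>i\<in>UNIV. Re (det M) * (cmod (v $ i))\<^sup>2)" by (simp add: sum_distrib_left)
  also have "\<dots> \<le> (\<Sum>i\<in>(UNIV::'r set). C ^ (CARD('r) - 1) * qf M v)" by (intro sum_mono comp)
  finally show ?thesis by simp
qed

text \<open>With \<open>u\<close> the phase of the entry, the difference of the forms at the sum and
  the difference of \<open>axis i 1\<close> and \<open>u *s axis j 1\<close> is four times the
  modulus. The parallelogram law for these vectors gives the same factor 4 on the right.\<close>

lemma hermitian_entry_le:
  fixes W :: "complex^'r::finite^'r"
  assumes herm: "hermitian W" and b: "\<And>v. \<bar>qf W v\<bar> \<le> B * (norm v)\<^sup>2"
  shows "cmod (W $ i $ j) \<le> B"
proof -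
  define u where "u = sgn (W $ i $ j)"
  show ?thesis
  proof (cases "W $ i $ j = 0")
    case True
    have "0 \<le> B" using b[of "axis i 1"] by (simp add: norm_axis)
    then show ?thesis using True by simp
  next
    case False
    have u1: "cmod u = 1" using False by (simp add: u_def norm_sgn)
    have uW: "W $ i $ j * cnj u = of_real (cmod (W $ i $ j))"
    proof -
      have "W $ i $ j * cnj u = (W $ i $ j * cnj (W $ i $ j)) / of_real (cmod (W $ i $ j))"
        by (simp add: u_def sgn_eq)
      also have "\<dots> = of_real ((cmod (W $ i $ j))\<^sup>2) / of_real (cmod (W $ i $ j))"
        by (simp only: complex_norm_square)
      finally show ?thesis using False by (simp add: power2_eq_square)
    qed
    have Wji: "W $ j $ i = cnj (W $ i $ j)" using herm unfolding hermitian_def by blast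
    let ?a = "axis i 1 :: complex^'r" and ?b = "u *s axis j 1 :: complex^'r"
    have m: "?a - ?b = ?a + (-1) *s ?b" by (simp add: Finite_Cartesian_Product.vec_eq_iff)
    have "qf W (?a + ?b) - qf W (?a - ?b) = 2 * Re (W $ i $ j * cnj u) + 2 * Re (u * W $ j $ i)"
      unfolding m qf_def sesq_add_left sesq_add_right sesq_scale_left sesq_scale_right sesq_axis by (simp add: algebra_simps)
    also have "Re (u * W $ j $ i) = Re (W $ i $ j * cnj u)" unfolding Wji by simp
    finally have "4 * cmod (W $ i $ j) = qf W (?a + ?b) - qf W (?a - ?b)" unfolding uW by simp
    also have "\<dots> \<le> B * (norm (?a + ?b))\<^sup>2 + B * (norm (?a - ?b))\<^sup>2"
      using b[of "?a + ?b"] b[of "?a - ?b"] by linarith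
    also have "\<dots> = B * (2 * (norm ?a)\<^sup>2 + 2 * (norm ?b)\<^sup>2)"
      by (simp add: power2_norm_eq_inner inner_add_left inner_add_right inner_diff_left inner_diff_right inner_commute algebra_simps)
    also have "\<dots> = B * 4" using u1 by (simp add: norm_axis norm_vector_scalar_mult)
    finally show ?thesis by simp
  qed
qed

text \<open>Stated for semidefinite forms because the form of a singular metric can degenerate at
  single points. The quadratic polynomial in \<open>t\<close> is the value of the form at
  \<open>t\<close> times \<open>v\<close> minus \<open>s\<close> times \<open>w\<close>.\<close>

lemma psd_cauchy_schwarz:
  fixes M :: "complex^'r::finite^'r"
  assumes herm: "hermitian M" and psd: "\<And>v. 0 \<le> qf M v"
  shows "(cmod (sesq M v w))\<^sup>2 \<le> qf M v * qf M w"
proof -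
  define s where "s = sesq M v w"
  have quad: "0 \<le> qf M v * t\<^sup>2 - 2 * (cmod s)\<^sup>2 * t + (cmod s)\<^sup>2 * qf M w" for t :: real
  proof -
    have ws: "sesq M w v = cnj s" unfolding s_def by (rule hermitian_sesq_cnj[OF herm])
    have "0 \<le> qf M (of_real t *s v + (- s) *s w)" by (rule psd)
    also have "\<dots> = Re (of_real t * of_real t * sesq M v v - of_real t * (s * cnj s) - of_real t * (s * cnj s) + (s * cnj s) * sesq M w w)"
      unfolding qf_def sesq_add_left sesq_add_right sesq_scale_left sesq_scale_right ws s_def[symmetric]
      by (simp add: algebra_simps)
    also have "s * cnj s = of_real ((cmod s)\<^sup>2)" by (simp only: complex_norm_square)
    also have "Re (of_real t * of_real t * sesq M v v - of_real t * of_real ((cmod s)\<^sup>2) - of_real t * of_real ((cmod s)\<^sup>2) + of_real ((cmod s)\<^sup>2) * sesq M w w)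
      = qf M v * t\<^sup>2 - 2 * (cmod s)\<^sup>2 * t + (cmod s)\<^sup>2 * qf M w"
      by (simp add: qf_def power2_eq_square algebra_simps)
    finally show ?thesis .
  qed
  show ?thesis
  proof (cases "s = 0")
    case True then show ?thesis using psd by (simp add: s_def)
  next
    case False
    then have s2: "(cmod s)\<^sup>2 > 0" by simp
    have qv: "qf M v > 0"
    proof (rule ccontr)
      assume "\<not> qf M v > 0"
      then have "qf M v = 0" using psd[of v] by simp
      \<comment> \<open>Without its quadratic term, the polynomial has negative slope, and it is
        already negative at \<open>qf M w + 1\<close>.\<close>
      then have "0 \<le> - 2 * (cmod s)\<^sup>2 * (qf M w + 1) + (cmod s)\<^sup>2 * qf M w" using quad[of "qf M w + 1"] by simp
      also have "\<dots> = - ((cmod s)\<^sup>2 * (qf M w + 2))" by (simp add: algebra_simps)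
      also have "\<dots> < 0" using s2 psd[of w] by (simp add: add_nonneg_pos)
      finally show False by simp
    qed
    have "0 \<le> qf M v * ((cmod s)\<^sup>2 / qf M v)\<^sup>2 - 2 * (cmod s)\<^sup>2 * ((cmod s)\<^sup>2 / qf M v) + (cmod s)\<^sup>2 * qf M w"
      by (rule quad)
    also have "\<dots> = (cmod s)\<^sup>2 * (qf M w - (cmod s)\<^sup>2 / qf M v)"
      using qv by (simp add: power2_eq_square field_simps)
    finally have "(cmod s)\<^sup>2 / qf M v \<le> qf M w" using s2 by (simp add: zero_le_mult_iff)
    then show ?thesis using qv by (simp add: s_def pos_divide_le_eq mult.commute)
  qed
qed

section \<open>The Jordan--von Neumann theorem\<close>

text \<open>Writing \<open>n * t\<close> as an integer plus a remainder in the unit interval,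
  additivity shows that \<open>n\<close> times the deviation from linearity is the deviation at the
  remainder, hence bounded independently of \<open>n\<close>.\<close>

lemma additive_bounded_linear:
  fixes f :: "real \<Rightarrow> real"
  assumes add: "\<And>s t. f (s + t) = f s + f t" and b: "\<And>t. \<bar>f t\<bar> \<le> C * \<bar>t\<bar>"
  shows "f t = t * f 1"
proof -
  have f0: "f 0 = 0" using add[of 0 0] by simp
  have fn: "f (real n * s) = real n * f s" for n s
    by (induction n) (simp_all add: f0 distrib_right add)
  have fm: "f (- s) = - f s" for s using add[of s "-s"] f0 by simp
  have fi: "f (of_int k * s) = of_int k * f s" for k s
  proof (cases "k \<ge> 0")
    case True then show ?thesis using fn[of "nat k" s] by simp
  next
    case False
    then have "f (- (of_int k * s)) = - (of_int k * f s)" using fn[of "nat (-k)" s] by simp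
    then show ?thesis using fm[of "of_int k * s"] by simp
  qed
  define D where "D = f t - t * f 1"
  have C: "0 \<le> C" using b[of 1] by simp
  have "real n * \<bar>D\<bar> \<le> C + \<bar>f 1\<bar>" for n
  proof -
    define k where "k = \<lfloor>real n * t\<rfloor>"
    define r where "r = real n * t - of_int k"
    have r: "0 \<le> r" "r \<le> 1" unfolding r_def k_def by linarith+
    have "real n * f t = f (of_int k * 1 + r)" using fn[of n t] by (simp add: r_def)
    also have "\<dots> = of_int k * f 1 + f r" unfolding add fi ..
    finally have "real n * D = f r - r * f 1" by (simp add: D_def r_def algebra_simps)
    moreover have "real n * \<bar>D\<bar> = \<bar>real n * D\<bar>" by (simp add: abs_mult)
    ultimately have "real n * \<bar>D\<bar> = \<bar>f r - r * f 1\<bar>" by (simp only:)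
    also have "\<dots> \<le> \<bar>f r\<bar> + \<bar>r * f 1\<bar>" by linarith
    also have "\<dots> \<le> C * \<bar>r\<bar> + \<bar>r\<bar> * \<bar>f 1\<bar>" using b[of r] by (simp add: abs_mult)
    also have "\<dots> \<le> C * 1 + 1 * \<bar>f 1\<bar>" using r C by (intro add_mono mult_left_mono mult_right_mono) auto
    finally show ?thesis by simp
  qed
  then have "\<bar>D\<bar> \<le> 0" using reals_Archimedean3[of "\<bar>D\<bar>"] by (metis abs_le_zero_iff abs_of_nonneg linorder_not_less not_le zero_less_abs_iff abs_ge_zero order_le_less)
  then show ?thesis by (simp add: D_def)
qed

text \<open>The parallelogram law makes the real polarization \<open>B\<close> additive. The
  triangle inequality gives the Cauchy-Schwarz bound for \<open>B\<close>, and an additive function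
  of a real variable with a linear bound is linear, which yields homogeneity over the reals.\<close>

theorem jordan_von_neumann:
  fixes q :: "complex^'r::finite \<Rightarrow> real"
  assumes nonneg: "\<And>v. 0 \<le> q v" and hom: "\<And>c v. q (c *s v) = (cmod c)\<^sup>2 * q v"
    and par: "\<And>v w. q (v + w) + q (v - w) = 2 * (q v + q w)"
    and tri: "\<And>v w. sqrt (q (v + w)) \<le> sqrt (q v) + sqrt (q w)"
  obtains M where "hermitian M" "\<And>v. qf M v = q v"
proof -
  define B where "B v w = (q (v + w) - q (v - w)) / 4" for v w
  have q0: "q 0 = 0" using hom[of 0 0] by simp
  have qm: "q (- v) = q v" for v
  proof -
    have "- v = (-1) *s v" by (simp add: Finite_Cartesian_Product.vec_eq_iff)
    then show ?thesis using hom[of "-1" v] by simp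
  qed
  have qi: "q (\<i> *s v) = q v" for v using hom[of \<i> v] by simp
  have Bsym: "B v w = B w v" for v w
    using qm[of "v - w"] by (simp add: B_def add.commute)
  have Bdiag: "B v v = q v" for v
  proof -
    have "v + v = 2 *s v" by (simp add: Finite_Cartesian_Product.vec_eq_iff)
    then show ?thesis using hom[of 2 v] by (simp add: B_def q0)
  qed
  \<comment> \<open>The parallelogram law for \<open>v + z\<close> and \<open>w\<close> minus that
    for \<open>v - z\<close> and \<open>w\<close>.\<close>
  have half: "B (v + w) z = 2 * B v z - B (v - w) z" for v w z
  proof -
    have "q (v + w + z) + q (v - w + z) = 2 * (q (v + z) + q w)"
      using par[of "v + z" w] by (simp add: algebra_simps)
    moreover have "q (v + w - z) + q (v - w - z) = 2 * (q (v - z) + q w)"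
      using par[of "v - z" w] by (simp add: algebra_simps)
    moreover have "a + b = 2 * (e + f) \<Longrightarrow> c + d = 2 * (g + f) \<Longrightarrow> (a - c) / 4 = 2 * ((e - g) / 4) - (b - d) / 4"
      for a b c d e f g :: real by (simp add: field_simps)
    ultimately show ?thesis unfolding B_def by blast
  qed
  have B0: "B 0 z = 0" for z by (simp add: B_def qm)
  have dbl: "B (v + v) z = 2 * B v z" for v z using half[of v v z] B0 by simp
  have Badd: "B (v + w) z = B v z + B w z" for v w z
  proof -
    \<comment> \<open>Half sum and half difference, so that \<open>half\<close> at \<open>x\<close>
      and \<open>y\<close> becomes an identity for \<open>v\<close> and \<open>w\<close>.\<close>
    define x y where "x = (1/2) *\<^sub>R (v + w)" and "y = (1/2) *\<^sub>R (v - w)"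
    have xy: "x + y = v" "x - y = w" "x + x = v + w"
      unfolding x_def y_def by (simp_all add: scaleR_add_right[symmetric] scaleR_diff_right[symmetric] flip: scaleR_add_left)
         (simp_all add: scaleR_add_right scaleR_diff_right flip: scaleR_add_left scaleR_2)
    have "B v z + B w z = 2 * B x z" using half[of x y z] xy by simp
    also have "\<dots> = B (v + w) z" using dbl[of x z] xy by simp
    finally show ?thesis by simp
  qed
  have Bcs: "\<bar>B v w\<bar> \<le> sqrt (q v) * sqrt (q w)" for v w
  proof -
    have 1: "q (v + w) \<le> q v + q w + 2 * (sqrt (q v) * sqrt (q w))" for v w
    proof -
      have "(sqrt (q (v + w)))\<^sup>2 \<le> (sqrt (q v) + sqrt (q w))\<^sup>2"
        by (rule power_mono[OF tri]) (simp add: nonneg)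
      then show ?thesis using nonneg by (simp add: power2_sum algebra_simps)
    qed
    have "2 * B v w = q (v + w) - q v - q w" using par[of v w] by (simp add: B_def field_simps)
    moreover have "2 * B v w = q v + q w - q (v - w)" using par[of v w] by (simp add: B_def field_simps)
    moreover have "q (v - w) \<le> q v + q w + 2 * (sqrt (q v) * sqrt (q w))" using 1[of v "- w"] qm[of w] by simp
    ultimately show ?thesis using 1[of v w] by linarith
  qed
  have Bscale: "B (complex_of_real t *s v) w = t * B v w" for t v w
  proof -
    have "(\<lambda>t. B (complex_of_real t *s v) w) t = t * (\<lambda>t. B (complex_of_real t *s v) w) 1"
    proof (rule additive_bounded_linear[where C = "sqrt (q v) * sqrt (q w)"])
      show "B (complex_of_real (s + t) *s v) w = B (complex_of_real s *s v) w + B (complex_of_real t *s v) w" for s t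
        by (simp add: Badd[symmetric] vector_sadd_rdistrib)
      show "\<bar>B (complex_of_real t *s v) w\<bar> \<le> sqrt (q v) * sqrt (q w) * \<bar>t\<bar>" for t
        using Bcs[of "complex_of_real t *s v" w] by (simp add: hom real_sqrt_mult mult_ac)
    qed
    then show ?thesis by simp
  qed
  have Bi: "B (\<i> *s v) (\<i> *s w) = B v w" for v w
    using qi[of "v + w"] qi[of "v - w"] by (simp add: B_def vector_add_ldistrib vector_ssub_ldistrib)
  have Bim: "B (\<i> *s v) w = - B v (\<i> *s w)" for v w
  proof -
    have "\<i> *s (\<i> *s v) = complex_of_real (-1) *s v" by (simp add: Finite_Cartesian_Product.vec_eq_iff)
    then have "B (\<i> *s v) w = B (complex_of_real (-1) *s v) (\<i> *s w)" using Bi[of "\<i> *s v" w] by simp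
    then show ?thesis unfolding Bscale by simp
  qed
  \<comment> \<open>The Hermitian form is recovered from its real part \<open>B\<close>; the sign of
    the second term makes it linear in the first argument.\<close>
  define h where "h v w = of_real (B v w) + \<i> * of_real (B v (\<i> *s w))" for v w
  have hadd: "h (v + v') w = h v w + h v' w" for v v' w by (simp add: h_def Badd algebra_simps)
  have hreal: "h (complex_of_real t *s v) w = of_real t * h v w" for t v w
    by (simp add: h_def Bscale algebra_simps)
  have hscale: "h (c *s v) w = c * h v w" for c v w
  proof -
    have "c *s v = complex_of_real (Re c) *s v + complex_of_real (Im c) *s (\<i> *s v)"
      by (simp add: Finite_Cartesian_Product.vec_eq_iff complex_eq_iff algebra_simps)
    then have "h (c *s v) w = of_real (Re c) * h v w + of_real (Im c) * h (\<i> *s v) w"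
      by (simp only: hadd hreal)
    also have "h (\<i> *s v) w = \<i> * h v w"
      unfolding h_def Bi by (simp add: Bim[of v w] algebra_simps)
    finally show ?thesis by (simp add: complex_eq_iff algebra_simps)
  qed
  have hcnj: "h w v = cnj (h v w)" for v w
    using Bsym[of w v] Bsym[of w "\<i> *s v"] Bim[of v w] by (simp add: h_def)
  define M where "M = (\<chi> i j. h (axis i 1) (axis j 1)) "
  have hsum: "h (\<Sum>i\<in>S. f i) w = (\<Sum>i\<in>S. h (f i) w)" if "finite S" for S :: "'r set" and f w
    using that
  proof (induction S)
    case empty show ?case using hscale[of 0 0 w] by simp
  qed (simp add: hadd)
  have exp: "h v w = (\<Sum>i\<in>UNIV. v $ i * h (axis i 1) w)" for v w
  proof -
    have "h v w = h (\<Sum>i\<in>UNIV. v $ i *s axis i 1) w" by (simp only: basis_expansion)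
    then show ?thesis by (simp only: hsum[OF finite] hscale)
  qed
  have hM: "h v w = sesq M v w" for v w
  proof -
    have "h (axis i 1) w = (\<Sum>j\<in>UNIV. cnj (w $ j) * h (axis i 1) (axis j 1))" for i
    proof -
      have "h (axis i 1) w = cnj (h w (axis i 1))" by (rule hcnj)
      also have "\<dots> = (\<Sum>j\<in>UNIV. cnj (w $ j) * cnj (h (axis j 1) (axis i 1)))" by (simp add: exp[of w])
      also have "\<dots> = (\<Sum>j\<in>UNIV. cnj (w $ j) * h (axis i 1) (axis j 1))"
        by (rule sum.cong[OF refl]) (simp only: hcnj[symmetric])
      finally show ?thesis .
    qed
    then show ?thesis unfolding exp[of v w] by (simp add: sesq_def M_def sum_distrib_left mult_ac)
  qed
  show ?thesis
  proof (rule that[of M])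
    show "hermitian M" unfolding hermitian_def M_def by (simp only: vec_lambda_beta) (intro allI hcnj)
    have "B v (\<i> *s v) = 0" for v using Bim[of v v] Bsym[of v "\<i> *s v"] by simp
    then show "qf M v = q v" for v by (simp add: qf_def hM[symmetric] h_def Bdiag)
  qed
qed

section \<open>Hermitian forms on a fiber\<close>

locale fiber =
  fixes V :: "'v cspace" and T :: "'v \<Rightarrow> complex^'r::finite"
  assumes mod: "Module.module ring_of_type_algebra V" and iso: "lin_iso V T"
begin

sublocale Module.module "ring_of_type_algebra :: complex ring" V by (rule mod)

definition Ti :: "complex^'r \<Rightarrow> 'v" where "Ti = inv_into (carrier V) T"

lemma bij: "bij_betw T (carrier V) UNIV" using iso by (simp add: lin_iso_def)

lemma inj: "inj_on T (carrier V)" using bij by (simp add: bij_betw_def)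

lemma Ti_in [simp]: "Ti x \<in> carrier V"
  unfolding Ti_def using bij by (metis UNIV_I bij_betw_def inv_into_into)

lemma T_Ti [simp]: "T (Ti x) = x"
  unfolding Ti_def using bij by (metis UNIV_I bij_betw_def f_inv_into_f)

lemma Ti_T [simp]: "a \<in> carrier V \<Longrightarrow> Ti (T a) = a"
  unfolding Ti_def using inj by simp

lemma T_add: "a \<in> carrier V \<Longrightarrow> b \<in> carrier V \<Longrightarrow> T (a \<oplus>\<^bsub>V\<^esub> b) = T a + T b"
  using iso by (simp add: lin_iso_def)

lemma T_smult: "a \<in> carrier V \<Longrightarrow> T (c \<odot>\<^bsub>V\<^esub> a) = c *s T a"
  using iso by (simp add: lin_iso_def)

lemma smult_in [simp]: "a \<in> carrier V \<Longrightarrow> c \<odot>\<^bsub>V\<^esub> a \<in> carrier V"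
  using smult_closed[of c a] by (simp add: ring_of_type_algebra_def)

lemma T_zero [simp]: "T \<zero>\<^bsub>V\<^esub> = 0"
  using T_add[of "\<zero>\<^bsub>V\<^esub>" "\<zero>\<^bsub>V\<^esub>"] by simp

lemma T_minus:
  assumes "a \<in> carrier V" "b \<in> carrier V"
  shows "T (a \<ominus>\<^bsub>V\<^esub> b) = T a - T b"
proof -
  have "T (\<ominus>\<^bsub>V\<^esub> b) + T b = T (\<ominus>\<^bsub>V\<^esub> b \<oplus>\<^bsub>V\<^esub> b)" using assms by (simp add: T_add)
  also have "\<dots> = 0" using assms by (simp add: M.l_neg)
  finally have "T (\<ominus>\<^bsub>V\<^esub> b) = - T b" by (simp add: eq_neg_iff_add_eq_0)
  then show ?thesis using assms by (simp add: a_minus_def T_add)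
qed

lemma minus_in [simp]: "a \<in> carrier V \<Longrightarrow> b \<in> carrier V \<Longrightarrow> a \<ominus>\<^bsub>V\<^esub> b \<in> carrier V"
  by (rule M.minus_closed)

lemma Ti_add: "Ti (x + y) = Ti x \<oplus>\<^bsub>V\<^esub> Ti y"
  by (rule inj_onD[OF inj]) (simp_all add: T_add)

lemma Ti_diff: "Ti (x - y) = Ti x \<ominus>\<^bsub>V\<^esub> Ti y"
  by (rule inj_onD[OF inj]) (simp_all add: T_minus)

lemma Ti_smult: "Ti (c *s x) = c \<odot>\<^bsub>V\<^esub> Ti x"
  by (rule inj_onD[OF inj]) (simp_all add: T_smult)

lemma T_eq_0_iff: "a \<in> carrier V \<Longrightarrow> T a = 0 \<longleftrightarrow> a = \<zero>\<^bsub>V\<^esub>"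
  using inj_on_eq_iff[OF inj, of a "\<zero>\<^bsub>V\<^esub>"] by simp

definition cm :: "('v \<Rightarrow> 'v \<Rightarrow> complex) \<Rightarrow> complex^'r^'r" where
  "cm h = (\<chi> i j. h (Ti (axis i 1)) (Ti (axis j 1)))"

lemma HermD:
  assumes "h \<in> Herm V"
  shows "a \<in> carrier V \<Longrightarrow> b \<in> carrier V \<Longrightarrow> c \<in> carrier V \<Longrightarrow> h (a \<oplus>\<^bsub>V\<^esub> b) c = h a c + h b c"
    "a \<in> carrier V \<Longrightarrow> b \<in> carrier V \<Longrightarrow> h (z \<odot>\<^bsub>V\<^esub> a) b = z * h a b"
    "a \<in> carrier V \<Longrightarrow> b \<in> carrier V \<Longrightarrow> h b a = cnj (h a b)"
  using assms unfolding Herm_def by blast+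

lemma hermitian_cm: assumes "h \<in> Herm V" shows "hermitian (cm h)"
  unfolding hermitian_def cm_def by (simp only: vec_lambda_beta) (intro allI HermD(3)[OF assms] Ti_in)

lemma Herm_expand:
  assumes h: "h \<in> Herm V" and a: "a \<in> carrier V" and b: "b \<in> carrier V"
  shows "h a b = sesq (cm h) (T a) (T b)"
proof -
  define k where "k x y = h (Ti x) (Ti y)" for x y
  have kadd: "k (x + x') y = k x y + k x' y" for x x' y
    by (simp add: k_def Ti_add HermD(1)[OF h])
  have kscale: "k (c *s x) y = c * k x y" for c x y
    by (simp add: k_def Ti_smult HermD(2)[OF h])
  have kcnj: "k y x = cnj (k x y)" for x y
    unfolding k_def by (rule HermD(3)[OF h]) simp_all
  have ksum: "k (\<Sum>i\<in>S. f i) y = (\<Sum>i\<in>S. k (f i) y)" if "finite S" for S :: "'r set" and f y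
    using that
  proof (induction S)
    case empty show ?case using kscale[of 0 0 y] by simp
  qed (simp add: kadd)
  have exp: "k x y = (\<Sum>i\<in>UNIV. x $ i * k (axis i 1) y)" for x y
  proof -
    have "k x y = k (\<Sum>i\<in>UNIV. x $ i *s axis i 1) y" by (simp only: basis_expansion)
    then show ?thesis by (simp only: ksum[OF finite] kscale)
  qed
  have ax: "k (axis i 1) y = (\<Sum>j\<in>UNIV. cnj (y $ j) * k (axis i 1) (axis j 1))" for i y
  proof -
    have "k (axis i 1) y = cnj (k y (axis i 1))" by (rule kcnj)
    also have "\<dots> = (\<Sum>j\<in>UNIV. cnj (y $ j) * cnj (k (axis j 1) (axis i 1)))" by (simp add: exp[of y])
    also have "\<dots> = (\<Sum>j\<in>UNIV. cnj (y $ j) * k (axis i 1) (axis j 1))"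
      by (rule sum.cong[OF refl]) (simp only: kcnj[symmetric])
    finally show ?thesis .
  qed
  have "k x y = sesq (cm h) x y" for x y
  proof -
    have "k x y = (\<Sum>i\<in>UNIV. x $ i * (\<Sum>j\<in>UNIV. cnj (y $ j) * k (axis i 1) (axis j 1)))"
      unfolding exp[of x y] by (rule sum.cong[OF refl]) (simp only: ax[of _ y, symmetric])
    then show ?thesis by (simp add: sesq_def cm_def k_def sum_distrib_left mult_ac)
  qed
  from this[of "T a" "T b"] show ?thesis using a b by (simp add: k_def)
qed

lemma Herm_of_matrix:
  assumes "hermitian M" shows "(\<lambda>a b. sesq M (T a) (T b)) \<in> Herm V"
  unfolding Herm_def
proof (rule CollectI, intro conjI ballI allI)
  show "sesq M (T b) (T a) = cnj (sesq M (T a) (T b))" for a b by (rule hermitian_sesq_cnj[OF assms])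
next
  show "sesq M (T (a \<oplus>\<^bsub>V\<^esub> b)) (T c) = sesq M (T a) (T c) + sesq M (T b) (T c)"
    if "a \<in> carrier V" "b \<in> carrier V" for a b c using that by (simp add: T_add sesq_add_left)
  show "sesq M (T (z \<odot>\<^bsub>V\<^esub> a)) (T b) = z * sesq M (T a) (T b)" if "a \<in> carrier V" for z a b
    using that by (simp add: T_smult sesq_scale_left)
qed

lemma Herm_cong:
  assumes "h \<in> Herm V" "\<And>a b. a \<in> carrier V \<Longrightarrow> b \<in> carrier V \<Longrightarrow> k a b = h a b"
  shows "k \<in> Herm V"
  unfolding Herm_def
proof (rule CollectI, intro conjI ballI allI)
  show "k b a = cnj (k a b)" if "a \<in> carrier V" "b \<in> carrier V" for a b
    unfolding assms(2)[OF that] assms(2)[OF that(2,1)] by (rule HermD(3)[OF assms(1) that])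
next
  show "k (a \<oplus>\<^bsub>V\<^esub> b) c = k a c + k b c" if "a \<in> carrier V" "b \<in> carrier V" "c \<in> carrier V" for a b c
    using that HermD(1)[OF assms(1) that] by (simp add: assms(2))
  show "k (z \<odot>\<^bsub>V\<^esub> a) b = z * k a b" if "a \<in> carrier V" "b \<in> carrier V" for z a b
    using that HermD(2)[OF assms(1) that] by (simp add: assms(2))
qed

lemma HermPos_pos:
  assumes h: "h \<in> HermPos V" and v: "v \<noteq> 0"
  shows "qf (cm h) v > 0"
proof -
  have "Ti v \<noteq> \<zero>\<^bsub>V\<^esub>" using v T_eq_0_iff[of "Ti v"] by simp
  then have "Re (h (Ti v) (Ti v)) > 0" using h unfolding HermPos_def by simp
  moreover have "h \<in> Herm V" using h by (simp add: HermPos_def)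
  ultimately show ?thesis using Herm_expand[of h "Ti v" "Ti v"] by (simp add: qf_def)
qed

lemma HermPosI:
  assumes h: "h \<in> Herm V" and pos: "\<And>v. v \<noteq> 0 \<Longrightarrow> qf (cm h) v > 0"
  shows "h \<in> HermPos V"
  unfolding HermPos_def
proof (intro CollectI conjI ballI impI h)
  fix a assume a: "a \<in> carrier V" "a \<noteq> \<zero>\<^bsub>V\<^esub>"
  then have "T a \<noteq> 0" using T_eq_0_iff by simp
  from pos[OF this] show "Re (h a a) > 0" using Herm_expand[OF h a(1) a(1)] by (simp add: qf_def)
qed

text \<open>Jordan-von Neumann in coordinates. Norms with a kernel are included, as they occur at
  exceptional points of a seminegative metric.\<close>

theorem norm_form_matrix:
  assumes N: "singular_inner_product V N" and fin: "finite_norm V N"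
  obtains M where "hermitian M" "\<And>v. qf M v = (enn2real (N (Ti v)))\<^sup>2"
    "\<And>a b. a \<in> carrier V \<Longrightarrow> b \<in> carrier V \<Longrightarrow> norm_form V N a b = sesq M (T a) (T b)"
proof -
  define n where "n v = enn2real (N (Ti v))" for v
  have Nn: "N (Ti v) = ennreal (n v)" for v
    using fin by (simp add: n_def finite_norm_def less_top)
  have n0: "0 \<le> n v" for v by (simp add: n_def)
  have hom: "n (c *s v) = cmod c * n v" for c v
  proof -
    have "ennreal (n (c *s v)) = ennreal (cmod c) * ennreal (n v)"
      using N unfolding singular_inner_product_def Nn[symmetric] Ti_smult by simp
    also have "\<dots> = ennreal (cmod c * n v)" using n0 by (simp add: ennreal_mult)
    finally show ?thesis using n0 by (simp add: ennreal_inj)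
  qed
  have tri: "n (v + w) \<le> n v + n w" for v w
  proof -
    have "N (Ti v \<oplus>\<^bsub>V\<^esub> Ti w) \<le> N (Ti v) + N (Ti w)" using N unfolding singular_inner_product_def by simp
    then have "ennreal (n (v + w)) \<le> ennreal (n v + n w)" using n0 by (simp add: Nn Ti_add[symmetric])
    then show ?thesis using n0 by (subst (asm) ennreal_le_iff) (auto intro: add_nonneg_nonneg)
  qed
  have par: "(n (v + w))\<^sup>2 + (n (v - w))\<^sup>2 = 2 * ((n v)\<^sup>2 + (n w)\<^sup>2)" for v w
  proof -
    have "(N (Ti v \<oplus>\<^bsub>V\<^esub> Ti w))\<^sup>2 + (N (Ti v \<ominus>\<^bsub>V\<^esub> Ti w))\<^sup>2 = 2 * ((N (Ti v))\<^sup>2 + (N (Ti w))\<^sup>2)"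
      using N unfolding singular_inner_product_def by simp
    then have "ennreal ((n (v + w))\<^sup>2 + (n (v - w))\<^sup>2) = ennreal (2 * ((n v)\<^sup>2 + (n w)\<^sup>2))"
      unfolding Ti_add[symmetric] Ti_diff[symmetric] Nn using n0
      by (simp add: ennreal_power ennreal_mult)
    then show ?thesis by (subst (asm) ennreal_inj) auto
  qed
  obtain M where M: "hermitian M" "\<And>v. qf M v = (n v)\<^sup>2"
  proof (rule jordan_von_neumann[of "\<lambda>v. (n v)\<^sup>2"])
    show "(n (c *s v))\<^sup>2 = (cmod c)\<^sup>2 * (n v)\<^sup>2" for c v by (simp add: hom power_mult_distrib)
    show "sqrt ((n (v + w))\<^sup>2) \<le> sqrt ((n v)\<^sup>2) + sqrt ((n w)\<^sup>2)" for v w using tri n0 by simp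
  qed (use par in auto)
  have form: "norm_form V N a b = sesq M (T a) (T b)" if a: "a \<in> carrier V" and b: "b \<in> carrier V" for a b
  proof -
    have q: "complex_of_real (enn2real ((N c)\<^sup>2)) = sesq M (T c) (T c)" if "c \<in> carrier V" for c
    proof -
      have "N c = ennreal (n (T c))" using Nn[of "T c"] that by simp
      then have "enn2real ((N c)\<^sup>2) = (n (T c))\<^sup>2" using n0 by (simp add: ennreal_power)
      then show ?thesis unfolding hermitian_sesq_real[OF M(1)] M(2) by simp
    qed
    have m: "x - y = x + (-1) *s y" for x y :: "complex^'r"
      by (simp add: Finite_Cartesian_Product.vec_eq_iff)
    have "norm_form V N a b = (sesq M (T a + T b) (T a + T b) - sesq M (T a - T b) (T a - T b)
      + \<i> * sesq M (T a + \<i> *s T b) (T a + \<i> *s T b) - \<i> * sesq M (T a - \<i> *s T b) (T a - \<i> *s T b)) / 4"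
      unfolding norm_form_def Let_def using a b by (simp add: q T_add T_minus T_smult)
    also have "\<dots> = sesq M (T a) (T b)"
      unfolding m sesq_add_left sesq_add_right sesq_scale_left sesq_scale_right by (simp add: algebra_simps)
    finally show ?thesis .
  qed
  show ?thesis
  proof (rule that[of M])
    show "qf M v = (enn2real (N (Ti v)))\<^sup>2" for v using M(2) by (simp add: n_def)
  qed (use M(1) form in auto)
qed

lemma orthonormal_expansion:
  fixes p :: "'r \<Rightarrow> complex^'r" and G :: "complex^'r^'r"
  assumes p: "\<And>i j. sesq G (p i) (p j) = (if i = j then 1 else 0)"
  shows "x = (\<Sum>i\<in>UNIV. sesq G x (p i) *s p i)"
proof -
  have "frame_gram G p = Finite_Cartesian_Product.mat 1"
    by (simp add: frame_gram_def p Finite_Cartesian_Product.mat_def)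
  then have "det G * of_real ((cmod (det (frame_matrix p)))\<^sup>2) = 1" using det_frame_gram[of G p] by simp
  then have "invertible (frame_matrix p)" by (auto simp: invertible_det_nz)
  then obtain Q where "frame_matrix p ** Q = Finite_Cartesian_Product.mat 1" unfolding invertible_def by blast
  then have "x = frame_matrix p *v (Q *v x)" by (simp add: matrix_vector_mul_assoc)
  moreover have "frame_matrix p *v y = (\<Sum>i\<in>UNIV. y $ i *s p i)" for y
    by (simp add: Finite_Cartesian_Product.vec_eq_iff matrix_vector_mult_def frame_matrix_def sum_component mult.commute)
  ultimately have x: "x = (\<Sum>i\<in>UNIV. (Q *v x) $ i *s p i)" by simp
  have "sesq G x (p j) = (Q *v x) $ j" for j
  proof -
    have "sesq G x (p j) = (\<Sum>i\<in>UNIV. (Q *v x) $ i * sesq G (p i) (p j))"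
      by (subst x) (simp only: sesq_sum_left sesq_scale_left)
    then show ?thesis by (simp add: p if_distrib[of "\<lambda>a. _ * a"] cong: if_cong)
  qed
  then show ?thesis using x by simp
qed

end

text \<open>In a frame orthonormal for \<open>\<gamma>\<close>, the endomorphism has, up to
  conjugation, the Gram matrix of \<open>w\<close> as its matrix, and \<open>b\<close> bounds its
  entries by \<open>\<beta>\<close>. Its trace is then at most \<open>r * \<beta>\<close> and the
  trace of its square at most \<open>(r * \<beta>)^2\<close> in modulus.\<close>

lemma herm_metric_le:
  fixes V :: "'v cspace" and T :: "'v \<Rightarrow> complex^'r::finite"
  assumes mod: "Module.module ring_of_type_algebra V" and iso: "lin_iso V T"
    and \<gamma>: "\<gamma> \<in> HermPos V" and w: "w \<in> Herm V"
    and b: "\<And>a. a \<in> carrier V \<Longrightarrow> \<bar>Re (w a a)\<bar> \<le> \<beta> * Re (\<gamma> a a)"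
  shows "herm_metric TYPE('r) V s \<gamma> w w \<le> (1 + \<bar>s\<bar>) * (real CARD('r) * \<beta>)\<^sup>2"
proof -
  \<comment> \<open>\<open>endo_trace\<close> reads endomorphisms in a chosen isomorphism, so the
    coordinates are those of this choice; \<open>T\<close> shows that there is one.\<close>
  define S where "S = (SOME T :: 'v \<Rightarrow> complex^'r. lin_iso V T)"
  have S: "lin_iso V S" unfolding S_def by (rule someI[where P = "lin_iso V"]) (rule iso)
  interpret fiber V S by (rule fiber.intro[OF mod S])
  have \<gamma>H: "\<gamma> \<in> Herm V" using \<gamma> by (simp add: HermPos_def)
  define G where "G = cm \<gamma>"
  define W where "W = cm w"
  have G: "hermitian G" unfolding G_def by (rule hermitian_cm[OF \<gamma>H])
  have W: "hermitian W" unfolding W_def by (rule hermitian_cm[OF w])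
  have Gpos: "qf G v > 0" if "v \<noteq> 0" for v unfolding G_def by (rule HermPos_pos[OF \<gamma> that])
  have WG: "\<bar>qf W v\<bar> \<le> \<beta> * qf G v" for v
    using b[of "Ti v"] Herm_expand[OF w, of "Ti v" "Ti v"] Herm_expand[OF \<gamma>H, of "Ti v" "Ti v"]
    by (simp add: qf_def W_def G_def)
  obtain p :: "'r \<Rightarrow> complex^'r" where p: "\<And>i j. sesq G (p i) (p j) = (if i = j then 1 else 0)"
    by (rule ex_orthonormal_frame[OF G Gpos]) blast+
  define P where "P = frame_matrix p"
  define Z where "Z = (\<chi> i l. cnj (sesq W (p i) (axis l 1)))"
  \<comment> \<open>\<open>A\<close> represents the endomorphism in the coordinates
    \<open>S\<close>. It factors through the frame, so by cyclicity its traces are those of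
    \<open>Z ** P\<close>, the conjugate of the Gram matrix of \<open>w\<close> in the
    frame.\<close>
  define A where "A = P ** Z"
  have Pv: "P *v y = (\<Sum>i\<in>UNIV. y $ i *s p i)" for y
    by (simp add: P_def Finite_Cartesian_Product.vec_eq_iff matrix_vector_mult_def frame_matrix_def sum_component mult.commute)
  have Wexp: "sesq W x y = (\<Sum>l\<in>UNIV. cnj (y $ l) * sesq W x (axis l 1))" for x y
  proof -
    have "sesq W x y = sesq W x (\<Sum>l\<in>UNIV. y $ l *s axis l 1)" by (simp only: basis_expansion)
    then show ?thesis by (simp only: sesq_sum_right sesq_scale_right)
  qed
  have Zv: "(Z *v y) $ i = cnj (sesq W (p i) y)" for y i
    unfolding Wexp[of "p i" y] by (simp add: Z_def matrix_vector_mult_def mult.commute)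
  have WA: "sesq W x y = sesq G x (A *v y)" for x y
  proof -
    have "sesq G x (A *v y) = sesq G x (\<Sum>i\<in>UNIV. (Z *v y) $ i *s p i)"
      unfolding A_def matrix_vector_mul_assoc[symmetric] Pv ..
    also have "\<dots> = (\<Sum>i\<in>UNIV. sesq W (p i) y * sesq G x (p i))"
      unfolding sesq_sum_right sesq_scale_right Zv by simp
    also have "\<dots> = sesq W (\<Sum>i\<in>UNIV. sesq G x (p i) *s p i) y"
      unfolding sesq_sum_left sesq_scale_left by (simp add: mult.commute)
    also have "\<dots> = sesq W x y" using orthonormal_expansion[OF p, of x] by simp
    finally show ?thesis by simp
  qed
  have fq: "form_quotient V \<gamma> w b = Ti (A *v S b)" if bV: "b \<in> carrier V" for b
    unfolding form_quotient_def
  proof (rule the_equality)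
    have "w a b = \<gamma> a (Ti (A *v S b))" if "a \<in> carrier V" for a
      using Herm_expand[OF w that bV] Herm_expand[OF \<gamma>H that, of "Ti (A *v S b)"] WA
      by (simp add: W_def G_def)
    then show "Ti (A *v S b) \<in> carrier V \<and> (\<forall>a\<in>carrier V. w a b = \<gamma> a (Ti (A *v S b)))" by simp
    \<comment> \<open>Uniqueness for the definite description: the form of \<open>G\<close> vanishes
      at \<open>d\<close> and is definite.\<close>
    fix c assume c: "c \<in> carrier V \<and> (\<forall>a\<in>carrier V. w a b = \<gamma> a c)"
    define d where "d = S c - A *v S b"
    have "sesq G x (S c) = sesq G x (A *v S b)" for x
    proof -
      have "sesq G x (S c) = \<gamma> (Ti x) c" using Herm_expand[OF \<gamma>H, of "Ti x" c] c by (simp add: G_def)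
      also have "\<dots> = w (Ti x) b" using c by simp
      also have "\<dots> = sesq W x (S b)" using Herm_expand[OF w, of "Ti x" b] bV by (simp add: W_def)
      finally show ?thesis using WA by simp
    qed
    then have "sesq G d (S c) = sesq G d (A *v S b)" by blast
    moreover have "S c = A *v S b + d" by (simp add: d_def)
    ultimately have "sesq G d d = 0" by (simp add: sesq_add_right)
    then have "d = 0" using Gpos[of d] by (cases "d = 0") (auto simp: qf_def)
    then have "Ti (S c) = Ti (A *v S b)" by (simp add: d_def)
    then show "c = Ti (A *v S b)" using c by simp
  qed
  have tr1: "endo_trace TYPE('r) V (form_quotient V \<gamma> w) = trace A"
  proof -
    have "S \<circ> form_quotient V \<gamma> w \<circ> inv_into (carrier V) S = (\<lambda>y. A *v y)"
      by (rule ext) (simp add: Ti_def[symmetric] fq)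
    then show ?thesis unfolding endo_trace_def S_def[symmetric] Let_def by (simp add: matrix_of_matrix_vector_mul)
  qed
  have tr2: "endo_trace TYPE('r) V (form_quotient V \<gamma> w \<circ> form_quotient V \<gamma> w) = trace (A ** A)"
  proof -
    have "S \<circ> (form_quotient V \<gamma> w \<circ> form_quotient V \<gamma> w) \<circ> inv_into (carrier V) S = (\<lambda>y. (A ** A) *v y)"
      by (rule ext) (simp add: Ti_def[symmetric] fq matrix_vector_mul_assoc)
    then show ?thesis unfolding endo_trace_def S_def[symmetric] Let_def by (simp add: matrix_of_matrix_vector_mul)
  qed
  have ZP: "(Z ** P) $ i $ j = cnj (frame_gram W p $ i $ j)" for i j
    using Wexp[of "p i" "p j"]
    by (simp add: matrix_matrix_mult_def Z_def P_def frame_matrix_def frame_gram_def mult.commute)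
  have ent: "cmod ((Z ** P) $ i $ j) \<le> \<beta>" for i j
  proof -
    have "cmod (frame_gram W p $ i $ j) \<le> \<beta>"
    proof (rule hermitian_entry_le)
      show "hermitian (frame_gram W p)" by (rule hermitian_frame_gram[OF W])
      fix v
      have "frame_gram G p = smat 1" by (simp add: frame_gram_def p Finite_Cartesian_Product.mat_def)
      then have "qf G (P *v v) = (norm v)\<^sup>2"
        using qf_smat[of 1 v] by (simp add: qf_def sesq_frame_gram P_def flip: sesq_frame_gram)
      then show "\<bar>qf (frame_gram W p) v\<bar> \<le> \<beta> * (norm v)\<^sup>2"
        using WG[of "P *v v"] by (simp add: qf_def sesq_frame_gram P_def)
    qed
    then show ?thesis by (simp add: ZP)
  qed
  have \<beta>: "0 \<le> \<beta>" using order_trans[OF norm_ge_zero ent] .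
  let ?r = "real CARD('r)"
  have t1: "cmod (trace A) \<le> ?r * \<beta>"
  proof -
    have "trace A = trace (Z ** P)" unfolding A_def by (rule trace_mul_sym)
    then have "cmod (trace A) \<le> (\<Sum>i\<in>UNIV. cmod ((Z ** P) $ i $ i))" unfolding trace_def by (simp add: norm_sum)
    also have "\<dots> \<le> (\<Sum>i\<in>(UNIV::'r set). \<beta>)" by (intro sum_mono ent)
    finally show ?thesis by simp
  qed
  have t2: "cmod (trace (A ** A)) \<le> (?r * \<beta>)\<^sup>2"
  proof -
    have "A ** A = P ** (Z ** (P ** Z))" unfolding A_def by (simp only: matrix_mul_assoc)
    also have "trace \<dots> = trace ((Z ** (P ** Z)) ** P)" by (rule trace_mul_sym)
    also have "\<dots> = trace ((Z ** P) ** (Z ** P))" by (simp only: matrix_mul_assoc)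
    finally have "trace (A ** A) = (\<Sum>i\<in>UNIV. \<Sum>k\<in>UNIV. (Z ** P) $ i $ k * (Z ** P) $ k $ i)"
      by (simp add: trace_def matrix_matrix_mult_def[of "Z ** P"])
    also have "cmod \<dots> \<le> (\<Sum>i\<in>UNIV. \<Sum>k\<in>UNIV. cmod ((Z ** P) $ i $ k * (Z ** P) $ k $ i))"
      by (intro order_trans[OF norm_sum] sum_mono norm_sum)
    also have "\<dots> \<le> (\<Sum>i\<in>(UNIV::'r set). \<Sum>k\<in>(UNIV::'r set). \<beta> * \<beta>)"
      unfolding norm_mult using \<beta> by (intro sum_mono mult_mono ent) auto
    finally show ?thesis by (simp add: power2_eq_square mult_ac)
  qed
  have "herm_metric TYPE('r) V s \<gamma> w w = Re (trace (A ** A)) + s * Re (trace A * trace A)"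
    unfolding herm_metric_def tr1 tr2 by (simp add: algebra_simps)
  also have "\<dots> \<le> cmod (trace (A ** A)) + \<bar>s\<bar> * cmod (trace A * trace A)"
  proof -
    have "s * Re (trace A * trace A) \<le> \<bar>s\<bar> * \<bar>Re (trace A * trace A)\<bar>" by (metis abs_ge_self abs_mult)
    also have "\<dots> \<le> \<bar>s\<bar> * cmod (trace A * trace A)" by (intro mult_left_mono abs_Re_le_cmod) auto
    finally show ?thesis using complex_Re_le_cmod[of "trace (A ** A)"] by linarith
  qed
  also have "\<dots> \<le> (?r * \<beta>)\<^sup>2 + \<bar>s\<bar> * (?r * \<beta>)\<^sup>2"
  proof -
    have "cmod (trace A * trace A) \<le> (?r * \<beta>)\<^sup>2"
      unfolding norm_mult power2_eq_square using t1 \<beta> by (intro mult_mono) auto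
    then show ?thesis using t2 by (intro add_mono mult_left_mono) auto
  qed
  finally show ?thesis by (simp add: algebra_simps)
qed

section \<open>Distance along a straight segment\<close>

text \<open>The straight segment is not a geodesic, but its length is logarithmic in the comparison
  constants, which is all that the square integrability of a logarithm can pay for.\<close>

theorem herm_dist_le:
  fixes V :: "'v cspace" and T :: "'v \<Rightarrow> complex^'r::finite"
  assumes mod: "Module.module ring_of_type_algebra V" and iso: "lin_iso V T"
    and h: "h \<in> HermPos V" and k: "k \<in> HermPos V"
    and c: "0 < c" "c \<le> 1" "1 \<le> C"
    and lo: "\<And>a. a \<in> carrier V \<Longrightarrow> c * Re (k a a) \<le> Re (h a a)"
    and up: "\<And>a. a \<in> carrier V \<Longrightarrow> Re (h a a) \<le> C * Re (k a a)"
  shows "herm_dist TYPE('r) V s h k \<le> ennreal (sqrt (1 + \<bar>s\<bar>) * real CARD('r) * (ln C - ln c))"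
proof -
  interpret fiber V T by (rule fiber.intro[OF mod iso])
  have hH: "h \<in> Herm V" and kH: "k \<in> Herm V" using h k by (auto simp: HermPos_def)
  define \<gamma> where "\<gamma> t a b = of_real (1 - t) * h a b + of_real t * k a b" for t a b
  define w where "w a b = k a b - h a b" for a b
  have deriv: "((\<lambda>u. \<gamma> u a b) has_vector_derivative w a b) (at t)" for t a b
    unfolding \<gamma>_def w_def by (auto intro!: derivative_eq_intros simp: has_vector_derivative_def scaleR_conv_of_real algebra_simps)
  have k0: "0 \<le> Re (k a a)" and h0: "0 \<le> Re (h a a)" if "a \<in> carrier V" for a
  proof -
    show "0 \<le> Re (k a a)"
    proof (cases "a = \<zero>\<^bsub>V\<^esub>")
      case True
      then show ?thesis using Herm_expand[OF kH that that] by (simp add: sesq_def)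
    next
      case False then show ?thesis using k that unfolding HermPos_def by (simp add: less_imp_le)
    qed
    then show "0 \<le> Re (h a a)" using lo[OF that] c by (smt (verit) mult_nonneg_nonneg)
  qed
  have wH: "w \<in> Herm V"
    unfolding Herm_def
  proof (rule CollectI, intro conjI ballI allI)
    show "w b a = cnj (w a b)" if "a \<in> carrier V" "b \<in> carrier V" for a b
      unfolding w_def HermD(3)[OF hH that] HermD(3)[OF kH that] by simp
  next
    show "w (a \<oplus>\<^bsub>V\<^esub> b) c = w a c + w b c" if "a \<in> carrier V" "b \<in> carrier V" "c \<in> carrier V" for a b c
      unfolding w_def HermD(1)[OF hH that] HermD(1)[OF kH that] by simp
    show "w (z \<odot>\<^bsub>V\<^esub> a) b = z * w a b" if "a \<in> carrier V" "b \<in> carrier V" for z a b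
      unfolding w_def HermD(2)[OF hH that] HermD(2)[OF kH that] by (simp add: algebra_simps)
  qed
  have \<gamma>H: "\<gamma> t \<in> Herm V" for t
    unfolding Herm_def
  proof (rule CollectI, intro conjI ballI allI)
    show "\<gamma> t b a = cnj (\<gamma> t a b)" if "a \<in> carrier V" "b \<in> carrier V" for a b
      unfolding \<gamma>_def HermD(3)[OF hH that] HermD(3)[OF kH that] by simp
  next
    show "\<gamma> t (a \<oplus>\<^bsub>V\<^esub> b) c = \<gamma> t a c + \<gamma> t b c" if "a \<in> carrier V" "b \<in> carrier V" "c \<in> carrier V" for a b c
      unfolding \<gamma>_def HermD(1)[OF hH that] HermD(1)[OF kH that] by (simp add: algebra_simps)
    show "\<gamma> t (z \<odot>\<^bsub>V\<^esub> a) b = z * \<gamma> t a b" if "a \<in> carrier V" "b \<in> carrier V" for z a b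
      unfolding \<gamma>_def HermD(2)[OF hH that] HermD(2)[OF kH that] by (simp add: algebra_simps)
  qed
  have Re\<gamma>: "Re (\<gamma> t a a) = (1 - t) * Re (h a a) + t * Re (k a a)" for t a by (simp add: \<gamma>_def)
  have \<gamma>pos: "\<gamma> t \<in> HermPos V" if t: "t \<in> {0..1}" for t
    unfolding HermPos_def
  proof (intro CollectI conjI ballI impI \<gamma>H)
    fix a assume a: "a \<in> carrier V" "a \<noteq> \<zero>\<^bsub>V\<^esub>"
    have "Re (h a a) > 0" "Re (k a a) > 0" using h k a unfolding HermPos_def by auto
    then show "Re (\<gamma> t a a) > 0" unfolding Re\<gamma> using t
      by (cases "t = 0") (auto intro!: add_nonneg_pos mult_nonneg_nonneg)
  qed
  have curve: "herm_curve V h k \<gamma>"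
    unfolding herm_curve_def
  proof (intro conjI ballI \<gamma>pos)
    fix a b
    have "(\<lambda>t. \<gamma> t a b) C1_differentiable_on {0..1}"
      unfolding C1_differentiable_on_def using deriv by (intro exI[of _ "\<lambda>_. w a b"]) auto
    then show "(\<lambda>t. \<gamma> t a b) piecewise_C1_differentiable_on {0..1}" by (rule C1_differentiable_imp_piecewise)
  qed (auto simp: \<gamma>_def)
  \<comment> \<open>On values at a vector, \<open>lo\<close> gives
    \<open>k - h <= (1 - c) * k\<close> and \<open>\<gamma> t >= ((1 - t) * c + t) * k\<close>;
    \<open>up\<close> gives \<open>h - k <= (1 - 1/C) * h\<close> and
    \<open>\<gamma> t >= ((1 - t) + t/C) * h\<close>. The two quotients bound the velocity from
    either side, and their sum is an integrand with an explicit primitive.\<close>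
  define \<beta> where "\<beta> t = (C - 1) / ((1 - t) * C + t) + (1 - c) / ((1 - t) * c + t)" for t :: real
  have pos: "(1 - t) * C + t > 0" "(1 - t) * c + t > 0" if "t \<in> {0..1}" for t
    using that c by (cases "t = 0"; auto intro!: add_nonneg_pos mult_nonneg_nonneg)+
  have \<beta>0: "0 \<le> \<beta> t" if "t \<in> {0..1}" for t
    unfolding \<beta>_def using pos[OF that] c by (intro add_nonneg_nonneg divide_nonneg_pos) auto
  have wb: "\<bar>Re (w a a)\<bar> \<le> \<beta> t * Re (\<gamma> t a a)" if t: "t \<in> {0..1}" and a: "a \<in> carrier V" for t a
  proof -
    let ?h = "Re (h a a)" and ?k = "Re (k a a)"
    note p = pos[OF t]
    have 1: "?k - ?h \<le> (1 - c) / ((1 - t) * c + t) * Re (\<gamma> t a a)"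
    proof -
      have "((1 - t) * c + t) * ?k \<le> Re (\<gamma> t a a)"
        unfolding Re\<gamma> using mult_left_mono[OF lo[OF a], of "1 - t"] t by (simp add: algebra_simps)
      then have "(1 - c) * (((1 - t) * c + t) * ?k) \<le> (1 - c) * Re (\<gamma> t a a)" using c by (intro mult_left_mono) auto
      then have "(1 - c) * ?k \<le> (1 - c) / ((1 - t) * c + t) * Re (\<gamma> t a a)"
        using p by (simp add: pos_le_divide_eq mult_ac)
      then show ?thesis using lo[OF a] by (simp add: algebra_simps)
    qed
    have 2: "?h - ?k \<le> (C - 1) / ((1 - t) * C + t) * Re (\<gamma> t a a)"
    proof -
      have "((1 - t) * C + t) * ?h \<le> C * Re (\<gamma> t a a)"
        unfolding Re\<gamma> using mult_left_mono[OF up[OF a], of t] t by (simp add: algebra_simps)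
      then have "(C - 1) * (((1 - t) * C + t) * ?h) \<le> (C - 1) * (C * Re (\<gamma> t a a))" using c by (intro mult_left_mono) auto
      then have "(C - 1) * ?h \<le> C * ((C - 1) / ((1 - t) * C + t) * Re (\<gamma> t a a))"
        using p by (simp add: pos_le_divide_eq mult_ac)
      moreover have "C * (?h - ?k) \<le> (C - 1) * ?h" using up[OF a] by (simp add: algebra_simps)
      ultimately have "C * (?h - ?k) \<le> C * ((C - 1) / ((1 - t) * C + t) * Re (\<gamma> t a a))" by linarith
      then show ?thesis using c by (subst (asm) mult_le_cancel_left_pos) auto
    qed
    have g: "0 \<le> Re (\<gamma> t a a)" unfolding Re\<gamma> using t h0[OF a] k0[OF a] by simp
    have "0 \<le> (C - 1) / ((1 - t) * C + t) * Re (\<gamma> t a a)" "0 \<le> (1 - c) / ((1 - t) * c + t) * Re (\<gamma> t a a)"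
      using p c g by (auto intro!: mult_nonneg_nonneg divide_nonneg_pos)
    then show ?thesis using 1 2 unfolding w_def \<beta>_def distrib_right by (simp add: abs_le_iff)
  qed
  let ?D = "sqrt (1 + \<bar>s\<bar>) * real CARD('r)"
  have metric: "sqrt (herm_metric TYPE('r) V s (\<gamma> t) w w) \<le> ?D * \<beta> t" if t: "t \<in> {0..1}" for t
  proof -
    have "herm_metric TYPE('r) V s (\<gamma> t) w w \<le> (1 + \<bar>s\<bar>) * (real CARD('r) * \<beta> t)\<^sup>2"
      by (rule herm_metric_le[OF mod iso \<gamma>pos[OF t] wH wb[OF t]])
    then have "sqrt (herm_metric TYPE('r) V s (\<gamma> t) w w) \<le> sqrt ((1 + \<bar>s\<bar>) * (real CARD('r) * \<beta> t)\<^sup>2)" by simp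
    also have "\<dots> = ?D * \<beta> t" using \<beta>0[OF t] by (simp add: real_sqrt_mult)
    finally show ?thesis .
  qed
  \<comment> \<open>A primitive of \<open>\<beta>\<close> with \<open>L 1 = 0\<close> and
    \<open>L 0 = ln c - ln C\<close>.\<close>
  define L where "L t = ln ((1 - t) * c + t) - ln ((1 - t) * C + t)" for t
  have dL: "(L has_real_derivative \<beta> t) (at t)" if "t \<in> {0..1}" for t
    unfolding L_def \<beta>_def using pos[OF that] by (auto intro!: derivative_eq_intros simp: diff_divide_distrib)
  have "herm_dist TYPE('r) V s h k \<le> herm_curve_length TYPE('r) V s \<gamma>"
    unfolding herm_dist_def by (rule INF_lower) (simp add: curve)
  also have "\<dots> = (\<integral>\<^sup>+t\<in>{0..1}. ennreal (sqrt (herm_metric TYPE('r) V s (\<gamma> t) w w)) \<partial>lborel)"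
  proof -
    have "(\<lambda>a b. vector_derivative (\<lambda>u. \<gamma> u a b) (at t)) = w" for t
      using deriv by (intro ext vector_derivative_at)
    then show ?thesis unfolding herm_curve_length_def Let_def by simp
  qed
  also have "\<dots> \<le> (\<integral>\<^sup>+t. ennreal (?D * \<beta> t) * indicator {0..1} t \<partial>lborel)"
    by (intro nn_integral_mono) (auto simp: indicator_def intro!: ennreal_leI metric)
  also have "\<dots> = ennreal (?D * L 1 - ?D * L 0)"
  proof (rule nn_integral_FTC_Icc)
    have "\<beta> \<in> borel_measurable borel" unfolding \<beta>_def by measurable
    then show "(\<lambda>t. ?D * \<beta> t) \<in> borel_measurable borel" by measurable
    show "((\<lambda>t. ?D * L t) has_real_derivative ?D * \<beta> t) (at t)" if "t \<in> {0..1}" for t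
      by (rule DERIV_cmult[OF dL[OF that]])
    show "0 \<le> ?D * \<beta> t" if "t \<in> {0..1}" for t using \<beta>0[OF that] by (auto intro!: mult_nonneg_nonneg)
  qed simp
  also have "?D * L 1 - ?D * L 0 = ?D * (ln C - ln c)" by (simp add: L_def algebra_simps)
  finally show ?thesis .
qed

section \<open>Plurisubharmonic functions\<close>

lemma ennreal_log_less_iff: "ennreal_log x < ennreal_log y \<longleftrightarrow> x < y"
  by (cases x rule: ennreal_cases; cases y rule: ennreal_cases)
     (auto simp: ennreal_log_def ennreal_eq_0_iff ennreal_less_iff top.not_eq_extremum[symmetric])

text \<open>The tangent inequality \<open>P * (ln x + 1 - ln P) <= x\<close>, with the negative
  parts moved to the other side so that it makes sense in \<open>ennreal\<close> and covers the
  values 0 and infinity of \<open>x\<close>.\<close>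

lemma ereal_ln_bound:
  fixes x :: ennreal and P :: real
  assumes P: "P > 0"
  defines "F \<equiv> ennreal_log x" and "k \<equiv> 1 - ln P"
  shows "ennreal P * e2ennreal F + ennreal (P * max 0 k) \<le> x + ennreal P * e2ennreal (- F) + ennreal (P * max 0 (- k))"
proof -
  consider "x = 0" | "x = \<infinity>" | y where "x = ennreal y" "y > 0"
    by (cases x rule: ennreal_cases) (auto simp: ennreal_eq_0_iff, metis ennreal_0 order_le_less)
  then show ?thesis
  proof cases
    case 1
    then have "e2ennreal (- F) = \<infinity>" by (simp add: F_def ennreal_log_def e2ennreal_infty)
    then show ?thesis using P by (simp add: ennreal_mult_top)
  next
    case 2 then show ?thesis by simp
  next
    case 3
    have F: "F = ereal (ln y)" using 3 by (simp add: F_def ennreal_log_def ennreal_eq_0_iff)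
    have m: "ennreal t = ennreal (max 0 t)" for t by (cases "0 \<le> t") (auto simp: max_def ennreal_neg)
    have e: "e2ennreal F = ennreal (max 0 (ln y))" "e2ennreal (- F) = ennreal (max 0 (- ln y))"
      unfolding F uminus_ereal.simps e2ennreal_ereal by (rule m)+
    have "ln (y / P) \<le> y / P - 1" using P 3 by (intro ln_le_minus_one) auto
    then have "P * (ln y + k) \<le> y" using P 3 by (simp add: ln_div k_def field_simps)
    moreover have "ln y = max 0 (ln y) - max 0 (- ln y)" "k = max 0 k - max 0 (-k)" by auto
    ultimately have "P * (max 0 (ln y) - max 0 (- ln y) + (max 0 k - max 0 (-k))) \<le> y" by metis
    then have "P * max 0 (ln y) + P * max 0 k \<le> y + P * max 0 (- ln y) + P * max 0 (- k)" by (simp add: algebra_simps)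
    then have "ennreal (P * max 0 (ln y) + P * max 0 k) \<le> ennreal (y + P * max 0 (- ln y) + P * max 0 (- k))" by (rule ennreal_leI)
    then show ?thesis unfolding e using P 3 by (simp add: ennreal_plus ennreal_mult)
  qed
qed

lemma e2ennreal_log_le: "e2ennreal (ennreal_log x) \<le> x"
proof -
  consider "x = 0" | "x = \<infinity>" | y where "x = ennreal y" "y > 0"
    by (cases x rule: ennreal_cases) (auto simp: ennreal_eq_0_iff, metis ennreal_0 order_le_less)
  then show ?thesis
  proof cases
    case 3
    have "e2ennreal (ennreal_log x) = ennreal (ln y)"
      using 3 by (simp add: ennreal_log_def ennreal_eq_0_iff e2ennreal_ereal)
    then show ?thesis using 3 ln_bound[of y] by (simp add: ennreal_leI)
  qed (auto simp: ennreal_log_def e2ennreal_neg)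
qed

text \<open>Jensen's inequality, proved by replacing exp with its tangent at log (n p).\<close>

theorem psh_exp_submean:
  fixes n :: "complex^'n::finite \<Rightarrow> ennreal"
  assumes psh: "psh_on S (\<lambda>z. ennreal_log (n z))" and S: "open S"
    and disc: "\<And>\<zeta>. cmod \<zeta> \<le> 1 \<Longrightarrow> p + \<zeta> *s q \<in> S"
  shows "ennreal (2 * pi) * n p \<le> (\<integral>\<^sup>+\<theta>. n (p + cis \<theta> *s q) \<partial>circ)"
proof -
  define F where "F \<theta> = ennreal_log (n (p + cis \<theta> *s q))" for \<theta>
  have inS: "p + cis \<theta> *s q \<in> S" for \<theta> using disc[of "cis \<theta>"] by simp
  have pS: "p \<in> S" using disc[of 0] by simp
  have cont: "continuous_on UNIV (\<lambda>\<theta>. p + cis \<theta> *s q)" by (intro continuous_intros continuous_on_cis)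
  have Fm: "F \<in> borel_measurable borel"
  proof (rule borel_measurableI_less)
    fix c
    have "openin (top_of_set S) {z\<in>S. ennreal_log (n z) < c}" using psh unfolding psh_on_def by blast
    then have "open {z\<in>S. ennreal_log (n z) < c}" using S openin_open_trans by blast
    then have "open ((\<lambda>\<theta>. p + cis \<theta> *s q) -` {z\<in>S. ennreal_log (n z) < c})"
      by (rule open_vimage[OF _ cont])
    also have "(\<lambda>\<theta>. p + cis \<theta> *s q) -` {z\<in>S. ennreal_log (n z) < c} = {\<theta> \<in> space borel. F \<theta> < c}"
      using inS by (auto simp: F_def)
    finally show "{\<theta> \<in> space borel. F \<theta> < c} \<in> sets borel" by simp
  qed
  have Fm': "F \<in> borel_measurable circ" by (rule borel_measurable_circ[OF Fm])
  define Ip where "Ip = (\<integral>\<^sup>+\<theta>. e2ennreal (F \<theta>) \<partial>circ)"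
  define Im where "Im = (\<integral>\<^sup>+\<theta>. e2ennreal (- F \<theta>) \<partial>circ)"
  define J where "J = (\<integral>\<^sup>+\<theta>. n (p + cis \<theta> *s q) \<partial>circ)"
  have sub: "ennreal_log (n p) \<le> (enn2ereal Ip - enn2ereal Im) / ereal (2*pi)"
    using psh disc unfolding psh_on_def ereal_integral_def Ip_def Im_def F_def circ_def by blast
  have np: "n p \<noteq> \<infinity>" using psh pS unfolding psh_on_def ennreal_log_def by fastforce
  show ?thesis
  proof (cases "n p = 0 \<or> J = \<infinity>")
    case True then show ?thesis by (auto simp: J_def)
  next
    case False
    define P where "P = enn2real (n p)"
    have P: "n p = ennreal P" "P > 0"
      using np False unfolding P_def by (simp_all add: less_top enn2real_positive_iff zero_less_iff_neq_zero)
    obtain j where j: "J = ennreal j" "j \<ge> 0" using False by (cases J rule: ennreal_cases) auto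
    have "Ip \<le> J" unfolding Ip_def J_def F_def by (intro nn_integral_mono e2ennreal_log_le)
    then obtain ip where ip: "Ip = ennreal ip" "ip \<ge> 0" using j by (cases Ip rule: ennreal_cases) (auto simp: top_unique)
    have lp: "ennreal_log (n p) = ereal (ln P)" using P by (simp add: ennreal_log_def ennreal_eq_0_iff)
    \<comment> \<open>If the negative part had infinite integral, the circle mean would be minus
      infinity, below the finite value \<open>ln P\<close> at the center.\<close>
    obtain im where im: "Im = ennreal im" "im \<ge> 0"
    proof (cases Im rule: ennreal_cases)
      case top
      then show ?thesis using sub lp ip by (simp add: ereal_divide_eq)
    qed (use that in auto)
    have "ereal (ln P) \<le> ereal ((ip - im) / (2*pi))" using sub lp ip im by simp
    then have s: "2 * pi * ln P \<le> ip - im" by (simp add: field_simps)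
    define k where "k = 1 - ln P"
    have "ennreal P * Ip + ennreal (2 * pi * (P * max 0 k)) =
       (\<integral>\<^sup>+\<theta>. ennreal P * e2ennreal (F \<theta>) + ennreal (P * max 0 k) \<partial>circ)"
      unfolding Ip_def using Fm' emeasure_circ P
      by (subst nn_integral_add) (auto simp: nn_integral_cmult ennreal_mult'[symmetric] mult.commute)
    also have "\<dots> \<le> (\<integral>\<^sup>+\<theta>. n (p + cis \<theta> *s q) + ennreal P * e2ennreal (- F \<theta>) + ennreal (P * max 0 (- k)) \<partial>circ)"
      unfolding F_def k_def by (intro nn_integral_mono ereal_ln_bound P)
    also have "\<dots> = J + ennreal P * Im + ennreal (2 * pi * (P * max 0 (- k)))"
    proof -
      have "(\<lambda>\<theta>. n (p + cis \<theta> *s q)) \<in> borel_measurable circ"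
      proof (rule borel_measurable_circ, rule borel_measurableI_less)
        fix c :: ennreal
        have "{\<theta> \<in> space borel. n (p + cis \<theta> *s q) < c} = {\<theta> \<in> space borel. F \<theta> < ennreal_log c}"
          by (simp add: F_def ennreal_log_less_iff)
        also have "\<dots> \<in> sets borel" using Fm by simp
        finally show "{\<theta> \<in> space borel. n (p + cis \<theta> *s q) < c} \<in> sets borel" .
      qed
      then show ?thesis
        unfolding J_def Im_def using Fm' emeasure_circ P
        by (subst nn_integral_add, simp, simp, subst nn_integral_add)
           (auto simp: nn_integral_cmult ennreal_mult'[symmetric] mult.commute)
    qed
    finally have "ennreal (P * ip + 2 * pi * (P * max 0 k)) \<le> ennreal (j + P * im + 2 * pi * (P * max 0 (- k)))"
      using P ip im j by (simp add: ennreal_plus ennreal_mult)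
    then have "P * ip + 2 * pi * (P * max 0 k) \<le> j + P * im + 2 * pi * (P * max 0 (- k))"
      using P im j by (subst (asm) ennreal_le_iff) (auto intro!: add_nonneg_nonneg mult_nonneg_nonneg)
    moreover have "max 0 k - max 0 (-k) = k" by auto
    ultimately have "P * (ip - im) + 2 * pi * P * (max 0 k - max 0 (-k)) \<le> j" by (simp add: algebra_simps)
    then have "P * (ip - im) + 2 * pi * P * k \<le> j" using \<open>max 0 k - max 0 (-k) = k\<close> by simp
    moreover have "P * (2 * pi * ln P) \<le> P * (ip - im)" using s P by (intro mult_left_mono) auto
    ultimately have "2 * pi * P \<le> j" by (simp add: k_def algebra_simps)
    then have "ennreal (2 * pi * P) \<le> ennreal j" by (rule ennreal_leI)
    then show ?thesis unfolding J_def[symmetric] j P by (simp add: ennreal_mult')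
  qed
qed

section \<open>Holomorphic functions\<close>

text \<open>A scalar version of \<open>holo_on\<close> at a single point, suited to sums and
  products; \<open>holo_onI\<close> returns to vector functions componentwise.\<close>

definition holo_at :: "complex^'n::finite \<Rightarrow> (complex^'n \<Rightarrow> complex) \<Rightarrow> bool" where
  "holo_at z f \<longleftrightarrow> (\<exists>D. (f has_derivative D) (at z) \<and> (\<forall>c v. D (c *s v) = c * D v))"

lemma holo_at_const: "holo_at z (\<lambda>_. a)"
  unfolding holo_at_def by (rule exI[of _ "\<lambda>_. 0"]) simp

lemma holo_at_add: "holo_at z f \<Longrightarrow> holo_at z g \<Longrightarrow> holo_at z (\<lambda>x. f x + g x)"
  unfolding holo_at_def
  by (elim exE, rule_tac x = "\<lambda>v. D v + Da v" in exI) (auto intro!: has_derivative_add simp: distrib_left)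

lemma holo_at_mult: "holo_at z f \<Longrightarrow> holo_at z g \<Longrightarrow> holo_at z (\<lambda>x. f x * g x)"
proof -
  assume "holo_at z f" "holo_at z g"
  then obtain D D' where D: "(f has_derivative D) (at z)" "\<And>c v. D (c *s v) = c * D v"
    and D': "(g has_derivative D') (at z)" "\<And>c v. D' (c *s v) = c * D' v"
    unfolding holo_at_def by blast
  show ?thesis unfolding holo_at_def
    by (rule exI, rule conjI, rule has_derivative_mult[OF D(1) D'(1)]) (simp add: D(2) D'(2) algebra_simps)
qed

lemma holo_at_sum: "(\<And>i. i \<in> I \<Longrightarrow> holo_at z (f i)) \<Longrightarrow> holo_at z (\<lambda>x. \<Sum>i\<in>I. f i x)"
  by (induction I rule: infinite_finite_induct) (auto intro: holo_at_const holo_at_add)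

lemma holo_at_power: "holo_at z f \<Longrightarrow> holo_at z (\<lambda>x. f x ^ k)"
  by (induction k) (auto intro: holo_at_const holo_at_mult)

lemma holo_at_component:
  assumes "holo_on S f" "z \<in> S"
  shows "holo_at z (\<lambda>x. f x $ j)"
proof -
  obtain D where D: "(f has_derivative D) (at z)" "\<And>c v. D (c *s v) = c *s D v"
    using assms unfolding holo_on_def by blast
  have "((\<lambda>x. f x $ j) has_derivative (\<lambda>v. D v $ j)) (at z)"
    by (rule bounded_linear.has_derivative[OF bounded_linear_vec_nth D(1)])
  then show ?thesis unfolding holo_at_def by (intro exI[of _ "\<lambda>v. D v $ j"]) (simp add: D(2))
qed

lemma holo_at_compose:
  assumes G: "holo_on S G" "z \<in> S" and f: "holo_at (G z) f"
  shows "holo_at z (\<lambda>x. f (G x))"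
proof -
  obtain D where D: "(G has_derivative D) (at z)" "\<And>c v. D (c *s v) = c *s D v"
    using G unfolding holo_on_def by blast
  obtain D' where D': "(f has_derivative D') (at (G z))" "\<And>c v. D' (c *s v) = c * D' v"
    using f unfolding holo_at_def by blast
  show ?thesis unfolding holo_at_def
    using diff_chain_at[OF D(1) D'(1)] by (intro exI[of _ "D' \<circ> D"]) (simp add: D(2) D'(2) o_def)
qed

lemma holo_at_coordinate: "holo_at z (\<lambda>x. x $ j)"
  unfolding holo_at_def
  by (intro exI[of _ "\<lambda>v. v $ j"]) (auto intro!: bounded_linear_imp_has_derivative bounded_linear_vec_nth)

lemma holo_onI:
  fixes f :: "complex^'n::finite \<Rightarrow> complex^'k::finite"
  assumes h: "\<And>z j. z \<in> S \<Longrightarrow> holo_at z (\<lambda>x. g x $ j)" and S: "open S" and eq: "\<And>z. z \<in> S \<Longrightarrow> f z = g z"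
  shows "holo_on S f"
  unfolding holo_on_def
proof
  fix z assume z: "z \<in> S"
  have "\<exists>D. \<forall>j. ((\<lambda>x. g x $ j) has_derivative D j) (at z) \<and> (\<forall>c v. D j (c *s v) = c * D j v)"
    using h[OF z] unfolding holo_at_def by (intro choice) blast
  then obtain D where D: "\<And>j. ((\<lambda>x. g x $ j) has_derivative D j) (at z)" "\<And>j c v. D j (c *s v) = c * D j v" by blast
  have bl: "bounded_linear (\<lambda>x. axis j x :: complex^'k)" for j
    by (rule bounded_linear_intro[where K = 1])
       (auto simp: axis_def Finite_Cartesian_Product.vec_eq_iff norm_axis[unfolded axis_def])
  have "((\<lambda>x. \<Sum>j\<in>UNIV. axis j (g x $ j)) has_derivative (\<lambda>v. \<Sum>j\<in>UNIV. axis j (D j v))) (at z)"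
    by (intro has_derivative_sum bounded_linear.has_derivative[OF bl] D)
  moreover have ax: "(\<Sum>j\<in>UNIV. axis j (y j)) = (\<chi> j. y j)" for y :: "'k \<Rightarrow> complex"
    by (simp add: Finite_Cartesian_Product.vec_eq_iff sum_component axis_def)
  ultimately have "(g has_derivative (\<lambda>v. \<chi> j. D j v)) (at z)" by simp
  then have "(f has_derivative (\<lambda>v. \<chi> j. D j v)) (at z)"
    by (rule has_derivative_transform_within_open[OF _ S z]) (simp add: eq)
  moreover have "(\<chi> j. D j (c *s v)) = c *s (\<chi> j. D j v)" for c v
    by (simp add: Finite_Cartesian_Product.vec_eq_iff D(2))
  ultimately show "\<exists>D. (f has_derivative D) (at z) \<and> (\<forall>c v. D (c *s v) = c *s D v)" by blast
qed

section \<open>The Riemannian volume in a chart\<close>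

text \<open>Reduced to the Hermitian case: at a complex vector with real part \<open>x\<close> and
  imaginary part \<open>y\<close>, the complexified form is the sum of the values at
  \<open>x\<close> and \<open>y\<close>, because the mixed terms are imaginary.\<close>

lemma det_pos_real:
  fixes G :: "real^'n::finite^'n"
  assumes sym: "\<And>i j. G $ i $ j = G $ j $ i"
    and pos: "\<And>x. x \<noteq> 0 \<Longrightarrow> (\<Sum>i\<in>UNIV. \<Sum>j\<in>UNIV. G $ i $ j * x $ i * x $ j) > 0"
  shows "det G > 0"
proof -
  define M where "M = (\<chi> i j. complex_of_real (G $ i $ j))"
  have "Re (det M) > 0"
  proof (rule hadamard_det_le(2))
    show "hermitian M" using sym by (simp add: hermitian_def M_def)
    fix v :: "complex^'n" assume v: "v \<noteq> 0"
    define x y where "x = (\<chi> i. Re (v $ i))" and "y = (\<chi> i. Im (v $ i))"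
    have nn: "0 \<le> (\<Sum>i\<in>UNIV. \<Sum>j\<in>UNIV. G $ i $ j * x $ i * x $ j)" for x
      using pos[of x] by (cases "x = 0") (auto simp: less_imp_le)
    have "qf M v = (\<Sum>i\<in>UNIV. \<Sum>j\<in>UNIV. G $ i $ j * x $ i * x $ j) + (\<Sum>i\<in>UNIV. \<Sum>j\<in>UNIV. G $ i $ j * y $ i * y $ j)"
      by (simp add: qf_def sesq_def M_def x_def y_def sum.distrib[symmetric] algebra_simps)
    moreover have "x \<noteq> 0 \<or> y \<noteq> 0"
      using v by (auto simp: x_def y_def Finite_Cartesian_Product.vec_eq_iff complex_eq_iff)
    ultimately show "qf M v > 0" using pos nn[of x] nn[of y] by (auto intro: add_pos_nonneg add_nonneg_pos)
  qed
  moreover have "det M = of_real (det G)"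
    by (simp add: Determinants.det_def M_def)
  ultimately show ?thesis by simp
qed

lemma det_gram_pos:
  fixes b :: "complex^'n::finite \<Rightarrow> complex^'n \<Rightarrow> real"
  assumes bil: "bilinear b" and sym: "\<And>v w. b v w = b w v" and pos: "\<And>v. v \<noteq> 0 \<Longrightarrow> b v v > 0"
  shows "det (gram b) > 0"
proof (rule det_pos_real)
  show "gram b $ i $ j = gram b $ j $ i" for i j by (simp add: gram_def sym)
  fix x :: "real^('n + 'n)" assume x: "x \<noteq> 0"
  define v where "v = (\<Sum>k\<in>UNIV. x $ k *\<^sub>R (real_frame k :: complex^'n))"
  have "v $ i = Complex (x $ Inl i) (x $ Inr i)" for i
  proof -
    have "v $ i = (\<Sum>k\<in>UNIV <+> UNIV. x $ k *\<^sub>R (real_frame k :: complex^'n) $ i)"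
      by (simp add: v_def sum_component)
    also have "\<dots> = (\<Sum>k\<in>UNIV. x $ Inl k *\<^sub>R (axis k 1 :: complex^'n) $ i) + (\<Sum>k\<in>UNIV. x $ Inr k *\<^sub>R (axis k \<i> :: complex^'n) $ i)"
      by (subst sum.Plus) (simp_all add: real_frame_def)
    also have "\<dots> = Complex (x $ Inl i) (x $ Inr i)"
      by (simp add: axis_def if_distrib[of "\<lambda>a. _ *\<^sub>R a"] complex_eq_iff cong: if_cong)
    finally show ?thesis .
  qed
  then have "v \<noteq> 0" using x
    by (auto simp: Finite_Cartesian_Product.vec_eq_iff complex_eq_iff split_sum_all)
  then have "0 < b v v" by (rule pos)
  also have "b v v = (\<Sum>(i,j)\<in>UNIV \<times> UNIV. b (x $ i *\<^sub>R real_frame i) (x $ j *\<^sub>R real_frame j))"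
    unfolding v_def by (rule bilinear_sum[OF bil])
  also have "\<dots> = (\<Sum>i\<in>UNIV. \<Sum>j\<in>UNIV. gram b $ i $ j * x $ i * x $ j)"
    unfolding sum.cartesian_product[symmetric]
    by (simp add: gram_def bilinear_lmul[OF bil] bilinear_rmul[OF bil] mult_ac)
  finally show "(\<Sum>i\<in>UNIV. \<Sum>j\<in>UNIV. gram b $ i $ j * x $ i * x $ j) > 0" .
qed

locale riemannian_chart =
  fixes A :: "('m::t2_space, 'n::finite) chart set"
    and g :: "('m, 'n) chart \<Rightarrow> 'm \<Rightarrow> complex^'n \<Rightarrow> complex^'n \<Rightarrow> real"
    and \<mu> :: "'m measure" and U :: "'m set" and \<phi> :: "'m \<Rightarrow> complex^'n"
  assumes atlas: "complex_atlas A" and metric: "riemannian_metric A g" and vol: "riemannian_volume A g \<mu>"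
    and chart: "(U, \<phi>) \<in> A"
begin

definition \<psi> where "\<psi> = inv_into U \<phi>"

definition dens :: "complex^'n \<Rightarrow> real" where "dens z = sqrt (det (gram (g (U, \<phi>) (\<psi> z))))"

lemma open_U: "open U" and open_im: "open (\<phi> ` U)" and homeo: "homeomorphism U (\<phi> ` U) \<phi> \<psi>"
  using atlas chart unfolding complex_atlas_def \<psi>_def by auto

lemma \<psi>_\<phi> [simp]: "x \<in> U \<Longrightarrow> \<psi> (\<phi> x) = x"
  using homeo unfolding homeomorphism_def by blast

lemma \<phi>_\<psi> [simp]: "z \<in> \<phi> ` U \<Longrightarrow> \<phi> (\<psi> z) = z"
  using homeo unfolding homeomorphism_def by blast

lemma \<psi>_in: "z \<in> \<phi> ` U \<Longrightarrow> \<psi> z \<in> U" by auto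

lemma cont_\<phi>: "continuous_on U \<phi>" and cont_\<psi>: "continuous_on (\<phi> ` U) \<psi>"
  using homeo unfolding homeomorphism_def by blast+

lemma open_preimage: "open B \<Longrightarrow> open (U \<inter> \<phi> -` B)"
  using continuous_open_preimage[OF cont_\<phi> open_U] by blast

lemma open_image: "open Y \<Longrightarrow> open (\<phi> ` (U \<inter> Y))"
proof -
  assume "open Y"
  then have "open (\<phi> ` U \<inter> \<psi> -` Y)" using continuous_open_preimage[OF cont_\<psi> open_im] by blast
  also have "\<phi> ` U \<inter> \<psi> -` Y = \<phi> ` (U \<inter> Y)" by force
  finally show ?thesis .
qed

lemma det_gram_chart_pos: "z \<in> \<phi> ` U \<Longrightarrow> det (gram (g (U, \<phi>) (\<psi> z))) > 0"
proof -
  assume "z \<in> \<phi> ` U"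
  then have x: "\<psi> z \<in> U" by (rule \<psi>_in)
  have "\<forall>x\<in>U. bilinear (g (U, \<phi>) x) \<and> (\<forall>v w. g (U, \<phi>) x v w = g (U, \<phi>) x w v) \<and> (\<forall>v. v \<noteq> 0 \<longrightarrow> g (U, \<phi>) x v v > 0)"
    using metric chart unfolding riemannian_metric_def by fast
  then show ?thesis using x by (intro det_gram_pos) blast+
qed

lemma dens_pos: "z \<in> \<phi> ` U \<Longrightarrow> dens z > 0"
  unfolding dens_def using det_gram_chart_pos by simp

lemma continuous_dens: "continuous_on (\<phi> ` U) dens"
proof -
  have "\<forall>v w. smooth_on (\<phi> ` U) (\<lambda>z. g (U, \<phi>) (inv_into U \<phi> z) v w)"
    using metric chart unfolding riemannian_metric_def by fast
  then have "continuous_on (\<phi> ` U) (\<lambda>z. g (U, \<phi>) (\<psi> z) v w)" for v w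
    unfolding smooth_on_def \<psi>_def by (metis Ck_on.simps(1))
  then have "continuous_on (\<phi> ` U) (\<lambda>z. gram (g (U, \<phi>) (\<psi> z)) $ i $ j)" for i j
    by (simp add: gram_def)
  then show ?thesis unfolding dens_def Determinants.det_def
    by (intro continuous_on_real_sqrt continuous_on_sum continuous_on_mult continuous_on_const continuous_on_prod)
qed

lemma dens_meas [measurable]: "(\<lambda>z. ennreal (dens z) * indicator (\<phi> ` U) z) \<in> borel_measurable borel"
proof -
  have "(\<lambda>z. indicator (\<phi> ` U) z *\<^sub>R dens z) \<in> borel_measurable borel"
    using open_im by (intro borel_measurable_continuous_on_indicator continuous_dens) auto
  then have "(\<lambda>z. ennreal (indicator (\<phi> ` U) z *\<^sub>R dens z)) \<in> borel_measurable borel" by measurable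
  also have "(\<lambda>z. ennreal (indicator (\<phi> ` U) z *\<^sub>R dens z)) = (\<lambda>z. ennreal (dens z) * indicator (\<phi> ` U) z)"
    by (auto simp: indicator_def fun_eq_iff)
  finally show ?thesis .
qed

lemma sets_\<mu>: "sets \<mu> = sets borel" using vol by (simp add: riemannian_volume_def)

lemma emeasure_chart:
  assumes "B \<in> sets borel" "B \<subseteq> U"
  shows "emeasure \<mu> B = (\<integral>\<^sup>+z. ennreal (dens z) * indicator (\<phi> ` B) z \<partial>lborel)"
proof -
  have "\<forall>(U, \<phi>)\<in>A. \<forall>B\<in>sets borel. B \<subseteq> U \<longrightarrow>
        emeasure \<mu> B = (\<integral>\<^sup>+ z\<in>\<phi> ` B. ennreal (sqrt (det (gram (g (U, \<phi>) (inv_into U \<phi> z))))) \<partial>lborel)"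
    using vol by (simp add: riemannian_volume_def)
  from bspec[OF this chart] show ?thesis using assms unfolding dens_def \<psi>_def by blast
qed

text \<open>\<open>\<phi>\<close> is arbitrary outside \<open>U\<close>, hence the cutoff.\<close>

lemma \<phi>_meas: "(\<lambda>x. indicator U x *\<^sub>R \<phi> x) \<in> borel_measurable borel"
  using open_U by (intro borel_measurable_continuous_on_indicator cont_\<phi>) auto

text \<open>\<open>riemannian_volume\<close> prescribes measures of sets. To pass to integrals, the
  image under the chart of \<open>\<mu>\<close> restricted to \<open>W\<close> is identified with a
  density of \<open>lborel\<close>.\<close>

lemma chart_nn_integral:
  assumes F [measurable]: "F \<in> borel_measurable borel" and B: "open B"
  shows "(\<integral>\<^sup>+x. F (\<phi> x) * indicator (U \<inter> \<phi> -` B) x \<partial>\<mu>) =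
    (\<integral>\<^sup>+z. F z * (ennreal (dens z) * indicator (\<phi> ` U \<inter> B) z) \<partial>lborel)"
proof -
  define W where "W = U \<inter> \<phi> -` B"
  have W: "open W" unfolding W_def by (rule open_preimage[OF B])
  have Wm [measurable]: "W \<in> sets \<mu>" using W by (simp add: sets_\<mu>)
  define f where "f x = indicator U x *\<^sub>R \<phi> x" for x
  have fm [measurable]: "f \<in> measurable \<mu> borel"
    using \<phi>_meas unfolding f_def[abs_def] measurable_cong_sets[OF sets_\<mu> refl] .
  have dB [measurable]: "(\<lambda>z. ennreal (dens z) * indicator (\<phi> ` U \<inter> B) z) \<in> borel_measurable borel"
  proof -
    have [measurable]: "B \<in> sets borel" using B by simp
    have "(\<lambda>z. ennreal (dens z) * indicator (\<phi> ` U) z * indicator B z) \<in> borel_measurable borel" by measurable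
    also have "(\<lambda>z. ennreal (dens z) * indicator (\<phi> ` U) z * indicator B z) = (\<lambda>z. ennreal (dens z) * indicator (\<phi> ` U \<inter> B) z)"
      by (auto simp: indicator_def)
    finally show ?thesis .
  qed
  have "distr (density \<mu> (indicator W)) borel f = density lborel (\<lambda>z. ennreal (dens z) * indicator (\<phi> ` U \<inter> B) z)"
  proof (rule measure_eqI)
    fix S assume "S \<in> sets (distr (density \<mu> (indicator W)) borel f)"
    then have S [measurable]: "S \<in> sets borel" by simp
    define W' where "W' = W \<inter> f -` S"
    have W': "W' \<in> sets borel" "W' \<subseteq> U"
    proof -
      have "f -` S \<inter> space \<mu> \<in> sets \<mu>" by (rule measurable_sets[OF fm S])
      then have "W \<inter> (f -` S \<inter> space \<mu>) \<in> sets \<mu>" using Wm by auto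
      moreover have "space \<mu> = UNIV" using sets_eq_imp_space_eq[OF sets_\<mu>] by simp
      ultimately show "W' \<in> sets borel" by (simp add: W'_def sets_\<mu>)
    qed (auto simp: W'_def W_def)
    have im: "\<phi> ` W' = \<phi> ` U \<inter> B \<inter> S" by (auto simp: W'_def W_def f_def)
    have "emeasure (distr (density \<mu> (indicator W)) borel f) S = emeasure (density \<mu> (indicator W)) (f -` S \<inter> space \<mu>)"
      by (subst emeasure_distr) auto
    also have "\<dots> = (\<integral>\<^sup>+x. indicator W x * indicator (f -` S \<inter> space \<mu>) x \<partial>\<mu>)"
      by (rule emeasure_density) auto
    also have "\<dots> = (\<integral>\<^sup>+x. indicator W' x \<partial>\<mu>)"
      by (rule nn_integral_cong) (auto simp: W'_def indicator_def)
    also have "\<dots> = emeasure \<mu> W'" using W' by (intro nn_integral_indicator) (simp add: sets_\<mu>)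
    also have "\<dots> = (\<integral>\<^sup>+z. ennreal (dens z) * indicator (\<phi> ` W') z \<partial>lborel)" by (rule emeasure_chart[OF W'])
    also have "\<dots> = (\<integral>\<^sup>+z. ennreal (dens z) * indicator (\<phi> ` U \<inter> B) z * indicator S z \<partial>lborel)"
      unfolding im by (rule nn_integral_cong) (auto simp: indicator_def)
    also have "\<dots> = emeasure (density lborel (\<lambda>z. ennreal (dens z) * indicator (\<phi> ` U \<inter> B) z)) S"
      by (rule emeasure_density[symmetric]) auto
    finally show "emeasure (distr (density \<mu> (indicator W)) borel f) S =
      emeasure (density lborel (\<lambda>z. ennreal (dens z) * indicator (\<phi> ` U \<inter> B) z)) S" .
  qed simp
  then have "(\<integral>\<^sup>+z. F z \<partial>distr (density \<mu> (indicator W)) borel f) = (\<integral>\<^sup>+z. F z \<partial>density lborel (\<lambda>z. ennreal (dens z) * indicator (\<phi> ` U \<inter> B) z))"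
    by simp
  moreover have "(\<integral>\<^sup>+z. F z \<partial>distr (density \<mu> (indicator W)) borel f) = (\<integral>\<^sup>+x. indicator W x * F (f x) \<partial>\<mu>)"
    by (subst nn_integral_distr, simp, simp, subst nn_integral_density) auto
  moreover have "(\<integral>\<^sup>+x. indicator W x * F (f x) \<partial>\<mu>) = (\<integral>\<^sup>+x. F (\<phi> x) * indicator W x \<partial>\<mu>)"
    by (rule nn_integral_cong) (auto simp: indicator_def W_def f_def)
  moreover have "(\<integral>\<^sup>+z. F z \<partial>density lborel (\<lambda>z. ennreal (dens z) * indicator (\<phi> ` U \<inter> B) z)) =
    (\<integral>\<^sup>+z. F z * (ennreal (dens z) * indicator (\<phi> ` U \<inter> B) z) \<partial>lborel)"
    by (subst nn_integral_density) (auto simp: mult.commute)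
  ultimately show ?thesis unfolding W_def by simp
qed

text \<open>The density of the volume is positive, so a null set of \<open>\<mu>\<close> has a
  Lebesgue null image in the chart.\<close>

lemma AE_chart:
  assumes "AE x in \<mu>. P x"
  shows "AE z in lborel. z \<in> \<phi> ` U \<longrightarrow> P (\<psi> z)"
proof -
  obtain N where N: "{x \<in> space \<mu>. \<not> P x} \<subseteq> N" "emeasure \<mu> N = 0" "N \<in> sets \<mu>"
    using AE_E[OF assms] by blast
  have sp: "space \<mu> = UNIV" using sets_eq_imp_space_eq[OF sets_\<mu>] by simp
  define N' where "N' = N \<inter> U"
  have N': "N' \<in> sets borel" "N' \<subseteq> U" using N(3) open_U by (auto simp: N'_def sets_\<mu>)
  have "emeasure \<mu> N' \<le> emeasure \<mu> N" using N(3) by (intro emeasure_mono) (auto simp: N'_def)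
  then have 0: "(\<integral>\<^sup>+z. ennreal (dens z) * indicator (\<phi> ` N') z \<partial>lborel) = 0"
    using N(2) emeasure_chart[OF N'] by simp
  have im: "\<phi> ` N' = \<psi> -` N' \<inter> \<phi> ` U" using N'(2) by force
  have "\<psi> \<in> borel_measurable (restrict_space borel (\<phi> ` U))"
    by (rule borel_measurable_continuous_on_restrict[OF cont_\<psi>])
  from measurable_sets[OF this N'(1)] have "\<psi> -` N' \<inter> \<phi> ` U \<in> sets (restrict_space borel (\<phi> ` U))"
    by (simp add: space_restrict_space)
  then have mi [measurable]: "\<phi> ` N' \<in> sets borel"
    unfolding im using open_im by (auto simp: sets_restrict_space)
  have "(\<lambda>z. ennreal (dens z) * indicator (\<phi> ` N') z) \<in> borel_measurable lborel"
  proof -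
    have "(\<lambda>z. ennreal (dens z) * indicator (\<phi> ` U) z * indicator (\<phi> ` N') z) \<in> borel_measurable borel" by measurable
    also have "(\<lambda>z. ennreal (dens z) * indicator (\<phi> ` U) z * indicator (\<phi> ` N') z) = (\<lambda>z. ennreal (dens z) * indicator (\<phi> ` N') z)"
      using N'(2) by (auto simp: indicator_def fun_eq_iff)
    finally show ?thesis by simp
  qed
  then have "AE z in lborel. ennreal (dens z) * indicator (\<phi> ` N') z = 0"
    using 0 nn_integral_0_iff_AE by blast
  then show ?thesis
  proof eventually_elim
    case (elim z)
    show "z \<in> \<phi> ` U \<longrightarrow> P (\<psi> z)"
    proof
      assume z: "z \<in> \<phi> ` U"
      have "z \<notin> \<phi> ` N'" using elim dens_pos[OF z] by (auto simp: indicator_def ennreal_eq_0_iff)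
      then have "\<psi> z \<notin> N" using z \<psi>_in[OF z] im by (auto simp: N'_def)
      then show "P (\<psi> z)" using N(1) sp by auto
    qed
  qed
qed

end

section \<open>Seminegative metrics in a chart\<close>

text \<open>By Cauchy-Schwarz, the diagonal bounds all entries. Upper semicontinuity provides local
  bounds for finitely many vectors only, so the whole form has to be controlled by the
  diagonal.\<close>

lemma qf_le_of_diagonal:
  fixes M :: "complex^'r::finite^'r"
  assumes herm: "hermitian M" and psd: "\<And>v. 0 \<le> qf M v" and d: "\<And>i. qf M (axis i 1) \<le> K"
  shows "qf M v \<le> (real CARD('r))\<^sup>2 * K * (norm v)\<^sup>2"
proof -
  have K: "0 \<le> K" using psd[of "axis undefined 1"] d[of undefined] by linarith
  have e: "cmod (M $ i $ j) \<le> K" for i j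
  proof -
    have "sesq M (axis i 1) (axis j 1) = M $ i $ j" by (rule sesq_axis)
    then have "(cmod (M $ i $ j))\<^sup>2 \<le> qf M (axis i 1) * qf M (axis j 1)"
      using psd_cauchy_schwarz[OF herm psd, of "axis i 1" "axis j 1"] by simp
    also have "\<dots> \<le> K * K" using psd d K by (intro mult_mono) auto
    finally show ?thesis using K by (metis power2_eq_square power2_le_imp_le)
  qed
  have "qf M v \<le> cmod (sesq M v v)" unfolding qf_def by (rule complex_Re_le_cmod)
  also have "\<dots> \<le> (\<Sum>i\<in>UNIV. \<Sum>j\<in>UNIV. cmod (M $ i $ j * v $ i * cnj (v $ j)))"
    unfolding sesq_def by (intro order_trans[OF norm_sum] sum_mono norm_sum)
  also have "\<dots> \<le> (\<Sum>i\<in>(UNIV::'r set). \<Sum>j\<in>(UNIV::'r set). K * (norm v * norm v))"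
    unfolding norm_mult complex_mod_cnj mult.assoc using K
    by (intro sum_mono mult_mono e Finite_Cartesian_Product.norm_nth_le) auto
  finally show ?thesis by (simp add: power2_eq_square mult_ac)
qed

locale bundle_chart = riemannian_chart A g \<mu> U \<phi>
  for A :: "('m::t2_space, 'n::finite) chart set" and g \<mu> U \<phi> +
  fixes E :: "'m \<Rightarrow> 'v cspace" and \<T> :: "('m, 'v, 'r::finite) triv set" and Y \<tau>
  assumes vb: "holomorphic_vector_bundle A E \<T>" and triv: "(Y, \<tau>) \<in> \<T>"
begin

lemma open_Y: "open Y"
  using vb triv unfolding holomorphic_vector_bundle_def by blast

lemma fiber_at: "x \<in> Y \<Longrightarrow> fiber (E x) (\<tau> x)"
  using vb triv unfolding holomorphic_vector_bundle_def by (intro fiber.intro) blast+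

definition D where "D = \<phi> ` (U \<inter> Y)"

lemma open_D: "open D" unfolding D_def by (rule open_image[OF open_Y])

lemma D_D: "z \<in> D \<Longrightarrow> z \<in> \<phi> ` U" "z \<in> D \<Longrightarrow> \<psi> z \<in> U" "z \<in> D \<Longrightarrow> \<psi> z \<in> Y" "z \<in> D \<Longrightarrow> \<phi> (\<psi> z) = z"
  by (auto simp: D_def)

text \<open>In another trivialization and chart, linearity on the fibers expresses the section by
  \<open>f\<close>, composed with the holomorphic change of charts, times the transition functions
  of the bundle.\<close>

lemma holomorphic_section_frame:
  assumes f: "\<And>z i. holo_at z (\<lambda>x. f x $ i)"
  shows "holomorphic_section A E \<T> (U \<inter> Y) (\<lambda>x. triv_inv E \<tau> x (f (\<phi> x)))"
  unfolding holomorphic_section_def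
proof (intro conjI ballI)
  fix x assume "x \<in> U \<inter> Y"
  then interpret fiber "E x" "\<tau> x" by (intro fiber_at) auto
  show "triv_inv E \<tau> x (f (\<phi> x)) \<in> carrier (E x)" using Ti_in unfolding Ti_def .
next
  fix t' assume t': "t' \<in> \<T>"
  obtain Y' \<tau>' where [simp]: "t' = (Y', \<tau>')" by (cases t')
  have "manifold_holo A (Y' \<inter> (U \<inter> Y)) (\<lambda>x. \<tau>' x (triv_inv E \<tau> x (f (\<phi> x))))"
    unfolding manifold_holo_def
  proof
    fix c' assume c': "c' \<in> A"
    obtain U' \<phi>' where [simp]: "c' = (U', \<phi>')" by (cases c')
    interpret c': riemannian_chart A g \<mu> U' \<phi>'
      using atlas metric vol c' by (intro riemannian_chart.intro) auto
    have tr: "holo_on (\<phi>' ` (U' \<inter> U)) (\<phi> \<circ> inv_into U' \<phi>')"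
      using atlas c' chart unfolding complex_atlas_def by fastforce
    have bt: "holo_on (\<phi>' ` (U' \<inter> (Y \<inter> Y'))) ((\<lambda>x. \<tau>' x (triv_inv E \<tau> x v)) \<circ> inv_into U' \<phi>')" for v
    proof -
      have "\<forall>(U, \<tau>)\<in>\<T>. \<forall>(U', \<tau>')\<in>\<T>. \<forall>v. manifold_holo A (U \<inter> U') (\<lambda>x. \<tau>' x (triv_inv E \<tau> x v))"
        using vb unfolding holomorphic_vector_bundle_def by blast
      from bspec[OF this triv] t' have "manifold_holo A (Y \<inter> Y') (\<lambda>x. \<tau>' x (triv_inv E \<tau> x v))" by auto
      from this[unfolded manifold_holo_def, THEN bspec, OF c'] show ?thesis by simp
    qed
    have "holo_on (\<phi>' ` (U' \<inter> (Y' \<inter> (U \<inter> Y)))) ((\<lambda>x. \<tau>' x (triv_inv E \<tau> x (f (\<phi> x)))) \<circ> inv_into U' \<phi>')"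
    proof (rule holo_onI)
      show "open (\<phi>' ` (U' \<inter> (Y' \<inter> (U \<inter> Y))))"
      proof (rule c'.open_image)
        have "open Y'" using vb t' unfolding holomorphic_vector_bundle_def by auto
        then show "open (Y' \<inter> (U \<inter> Y))" using open_U open_Y by auto
      qed
      fix z assume z: "z \<in> \<phi>' ` (U' \<inter> (Y' \<inter> (U \<inter> Y)))"
      define x where "x = inv_into U' \<phi>' z"
      have x: "x \<in> U'" "x \<in> Y'" "x \<in> U" "x \<in> Y" using z c'.\<psi>_\<phi> unfolding x_def c'.\<psi>_def by auto
      interpret F: fiber "E x" "\<tau> x" by (rule fiber_at[OF x(4)])
      interpret F': fiber "E x" "\<tau>' x"
        using vb t' x(2) unfolding holomorphic_vector_bundle_def by (intro fiber.intro) auto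
      have lin: "\<tau>' x (triv_inv E \<tau> x (\<Sum>k\<in>K. c k *s v k)) = (\<Sum>k\<in>K. c k *s \<tau>' x (triv_inv E \<tau> x (v k)))"
        if "finite K" for K :: "'r set" and c v
        unfolding F.Ti_def[symmetric] using that
      proof (induction K)
        case empty
        have "F.Ti 0 = \<zero>\<^bsub>E x\<^esub>" using F.T_eq_0_iff[of "F.Ti 0"] by simp
        then show ?case by simp
      qed (simp add: F.Ti_add F.Ti_smult F'.T_add F'.T_smult)
      show "((\<lambda>x. \<tau>' x (triv_inv E \<tau> x (f (\<phi> x)))) \<circ> inv_into U' \<phi>') z =
        (\<chi> j. \<Sum>k\<in>UNIV. f ((\<phi> \<circ> inv_into U' \<phi>') z) $ k * ((\<lambda>x. \<tau>' x (triv_inv E \<tau> x (axis k 1))) \<circ> inv_into U' \<phi>') z $ j)"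
        using lin[OF finite, of "\<lambda>k. f (\<phi> x) $ k" "\<lambda>k. axis k 1" UNIV]
        by (simp add: basis_expansion x_def[symmetric] Finite_Cartesian_Product.vec_eq_iff sum_component)
    next
      fix z j assume z: "z \<in> \<phi>' ` (U' \<inter> (Y' \<inter> (U \<inter> Y)))"
      have "holo_at z (\<lambda>z. \<Sum>k\<in>UNIV. f ((\<phi> \<circ> inv_into U' \<phi>') z) $ k * ((\<lambda>x. \<tau>' x (triv_inv E \<tau> x (axis k 1))) \<circ> inv_into U' \<phi>') z $ j)"
        using z by (intro holo_at_sum holo_at_mult holo_at_compose[OF tr] f holo_at_component[OF bt]) auto
      then show "holo_at z (\<lambda>z. (\<chi> j. \<Sum>k\<in>UNIV. f ((\<phi> \<circ> inv_into U' \<phi>') z) $ k *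
          ((\<lambda>x. \<tau>' x (triv_inv E \<tau> x (axis k 1))) \<circ> inv_into U' \<phi>') z $ j) $ j)" by simp
    qed
    then show "case c' of (Ua, \<phi>') \<Rightarrow> holo_on (\<phi>' ` (Ua \<inter> (Y' \<inter> (U \<inter> Y)))) ((\<lambda>x. \<tau>' x (triv_inv E \<tau> x (f (\<phi> x)))) \<circ> inv_into Ua \<phi>')"
      by simp
  qed
  then show "case t' of (Ua, \<tau>') \<Rightarrow> manifold_holo A (Ua \<inter> (U \<inter> Y)) (\<lambda>x. \<tau>' x (triv_inv E \<tau> x (f (\<phi> x))))" by simp
qed

end

locale seminegative_chart = bundle_chart A g \<mu> U \<phi> E \<T> Y \<tau>
  for A :: "('m::t2_space, 'n::finite) chart set" and g \<mu> U \<phi>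
    and E :: "'m \<Rightarrow> 'v cspace" and \<T> :: "('m, 'v, 'r::finite) triv set" and Y \<tau> +
  fixes h :: "'m \<Rightarrow> 'v \<Rightarrow> ennreal"
  assumes seminegative: "griffiths_seminegative A \<mu> E \<T> h"
begin

definition nrm :: "complex^'n \<Rightarrow> complex^'r \<Rightarrow> ennreal" where
  "nrm z v = h (\<psi> z) (triv_inv E \<tau> (\<psi> z) v)"

lemma psh_section:
  assumes f: "\<And>z i. holo_at z (\<lambda>x. f x $ i)"
  shows "psh_on D (\<lambda>z. ennreal_log ((nrm z (f (\<phi> (\<psi> z))))\<^sup>2))"
proof -
  have "open (U \<inter> Y)" using open_U open_Y by auto
  then have "manifold_psh A (U \<inter> Y) (\<lambda>x. ennreal_log ((h x (triv_inv E \<tau> x (f (\<phi> x))))\<^sup>2))"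
    using seminegative holomorphic_section_frame[OF f] unfolding griffiths_seminegative_def by blast
  then have "psh_on (\<phi> ` (U \<inter> (U \<inter> Y))) ((\<lambda>x. ennreal_log ((h x (triv_inv E \<tau> x (f (\<phi> x))))\<^sup>2)) \<circ> inv_into U \<phi>)"
    using chart unfolding manifold_psh_def by fast
  then show ?thesis unfolding D_def nrm_def \<psi>_def o_def by (simp add: Int_left_absorb)
qed

lemma psh_constant: "psh_on D (\<lambda>z. ennreal_log ((nrm z v)\<^sup>2))"
  by (rule psh_section[of "\<lambda>_. v"]) (rule holo_at_const)

text \<open>A plurisubharmonic function never takes the value infinity, so a seminegative metric is
  finite at every point and not only almost everywhere.\<close>

lemma nrm_finite: "z \<in> D \<Longrightarrow> nrm z v \<noteq> \<infinity>"
proof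
  assume "z \<in> D" "nrm z v = \<infinity>"
  then have "ennreal_log \<infinity> < \<infinity>"
    using psh_constant[of v] unfolding psh_on_def by (force simp: power2_eq_square)
  then show False by (simp add: ennreal_log_def)
qed

lemma singular: "singular_hermitian_metric \<mu> E \<T> h"
  using seminegative by (simp add: griffiths_seminegative_def)

text \<open>The matrix of the metric in the local frame. A Hermitian matrix is determined by its
  quadratic form, so the choice is unique where such a matrix exists, in particular on
  \<open>D\<close>.\<close>

definition fm :: "complex^'n \<Rightarrow> complex^'r^'r" where
  "fm z = (SOME M. hermitian M \<and> (\<forall>v. qf M v = (enn2real (nrm z v))\<^sup>2))"

lemma fm:
  assumes "z \<in> D"
  shows "hermitian (fm z)" "qf (fm z) v = (enn2real (nrm z v))\<^sup>2"
proof -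
  interpret fiber "E (\<psi> z)" "\<tau> (\<psi> z)" by (rule fiber_at[OF D_D(3)[OF assms]])
  have "finite_norm (E (\<psi> z)) (h (\<psi> z))"
    unfolding finite_norm_def using nrm_finite[OF assms] Ti_T unfolding nrm_def Ti_def by metis
  moreover have "singular_inner_product (E (\<psi> z)) (h (\<psi> z))"
    using singular unfolding singular_hermitian_metric_def by blast
  ultimately obtain M where "hermitian M" "\<And>v. qf M v = (enn2real (h (\<psi> z) (Ti v)))\<^sup>2"
    using norm_form_matrix by metis
  then have "\<exists>M. hermitian M \<and> (\<forall>v. qf M v = (enn2real (nrm z v))\<^sup>2)" unfolding nrm_def Ti_def by blast
  from someI_ex[OF this] show "hermitian (fm z)" "qf (fm z) v = (enn2real (nrm z v))\<^sup>2"
    unfolding fm_def by blast+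
qed

lemma qf_nonneg: "z \<in> D \<Longrightarrow> 0 \<le> qf (fm z) v" by (simp add: fm)

lemma ennreal_qf: "z \<in> D \<Longrightarrow> ennreal (qf (fm z) v) = (nrm z v)\<^sup>2"
  using nrm_finite[of z v] by (simp add: fm ennreal_power[symmetric] less_top)

lemma usc_fm: "usc_forms D fm"
  unfolding usc_forms_def
proof (intro allI ballI impI)
  fix v z and \<epsilon> :: real assume z: "z \<in> D" and \<epsilon>: "\<epsilon> > 0"
  define c where "c = ennreal_log (ennreal (qf (fm z) v + \<epsilon>))"
  have "openin (top_of_set D) {y\<in>D. ennreal_log ((nrm y v)\<^sup>2) < c}"
    using psh_constant[of v] unfolding psh_on_def by blast
  then have "open {y\<in>D. ennreal_log ((nrm y v)\<^sup>2) < c}" using open_D openin_open_trans by blast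
  moreover have iff: "y \<in> {y\<in>D. ennreal_log ((nrm y v)\<^sup>2) < c} \<longleftrightarrow> y \<in> D \<and> qf (fm y) v < qf (fm z) v + \<epsilon>" for y
    using qf_nonneg[of y v] by (auto simp: c_def ennreal_log_less_iff ennreal_qf[symmetric] ennreal_less_iff)
  moreover have "z \<in> {y\<in>D. ennreal_log ((nrm y v)\<^sup>2) < c}" unfolding iff using z \<epsilon> by simp
  ultimately obtain \<delta> where "\<delta> > 0" "\<And>y. dist y z < \<delta> \<Longrightarrow> y \<in> {y\<in>D. ennreal_log ((nrm y v)\<^sup>2) < c}"
    unfolding open_dist by blast
  then show "\<exists>\<delta>>0. \<forall>y. dist y z < \<delta> \<longrightarrow> qf (fm y) v \<le> qf (fm z) v + \<epsilon>"
    unfolding iff by (intro exI[of _ \<delta>]) (auto intro: less_imp_le)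
qed

lemma locally_bounded:
  assumes z0: "z0 \<in> D"
  obtains R K where "R > 0" "0 \<le> K" "ball z0 R \<subseteq> D"
    "\<And>z v. z \<in> ball z0 R \<Longrightarrow> qf (fm z) v \<le> K * (norm v)\<^sup>2"
proof -
  obtain R0 where R0: "R0 > 0" "ball z0 R0 \<subseteq> D" using open_D z0 by (auto simp: open_contains_ball)
  have "\<forall>i. \<exists>\<delta>>0. \<forall>y. dist y z0 < \<delta> \<longrightarrow> qf (fm y) (axis i 1) \<le> qf (fm z0) (axis i 1) + 1"
    using usc_fm z0 unfolding usc_forms_def by simp
  then obtain \<delta> where \<delta>: "\<And>i. \<delta> i > 0"
    "\<And>i y. dist y z0 < \<delta> i \<Longrightarrow> qf (fm y) (axis i 1) \<le> qf (fm z0) (axis i 1) + 1" by metis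
  define R where "R = Min (insert R0 (range \<delta>))"
  define K1 where "K1 = Max (range (\<lambda>i. qf (fm z0) (axis i 1))) + 1"
  have R: "R > 0" using R0 \<delta>(1) unfolding R_def by (subst Min_gr_iff) auto
  have le: "R \<le> R0" "R \<le> \<delta> i" for i unfolding R_def by (intro Min_le; simp)+
  have K1: "qf (fm z0) (axis i 1) + 1 \<le> K1" for i unfolding K1_def by auto
  have K1': "0 \<le> K1" using K1[of undefined] qf_nonneg[OF z0, of "axis undefined 1"] by linarith
  show ?thesis
  proof (rule that[of R "(real CARD('r))\<^sup>2 * K1"])
    show sub: "ball z0 R \<subseteq> D" using R0 le(1) subset_ball by blast
    fix z v assume z: "z \<in> ball z0 R"
    then have zD: "z \<in> D" using sub by blast
    show "qf (fm z) v \<le> (real CARD('r))\<^sup>2 * K1 * (norm v)\<^sup>2"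
    proof (rule qf_le_of_diagonal[OF fm(1)[OF zD] qf_nonneg[OF zD]])
      fix i
      have "dist z z0 < \<delta> i" using z le(2)[of i] by (simp add: dist_commute)
      from \<delta>(2)[OF this] show "qf (fm z) (axis i 1) \<le> K1" using K1[of i] by linarith
    qed
  qed (use R K1' in auto)
qed

lemma polynomial_submean:
  assumes q: "q \<noteq> 0" and disc: "\<And>\<zeta>. cmod \<zeta> \<le> 1 \<Longrightarrow> p + \<zeta> *s q \<in> D"
  shows "ennreal (2 * pi * qf (fm p) (a 0)) \<le>
    (\<integral>\<^sup>+\<theta>. ennreal (qf (fm (p + cis \<theta> *s q)) (\<Sum>k\<le>m. cis (real k * \<theta>) *s a k)) \<partial>circ)"
proof -
  define \<kappa> where "\<kappa> = (\<Sum>i\<in>UNIV. q $ i * cnj (q $ i))"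
  have "\<kappa> = of_real (\<Sum>i\<in>UNIV. (cmod (q $ i))\<^sup>2)" unfolding \<kappa>_def of_real_sum by (rule sum.cong[OF refl]) (rule complex_norm_square[symmetric])
  moreover have "(\<Sum>i\<in>UNIV. (cmod (q $ i))\<^sup>2) = (norm q)\<^sup>2"
    by (simp add: norm_vec_def L2_set_def sum_nonneg)
  ultimately have \<kappa>: "\<kappa> \<noteq> 0" using q by simp
  \<comment> \<open>The affine function with value \<open>\<zeta>\<close> at
    \<open>p + \<zeta> *s q\<close>. Substituted for the coordinate of the disc, it extends a
    polynomial section over the disc to a holomorphic section over the chart; this is where
    \<open>q \<noteq> 0\<close> is needed.\<close>
  define l where "l z = (\<Sum>i\<in>UNIV. (z $ i + - (p $ i)) * (cnj (q $ i) / \<kappa>))" for z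
  have l: "l (p + \<zeta> *s q) = \<zeta>" for \<zeta>
  proof -
    have "l (p + \<zeta> *s q) = (\<Sum>i\<in>UNIV. \<zeta> / \<kappa> * (q $ i * cnj (q $ i)))"
      unfolding l_def by (intro sum.cong) auto
    also have "\<dots> = \<zeta> / \<kappa> * \<kappa>" by (simp only: \<kappa>_def sum_distrib_left)
    finally have "l (p + \<zeta> *s q) = \<zeta> / \<kappa> * \<kappa>" .
    then show ?thesis using \<kappa> by simp
  qed
  define f where "f z = (\<Sum>k\<le>m. (l z) ^ k *s a k)" for z
  have "holo_at z (\<lambda>z. \<Sum>k\<le>m. (l z) ^ k * a k $ i)" for z i
    unfolding l_def by (intro holo_at_sum holo_at_mult holo_at_power holo_at_add holo_at_const holo_at_coordinate)
  then have f: "holo_at z (\<lambda>z. f z $ i)" for z i by (simp add: f_def sum_component)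
  have p: "p \<in> D" using disc[of 0] by simp
  have "f p = (\<Sum>k\<le>m. (if k = 0 then a k else 0))"
    unfolding f_def using l[of 0] by (intro sum.cong) (auto simp: power_0_left)
  then have fp: "f p = a 0" by simp
  have fc: "f (p + cis \<theta> *s q) = (\<Sum>k\<le>m. cis (real k * \<theta>) *s a k)" for \<theta>
    unfolding f_def l by (simp add: Complex.DeMoivre)
  have "ennreal (2 * pi) * (nrm p (f (\<phi> (\<psi> p))))\<^sup>2 \<le>
     (\<integral>\<^sup>+\<theta>. (nrm (p + cis \<theta> *s q) (f (\<phi> (\<psi> (p + cis \<theta> *s q)))))\<^sup>2 \<partial>circ)"
    by (rule psh_exp_submean[OF psh_section[OF f] open_D disc])
  also have "\<dots> = (\<integral>\<^sup>+\<theta>. ennreal (qf (fm (p + cis \<theta> *s q)) (\<Sum>k\<le>m. cis (real k * \<theta>) *s a k)) \<partial>circ)"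
    using disc by (intro nn_integral_cong) (simp add: ennreal_qf D_D(4) fc)
  finally show ?thesis
    using p qf_nonneg[OF p, of "a 0"] by (simp add: D_D(4) fp ennreal_qf[symmetric] ennreal_mult)
qed

lemma AE_definite: "AE x in \<mu>. finite_norm (E x) (h x) \<and> definite_norm (E x) (h x)"
  using singular unfolding singular_hermitian_metric_def by blast

lemma qf_pos:
  assumes z: "z \<in> D" and d: "definite_norm (E (\<psi> z)) (h (\<psi> z))" and v: "v \<noteq> 0"
  shows "qf (fm z) v > 0"
proof -
  interpret fiber "E (\<psi> z)" "\<tau> (\<psi> z)" by (rule fiber_at[OF D_D(3)[OF z]])
  have "nrm z v \<noteq> 0"
    using d v T_eq_0_iff[of "Ti v"] Ti_in[of v] unfolding definite_norm_def nrm_def Ti_def[symmetric] by auto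
  then have "enn2real (nrm z v) > 0"
    using nrm_finite[OF z, of v] by (simp add: enn2real_positive_iff zero_less_iff_neq_zero less_top)
  then show ?thesis by (simp add: fm[OF z])
qed

end

context riemannian_chart
begin

text \<open>The density is bounded on the compact ball \<open>cball a r\<close>, which
  \<open>r < R\<close> places inside the chart.\<close>

lemma nn_integral_chart_finite:
  assumes F [measurable]: "F \<in> borel_measurable borel"
    and r: "r < R" and sub: "ball a R \<subseteq> \<phi> ` U"
    and fin: "(\<integral>\<^sup>+z. F z * indicator (ball a r) z \<partial>lborel) < \<infinity>"
  shows "(\<integral>\<^sup>+x. F (\<phi> x) * indicator (U \<inter> \<phi> -` ball a r) x \<partial>\<mu>) < \<infinity>"
proof -
  have [measurable]: "ball a r \<in> sets borel" by simp
  have "cball a r \<subseteq> ball a R" using r by auto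
  then have c: "cball a r \<subseteq> \<phi> ` U" using sub by (rule subset_trans)
  have "compact (dens ` cball a r)"
    by (rule compact_continuous_image[OF continuous_on_subset[OF continuous_dens c] compact_cball])
  then have "bounded (dens ` cball a r)" by (rule compact_imp_bounded)
  then obtain C where C: "\<And>z. z \<in> cball a r \<Longrightarrow> \<bar>dens z\<bar> \<le> C"
    unfolding bounded_iff by (auto simp del: mem_cball)
  have "(\<integral>\<^sup>+x. F (\<phi> x) * indicator (U \<inter> \<phi> -` ball a r) x \<partial>\<mu>) =
    (\<integral>\<^sup>+z. F z * (ennreal (dens z) * indicator (\<phi> ` U \<inter> ball a r) z) \<partial>lborel)"
    by (rule chart_nn_integral) auto
  also have "\<dots> \<le> (\<integral>\<^sup>+z. ennreal C * (F z * indicator (ball a r) z) \<partial>lborel)"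
  proof (rule nn_integral_mono)
    fix z
    show "F z * (ennreal (dens z) * indicator (\<phi> ` U \<inter> ball a r) z) \<le> ennreal C * (F z * indicator (ball a r) z)"
    proof (cases "z \<in> ball a r")
      case True
      then have "dens z \<le> C" using C[of z] by (simp add: abs_le_iff)
      then have "ennreal (dens z) * F z \<le> ennreal C * F z" by (intro mult_right_mono ennreal_leI) auto
      then show ?thesis by (auto simp: indicator_def mult.commute)
    qed simp
  qed
  also have "\<dots> = ennreal C * (\<integral>\<^sup>+z. F z * indicator (ball a r) z \<partial>lborel)"
    by (rule nn_integral_cmult) simp
  also have "\<dots> < \<infinity>" using fin by (simp add: ennreal_mult_less_top)
  finally show ?thesis .
qed

end

context seminegative_chart
begin

text \<open>\<open>\<Phi>\<close> is an integrable majorant of the square of \<open>ln c\<close>,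
  where \<open>c\<close> bounds the norm from both sides. The condition
  \<open>1 \<le> \<Phi> x\<close> lets later steps absorb additive constants. The upper bound of the
  metric and \<open>det_norm_le_form\<close> turn the logarithm of the determinant into such a
  \<open>c\<close>.\<close>

theorem local_estimate:
  assumes x0: "x0 \<in> U" "x0 \<in> Y"
  obtains W \<Phi> where "open W" "x0 \<in> W" "W \<subseteq> U \<inter> Y" "\<Phi> \<in> borel_measurable borel"
    "(\<integral>\<^sup>+x. \<Phi> x \<partial>\<mu>) < \<infinity>"
    "AE x in \<mu>. x \<in> W \<longrightarrow> 1 \<le> \<Phi> x \<and> (\<exists>c>0. c \<le> 1 \<and> ennreal ((ln c)\<^sup>2) \<le> \<Phi> x \<and>
       (\<forall>v. ennreal (c * norm v) \<le> h x (triv_inv E \<tau> x v) \<and> h x (triv_inv E \<tau> x v) \<le> ennreal (norm v / c)))"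
proof -
  define z0 where "z0 = \<phi> x0"
  have z0: "z0 \<in> D" using x0 by (auto simp: z0_def D_def)
  obtain R K where RK: "R > 0" "0 \<le> K" "ball z0 R \<subseteq> D"
    "\<And>z v. z \<in> ball z0 R \<Longrightarrow> qf (fm z) v \<le> K * (norm v)\<^sup>2"
    by (rule locally_bounded[OF z0]) blast
  \<comment> \<open>With \<open>a0\<close> within \<open>\<rho>/8\<close> of \<open>z0\<close>, the
    ball of radius \<open>8 * \<rho>\<close> about \<open>a0\<close> stays within
    \<open>9 * \<rho>\<close> of \<open>z0\<close>, and the ball of radius \<open>\<rho>/4\<close>
    about \<open>a0\<close>, on which the integral is finite, still contains
    \<open>z0\<close>.\<close>
  define \<rho> where "\<rho> = R / 9"
  have \<rho>: "\<rho> > 0" using RK by (simp add: \<rho>_def)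
  \<comment> \<open>The metric may degenerate at \<open>z0\<close> itself, but a null set contains
    no ball.\<close>
  obtain a0 where a0: "a0 \<in> ball z0 (\<rho>/8)" "definite_norm (E (\<psi> a0)) (h (\<psi> a0))"
  proof (rule ccontr)
    assume n: "\<not> thesis"
    have "AE z in lborel. z \<in> ball z0 (\<rho>/8) \<longrightarrow> z \<in> {}"
      using AE_chart[OF AE_definite]
    proof eventually_elim
      case (elim z)
      show ?case
      proof
        assume z: "z \<in> ball z0 (\<rho>/8)"
        then have "z \<in> ball z0 R" using \<rho> by (auto simp: \<rho>_def)
        then have "z \<in> \<phi> ` U" using RK(3) D_D(1) by blast
        then show "z \<in> {}" using elim n z \<open>\<And>a0. a0 \<in> ball z0 (\<rho>/8) \<Longrightarrow> definite_norm (E (\<psi> a0)) (h (\<psi> a0)) \<Longrightarrow> thesis\<close> by blast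
      qed
    qed
    then have "AE z in lebesgue. z \<in> ball z0 (\<rho>/8) \<longrightarrow> z \<in> {}" by (rule AE_completion)
    then have "AE z\<in>ball z0 (\<rho>/8) in lebesgue. z \<in> {}" .
    from mem_closed_if_AE_lebesgue_open[OF _ _ this, of z0] \<rho> show False by simp
  qed
  define B where "B = ball a0 (8*\<rho>)"
  have Bsub: "B \<subseteq> ball z0 R"
  proof
    fix z assume "z \<in> B"
    then have "dist a0 z < 8 * \<rho>" by (simp add: B_def)
    moreover have "dist z0 z \<le> dist z0 a0 + dist a0 z" by (rule dist_triangle)
    ultimately show "z \<in> ball z0 R" using a0(1) \<rho> by (simp add: \<rho>_def)
  qed
  have BD: "z \<in> D" if "z \<in> B" for z using that Bsub RK(3) by blast
  have usc: "usc_forms B fm" using usc_fm BD unfolding usc_forms_def by blast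
  have a0B: "a0 \<in> B" using \<rho> by (simp add: B_def)
  define b where "b = real CARD('r) * ln (K + 1)"
  have [measurable]: "ball a0 (\<rho>/4) \<in> sets borel" by simp
  define Z where "Z z = (if z \<in> B then fm z else 0)" for z
  define F0 where "F0 z = (if Re (det (Z z)) > 0 then ennreal ((b - ln (Re (det (Z z))))\<^sup>2) else 0)" for z
  define \<kappa> where "\<kappa> = ln (real CARD('r)) + ln (K + 1)"
  \<comment> \<open>The square of a sum is at most twice the sum of the squares, which accounts for
    the factors 2; the summand 1 provides \<open>1 \<le> \<Phi> x\<close>.\<close>
  define F where "F z = 2 * F0 z + ennreal (2 * \<kappa>\<^sup>2 + 1)" for z
  have Zm: "(\<lambda>z. Z z $ i $ j) \<in> borel_measurable borel" for i j
    unfolding Z_def by (rule borel_measurable_usc_forms[OF _ _ usc]) (auto simp: B_def intro!: fm(1) BD[unfolded B_def])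
  have [measurable]: "(\<lambda>z. det (Z z)) \<in> borel_measurable borel" by (rule borel_measurable_det[OF Zm])
  have F0m [measurable]: "F0 \<in> borel_measurable borel" unfolding F0_def[abs_def] by measurable
  have Fm [measurable]: "F \<in> borel_measurable borel" unfolding F_def[abs_def] by measurable
  have "(\<integral>\<^sup>+z. (if Re (det (fm z)) > 0 then ennreal ((real CARD('r) * ln (K+1) - ln (Re (det (fm z))))\<^sup>2) else 0)
      * indicator (ball a0 (\<rho>/4)) z \<partial>lborel) < \<infinity>"
  proof (rule log_det_square_integral[OF \<rho> RK(2)]; (fold B_def)?)
    show "hermitian (fm z)" if "z \<in> B" for z using fm(1) BD that by blast
    show "0 \<le> qf (fm z) v" if "z \<in> B" for z v using qf_nonneg BD that by blast
    show "qf (fm z) v \<le> K * (norm v)\<^sup>2" if "z \<in> B" for z v using RK(4) Bsub that by blast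
    show "usc_forms B fm" by (rule usc)
    show "ennreal (2 * pi * qf (fm p) (a 0)) \<le>
       (\<integral>\<^sup>+\<theta>. ennreal (qf (fm (p + cis \<theta> *s q)) (\<Sum>k\<le>m. cis (real k * \<theta>) *s a k)) \<partial>circ)"
      if "q \<noteq> 0" "\<And>\<zeta>. cmod \<zeta> \<le> 1 \<Longrightarrow> p + \<zeta> *s q \<in> B" for p q m a
      using that BD by (intro polynomial_submean) auto
    show "qf (fm a0) v > 0" if "v \<noteq> 0" for v by (rule qf_pos[OF BD[OF a0B] a0(2) that])
  qed
  also have "(\<integral>\<^sup>+z. (if Re (det (fm z)) > 0 then ennreal ((real CARD('r) * ln (K+1) - ln (Re (det (fm z))))\<^sup>2) else 0)
      * indicator (ball a0 (\<rho>/4)) z \<partial>lborel) = (\<integral>\<^sup>+z. F0 z * indicator (ball a0 (\<rho>/4)) z \<partial>lborel)"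
    using \<rho> by (intro nn_integral_cong) (auto simp: F0_def Z_def B_def b_def indicator_def)
  finally have F0fin: "(\<integral>\<^sup>+z. F0 z * indicator (ball a0 (\<rho>/4)) z \<partial>lborel) < \<infinity>" .
  have "(\<integral>\<^sup>+z. F z * indicator (ball a0 (\<rho>/4)) z \<partial>lborel) =
      (\<integral>\<^sup>+z. 2 * (F0 z * indicator (ball a0 (\<rho>/4)) z) + ennreal (2 * \<kappa>\<^sup>2 + 1) * indicator (ball a0 (\<rho>/4)) z \<partial>lborel)"
    by (intro nn_integral_cong) (simp add: F_def distrib_right mult.assoc)
  also have "\<dots> = 2 * (\<integral>\<^sup>+z. F0 z * indicator (ball a0 (\<rho>/4)) z \<partial>lborel) + ennreal (2 * \<kappa>\<^sup>2 + 1) * emeasure lborel (ball a0 (\<rho>/4))"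
  proof (subst nn_integral_add)
    show "(\<lambda>z. 2 * (F0 z * indicator (ball a0 (\<rho>/4)) z)) \<in> borel_measurable lborel"
      "(\<lambda>z. ennreal (2 * \<kappa>\<^sup>2 + 1) * indicator (ball a0 (\<rho>/4)) z) \<in> borel_measurable lborel" by simp_all
  qed (simp add: nn_integral_cmult nn_integral_cmult_indicator del: ennreal_plus)
  also have "\<dots> < \<infinity>"
    using F0fin emeasure_lborel_ball_finite[of a0 "\<rho>/4"] by (simp add: ennreal_mult_less_top)
  finally have Ffin: "(\<integral>\<^sup>+z. F z * indicator (ball a0 (\<rho>/4)) z \<partial>lborel) < \<infinity>" .
  define W where "W = U \<inter> \<phi> -` ball a0 (\<rho>/4)"
  have W: "open W" unfolding W_def by (rule open_preimage) simp
  have smallB: "ball a0 (\<rho>/4) \<subseteq> B" using \<rho> by (auto simp: B_def)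
  define \<Phi> where "\<Phi> x = F (\<phi> x) * indicator W x" for x
  have Wz: "\<phi> x \<in> B" "x \<in> U" "\<psi> (\<phi> x) = x" if "x \<in> W" for x
    using that smallB by (auto simp: W_def)
  show ?thesis
  proof (rule that[of W \<Phi>])
    show "open W" by (rule W)
    have "dist a0 z0 < \<rho> / 8" using a0(1) by (simp add: dist_commute)
    then have "dist a0 z0 < \<rho> / 4" using \<rho> by linarith
    then show "x0 \<in> W" using x0(1) by (simp add: W_def z0_def)
    show "W \<subseteq> U \<inter> Y"
    proof
      fix x assume "x \<in> W"
      from Wz[OF this] D_D(3)[OF BD] show "x \<in> U \<inter> Y" by force
    qed
    have "(\<lambda>x. F (indicator U x *\<^sub>R \<phi> x) * indicator W x) \<in> borel_measurable borel"
    proof -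
      have [measurable]: "W \<in> sets borel" using W by simp
      show ?thesis using \<phi>_meas by measurable
    qed
    also have "(\<lambda>x. F (indicator U x *\<^sub>R \<phi> x) * indicator W x) = \<Phi>"
      by (auto simp: \<Phi>_def W_def indicator_def fun_eq_iff)
    finally show "\<Phi> \<in> borel_measurable borel" .
    show "(\<integral>\<^sup>+x. \<Phi> x \<partial>\<mu>) < \<infinity>"
      unfolding \<Phi>_def W_def
    proof (rule nn_integral_chart_finite[OF Fm _ _ Ffin])
      show "ball a0 (8*\<rho>) \<subseteq> \<phi> ` U" using BD D_D(1) unfolding B_def by blast
    qed (use \<rho> in auto)
    show "AE x in \<mu>. x \<in> W \<longrightarrow> 1 \<le> \<Phi> x \<and> (\<exists>c>0. c \<le> 1 \<and> ennreal ((ln c)\<^sup>2) \<le> \<Phi> x \<and>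
       (\<forall>v. ennreal (c * norm v) \<le> h x (triv_inv E \<tau> x v) \<and> h x (triv_inv E \<tau> x v) \<le> ennreal (norm v / c)))"
      using AE_definite
    proof eventually_elim
      case (elim x)
      show ?case
      proof (intro impI conjI)
        assume x: "x \<in> W"
        define z where "z = \<phi> x"
        have zB: "z \<in> B" and zD: "z \<in> D" and \<psi>z: "\<psi> z = x" using Wz[OF x] BD by (auto simp: z_def)
        have Phi: "\<Phi> x = F z" using x by (simp add: \<Phi>_def z_def)
        show "1 \<le> \<Phi> x"
        proof -
          have "ennreal 1 \<le> ennreal (2 * \<kappa>\<^sup>2 + 1)" by (rule ennreal_leI) simp
          also have "\<dots> \<le> F z" unfolding F_def by simp
          finally show ?thesis using Phi ennreal_1 by (simp del: ennreal_plus)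
        qed
        have pos: "qf (fm z) v > 0" if "v \<noteq> 0" for v
          using qf_pos[OF zD _ that] elim \<psi>z by simp
        define K' where "K' = K + 1"
        have K': "K' \<ge> 1" using RK(2) by (simp add: K'_def)
        have up: "qf (fm z) v \<le> K' * (norm v)\<^sup>2" for v
          using RK(4)[of z v] zB Bsub RK(2) unfolding K'_def by (smt (verit) mult_right_mono subsetD zero_le_power2)
        define d where "d = Re (det (fm z))"
        define r where "r = CARD('r)"
        have r: "r \<ge> 1" unfolding r_def using zero_less_card_finite[where 'a='r] by linarith
        have d: "d > 0" unfolding d_def by (rule hadamard_det_le(2)[OF fm(1)[OF zD] pos])
        have dle: "d \<le> K' ^ r" unfolding d_def r_def by (rule det_le_power[OF fm(1)[OF zD] pos up])
        have lower: "d * (norm v)\<^sup>2 \<le> real r * K' ^ (r - 1) * qf (fm z) v" for v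
          unfolding d_def r_def by (rule det_norm_le_form[OF fm(1)[OF zD] pos up])
        \<comment> \<open>The power \<open>r - 1\<close> of \<open>K'\<close> would do for the lower
          bound. With \<open>r + 1\<close> one also has \<open>c * K' \<le> 1\<close>, so the same
          \<open>c\<close> serves for the upper bound. In \<open>ln c\<close>, the term
          \<open>b\<close> accounts for \<open>r\<close> of the factors \<open>K'\<close>, and
          \<open>\<kappa>\<close> for the last one and for \<open>r\<close>.\<close>
        define c where "c = d / (real r * K' ^ (r + 1))"
        have rK: "real r * K' ^ (r + 1) > 0" using r K' by simp
        have c0: "c > 0" using d rK by (simp add: c_def)
        have cK: "c * K' \<le> 1"
        proof -
          have "d * K' \<le> K' ^ r * K'" using dle K' by (intro mult_right_mono) auto
          also have "\<dots> \<le> real r * K' ^ (r + 1)" using r K' by simp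
          finally show ?thesis using rK unfolding c_def times_divide_eq_left by (simp only: divide_le_eq_1_pos)
        qed
        have "c * 1 \<le> c * K'" using K' c0 by (intro mult_left_mono) auto
        then have c1: "c \<le> 1" using cK by simp
        have q_ge: "c * (norm v)\<^sup>2 \<le> qf (fm z) v" for v
        proof -
          have "real r * K' ^ (r - 1) * qf (fm z) v \<le> real r * K' ^ (r + 1) * qf (fm z) v"
            using K' r qf_nonneg[OF zD] by (intro mult_right_mono mult_left_mono power_increasing) auto
          then have "d * (norm v)\<^sup>2 \<le> real r * K' ^ (r + 1) * qf (fm z) v" using lower[of v] by linarith
          then show ?thesis using rK by (simp add: c_def field_simps)
        qed
        have q_le: "qf (fm z) v \<le> (norm v)\<^sup>2 / c" for v
        proof -
          have "K' \<le> 1 / c" using cK c0 by (simp add: field_simps)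
          then have "K' * (norm v)\<^sup>2 \<le> 1 / c * (norm v)\<^sup>2" by (intro mult_right_mono) auto
          then show ?thesis using up[of v] by simp
        qed
        have bounds: "ennreal (c * norm v) \<le> h x (triv_inv E \<tau> x v) \<and> h x (triv_inv E \<tau> x v) \<le> ennreal (norm v / c)" for v
        proof -
          define t where "t = enn2real (nrm z v)"
          have t: "h x (triv_inv E \<tau> x v) = ennreal t" "t \<ge> 0"
            using nrm_finite[OF zD, of v] \<psi>z unfolding t_def nrm_def by (auto simp: less_top)
          have q: "qf (fm z) v = t\<^sup>2" by (simp add: t_def fm(2)[OF zD])
          have "(c * norm v)\<^sup>2 \<le> t\<^sup>2"
          proof -
            have "(c * norm v)\<^sup>2 = c * (c * (norm v)\<^sup>2)" by (simp add: power2_eq_square)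
            also have "\<dots> \<le> 1 * (c * (norm v)\<^sup>2)" using c0 c1 by (intro mult_right_mono) auto
            finally show ?thesis using q_ge[of v] q by simp
          qed
          then have 1: "c * norm v \<le> t" by (rule power2_le_imp_le[OF _ t(2)])
          have "t\<^sup>2 \<le> (norm v / c)\<^sup>2"
          proof -
            have "(norm v)\<^sup>2 / c \<le> (norm v)\<^sup>2 / (c * c)"
              using c0 c1 by (intro divide_left_mono) (auto simp: mult_le_one mult_left_le)
            then show ?thesis using q_le[of v] q by (simp add: power_divide power2_eq_square)
          qed
          then have 2: "t \<le> norm v / c" by (rule power2_le_imp_le) (use c0 in auto)
          show ?thesis using 1 2 t by (simp add: ennreal_leI)
        qed
        have "ln c = - ((b - ln d) + \<kappa>)"
          unfolding b_def \<kappa>_def K'_def[symmetric] c_def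
          using d r K' by (simp add: r_def ln_div ln_mult ln_realpow algebra_simps)
        then have "(ln c)\<^sup>2 = ((b - ln d) + \<kappa>)\<^sup>2" by (simp only: power2_minus)
        also have "\<dots> \<le> 2 * (b - ln d)\<^sup>2 + 2 * \<kappa>\<^sup>2" using sum_squares_bound[of "b - ln d" \<kappa>] by (simp add: power2_sum)
        finally have "ennreal ((ln c)\<^sup>2) \<le> ennreal (2 * (b - ln d)\<^sup>2 + (2 * \<kappa>\<^sup>2 + 1))" by (intro ennreal_leI) simp
        also have "\<dots> = F z"
          using d zB unfolding F_def F0_def Z_def d_def[symmetric] by (simp add: d_def[symmetric] ennreal_plus ennreal_mult)
        finally show "\<exists>c>0. c \<le> 1 \<and> ennreal ((ln c)\<^sup>2) \<le> \<Phi> x \<and>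
           (\<forall>v. ennreal (c * norm v) \<le> h x (triv_inv E \<tau> x v) \<and> h x (triv_inv E \<tau> x v) \<le> ennreal (norm v / c))"
          using c0 c1 bounds Phi by auto
      qed
    qed
  qed
qed

end

section \<open>The dual bundle\<close>

lemma norm_pairing_le:
  fixes v y :: "complex^'r::finite"
  shows "cmod (\<Sum>i\<in>UNIV. v $ i * y $ i) \<le> norm v * norm y"
proof -
  have "cmod (\<Sum>i\<in>UNIV. v $ i * y $ i) \<le> (\<Sum>i\<in>UNIV. \<bar>cmod (v $ i)\<bar> * \<bar>cmod (y $ i)\<bar>)"
    by (rule order_trans[OF norm_sum]) (simp add: norm_mult)
  also have "\<dots> \<le> L2_set (\<lambda>i. cmod (v $ i)) UNIV * L2_set (\<lambda>i. cmod (y $ i)) UNIV"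
    by (rule L2_set_mult_ineq)
  finally show ?thesis by (simp add: norm_vec_def)
qed

context fiber
begin

definition dT :: "('v \<Rightarrow> complex) \<Rightarrow> complex^'r" where "dT f = (\<chi> i. f (Ti (axis i 1)))"

definition functional :: "complex^'r \<Rightarrow> 'v \<Rightarrow> complex" where
  "functional y = (\<lambda>a\<in>carrier V. \<Sum>i\<in>UNIV. T a $ i * y $ i)"

lemma dual_carrier:
  "f \<in> carrier (dual_space V) \<longleftrightarrow> f \<in> extensional (carrier V) \<and>
     (\<forall>a\<in>carrier V. \<forall>b\<in>carrier V. f (a \<oplus>\<^bsub>V\<^esub> b) = f a + f b) \<and> (\<forall>c. \<forall>a\<in>carrier V. f (c \<odot>\<^bsub>V\<^esub> a) = c * f a)"
  by (simp add: dual_space_def)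

lemma dual_add: "f \<oplus>\<^bsub>dual_space V\<^esub> f' = (\<lambda>a\<in>carrier V. f a + f' a)"
  and dual_smult: "c \<odot>\<^bsub>dual_space V\<^esub> f = (\<lambda>a\<in>carrier V. c * f a)"
  and dual_zero: "\<zero>\<^bsub>dual_space V\<^esub> = (\<lambda>a\<in>carrier V. 0)"
  by (simp_all add: dual_space_def)

lemma functional_in: "functional y \<in> carrier (dual_space V)"
  unfolding dual_carrier functional_def
  by (auto simp: T_add T_smult sum.distrib sum_distrib_left distrib_right mult.assoc)

lemma functional_Ti: "functional y (Ti v) = (\<Sum>i\<in>UNIV. v $ i * y $ i)"
  by (simp add: functional_def)

lemma dT_functional [simp]: "dT (functional y) = y"
proof -
  have "functional y (Ti (axis i 1)) = y $ i" for i
  proof -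
    have "functional y (Ti (axis i 1)) = (\<Sum>j\<in>UNIV. if j = i then y $ j else 0)"
      unfolding functional_Ti by (intro sum.cong) (auto simp: axis_def)
    then show ?thesis by simp
  qed
  then show ?thesis by (simp add: dT_def Finite_Cartesian_Product.vec_eq_iff)
qed

lemma functional_dT:
  assumes f: "f \<in> carrier (dual_space V)"
  shows "functional (dT f) = f"
proof (rule extensionalityI)
  show "functional (dT f) \<in> extensional (carrier V)" using functional_in dual_carrier by blast
  show "f \<in> extensional (carrier V)" using f dual_carrier by blast
  fix a assume a: "a \<in> carrier V"
  have fadd: "f (Ti (x + y)) = f (Ti x) + f (Ti y)" and fs: "f (Ti (c *s x)) = c * f (Ti x)" for x y c
    using f unfolding dual_carrier Ti_add Ti_smult by simp_all
  have "f (Ti (\<Sum>i\<in>S. g i)) = (\<Sum>i\<in>S. f (Ti (g i)))" if "finite S" for S :: "'r set" and g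
    using that
  proof (induction S)
    case empty show ?case using fs[of 0 0] by simp
  qed (simp add: fadd)
  from this[OF finite, of "\<lambda>i. T a $ i *s axis i 1" UNIV]
  have "f (Ti (T a)) = (\<Sum>i\<in>UNIV. T a $ i * f (Ti (axis i 1)))" by (simp add: basis_expansion fs)
  then show "functional (dT f) a = f a" using a by (simp add: functional_def dT_def)
qed

lemma dual_add_in:
  assumes "f \<in> carrier (dual_space V)" "f' \<in> carrier (dual_space V)"
  shows "f \<oplus>\<^bsub>dual_space V\<^esub> f' \<in> carrier (dual_space V)"
  using assms unfolding dual_carrier dual_add by (auto simp: distrib_left)

lemma dual_smult_in:
  assumes "f \<in> carrier (dual_space V)"
  shows "c \<odot>\<^bsub>dual_space V\<^esub> f \<in> carrier (dual_space V)"
  using assms unfolding dual_carrier dual_smult by (auto simp: distrib_left)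

lemma dual_zero_in: "\<zero>\<^bsub>dual_space V\<^esub> \<in> carrier (dual_space V)"
  unfolding dual_carrier dual_zero by auto

lemma dT_add: "dT (f \<oplus>\<^bsub>dual_space V\<^esub> f') = dT f + dT f'"
  and dT_smult: "dT (c \<odot>\<^bsub>dual_space V\<^esub> f) = c *s dT f"
  and dT_zero: "dT \<zero>\<^bsub>dual_space V\<^esub> = 0"
  by (simp_all add: dT_def dual_add dual_smult dual_zero Finite_Cartesian_Product.vec_eq_iff)

lemma inj_dT: "inj_on dT (carrier (dual_space V))"
  by (rule inj_on_inverseI[of _ functional]) (rule functional_dT)

lemma inv_dT: "inv_into (carrier (dual_space V)) dT y = functional y"
  using inv_into_f_f[OF inj_dT functional_in, of y] by simp

lemma dual_iso: "lin_iso (dual_space V) dT"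
  unfolding lin_iso_def
proof (intro conjI ballI allI dT_add dT_smult)
  have "dT ` carrier (dual_space V) = UNIV" using functional_in by (auto intro!: image_eqI[of _ dT "functional _"])
  then show "bij_betw dT (carrier (dual_space V)) UNIV" using inj_dT by (simp add: bij_betw_def)
qed

text \<open>The axioms are pulled back from the coordinate space along the injective linear map
  \<open>dT\<close>.\<close>

lemma dual_module: "Module.module ring_of_type_algebra (dual_space V)"
proof (rule moduleI)
  show "cring (ring_of_type_algebra :: complex ring)" by (rule Module.module.axioms(1)[OF mod])
  show "abelian_group (dual_space V)"
  proof (rule abelian_groupI)
    fix f assume f: "f \<in> carrier (dual_space V)"
    show "\<exists>k\<in>carrier (dual_space V). k \<oplus>\<^bsub>dual_space V\<^esub> f = \<zero>\<^bsub>dual_space V\<^esub>"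
    proof (rule bexI[of _ "functional (- dT f)"])
      show "functional (- dT f) \<oplus>\<^bsub>dual_space V\<^esub> f = \<zero>\<^bsub>dual_space V\<^esub>"
        by (rule inj_onD[OF inj_dT]) (use f in \<open>auto simp: dT_add dT_zero intro!: dual_add_in dual_zero_in functional_in\<close>)
    qed (rule functional_in)
  qed (auto intro!: dual_add_in dual_zero_in inj_onD[OF inj_dT] simp: dT_add dT_zero add_ac)
qed (auto intro!: dual_add_in dual_smult_in inj_onD[OF inj_dT]
      simp: dT_add dT_smult ring_of_type_algebra_def vector_add_ldistrib vector_sadd_rdistrib)

text \<open>For the lower bound, the upper dual bound is tested on the functional with the conjugate
  coordinates of \<open>v\<close>, evaluated at the normalized \<open>v\<close>. For the upper
  bound, the lower dual bound is applied to the pairing with \<open>v\<close> in the form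
  \<open>M\<close>, whose dual norm is at most the norm of \<open>v\<close> by
  Cauchy-Schwarz.\<close>

lemma bounds_of_dual_bounds:
  assumes N: "singular_inner_product V N" and fin: "finite_norm V N" and def: "definite_norm V N"
    and c: "c > 0"
    and lo: "\<And>y. ennreal (c * norm y) \<le> dual_norm V N (functional y)"
    and up: "\<And>y. dual_norm V N (functional y) \<le> ennreal (norm y / c)"
  shows "ennreal (c * norm v) \<le> N (Ti v) \<and> N (Ti v) \<le> ennreal (norm v / c)"
proof (cases "v = 0")
  case True
  have "N (Ti 0) = 0"
  proof -
    have "N ((0::complex) \<odot>\<^bsub>V\<^esub> Ti 0) = ennreal (cmod 0) * N (Ti 0)"
      using N unfolding singular_inner_product_def by simp
    then show ?thesis by (simp add: Ti_smult[symmetric])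
  qed
  then show ?thesis using True by simp
next
  case False
  obtain M where M: "hermitian M" "\<And>v. qf M v = (enn2real (N (Ti v)))\<^sup>2"
    by (rule norm_form_matrix[OF N fin]) blast
  define t where "t v = enn2real (N (Ti v))" for v
  have Nt: "N (Ti v) = ennreal (t v)" for v using fin by (simp add: t_def finite_norm_def less_top)
  have t0: "0 \<le> t v" for v by (simp add: t_def)
  have tpos: "t v > 0"
  proof -
    have "Ti v \<noteq> \<zero>\<^bsub>V\<^esub>" using False T_eq_0_iff[of "Ti v"] by auto
    then have "N (Ti v) \<noteq> 0" using def unfolding definite_norm_def by auto
    then show ?thesis using t0[of v] unfolding Nt by (cases "t v = 0") auto
  qed
  have psd: "0 \<le> qf M v" for v by (simp add: M)
  have 1: "c * norm v \<le> t v"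
  proof -
    define y where "y = (\<chi> i. cnj (v $ i))"
    have ny: "norm y = norm v" by (simp add: y_def norm_vec_def)
    have "(\<Sum>i\<in>UNIV. v $ i * y $ i) = of_real (\<Sum>i\<in>UNIV. (cmod (v $ i))\<^sup>2)"
      unfolding of_real_sum y_def by (rule sum.cong[OF refl]) (simp only: vec_lambda_beta complex_norm_square)
    also have "(\<Sum>i\<in>UNIV. (cmod (v $ i))\<^sup>2) = (norm v)\<^sup>2" by (simp add: norm_vec_def L2_set_def sum_nonneg)
    finally have fy: "functional y (Ti v) = of_real ((norm v)\<^sup>2)" unfolding functional_Ti .
    define a where "a = of_real (1 / t v) *s v"
    have "N (Ti a) = ennreal (cmod (of_real (1 / t v))) * N (Ti v)"
      using N unfolding a_def Ti_smult singular_inner_product_def by simp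
    also have "\<dots> = 1" using tpos unfolding Nt by (simp add: ennreal_mult[symmetric] norm_divide)
    finally have "ennreal (cmod (functional y (Ti a))) \<le> dual_norm V N (functional y)"
      unfolding dual_norm_def by (intro SUP_upper) auto
    also have "functional y (Ti a) = of_real (1 / t v) * functional y (Ti v)"
      using functional_in[of y] unfolding dual_carrier a_def Ti_smult by simp
    finally have "ennreal ((norm v)\<^sup>2 / t v) \<le> dual_norm V N (functional y)"
      unfolding fy using tpos by (simp add: norm_mult norm_divide norm_power)
    also have "\<dots> \<le> ennreal (norm v / c)" using up[of y] ny by simp
    finally have "(norm v)\<^sup>2 / t v \<le> norm v / c" using c by (subst (asm) ennreal_le_iff) auto
    then show ?thesis using tpos c False by (simp add: field_simps power2_eq_square)
  qed
  have 2: "t v \<le> norm v / c"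
  proof -
    define y where "y = (\<chi> i. \<Sum>j\<in>UNIV. M $ i $ j * cnj (v $ j))"
    have fy: "functional y (Ti a) = sesq M a v" for a
      by (simp add: functional_Ti y_def sesq_def sum_distrib_left mult_ac)
    have "dual_norm V N (functional y) \<le> ennreal (t v)"
      unfolding dual_norm_def
    proof (rule SUP_least)
      fix a assume a: "a \<in> {a \<in> carrier V. N a \<le> 1}"
      have "N a = ennreal (t (T a))" using Nt[of "T a"] a by simp
      then have ta: "t (T a) \<le> 1" using a by simp
      have "(cmod (functional y a))\<^sup>2 \<le> (t (T a))\<^sup>2 * (t v)\<^sup>2"
        using psd_cauchy_schwarz[OF M(1) psd, of "T a" v] fy[of "T a"] a by (simp add: M(2) t_def)
      also have "\<dots> \<le> 1 * (t v)\<^sup>2" using ta t0[of "T a"] by (intro mult_right_mono) (auto simp: power_le_one)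
      finally have "(cmod (functional y a))\<^sup>2 \<le> (t v)\<^sup>2" by simp
      then have "cmod (functional y a) \<le> t v" by (rule power2_le_imp_le) (rule t0)
      then show "ennreal (cmod (functional y a)) \<le> ennreal (t v)" by (rule ennreal_leI)
    qed
    with lo[of y] have "ennreal (c * norm y) \<le> ennreal (t v)" by (rule order_trans)
    then have cy: "c * norm y \<le> t v" using t0 by (subst (asm) ennreal_le_iff) auto
    have "(t v)\<^sup>2 = Re (functional y (Ti v))" by (simp add: fy M(2)[symmetric] qf_def t_def)
    also have "\<dots> \<le> cmod (functional y (Ti v))" by (rule complex_Re_le_cmod)
    also have "\<dots> \<le> norm v * norm y" unfolding functional_Ti by (rule norm_pairing_le)
    finally have "c * (t v)\<^sup>2 \<le> c * (norm v * norm y)" using c by (intro mult_left_mono) auto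
    also have "c * (norm v * norm y) = norm v * (c * norm y)" by simp
    also have "\<dots> \<le> norm v * t v" using cy by (intro mult_left_mono) auto
    finally have "c * t v \<le> norm v" using tpos by (simp add: power2_eq_square)
    then show ?thesis using c by (simp add: field_simps)
  qed
  show ?thesis unfolding Nt using 1 2 by (simp add: ennreal_leI)
qed

end

text \<open>The transition function of the dual trivializations is the transpose of the transition
  function of \<open>E\<close> in the opposite direction, hence again holomorphic.\<close>

lemma dual_bundle:
  fixes A :: "('m::t2_space, 'n::finite) chart set" and \<T> :: "('m, 'v, 'r::finite) triv set"
  assumes atlas: "complex_atlas A" and vb: "holomorphic_vector_bundle A E \<T>"
  shows "holomorphic_vector_bundle A (\<lambda>x. dual_space (E x)) (dual_trivs E \<T>)"
proof -
  have mod: "Module.module ring_of_type_algebra (E x)" for x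
    using vb by (simp add: holomorphic_vector_bundle_def)
  have cover: "(\<Union>(U, \<tau>)\<in>\<T>. U) = UNIV" using vb by (simp add: holomorphic_vector_bundle_def)
  have triv: "open Y" "\<And>x. x \<in> Y \<Longrightarrow> lin_iso (E x) (\<tau> x)" if "(Y, \<tau>) \<in> \<T>" for Y \<tau>
    using vb that unfolding holomorphic_vector_bundle_def by blast+
  have fib: "fiber (E x) (\<tau> x)" if "(Y, \<tau>) \<in> \<T>" "x \<in> Y" for Y \<tau> x
    using mod triv that by (intro fiber.intro) auto
  have trans: "manifold_holo A (Y \<inter> Y') (\<lambda>x. \<tau>' x (triv_inv E \<tau> x v))"
    if "(Y, \<tau>) \<in> \<T>" "(Y', \<tau>') \<in> \<T>" for Y \<tau> Y' \<tau>' v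
  proof -
    have "\<forall>(U, \<tau>)\<in>\<T>. \<forall>(U', \<tau>')\<in>\<T>. \<forall>v. manifold_holo A (U \<inter> U') (\<lambda>x. \<tau>' x (triv_inv E \<tau> x v))"
      using vb unfolding holomorphic_vector_bundle_def by blast
    from bspec[OF this that(1)] that(2) show ?thesis by auto
  qed
  define d where "d \<tau> = (\<lambda>x (f :: 'v \<Rightarrow> complex). \<chi> i. f (triv_inv E \<tau> x (axis i 1)))" for \<tau> :: "'m \<Rightarrow> 'v \<Rightarrow> complex^'r"
  have D: "dual_trivs E \<T> = (\<lambda>(U, \<tau>). (U, d \<tau>)) ` \<T>" by (simp add: dual_trivs_def d_def)
  have dT: "fiber.dT (E x) (\<tau> x) = d \<tau> x" if "(Y, \<tau>) \<in> \<T>" "x \<in> Y" for Y \<tau> x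
  proof -
    interpret fiber "E x" "\<tau> x" by (rule fib[OF that])
    show ?thesis by (simp add: dT_def d_def Ti_def fun_eq_iff)
  qed
  have dmod: "Module.module ring_of_type_algebra (dual_space (E x))" for x
  proof -
    have "x \<in> (\<Union>(U, \<tau>)\<in>\<T>. U)" unfolding cover by simp
    then obtain Y \<tau> where "(Y, \<tau>) \<in> \<T>" "x \<in> Y" by auto
    from fib[OF this] show ?thesis by (rule fiber.dual_module)
  qed
  have diso: "lin_iso (dual_space (E x)) (d \<tau> x)" if "(Y, \<tau>) \<in> \<T>" "x \<in> Y" for Y \<tau> x
    using fiber.dual_iso[OF fib[OF that]] dT[OF that] by simp
  have dtrans: "manifold_holo A (Y \<inter> Y') (\<lambda>x. d \<tau>' x (triv_inv (\<lambda>x. dual_space (E x)) (d \<tau>) x v))"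
    if t: "(Y, \<tau>) \<in> \<T>" and t': "(Y', \<tau>') \<in> \<T>" for Y \<tau> Y' \<tau>' v
    unfolding manifold_holo_def
  proof (intro ballI)
    fix c assume c: "c \<in> A"
    obtain U \<phi> where [simp]: "c = (U, \<phi>)" by (cases c)
    have U: "open U" "open (\<phi> ` U)" "homeomorphism U (\<phi> ` U) \<phi> (inv_into U \<phi>)"
      using atlas c unfolding complex_atlas_def by auto
    have op: "open (\<phi> ` (U \<inter> (Y \<inter> Y')))"
    proof -
      have "open (\<phi> ` U \<inter> inv_into U \<phi> -` (Y \<inter> Y'))"
        using U triv(1)[OF t] triv(1)[OF t'] unfolding homeomorphism_def
        by (intro continuous_open_preimage) auto
      also have "\<phi> ` U \<inter> inv_into U \<phi> -` (Y \<inter> Y') = \<phi> ` (U \<inter> (Y \<inter> Y'))"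
        using U(3) unfolding homeomorphism_def by force
      finally show ?thesis .
    qed
    have "holo_on (\<phi> ` (U \<inter> (Y \<inter> Y'))) ((\<lambda>x. d \<tau>' x (triv_inv (\<lambda>x. dual_space (E x)) (d \<tau>) x v)) \<circ> inv_into U \<phi>)"
    proof (rule holo_onI[OF _ op])
      fix z assume "z \<in> \<phi> ` (U \<inter> (Y \<inter> Y'))"
      define x where "x = inv_into U \<phi> z"
      have x: "x \<in> Y" "x \<in> Y'"
        using \<open>z \<in> \<phi> ` (U \<inter> (Y \<inter> Y'))\<close> U(3) unfolding x_def homeomorphism_def by auto
      interpret fiber "E x" "\<tau> x" by (rule fib[OF t x(1)])
      interpret F': fiber "E x" "\<tau>' x" by (rule fib[OF t' x(2)])
      have inv: "triv_inv (\<lambda>x. dual_space (E x)) (d \<tau>) x v = functional v"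
        using inv_dT[of v] dT[OF t x(1)] by simp
      have "d \<tau>' x (functional v) = (\<chi> j. \<Sum>i\<in>UNIV. \<tau> x (triv_inv E \<tau>' x (axis j 1)) $ i * v $ i)"
        unfolding d_def functional_def F'.Ti_def[symmetric] by simp
      then show "((\<lambda>x. d \<tau>' x (triv_inv (\<lambda>x. dual_space (E x)) (d \<tau>) x v)) \<circ> inv_into U \<phi>) z =
        (\<chi> j. \<Sum>i\<in>UNIV. ((\<lambda>x. \<tau> x (triv_inv E \<tau>' x (axis j 1))) \<circ> inv_into U \<phi>) z $ i * v $ i)"
        using inv by (simp add: x_def[symmetric])
    next
      fix z j assume z: "z \<in> \<phi> ` (U \<inter> (Y \<inter> Y'))"
      have tr: "holo_on (\<phi> ` (U \<inter> (Y' \<inter> Y))) ((\<lambda>x. \<tau> x (triv_inv E \<tau>' x (axis j 1))) \<circ> inv_into U \<phi>)"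
        using trans[OF t' t, unfolded manifold_holo_def, THEN bspec, OF c] by simp
      have "holo_at z (\<lambda>z. \<Sum>i\<in>UNIV. ((\<lambda>x. \<tau> x (triv_inv E \<tau>' x (axis j 1))) \<circ> inv_into U \<phi>) z $ i * v $ i)"
        using z by (intro holo_at_sum holo_at_mult holo_at_const holo_at_component[OF tr]) auto
      then show "holo_at z (\<lambda>z. (\<chi> j. \<Sum>i\<in>UNIV. ((\<lambda>x. \<tau> x (triv_inv E \<tau>' x (axis j 1))) \<circ> inv_into U \<phi>) z $ i * v $ i) $ j)"
        by simp
    qed
    then show "case c of (Ua, \<phi>) \<Rightarrow> holo_on (\<phi> ` (Ua \<inter> (Y \<inter> Y')))
        ((\<lambda>x. d \<tau>' x (triv_inv (\<lambda>x. dual_space (E x)) (d \<tau>) x v)) \<circ> inv_into Ua \<phi>)" by simp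
  qed
  show ?thesis
    unfolding holomorphic_vector_bundle_def D
  proof (intro conjI allI)
    show "(\<Union>(U, \<tau>)\<in>(\<lambda>(U, \<tau>). (U, d \<tau>)) ` \<T>. U) = UNIV" using cover by force
    show "\<forall>(U, \<tau>)\<in>(\<lambda>(U, \<tau>). (U, d \<tau>)) ` \<T>. open U \<and> (\<forall>x\<in>U. lin_iso (dual_space (E x)) (\<tau> x))"
      using triv(1) diso by auto
    show "\<forall>(U, \<tau>)\<in>(\<lambda>(U, \<tau>). (U, d \<tau>)) ` \<T>. \<forall>(U', \<tau>')\<in>(\<lambda>(U, \<tau>). (U, d \<tau>)) ` \<T>. \<forall>v.
        manifold_holo A (U \<inter> U') (\<lambda>x. \<tau>' x (triv_inv (\<lambda>x. dual_space (E x)) \<tau> x v))"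
      using dtrans by auto
  qed (rule dmod)
qed

section \<open>Square integrability\<close>

context bundle_chart
begin

theorem local_bounds:
  assumes h: "singular_hermitian_metric \<mu> E \<T> h"
    and sign: "griffiths_seminegative A \<mu> E \<T> h \<or> griffiths_semipositive A \<mu> E \<T> h"
    and x0: "x0 \<in> U" "x0 \<in> Y"
  obtains W \<Phi> where "open W" "x0 \<in> W" "W \<subseteq> U \<inter> Y" "\<Phi> \<in> borel_measurable borel"
    "(\<integral>\<^sup>+x. \<Phi> x \<partial>\<mu>) < \<infinity>"
    "AE x in \<mu>. x \<in> W \<longrightarrow> 1 \<le> \<Phi> x \<and> (\<exists>c>0. c \<le> 1 \<and> ennreal ((ln c)\<^sup>2) \<le> \<Phi> x \<and>
       (\<forall>v. ennreal (c * norm v) \<le> h x (triv_inv E \<tau> x v) \<and> h x (triv_inv E \<tau> x v) \<le> ennreal (norm v / c)))"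
  using sign
proof
  assume "griffiths_seminegative A \<mu> E \<T> h"
  then interpret seminegative_chart A g \<mu> U \<phi> E \<T> Y \<tau> h
    by (intro seminegative_chart.intro bundle_chart_axioms seminegative_chart_axioms.intro)
  show thesis by (rule local_estimate[OF x0]) (rule that)
next
  assume sp: "griffiths_semipositive A \<mu> E \<T> h"
  define \<tau>' where "\<tau>' = (\<lambda>x (f :: 'v \<Rightarrow> complex). \<chi> i. f (triv_inv E \<tau> x (axis i 1)))"
  have t': "(Y, \<tau>') \<in> dual_trivs E \<T>"
    unfolding dual_trivs_def using triv by (intro image_eqI[of _ _ "(Y, \<tau>)"]) (auto simp: \<tau>'_def)
  interpret dual: seminegative_chart A g \<mu> U \<phi> "\<lambda>x. dual_space (E x)" "dual_trivs E \<T>" Y \<tau>'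
      "\<lambda>x. dual_norm (E x) (h x)"
    using sp t' dual_bundle[OF atlas vb] unfolding griffiths_semipositive_def
    by (intro seminegative_chart.intro bundle_chart.intro riemannian_chart_axioms
        seminegative_chart_axioms.intro bundle_chart_axioms.intro) auto
  obtain W \<Phi> where W: "open W" "x0 \<in> W" "W \<subseteq> U \<inter> Y" "\<Phi> \<in> borel_measurable borel"
    "(\<integral>\<^sup>+x. \<Phi> x \<partial>\<mu>) < \<infinity>" and
    bd: "AE x in \<mu>. x \<in> W \<longrightarrow> 1 \<le> \<Phi> x \<and> (\<exists>c>0. c \<le> 1 \<and> ennreal ((ln c)\<^sup>2) \<le> \<Phi> x \<and>
       (\<forall>v. ennreal (c * norm v) \<le> dual_norm (E x) (h x) (triv_inv (\<lambda>x. dual_space (E x)) \<tau>' x v) \<and>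
          dual_norm (E x) (h x) (triv_inv (\<lambda>x. dual_space (E x)) \<tau>' x v) \<le> ennreal (norm v / c)))"
    by (rule dual.local_estimate[OF x0]) blast
  have sing: "singular_inner_product (E x) (h x)" for x
    using h unfolding singular_hermitian_metric_def by blast
  have "AE x in \<mu>. finite_norm (E x) (h x) \<and> definite_norm (E x) (h x)"
    using h unfolding singular_hermitian_metric_def by blast
  then have "AE x in \<mu>. x \<in> W \<longrightarrow> 1 \<le> \<Phi> x \<and> (\<exists>c>0. c \<le> 1 \<and> ennreal ((ln c)\<^sup>2) \<le> \<Phi> x \<and>
       (\<forall>v. ennreal (c * norm v) \<le> h x (triv_inv E \<tau> x v) \<and> h x (triv_inv E \<tau> x v) \<le> ennreal (norm v / c)))"
    using bd
  proof eventually_elim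
    case (elim x)
    show ?case
    proof
      assume x: "x \<in> W"
      then interpret fiber "E x" "\<tau> x" using W(3) by (intro fiber_at) auto
      have inv: "triv_inv (\<lambda>x. dual_space (E x)) \<tau>' x v = functional v" for v
      proof -
        have "\<tau>' x = dT" by (simp add: \<tau>'_def dT_def Ti_def fun_eq_iff)
        then show ?thesis using inv_dT by simp
      qed
      obtain c where c: "c > 0" "c \<le> 1" "ennreal ((ln c)\<^sup>2) \<le> \<Phi> x"
        "\<And>v. ennreal (c * norm v) \<le> dual_norm (E x) (h x) (functional v)"
        "\<And>v. dual_norm (E x) (h x) (functional v) \<le> ennreal (norm v / c)" and one: "1 \<le> \<Phi> x"
        using elim(2) x unfolding inv by blast
      have "ennreal (c * norm v) \<le> h x (Ti v) \<and> h x (Ti v) \<le> ennreal (norm v / c)" for v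
        using elim(1) by (intro bounds_of_dual_bounds[OF sing _ _ c(1,4,5)]) auto
      then show "1 \<le> \<Phi> x \<and> (\<exists>c>0. c \<le> 1 \<and> ennreal ((ln c)\<^sup>2) \<le> \<Phi> x \<and>
        (\<forall>v. ennreal (c * norm v) \<le> h x (triv_inv E \<tau> x v) \<and> h x (triv_inv E \<tau> x v) \<le> ennreal (norm v / c)))"
        using c one unfolding Ti_def by blast
    qed
  qed
  with W show thesis by (rule that)
qed

text \<open>The form is continuous and positive on the product of a closed ball and the unit sphere,
  which is compact; homogeneity extends the bounds to all vectors.\<close>

lemma smooth_metric_bounds:
  fixes \<alpha> :: "'m \<Rightarrow> real"
  assumes h0: "smooth_hermitian_metric A E \<T> h0" and \<alpha>: "manifold_smooth A UNIV \<alpha>"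
    and x0: "x0 \<in> U" "x0 \<in> Y"
  obtains W c s where "open W" "x0 \<in> W" "W \<subseteq> U \<inter> Y" "0 < c" "c \<le> 1"
    "\<And>x. x \<in> W \<Longrightarrow> \<bar>\<alpha> x\<bar> \<le> s"
    "\<And>x a. x \<in> W \<Longrightarrow> a \<in> carrier (E x) \<Longrightarrow> c * (norm (\<tau> x a))\<^sup>2 \<le> Re (h0 x a a)"
    "\<And>x a. x \<in> W \<Longrightarrow> a \<in> carrier (E x) \<Longrightarrow> Re (h0 x a a) \<le> (norm (\<tau> x a))\<^sup>2 / c"
proof -
  define z0 where "z0 = \<phi> x0"
  have "z0 \<in> D" using x0 by (auto simp: z0_def D_def)
  then obtain \<delta> where \<delta>: "\<delta> > 0" "cball z0 \<delta> \<subseteq> D"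
    using open_D by (auto simp: open_contains_cball)
  define G where "G z = (\<chi> i j. h0 (\<psi> z) (triv_inv E \<tau> (\<psi> z) (axis i 1)) (triv_inv E \<tau> (\<psi> z) (axis j 1)))" for z
  have contG: "continuous_on D (\<lambda>z. G z $ i $ j)" for i j
  proof -
    have "\<forall>(U, \<tau>)\<in>\<T>. \<forall>v w. manifold_smooth A U (\<lambda>x. h0 x (triv_inv E \<tau> x v) (triv_inv E \<tau> x w))"
      using h0 by (simp add: smooth_hermitian_metric_def)
    from bspec[OF this triv] have "manifold_smooth A Y (\<lambda>x. h0 x (triv_inv E \<tau> x (axis i 1)) (triv_inv E \<tau> x (axis j 1)))"
      by simp
    from this[unfolded manifold_smooth_def, THEN bspec, OF chart]
    have "continuous_on (\<phi> ` (U \<inter> Y)) ((\<lambda>x. h0 x (triv_inv E \<tau> x (axis i 1)) (triv_inv E \<tau> x (axis j 1))) \<circ> inv_into U \<phi>)"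
      unfolding smooth_on_def by (auto dest: spec[of _ 0])
    then show ?thesis by (simp add: G_def D_def \<psi>_def o_def)
  qed
  define q where "q = (\<lambda>(z, v). qf (G z) v)"
  define C where "C = cball z0 \<delta> \<times> sphere (0 :: complex^'r) 1"
  have C: "compact C" unfolding C_def by (intro compact_Times compact_cball compact_sphere)
  have nonempty: "C \<noteq> {}"
  proof -
    have "(z0, axis undefined 1) \<in> C" using \<delta> by (simp add: C_def norm_axis)
    then show ?thesis by blast
  qed
  have qcont: "continuous_on C q"
  proof -
    have "continuous_on C (\<lambda>p. G (fst p) $ i $ j)" for i j
      by (rule continuous_on_compose2[OF contG]) (use \<delta> in \<open>auto simp: C_def intro!: continuous_intros\<close>)
    moreover have "continuous_on C (\<lambda>p. snd p $ i)" for i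
      by (intro continuous_intros)
    ultimately show ?thesis unfolding q_def qf_def sesq_def case_prod_unfold
      by (intro continuous_on_Re continuous_on_sum continuous_on_mult continuous_on_cnj)
  qed
  have h0pos: "h0 x \<in> HermPos (E x)" for x using h0 by (simp add: smooth_hermitian_metric_def)
  have qf_h0: "Re (h0 x a a) = qf (G (\<phi> x)) (\<tau> x a)" if "x \<in> U \<inter> Y" "a \<in> carrier (E x)" for x a
  proof -
    interpret fiber "E x" "\<tau> x" using that by (intro fiber_at) auto
    have "cm (h0 x) = G (\<phi> x)" using that(1) by (simp add: cm_def G_def Ti_def)
    moreover have "h0 x \<in> Herm (E x)" using h0pos by (simp add: HermPos_def)
    ultimately show ?thesis using Herm_expand[of "h0 x" a a] that(2) by (simp add: qf_def)
  qed
  have qpos: "q p > 0" if "p \<in> C" for p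
  proof -
    obtain z v where p: "p = (z, v)" "z \<in> D" "v \<noteq> 0"
    proof
      have "fst p \<in> cball z0 \<delta>" "snd p \<in> sphere 0 1" using \<open>p \<in> C\<close> by (auto simp: C_def)
      then show "p = (fst p, snd p)" "fst p \<in> D" "snd p \<noteq> 0" using \<delta>(2) by auto
    qed
    interpret fiber "E (\<psi> z)" "\<tau> (\<psi> z)" by (rule fiber_at[OF D_D(3)[OF p(2)]])
    have "cm (h0 (\<psi> z)) = G z" by (simp add: cm_def G_def Ti_def)
    then show ?thesis using HermPos_pos[OF h0pos p(3)] by (simp add: q_def p(1))
  qed
  obtain p1 where p1: "p1 \<in> C" "\<And>p. p \<in> C \<Longrightarrow> q p1 \<le> q p"
    using continuous_attains_inf[OF C nonempty qcont] by blast
  obtain p2 where p2: "p2 \<in> C" "\<And>p. p \<in> C \<Longrightarrow> q p \<le> q p2"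
    using continuous_attains_sup[OF C nonempty qcont] by blast
  define c where "c = min 1 (min (q p1) (1 / q p2))"
  have c: "0 < c" "c \<le> 1" "c \<le> q p1" "q p2 \<le> 1 / c"
  proof -
    show 0: "0 < c" using qpos[OF p1(1)] qpos[OF p2(1)] by (simp add: c_def)
    show "c \<le> 1" "c \<le> q p1" by (auto simp: c_def)
    have "c \<le> 1 / q p2" by (auto simp: c_def)
    then show "q p2 \<le> 1 / c" using 0 qpos[OF p2(1)] by (simp add: field_simps)
  qed
  have unit: "c * (norm v)\<^sup>2 \<le> qf (G z) v \<and> qf (G z) v \<le> (norm v)\<^sup>2 / c" if z: "z \<in> cball z0 \<delta>" for z v
  proof (cases "v = 0")
    case True then show ?thesis by (simp add: qf_def sesq_def)
  next
    case False
    define u where "u = of_real (1 / norm v) *s v"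
    have nu: "norm u = 1" using False by (simp add: u_def norm_vector_scalar_mult norm_divide)
    have vu: "v = of_real (norm v) *s u" using False by (simp add: u_def Finite_Cartesian_Product.vec_eq_iff)
    have s: "qf (G z) v = (norm v)\<^sup>2 * qf (G z) u"
      by (subst vu) (simp add: qf_def sesq_scale_left sesq_scale_right power2_eq_square)
    have "(z, u) \<in> C" using z nu by (simp add: C_def)
    then have "c \<le> qf (G z) u" "qf (G z) u \<le> 1 / c"
      using p1(2)[of "(z, u)"] p2(2)[of "(z, u)"] c by (auto simp: q_def)
    then have "(norm v)\<^sup>2 * c \<le> qf (G z) v" "qf (G z) v \<le> (norm v)\<^sup>2 * (1 / c)"
      unfolding s by (intro mult_left_mono; simp)+
    then show ?thesis by (simp add: mult.commute)
  qed
  have "continuous_on (\<phi> ` U) (\<lambda>z. \<alpha> (\<psi> z))"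
  proof -
    have "continuous_on (\<phi> ` (U \<inter> UNIV)) (\<alpha> \<circ> inv_into U \<phi>)"
      using \<alpha>[unfolded manifold_smooth_def, THEN bspec, OF chart] unfolding smooth_on_def by (auto dest: spec[of _ 0])
    then show ?thesis by (simp add: \<psi>_def o_def)
  qed
  then have "continuous_on (cball z0 \<delta>) (\<lambda>z. \<alpha> (\<psi> z))"
    by (rule continuous_on_subset) (use \<delta> D_D(1) in blast)
  then have "bounded ((\<lambda>z. \<alpha> (\<psi> z)) ` cball z0 \<delta>)"
    by (intro compact_imp_bounded compact_continuous_image compact_cball)
  then obtain s where s: "\<And>z. z \<in> cball z0 \<delta> \<Longrightarrow> \<bar>\<alpha> (\<psi> z)\<bar> \<le> s"
    unfolding bounded_iff by (auto simp del: mem_cball)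
  define W where "W = U \<inter> \<phi> -` ball z0 \<delta>"
  have Wz: "x \<in> U \<inter> Y \<and> \<phi> x \<in> cball z0 \<delta> \<and> \<psi> (\<phi> x) = x" if "x \<in> W" for x
  proof -
    have "\<phi> x \<in> cball z0 \<delta>" "x \<in> U" using that by (auto simp: W_def)
    moreover then have "\<phi> x \<in> D" using \<delta>(2) by blast
    ultimately show ?thesis using D_D(3)[of "\<phi> x"] by simp
  qed
  show ?thesis
  proof (rule that[of W c s])
    show "open W" unfolding W_def by (rule open_preimage) simp
    show "x0 \<in> W" using x0 \<delta> by (simp add: W_def z0_def)
    show "W \<subseteq> U \<inter> Y" using Wz by blast
    show "\<bar>\<alpha> x\<bar> \<le> s" if "x \<in> W" for x using s[of "\<phi> x"] Wz[OF that] by simp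
    show "c * (norm (\<tau> x a))\<^sup>2 \<le> Re (h0 x a a)" "Re (h0 x a a) \<le> (norm (\<tau> x a))\<^sup>2 / c"
      if "x \<in> W" "a \<in> carrier (E x)" for x a
      using unit[of "\<phi> x" "\<tau> x a"] Wz[OF that(1)] qf_h0[of x a] that(2) by auto
  qed (use c in auto)
qed

theorem local_square_integral:
  assumes h0: "smooth_hermitian_metric A E \<T> h0" and \<alpha>: "manifold_smooth A UNIV \<alpha>"
    and h: "singular_hermitian_metric \<mu> E \<T> h"
    and sign: "griffiths_seminegative A \<mu> E \<T> h \<or> griffiths_semipositive A \<mu> E \<T> h"
    and x0: "x0 \<in> U" "x0 \<in> Y"
  shows "\<exists>W \<Phi>. open W \<and> x0 \<in> W \<and> \<Phi> \<in> borel_measurable borel \<and> (\<integral>\<^sup>+x. \<Phi> x \<partial>\<mu>) < \<infinity> \<and>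
    (AE x in \<mu>. x \<in> W \<longrightarrow> (herm_dist TYPE('r) (E x) (\<alpha> x) (norm_form (E x) (h x)) (h0 x))\<^sup>2 \<le> \<Phi> x)"
proof -
  obtain W \<Phi> where W: "open W" "x0 \<in> W" "W \<subseteq> U \<inter> Y" "\<Phi> \<in> borel_measurable borel"
    "(\<integral>\<^sup>+x. \<Phi> x \<partial>\<mu>) < \<infinity>" and
    bd: "AE x in \<mu>. x \<in> W \<longrightarrow> 1 \<le> \<Phi> x \<and> (\<exists>c>0. c \<le> 1 \<and> ennreal ((ln c)\<^sup>2) \<le> \<Phi> x \<and>
       (\<forall>v. ennreal (c * norm v) \<le> h x (triv_inv E \<tau> x v) \<and> h x (triv_inv E \<tau> x v) \<le> ennreal (norm v / c)))"
    by (rule local_bounds[OF h sign x0]) blast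
  obtain W0 c0 s where W0: "open W0" "x0 \<in> W0" "W0 \<subseteq> U \<inter> Y" and c0: "0 < c0" "c0 \<le> 1"
    and s: "\<And>x. x \<in> W0 \<Longrightarrow> \<bar>\<alpha> x\<bar> \<le> s"
    and lo: "\<And>x a. x \<in> W0 \<Longrightarrow> a \<in> carrier (E x) \<Longrightarrow> c0 * (norm (\<tau> x a))\<^sup>2 \<le> Re (h0 x a a)"
    and up: "\<And>x a. x \<in> W0 \<Longrightarrow> a \<in> carrier (E x) \<Longrightarrow> Re (h0 x a a) \<le> (norm (\<tau> x a))\<^sup>2 / c0"
    by (rule smooth_metric_bounds[OF h0 \<alpha> x0]) blast
  have s0: "0 \<le> s" using s[OF W0(2)] by linarith
  define r where "r = real CARD('r)"
  \<comment> \<open>The numbers come from \<open>(2 * ln e)^2 = 4 * (ln e)^2\<close> and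
    \<open>(ln e)^2 \<le> 8 * (ln c)^2 + 2 * (ln c0)^2\<close>, and \<open>1 + s\<close> bounds the
    factor that contains \<open>\<alpha>\<close>. The constant summand is absorbed by
    \<open>1 \<le> \<Phi> x\<close>.\<close>
  define L where "L = (1 + s) * r\<^sup>2 * 4 * (8 + 2 * (ln c0)\<^sup>2)"
  have L0: "0 \<le> L" using s0 by (simp add: L_def)
  have sing: "singular_inner_product (E x) (h x)" for x
    using h unfolding singular_hermitian_metric_def by blast
  have "AE x in \<mu>. finite_norm (E x) (h x) \<and> definite_norm (E x) (h x)"
    using h unfolding singular_hermitian_metric_def by blast
  then have "AE x in \<mu>. x \<in> W \<inter> W0 \<longrightarrow>
    (herm_dist TYPE('r) (E x) (\<alpha> x) (norm_form (E x) (h x)) (h0 x))\<^sup>2 \<le> ennreal L * \<Phi> x"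
    using bd
  proof eventually_elim
    case (elim x)
    show ?case
    proof
      assume x: "x \<in> W \<inter> W0"
      then interpret fiber "E x" "\<tau> x" using W(3) by (intro fiber_at) auto
      obtain c where c: "c > 0" "c \<le> 1" "ennreal ((ln c)\<^sup>2) \<le> \<Phi> x"
        "\<And>v. ennreal (c * norm v) \<le> h x (Ti v)" "\<And>v. h x (Ti v) \<le> ennreal (norm v / c)"
        and one: "1 \<le> \<Phi> x"
        using elim(2) x unfolding Ti_def by blast
      obtain M where M: "hermitian M" "\<And>v. qf M v = (enn2real (h x (Ti v)))\<^sup>2"
        "\<And>a b. a \<in> carrier (E x) \<Longrightarrow> b \<in> carrier (E x) \<Longrightarrow> norm_form (E x) (h x) a b = sesq M (\<tau> x a) (\<tau> x b)"
        using norm_form_matrix[OF sing conjunct1[OF elim(1)]] by blast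
      have q: "c\<^sup>2 * (norm v)\<^sup>2 \<le> qf M v \<and> qf M v \<le> (norm v)\<^sup>2 / c\<^sup>2" for v
      proof -
        define t where "t = enn2real (h x (Ti v))"
        have "h x (Ti v) \<noteq> \<infinity>" using c(5)[of v] by (auto simp: top_unique)
        then have "h x (Ti v) = ennreal t" "0 \<le> t" by (simp_all add: t_def less_top)
        then have "c * norm v \<le> t" "t \<le> norm v / c"
          using c(4,5)[of v] c(1) by (simp_all add: ennreal_le_iff)
        then have "(c * norm v)\<^sup>2 \<le> t\<^sup>2" "t\<^sup>2 \<le> (norm v / c)\<^sup>2"
          using c(1) \<open>0 \<le> t\<close> by (intro power_mono; simp)+
        then show ?thesis by (simp add: M(2) t_def power_mult_distrib power_divide)
      qed
      define nf where "nf = norm_form (E x) (h x)"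
      have nfH: "nf \<in> Herm (E x)"
        by (rule Herm_cong[OF Herm_of_matrix[OF M(1)]]) (simp add: nf_def M(3))
      have nf: "nf \<in> HermPos (E x)"
      proof (rule HermPosI[OF nfH])
        have "cm nf = M" by (simp add: cm_def nf_def M(3) Finite_Cartesian_Product.vec_eq_iff)
        then show "qf (cm nf) v > 0" if "v \<noteq> 0" for v
          using q[of v] c(1) that by (smt (verit) mult_pos_pos zero_less_norm_iff zero_less_power)
      qed
      have h0x: "h0 x \<in> HermPos (E x)" using h0 by (simp add: smooth_hermitian_metric_def)
      \<comment> \<open>The norm is compared with the coordinate norm up to \<open>c\<close>, so the
        form up to \<open>c^2\<close>, and \<open>h0\<close> up to \<open>c0\<close>. Hence
        \<open>e\<close> and \<open>1 / e\<close> serve as the two constants in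
        \<open>herm_dist_le\<close>.\<close>
      define e where "e = c\<^sup>2 * c0"
      have e: "0 < e" "e \<le> 1" using c c0 by (auto simp: e_def power_le_one intro!: mult_le_one)
      have "herm_dist TYPE('r) (E x) (\<alpha> x) nf (h0 x) \<le> ennreal (sqrt (1 + \<bar>\<alpha> x\<bar>) * real CARD('r) * (ln (1 / e) - ln e))"
      proof (rule herm_dist_le[OF mod iso nf h0x])
        fix a assume a: "a \<in> carrier (E x)"
        define m where "m = (norm (\<tau> x a))\<^sup>2"
        have Re: "Re (nf a a) = qf M (\<tau> x a)" using a by (simp add: nf_def M(3) qf_def)
        have 1: "c\<^sup>2 * m \<le> Re (nf a a)" "Re (nf a a) \<le> m / c\<^sup>2" using q[of "\<tau> x a"] by (simp_all add: Re m_def)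
        have 2: "c0 * m \<le> Re (h0 x a a)" "Re (h0 x a a) \<le> m / c0" using lo[of x a] up[of x a] a x by (simp_all add: m_def)
        have "e * Re (h0 x a a) \<le> e * (m / c0)" using 2 e by (intro mult_left_mono) auto
        also have "e * (m / c0) = c\<^sup>2 * m" using c0 by (simp add: e_def)
        finally show "e * Re (h0 x a a) \<le> Re (nf a a)" using 1 by linarith
        have "m / c\<^sup>2 = 1 / e * (c0 * m)" using c c0 by (simp add: e_def)
        also have "\<dots> \<le> 1 / e * Re (h0 x a a)" using 2 e by (intro mult_left_mono) auto
        finally show "Re (nf a a) \<le> 1 / e * Re (h0 x a a)" using 1 by linarith
      qed (use e in auto)
      then have "(herm_dist TYPE('r) (E x) (\<alpha> x) nf (h0 x))\<^sup>2 \<le> (ennreal (sqrt (1 + \<bar>\<alpha> x\<bar>) * r * (ln (1 / e) - ln e)))\<^sup>2"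
        unfolding r_def by (rule power_mono) simp
      also have "\<dots> = ennreal ((sqrt (1 + \<bar>\<alpha> x\<bar>) * r * (ln (1 / e) - ln e))\<^sup>2)"
      proof (rule ennreal_power)
        have "0 \<le> ln (1 / e) - ln e" using e by (simp add: ln_div)
        then show "0 \<le> sqrt (1 + \<bar>\<alpha> x\<bar>) * r * (ln (1 / e) - ln e)"
          by (intro mult_nonneg_nonneg) (auto simp: r_def)
      qed
      also have "(sqrt (1 + \<bar>\<alpha> x\<bar>) * r * (ln (1 / e) - ln e))\<^sup>2 = (1 + \<bar>\<alpha> x\<bar>) * r\<^sup>2 * 4 * (ln e)\<^sup>2"
        using e by (simp add: ln_div power_mult_distrib)
      also have "ennreal \<dots> \<le> ennreal ((1 + s) * r\<^sup>2 * 4 * (8 * (ln c)\<^sup>2 + 2 * (ln c0)\<^sup>2))"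
      proof (intro ennreal_leI mult_mono)
        have le: "ln e = 2 * ln c + ln c0" using c c0 by (simp add: e_def ln_mult ln_realpow)
        show "(ln e)\<^sup>2 \<le> 8 * (ln c)\<^sup>2 + 2 * (ln c0)\<^sup>2"
          unfolding le using sum_squares_bound[of "2 * ln c" "ln c0"] by (simp add: power2_sum power_mult_distrib)
      qed (use s[of x] x s0 in auto)
      also have "\<dots> = ennreal ((1 + s) * r\<^sup>2 * 4) * (8 * ennreal ((ln c)\<^sup>2) + ennreal (2 * (ln c0)\<^sup>2))"
        using s0 by (simp add: ennreal_mult ennreal_plus)
      also have "\<dots> \<le> ennreal ((1 + s) * r\<^sup>2 * 4) * (8 * \<Phi> x + ennreal (2 * (ln c0)\<^sup>2) * \<Phi> x)"
        using c(3) mult_left_mono[OF one, of "ennreal (2 * (ln c0)\<^sup>2)"] by (intro mult_left_mono add_mono) auto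
      also have "\<dots> = ennreal L * \<Phi> x"
        using s0 by (simp add: L_def ennreal_mult ennreal_plus distrib_right distrib_left mult.assoc)
      finally show "(herm_dist TYPE('r) (E x) (\<alpha> x) (norm_form (E x) (h x)) (h0 x))\<^sup>2 \<le> ennreal L * \<Phi> x"
        unfolding nf_def .
    qed
  qed
  moreover have "(\<lambda>x. ennreal L * \<Phi> x) \<in> borel_measurable borel" using W(4) by measurable
  moreover have "(\<integral>\<^sup>+x. ennreal L * \<Phi> x \<partial>\<mu>) < \<infinity>"
  proof -
    have "\<Phi> \<in> borel_measurable \<mu>" using W(4) measurable_cong_sets[OF sets_\<mu> refl] by blast
    then show ?thesis using W(5) by (subst nn_integral_cmult) (auto simp: ennreal_mult_less_top)
  qed
  moreover have "open (W \<inter> W0)" "x0 \<in> W \<inter> W0" using W W0 by auto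
  ultimately show ?thesis by blast
qed

end


theorem theorem1p2:
  fixes A :: "('m::t2_space, 'n::finite) chart set"
    and g :: "('m, 'n) chart \<Rightarrow> 'm \<Rightarrow> complex^'n \<Rightarrow> complex^'n \<Rightarrow> real"
    and \<mu> :: "'m measure"
    and E :: "'m \<Rightarrow> 'v cspace"
    and \<T> :: "('m, 'v, 'r::finite) triv set"
    and \<alpha> :: "'m \<Rightarrow> real"
    and h0 :: "'m \<Rightarrow> 'v \<Rightarrow> 'v \<Rightarrow> complex"
    and h :: "'m \<Rightarrow> 'v \<Rightarrow> ennreal"
  assumes "compact (UNIV :: 'm set)"
    and "complex_atlas A"
    and "riemannian_metric A g"
    and "riemannian_volume A g \<mu>"
    and "holomorphic_vector_bundle A E \<T>"
    and "manifold_smooth A UNIV \<alpha>"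
    and "\<And>x. \<alpha> x > - 1 / real CARD('r)"
    and "smooth_hermitian_metric A E \<T> h0"
    and "singular_hermitian_metric \<mu> E \<T> h"
    and "griffiths_seminegative A \<mu> E \<T> h \<or> griffiths_semipositive A \<mu> E \<T> h"
  shows "L2_integrable \<mu> E \<T> \<alpha> h0 h"
proof -
  have sets: "sets \<mu> = sets borel" using assms(4) by (simp add: riemannian_volume_def)
  define f where "f x = (herm_dist TYPE('r) (E x) (\<alpha> x) (norm_form (E x) (h x)) (h0 x))\<^sup>2" for x
  define P where "P p W \<Phi> \<longleftrightarrow> open W \<and> p \<in> W \<and> \<Phi> \<in> borel_measurable borel \<and> (\<integral>\<^sup>+x. \<Phi> x \<partial>\<mu>) < \<infinity> \<and>
    (AE x in \<mu>. x \<in> W \<longrightarrow> f x \<le> \<Phi> x)" for p W \<Phi>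
  have "\<exists>W \<Phi>. P x0 W \<Phi>" for x0
  proof -
    have "x0 \<in> (\<Union>(U, \<phi>)\<in>A. U)" using assms(2) by (simp add: complex_atlas_def)
    then obtain U \<phi> where U: "(U, \<phi>) \<in> A" "x0 \<in> U" by auto
    have "x0 \<in> (\<Union>(Y, \<tau>)\<in>\<T>. Y)" using assms(5) by (simp add: holomorphic_vector_bundle_def)
    then obtain Y \<tau> where Y: "(Y, \<tau>) \<in> \<T>" "x0 \<in> Y" by auto
    interpret bundle_chart A g \<mu> U \<phi> E \<T> Y \<tau>
      using assms U Y by (intro bundle_chart.intro riemannian_chart.intro bundle_chart_axioms.intro)
    show ?thesis unfolding P_def f_def by (rule local_square_integral[OF assms(8,6,9,10) U(2) Y(2)])
  qed
  then have "\<forall>p. \<exists>W. \<exists>\<Phi>. P p W \<Phi>" by blast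
  from choice[OF this] obtain W where "\<forall>p. \<exists>\<Phi>. P p (W p) \<Phi>" by blast
  from choice[OF this] obtain \<Phi> where "\<And>p. P p (W p) (\<Phi> p)" by blast
  then have W: "open (W p)" "p \<in> W p" "\<Phi> p \<in> borel_measurable borel"
    "(\<integral>\<^sup>+x. \<Phi> p x \<partial>\<mu>) < \<infinity>" "AE x in \<mu>. x \<in> W p \<longrightarrow> f x \<le> \<Phi> p x" for p
    unfolding P_def by blast+
  obtain F where F: "finite F" "UNIV \<subseteq> (\<Union>p\<in>F. W p)"
    by (rule compactE_image[OF assms(1), of UNIV W]) (use W in auto)
  define \<Psi> where "\<Psi> x = (\<Sum>p\<in>F. \<Phi> p x)" for x
  have \<Phi>m: "\<Phi> p \<in> borel_measurable \<mu>" for p using W(3)[of p] measurable_cong_sets[OF sets refl] by blast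
  have "AE x in \<mu>. \<forall>p\<in>F. x \<in> W p \<longrightarrow> f x \<le> \<Phi> p x"
    using F(1) W(5) by (simp add: AE_finite_all)
  then have "AE x in \<mu>. f x \<le> \<Psi> x"
  proof eventually_elim
    case (elim x)
    obtain p where p: "p \<in> F" "x \<in> W p" using F(2) by blast
    then have "f x \<le> \<Phi> p x" using elim by blast
    also have "\<dots> \<le> \<Psi> x" unfolding \<Psi>_def using p(1) F(1) by (intro member_le_sum) auto
    finally show ?case .
  qed
  then have "AE x in completion \<mu>. f x \<le> \<Psi> x" by (rule AE_completion)
  \<comment> \<open>Monotonicity asks for no measurability of the squared distance; the majorant
    \<open>\<Psi>\<close> is Borel measurable, so its integral is the same for \<open>\<mu>\<close>
    and its completion.\<close>
  then have "(\<integral>\<^sup>+x. f x \<partial>completion \<mu>) \<le> (\<integral>\<^sup>+x. \<Psi> x \<partial>completion \<mu>)" by (rule nn_integral_mono_AE)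
  also have "\<dots> = (\<integral>\<^sup>+x. \<Psi> x \<partial>\<mu>)" by (rule nn_integral_completion)
  also have "\<dots> = (\<Sum>p\<in>F. \<integral>\<^sup>+x. \<Phi> p x \<partial>\<mu>)" unfolding \<Psi>_def using \<Phi>m by (intro nn_integral_sum) auto
  also have "\<dots> < \<infinity>" using F(1) W(4) by simp
  finally show ?thesis using assms(9) unfolding L2_integrable_def f_def by blast
qed

end
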